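(* Assuming the strong form of the Elliott--Halberstam conjecture given in the context, we have, as $Q$ tends to infinity, $$\sum_{Q/2 < q \leq Q} | \kappa(q) | = o(\pi^*(Q)),$$ where the sum runs over the odd primes $q$ in $(Q/2,Q]$.
   Context: For a number field $K$ let $\zeta_K(s)$ be its Dedekind zeta function, with Laurent expansion $\zeta_K(s)=\frac{\alpha_K}{s-1}+c_K+c_1(K)(s-1)+\dots$ around $s=1$, and let $\gamma_K=c_K/\alpha_K$ be its Euler--Kronecker constant. For an odd prime $q$ let $\gamma_q=\gamma_{\mathbb{Q}(\zeta_q)}$ and $\gamma_q^+=\gamma_{\mathbb{Q}(\zeta_q+\zeta_q^{-1})}$, where $\zeta_q$ is a primitive $q$-th root of unity, and put $\kappa(q)=(\gamma_q^+-\gamma_q)/\log q$. The letter $q$ always denotes an odd prime. With $\pi(x)=\#\{p\le x:p\text{ prime}\}$ put $\pi^*(Q)=\pi(Q)-\pi(Q/2)$, and $\pi(t;d,a)=\#\{p\le t: p \text{ prime},\ p\equiv a \pmod d\}$. Write $\log_2 u=\log\log u$. Strong form of the Elliott--Halberstam conjecture: we have $$\sum_{u < q \leq 2u} \bigl| \pi(t;q,1) - \pi(t;q,-1) \bigr| \ll \frac{t}{(\log t)^3}$$ uniformly for any $t \geq u \exp\bigl(\frac{\log u}{\sqrt{\log_2 u}}\bigr)$, the sum being over primes $q$. *)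

theory Defs
  imports
    "HOL-Complex_Analysis.Complex_Analysis"
    "HOL-Algebra.Algebraic_Closure_Type"
    "HOL-Algebra.Generated_Fields"
    "HOL-Algebra.QuotRing"
    "HOL-Number_Theory.Cong"
    "HOL-Library.Landau_Symbols"
begin

section \<open>Dedekind zeta functions and Euler--Kronecker constants\<close>

text \<open>Number fields are represented by their carriers, as subsets of the complex numbers.\<close>

definition adjoin_rat :: "complex \<Rightarrow> complex set" where
  "adjoin_rat z = generate_field (ring_of_type_algebra :: complex ring) {z}"

definition ring_of_integers :: "complex set \<Rightarrow> complex ring" where
  "ring_of_integers K = ring_of_type_algebra\<lparr>carrier := {x \<in> K. algebraic_int x}\<rparr>"

definition nonzero_ideals :: "complex set \<Rightarrow> complex set set" where
  "nonzero_ideals K = {I. ideal I (ring_of_integers K) \<and> I \<noteq> {0}}"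

definition ideal_norm :: "complex set \<Rightarrow> complex set \<Rightarrow> nat" where
  "ideal_norm K I = card (carrier (ring_of_integers K Quot I))"

definition dedekind_series :: "complex set \<Rightarrow> complex \<Rightarrow> complex" where
  "dedekind_series K s = (\<Sum>\<^sub>\<infinity>I\<in>nonzero_ideals K. of_nat (ideal_norm K I) powr (-s))"

definition continues_dedekind_series :: "complex set \<Rightarrow> (complex \<Rightarrow> complex) \<Rightarrow> bool" where
  "continues_dedekind_series K Z \<longleftrightarrow>
     Z meromorphic_on {s. Re s \<ge> 1} \<and> (\<forall>s. Re s > 1 \<longrightarrow> Z s = dedekind_series K s)"

text \<open>
  Meromorphy on a set means meromorphy on a neighbourhood of it. Only the germ of the
  zeta function at 1 is used below, so the continuation is not extended further to the left;
  its values outside the closed half-plane are unspecified. The Laurent expansion at 1 does not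
  depend on the choice, see \<open>laurent_expansion_continuation_unique\<close>.
\<close>
definition dedekind_zeta :: "complex set \<Rightarrow> complex \<Rightarrow> complex" where
  "dedekind_zeta K = (SOME Z. continues_dedekind_series K Z)"

lemma laurent_expansion_continuation_unique:
  assumes "continues_dedekind_series K Y" "continues_dedekind_series K Z"
  shows "laurent_expansion Y 1 = laurent_expansion Z 1"
proof (rule laurent_expansion_cong)
  have mero: "Y meromorphic_on {1}" "Z meromorphic_on {1}"
    using assms by (auto simp: continues_dedekind_series_def intro: meromorphic_on_subset)
  define D where "D = (\<lambda>w. Y w - Z w)"
  have "D meromorphic_on {1}"
    unfolding D_def using mero by (intro meromorphic_intros)
  hence sing: "isolated_singularity_at D 1" "not_essential D 1"
    by (simp_all add: meromorphic_at_iff)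
  have zero: "D s = 0" if "Re s > 1" for s
    using assms that by (simp add: continues_dedekind_series_def D_def)
  have "\<exists>\<^sub>F w in at 1. D w = 0"
    unfolding frequently_at
  proof safe
    fix e :: real assume "e > 0"
    thus "\<exists>x\<in>UNIV. x \<noteq> 1 \<and> dist x 1 < e \<and> D x = 0"
      by (intro bexI[of _ "1 + of_real (e / 2)"]) (auto simp: dist_norm intro!: zero)
  qed
  hence "\<forall>\<^sub>F w in at 1. D w = 0"
    by (rule not_essential_frequently_0_imp_eventually_0[OF sing])
  thus "\<forall>\<^sub>F w in at 1. Y w = Z w"
    by (simp add: D_def)
qed simp

definition euler_kronecker :: "complex set \<Rightarrow> complex" where
  "euler_kronecker K =
     fls_nth (laurent_expansion (dedekind_zeta K) 1) 0 /
     fls_nth (laurent_expansion (dedekind_zeta K) 1) (-1)"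

definition zeta_root :: "nat \<Rightarrow> complex" where
  "zeta_root q = cis (2 * pi / real q)"

definition gamma_cyc :: "nat \<Rightarrow> complex" where
  "gamma_cyc q = euler_kronecker (adjoin_rat (zeta_root q))"

definition gamma_cyc_plus :: "nat \<Rightarrow> complex" where
  "gamma_cyc_plus q = euler_kronecker (adjoin_rat (zeta_root q + inverse (zeta_root q)))"

text \<open>The constants are real numbers, but are kept in the type of Laurent coefficients;
  absolute values of them are written as \<open>norm\<close>.\<close>
definition kappa :: "nat \<Rightarrow> complex" where
  "kappa q = (gamma_cyc_plus q - gamma_cyc q) / of_real (ln (real q))"


section \<open>Counting primes\<close>

definition odd_primes_in :: "real \<Rightarrow> real \<Rightarrow> nat set" where
  "odd_primes_in a b = {q. Factorial_Ring.prime q \<and> odd q \<and> a < real q \<and> real q \<le> b}"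

definition prime_count :: "real \<Rightarrow> nat" where
  "prime_count x = card {p::nat. Factorial_Ring.prime p \<and> real p \<le> x}"

definition prime_count_star :: "real \<Rightarrow> real" where
  "prime_count_star x = real (prime_count x) - real (prime_count (x / 2))"

definition prime_count_ap :: "real \<Rightarrow> nat \<Rightarrow> int \<Rightarrow> nat" where
  "prime_count_ap t d a = card {p::nat. Factorial_Ring.prime p \<and> real p \<le> t \<and> [int p = a] (mod int d)}"

text \<open>The bound is required for all sufficiently large \<open>u\<close> (for small \<open>u\<close> the iterated
  logarithm is not positive), with a constant independent of \<open>u\<close> and \<open>t\<close>.\<close>
definition strong_elliott_halberstam :: bool where
  "strong_elliott_halberstam \<longleftrightarrow>
     (\<exists>C::real. \<forall>\<^sub>F u::real in at_top. \<forall>t \<ge> u * exp (ln u / sqrt (ln (ln u))).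
        (\<Sum>q\<in>odd_primes_in u (2 * u).
           \<bar>real (prime_count_ap t q 1) - real (prime_count_ap t q (-1))\<bar>) \<le> C * (t / (ln t) ^ 3))"

end

theory Submission
  imports Defs "Jordan_Normal_Form.Char_Poly" "HOL-Number_Theory.Number_Theory" "HOL-Real_Asymp.Real_Asymp"
begin

text \<open>
  Write \<open>log \<zeta>\<^sub>K(s) = \<Sum> b\<^sub>K(m) m\<^sup>-\<^sup>s\<close>. Up to a factor that is holomorphic and nonzero near 1, the zeta
  functions of \<open>\<rat>(\<zeta>\<^sub>q)\<close> and of its maximal real subfield are products of Dirichlet L-functions, so both have a
  simple pole at 1, and the difference of the two Euler--Kronecker constants is the limit, as
  \<open>s\<close> decreases to 1, of \<open>\<Sum> \<Delta>(m) log m m\<^sup>-\<^sup>s\<close>, where \<open>\<Delta>\<close> is the difference of the coefficients \<open>b\<close>.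
  By the decomposition laws, \<open>\<Delta>(p) = \<plusminus>(q - 1)/2\<close> for primes \<open>p \<equiv> \<plusminus>1\<close> modulo \<open>q\<close>, and the only other
  \<open>m\<close> with \<open>\<Delta>(m) \<noteq> 0\<close> are proper prime powers \<open>m \<equiv> \<plusminus>1\<close>.

  Now sum over the primes \<open>q\<close> in \<open>(u, 2u]\<close>, where \<open>u = Q/2\<close>. The prime powers are harmless because \<open>m\<^sup>2 - 1\<close> has only
  \<open>O(log m)\<close> prime factors. The primes above \<open>T = u exp (log u / sqrt (log log u))\<close> contribute
  \<open>O(1 / log u)\<close> by partial summation and the Elliott--Halberstam hypothesis. For \<open>p = kq \<plusminus> 1\<close> below \<open>T\<close>
  an upper bound sieve counts the \<open>q\<close> for which \<open>p\<close> is prime, and summing over \<open>k\<close> gives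
  \<open>O(log T log (T/u) / log\<^sup>2 u) = O(1 / sqrt (log log u))\<close>. Chebyshev's lower bound for the number of \<open>q\<close>
  finishes the proof.
\<close>

hide_const (open) Divisibility.prime

section \<open>Lattices and ideals in rings of integers\<close>

text \<open>Since \<open>kappa q\<close> carries a factor of order q / log q, as large as the number
  of moduli itself, the prime sums attached to all q in a dyadic range must total o(1) together;
  every estimate is therefore an average over q. The work is done at real \<sigma> > 1, where all
  series converge absolutely, with bounds uniform in \<sigma>; the limit is taken only after the
  finite sum over q. Little of the decomposition law is needed. A zeta function is compared with a
  product of L-functions at prime arguments only: a bounded discrepancy supported on q and on proper
  prime powers gives a series convergent for Re s > 1/2, so the residue degrees of non-split primes
  never enter and a congruence for norms suffices. Nonvanishing at 1 rests on Landau's theorem: a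
  zero would make the logarithmic series converge at 1/(2(q - 1)), where the terms at p^(q - 1)
  alone give the sum of p^(-1/2), divergent by Chebyshev. The cube of the logarithm in the
  hypothesis is what partial summation needs: it leaves 1/(n log^2 n), which is summable.\<close>

definition additive_set :: "'a::ab_group_add set \<Rightarrow> bool" where
  "additive_set A \<longleftrightarrow> 0 \<in> A \<and> (\<forall>x\<in>A. \<forall>y\<in>A. x - y \<in> A)"

text \<open>The order \<open>b + x\<close> matches the right cosets of \<open>FactRing\<close>, so
  that the carrier of a quotient ring is literally \<open>cosets R I\<close>; see
  \<open>carrier_Quot\<close>.\<close>

definition coset_of :: "'a::ab_group_add set \<Rightarrow> 'a \<Rightarrow> 'a set" where
  "coset_of B x = (\<lambda>b. b + x) ` B"

definition cosets :: "'a::ab_group_add set \<Rightarrow> 'a set \<Rightarrow> 'a set set" where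
  "cosets A B = coset_of B ` A"

text \<open>The index [A : B]. An infinite index reads 0, because \<open>card\<close> of an infinite
  set is 0; finiteness therefore appears below as positivity, in \<open>idx_pos\<close>.\<close>

definition idx :: "'a::ab_group_add set \<Rightarrow> 'a set \<Rightarrow> nat" where
  "idx A B = card (cosets A B)"

lemma additive_setD:
  assumes "additive_set A"
  shows "0 \<in> A" "x \<in> A \<Longrightarrow> y \<in> A \<Longrightarrow> x - y \<in> A" "x \<in> A \<Longrightarrow> - x \<in> A"
    "x \<in> A \<Longrightarrow> y \<in> A \<Longrightarrow> x + y \<in> A"
proof -
  show z: "0 \<in> A" and d: "x \<in> A \<Longrightarrow> y \<in> A \<Longrightarrow> x - y \<in> A" for x y
    using assms by (auto simp: additive_set_def)
  show m: "x \<in> A \<Longrightarrow> - x \<in> A" for x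
    using d[OF z, of x] by simp
  show "x \<in> A \<Longrightarrow> y \<in> A \<Longrightarrow> x + y \<in> A"
    using d[of x "-y"] m[of y] by simp
qed

lemma additive_set_sum:
  assumes "additive_set A" "\<And>i. i \<in> I \<Longrightarrow> f i \<in> A"
  shows "sum f I \<in> A"
  using assms(2)
  by (induction I rule: infinite_finite_induct) (auto intro: additive_setD[OF assms(1)])

lemma additive_set_of_int:
  assumes "additive_set A" "(x::'a::ring_1) \<in> A"
  shows "of_int k * x \<in> A"
proof -
  have n: "of_nat m * x \<in> A" for m
    by (induction m) (auto simp: algebra_simps intro: additive_setD[OF assms(1)] assms(2))
  show ?thesis
  proof (cases k rule: int_cases2)
    case (nonneg m)
    thus ?thesis using n[of m] by simp
  next
    case (nonpos m)
    thus ?thesis using additive_setD(3)[OF assms(1) n[of m]] by simp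
  qed
qed

lemma additive_set_Int: "additive_set A \<Longrightarrow> additive_set B \<Longrightarrow> additive_set (A \<inter> B)"
  by (auto simp: additive_set_def)

lemma coset_of_eq_iff:
  assumes "additive_set B"
  shows "coset_of B x = coset_of B y \<longleftrightarrow> x - y \<in> B"
proof
  assume "coset_of B x = coset_of B y"
  moreover have "x \<in> coset_of B x"
    unfolding coset_of_def using additive_setD(1)[OF assms] by force
  ultimately show "x - y \<in> B" by (auto simp: coset_of_def)
next
  assume xy: "x - y \<in> B"
  have "coset_of B x \<subseteq> coset_of B y" if "x - y \<in> B" for x y
  proof
    fix z assume "z \<in> coset_of B x"
    then obtain b where "b \<in> B" "z = b + x" by (auto simp: coset_of_def)
    hence "z = (b + (x - y)) + y" "b + (x - y) \<in> B"
      using additive_setD(4)[OF assms _ that] by auto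
    thus "z \<in> coset_of B y" unfolding coset_of_def by blast
  qed
  from this[OF xy] this[of y x] show "coset_of B x = coset_of B y"
    using additive_setD(3)[OF assms xy] by auto
qed

text \<open>The map \<open>f\<close> need not be additive: it is enough that it preserves and
  reflects congruence and meets every coset. The applications take multiplication by a fixed
  element.\<close>

lemma idx_cong_map:
  assumes "additive_set B" "additive_set B'"
    and f: "\<And>x. x \<in> A \<Longrightarrow> f x \<in> A'"
    and iff: "\<And>x y. x \<in> A \<Longrightarrow> y \<in> A \<Longrightarrow> f x - f y \<in> B' \<longleftrightarrow> x - y \<in> B"
    and surj: "\<And>z. z \<in> A' \<Longrightarrow> \<exists>x\<in>A. z - f x \<in> B'"
  shows "idx A B = idx A' B'"
proof -
  define g where "g U = coset_of B' (f (SOME x. x \<in> A \<and> coset_of B x = U))" for U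
  have g: "g (coset_of B x) = coset_of B' (f x)" if "x \<in> A" for x
  proof -
    have "\<exists>y. y \<in> A \<and> coset_of B y = coset_of B x" using that by blast
    from someI_ex[OF this] show ?thesis
      unfolding g_def using iff[OF _ that] that
      by (auto simp: coset_of_eq_iff[OF assms(1)] coset_of_eq_iff[OF assms(2)])
  qed
  have "bij_betw g (cosets A B) (cosets A' B')"
  proof (rule bij_betw_imageI)
    show "inj_on g (cosets A B)"
      by (auto simp: inj_on_def cosets_def g coset_of_eq_iff[OF assms(1)] coset_of_eq_iff[OF assms(2)] iff)
    show "g ` cosets A B = cosets A' B'"
    proof (intro equalityI subsetI)
      fix Y assume "Y \<in> g ` cosets A B"
      thus "Y \<in> cosets A' B'" by (auto simp: cosets_def g f)
    next
      fix Y assume "Y \<in> cosets A' B'"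
      then obtain z where z: "z \<in> A'" "Y = coset_of B' z" by (auto simp: cosets_def)
      from surj[OF z(1)] obtain x where "x \<in> A" "z - f x \<in> B'" by blast
      hence "Y = g (coset_of B x)" using z by (simp add: g coset_of_eq_iff[OF assms(2)])
      thus "Y \<in> g ` cosets A B" using \<open>x \<in> A\<close> by (auto simp: cosets_def)
    qed
  qed
  thus ?thesis unfolding idx_def by (rule bij_betw_same_card)
qed

text \<open>A choice \<open>r\<close> of representatives of A/B turns A/B x B/C into A/C by adding
  \<open>r U\<close> to a coset of C. Infinite indices are harmless, as both sides are then
  0.\<close>

lemma idx_tower:
  assumes A: "additive_set A" and B: "additive_set B" and C: "additive_set C"
    and sub: "C \<subseteq> B" "B \<subseteq> A"
  shows "idx A C = idx A B * idx B C"
proof -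
  define r where "r U = (SOME x. x \<in> A \<and> coset_of B x = U)" for U
  have r: "r U \<in> A" "coset_of B (r U) = U" if "U \<in> cosets A B" for U
  proof -
    have "\<exists>y. y \<in> A \<and> coset_of B y = U" using that by (auto simp: cosets_def)
    from someI_ex[OF this] show "r U \<in> A" "coset_of B (r U) = U" by (auto simp: r_def)
  qed
  define h where "h = (\<lambda>(U, Y). (\<lambda>y. y + r U) ` Y)"
  have h: "h (U, coset_of C b) = coset_of C (b + r U)" for U b
    by (auto simp: h_def coset_of_def image_image add_ac)
  have "bij_betw h (cosets A B \<times> cosets B C) (cosets A C)"
  proof (rule bij_betw_imageI)
    show "inj_on h (cosets A B \<times> cosets B C)"
    proof (rule inj_onI, clarify)
      fix U Y U' Y'
      assume U: "U \<in> cosets A B" "U' \<in> cosets A B" and Y: "Y \<in> cosets B C" "Y' \<in> cosets B C"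
        and eq: "h (U, Y) = h (U', Y')"
      obtain b b' where b: "b \<in> B" "b' \<in> B" "Y = coset_of C b" "Y' = coset_of C b'"
        using Y by (auto simp: cosets_def)
      have *: "b + r U - (b' + r U') \<in> C"
        using eq b by (simp add: h coset_of_eq_iff[OF C])
      hence "b + r U - (b' + r U') - (b - b') \<in> B"
        using additive_setD(2)[OF B _ additive_setD(2)[OF B b(1,2)]] sub(1) by blast
      hence "r U - r U' \<in> B" by (simp add: algebra_simps)
      hence "U = U'" using r U coset_of_eq_iff[OF B] by metis
      thus "U = U' \<and> Y = Y'" using * b by (simp add: coset_of_eq_iff[OF C])
    qed
    show "h ` (cosets A B \<times> cosets B C) = cosets A C"
    proof (intro equalityI subsetI)
      fix Z assume "Z \<in> h ` (cosets A B \<times> cosets B C)"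
      then obtain U Y where U: "U \<in> cosets A B" "Y \<in> cosets B C" "Z = h (U, Y)"
        by blast
      then obtain b where "b \<in> B" "Z = coset_of C (b + r U)"
        unfolding cosets_def by (auto simp: h)
      thus "Z \<in> cosets A C" using r(1)[OF U(1)] sub(2) additive_setD(4)[OF A]
        by (auto simp: cosets_def)
    next
      fix Z assume "Z \<in> cosets A C"
      then obtain a where a: "a \<in> A" "Z = coset_of C a" by (auto simp: cosets_def)
      let ?U = "coset_of B a"
      have U: "?U \<in> cosets A B" using a by (auto simp: cosets_def)
      have "a - r ?U \<in> B" using r(2)[OF U] coset_of_eq_iff[OF B] by metis
      hence "(?U, coset_of C (a - r ?U)) \<in> cosets A B \<times> cosets B C"
        using U by (auto simp: cosets_def)
      moreover have "Z = h (?U, coset_of C (a - r ?U))" by (simp add: h a)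
      ultimately show "Z \<in> h ` (cosets A B \<times> cosets B C)" by blast
    qed
  qed
  thus ?thesis unfolding idx_def using bij_betw_same_card card_cartesian_product by metis
qed

lemma cosets_self: "additive_set A \<Longrightarrow> cosets A A = {A}"
proof -
  assume A: "additive_set A"
  have "coset_of A 0 = A" by (simp add: coset_of_def)
  hence "coset_of A x = A" if "x \<in> A" for x
    using that coset_of_eq_iff[OF A, of x 0] by simp
  thus ?thesis using additive_setD(1)[OF A] by (auto simp: cosets_def)
qed

lemma idx_self [simp]: "additive_set A \<Longrightarrow> idx A A = 1"
  by (simp add: idx_def cosets_self)

lemma idx_eq_1_iff:
  assumes "additive_set A" "additive_set B" "B \<subseteq> A"
  shows "idx A B = 1 \<longleftrightarrow> A = B"
proof
  assume "idx A B = 1"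
  then obtain U where U: "cosets A B = {U}" by (auto simp: idx_def card_1_singleton_iff)
  have "a \<in> B" if "a \<in> A" for a
  proof -
    have "coset_of B a = coset_of B 0"
      using U that additive_setD(1)[OF assms(1)] by (metis cosets_def imageI singletonD)
    thus ?thesis using coset_of_eq_iff[OF assms(2), of a 0] by simp
  qed
  thus "A = B" using assms(3) by auto
qed (use assms in auto)

text \<open>Only sums of products are generated. Zero and negatives come from the module structure
  of the factors, see \<open>modl_sprod\<close>.\<close>

inductive_set sprod :: "'a::comm_ring_1 set \<Rightarrow> 'a set \<Rightarrow> 'a set" for A B where
  base: "a \<in> A \<Longrightarrow> b \<in> B \<Longrightarrow> a * b \<in> sprod A B"
| add: "x \<in> sprod A B \<Longrightarrow> y \<in> sprod A B \<Longrightarrow> x + y \<in> sprod A B"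

lemma sprod_least:
  assumes "\<And>a b. a \<in> A \<Longrightarrow> b \<in> B \<Longrightarrow> a * b \<in> S" "\<And>x y. x \<in> S \<Longrightarrow> y \<in> S \<Longrightarrow> x + y \<in> S"
  shows "sprod A B \<subseteq> S"
proof
  fix x assume "x \<in> sprod A B" thus "x \<in> S"
    by induction (use assms in auto)
qed

lemma sprod_mono: "A \<subseteq> A' \<Longrightarrow> B \<subseteq> B' \<Longrightarrow> sprod A B \<subseteq> sprod A' B'"
  by (rule sprod_least) (auto intro: sprod.intros)

lemma sprod_commute: "sprod A B = sprod B A"
proof -
  have "sprod A B \<subseteq> sprod B A" for A B :: "'a set"
  proof (rule sprod_least)
    fix a b assume "a \<in> A" "b \<in> B"
    from sprod.base[OF this(2,1)] show "a * b \<in> sprod B A" by (simp only: mult.commute)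
  qed (rule sprod.add)
  thus ?thesis by blast
qed

lemma sprod_assoc: "sprod (sprod A B) C = sprod A (sprod B C)"
proof
  show "sprod (sprod A B) C \<subseteq> sprod A (sprod B C)"
  proof (rule sprod_least)
    fix x c assume "x \<in> sprod A B" and c: "c \<in> C"
    thus "x * c \<in> sprod A (sprod B C)"
    proof induction
      case (base a b)
      thus ?case using c by (simp add: mult.assoc sprod.base)
    next
      case (add x y)
      thus ?case by (simp add: distrib_right sprod.add)
    qed
  qed (rule sprod.add)
  show "sprod A (sprod B C) \<subseteq> sprod (sprod A B) C"
  proof (rule sprod_least)
    fix x a assume a: "a \<in> A" and "x \<in> sprod B C"
    from this(2) show "a * x \<in> sprod (sprod A B) C"
    proof induction
      case (base b c)
      thus ?case using a by (metis mult.assoc sprod.base)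
    next
      case (add x y)
      thus ?case by (simp add: distrib_left sprod.add)
    qed
  qed (rule sprod.add)
qed

lemma sprod_left_commute: "sprod A (sprod B C) = sprod B (sprod A C)"
  by (metis sprod_assoc sprod_commute)

text \<open>The determinant trick: \<open>v\<close> is an eigenvector of the integer matrix
  \<open>M\<close> for the eigenvalue \<open>x\<close>, so \<open>x\<close> is a root of a monic
  integer polynomial, the characteristic polynomial.\<close>

lemma algebraic_int_eigenvalue:
  fixes x :: complex and v :: "nat \<Rightarrow> complex" and M :: "nat \<Rightarrow> nat \<Rightarrow> int"
  assumes eq: "\<And>i. i < N \<Longrightarrow> x * v i = (\<Sum>j<N. of_int (M i j) * v j)"
    and nz: "i0 < N" "v i0 \<noteq> 0"
  shows "algebraic_int x"
proof -
  define A where "A = Matrix.mat N N (\<lambda>(i, j). M i j)"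
  have A: "A \<in> carrier_mat N N" by (simp add: A_def)
  define B :: "complex Matrix.mat" where "B = map_mat of_int A"
  have B: "B \<in> carrier_mat N N" using A by (simp add: B_def)
  define u where "u = Matrix.vec N v"
  have "eigenvector B u x"
    unfolding eigenvector_def
  proof (intro conjI)
    show "u \<in> carrier_vec (dim_row B)" using B by (simp add: u_def)
    show "u \<noteq> 0\<^sub>v (dim_row B)"
    proof
      assume "u = 0\<^sub>v (dim_row B)"
      hence "vec_index u i0 = vec_index (0\<^sub>v (dim_row B)) i0" by (rule arg_cong)
      thus False using nz B by (simp add: u_def)
    qed
    show "B *\<^sub>v u = x \<cdot>\<^sub>v u"
    proof (rule eq_vecI)
      fix i assume "i < dim_vec (x \<cdot>\<^sub>v u)"
      hence i: "i < N" by (simp add: u_def)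
      show "vec_index (B *\<^sub>v u) i = vec_index (x \<cdot>\<^sub>v u) i"
      proof -
        have "vec_index (B *\<^sub>v u) i = (\<Sum>j<N. of_int (M i j) * v j)"
          using i by (simp add: u_def B_def A_def scalar_prod_def row_def atLeast0LessThan)
        also have "\<dots> = vec_index (x \<cdot>\<^sub>v u) i"
          using i eq[OF i] by (simp add: u_def)
        finally show ?thesis .
      qed
    qed (use B in \<open>simp add: u_def\<close>)
  qed
  hence "eigenvalue B x" unfolding eigenvalue_def by (rule exI)
  hence "poly (char_poly B) x = 0" using eigenvalue_root_char_poly[OF B] by simp
  moreover have "char_poly B = map_poly of_int (char_poly A)"
    unfolding B_def using of_int_hom.char_poly_hom[OF A] by simp
  moreover have "poly.coeff (char_poly A) (Polynomial.degree (char_poly A)) = 1" using degree_monic_char_poly[OF A] by simp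
  ultimately show ?thesis unfolding algebraic_int_altdef_ipoly by (intro exI[of _ "char_poly A"]) simp
qed

text \<open>Assumption \<open>int_closed\<close> is integral closedness: \<open>x\<close> is integral if its powers have a common denominator.\<close>
locale number_ring =
  fixes R :: "complex set" and n :: nat and e :: "nat \<Rightarrow> complex"
  assumes one_closed: "1 \<in> R"
    and mult_closed: "x \<in> R \<Longrightarrow> y \<in> R \<Longrightarrow> x * y \<in> R"
    and span: "R = range (\<lambda>a :: nat \<Rightarrow> int. \<Sum>i<n. of_int (a i) * e i)"
    and indep: "(\<Sum>i<n. of_int (a i) * e i) = 0 \<Longrightarrow> i < n \<Longrightarrow> a i = 0"
    and int_closed: "m > 0 \<Longrightarrow> (\<And>k. of_nat m * x ^ k \<in> R) \<Longrightarrow> x \<in> R"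
begin

lemma spanI: "(\<Sum>i<n. of_int (a i) * e i) \<in> R"
  unfolding span by blast

lemma R_additive: "additive_set R"
  unfolding additive_set_def
proof (intro conjI ballI)
  from spanI[of "\<lambda>_. 0"]
  show "0 \<in> R" by simp
  fix x y assume "x \<in> R" "y \<in> R"
  then obtain a b where "x = (\<Sum>i<n. of_int (a i) * e i)" "y = (\<Sum>i<n. of_int (b i) * e i)"
    unfolding span by auto
  thus "x - y \<in> R" using spanI[of "\<lambda>i. a i - b i"]
    by (simp add: sum_subtractf left_diff_distrib)
qed

lemmas R_closed = additive_setD[OF R_additive]

lemma power_closed: "x \<in> R \<Longrightarrow> x ^ k \<in> R"
  by (induction k) (auto intro: one_closed mult_closed)

lemma of_int_closed: "of_int k \<in> R"
  using additive_set_of_int[OF R_additive one_closed, of k] by simp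

lemma of_nat_closed: "of_nat k \<in> R"
  using of_int_closed[of "int k"] by simp

lemma basis_closed: "i < n \<Longrightarrow> e i \<in> R"
proof -
  assume i: "i < n"
  have "(\<Sum>j<n. of_int ((\<lambda>j. if j = i then 1 else 0) j) * e j) = (\<Sum>j<n. if j = i then e j else 0)"
    by (intro sum.cong) auto
  also have "\<dots> = e i" using i by simp
  finally show ?thesis using spanI[of "\<lambda>j. if j = i then 1 else 0"] by simp
qed

lemma n_pos: "n > 0"
proof (rule ccontr)
  assume "\<not> n > 0"
  hence "R = {0}" using span by auto
  thus False using one_closed by simp
qed

lemma algebraic_int:
  assumes "x \<in> R"
  shows "algebraic_int x"
proof -
  have "\<exists>a :: nat \<Rightarrow> int. x * e i = (\<Sum>j<n. of_int (a j) * e j)" if "i < n" for i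
    using mult_closed[OF assms basis_closed[OF that]] unfolding span by auto
  then obtain M :: "nat \<Rightarrow> nat \<Rightarrow> int"
    where M: "\<And>i. i < n \<Longrightarrow> x * e i = (\<Sum>j<n. of_int (M i j) * e j)"
    by metis
  have "e 0 \<noteq> 0"
  proof
    assume "e 0 = 0"
    hence "(\<Sum>i<n. of_int ((\<lambda>i. if i = 0 then 1 else 0) i) * e i) = 0"
      by (intro sum.neutral) auto
    from indep[OF this n_pos] show False by simp
  qed
  thus ?thesis using algebraic_int_eigenvalue[OF M n_pos] by blast
qed

text \<open>In an integer polynomial equation for x, cancelling powers of x makes the constant term
  nonzero; that constant is then, up to sign, x times a polynomial expression in x. The final case
  split only adjusts the sign.\<close>

lemma dvd_nat:
  assumes "x \<in> R" "x \<noteq> 0"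
  shows "\<exists>y\<in>R. \<exists>m>0. x * y = of_nat m"
proof -
  have poly: "poly (map_poly of_int p) x \<in> R" for p :: "int poly"
    by (induction p) (auto simp: map_poly_pCons intro: R_closed of_int_closed mult_closed assms)
  have "\<exists>y\<in>R. \<exists>c::int. c \<noteq> 0 \<and> x * y = of_int c"
    if "p \<noteq> 0" "poly (map_poly of_int p) x = 0" for p :: "int poly"
    using that
  proof (induction p)
    case (pCons a p)
    have eq: "of_int a + x * poly (map_poly of_int p) x = 0"
      using pCons.prems by (simp add: map_poly_pCons)
    show ?case
    proof (cases "a = 0")
      case True
      hence "p \<noteq> 0" "poly (map_poly of_int p) x = 0"
        using pCons.prems eq assms(2) by auto
      thus ?thesis using pCons.IH by blast
    next
      case False
      have "x * poly (map_poly of_int p) x = of_int (-a)"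
        using eq by (simp add: add_eq_0_iff)
      thus ?thesis using False poly[of p] by (intro bexI exI[of _ "-a"]) auto
    qed
  qed simp
  moreover obtain p :: "int poly" where "poly (map_poly of_int p) x = 0" "p \<noteq> 0"
    using algebraic_int[OF assms(1)] unfolding algebraic_int_altdef_ipoly by fastforce
  ultimately obtain y c where y: "y \<in> R" "c \<noteq> 0" "x * y = of_int c" by metis
  show ?thesis
  proof (cases "c > 0")
    case True
    hence "x * y = of_nat (nat c)" using y by simp
    thus ?thesis using True y by (metis zero_less_nat_eq)
  next
    case False
    hence "x * (- y) = of_nat (nat (- c))" using y by simp
    thus ?thesis using False y R_closed(3) by (metis linorder_neqE_linordered_idom neg_0_less_iff_less zero_less_nat_eq)
  qed
qed

text \<open>Submodules of the complex numbers, not only of \<open>R\<close>: inverses of ideals such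
  as \<open>pinv P\<close> have to be covered as well.\<close>

definition modl :: "complex set \<Rightarrow> bool" where
  "modl I \<longleftrightarrow> additive_set I \<and> (\<forall>x\<in>R. \<forall>y\<in>I. x * y \<in> I)"

text \<open>The ideals here are the nonzero ones.\<close>
definition idl :: "complex set \<Rightarrow> bool" where
  "idl I \<longleftrightarrow> modl I \<and> I \<subseteq> R \<and> I \<noteq> {0}"

lemma modlD:
  assumes "modl I"
  shows "additive_set I" "x \<in> R \<Longrightarrow> y \<in> I \<Longrightarrow> x * y \<in> I" "x \<in> R \<Longrightarrow> y \<in> I \<Longrightarrow> y * x \<in> I"
  using assms by (auto simp: modl_def mult.commute)

lemma modl_closed:
  assumes "modl I"
  shows "0 \<in> I" "x \<in> I \<Longrightarrow> y \<in> I \<Longrightarrow> x - y \<in> I" "x \<in> I \<Longrightarrow> - x \<in> I"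
    "x \<in> I \<Longrightarrow> y \<in> I \<Longrightarrow> x + y \<in> I"
  using additive_setD[OF modlD(1)[OF assms]] by auto

lemma idlD:
  assumes "idl I"
  shows "modl I" "additive_set I" "x \<in> I \<Longrightarrow> x \<in> R" "I \<subseteq> R"
  using assms by (auto simp: idl_def modl_def)

lemma idl_eq_R: "idl I \<Longrightarrow> 1 \<in> I \<Longrightarrow> I = R"
  using modlD(3)[OF idlD(1), of I _ 1] idlD(3)[of I] by fastforce

lemma modl_R: "modl R"
  unfolding modl_def using R_additive mult_closed by blast

lemma idl_R: "idl R"
  unfolding idl_def using modl_R one_closed by auto

lemma modl_image: "modl I \<Longrightarrow> modl ((*) c ` I)"
  unfolding modl_def
proof (elim conjE, intro conjI)
  assume I: "additive_set I" "\<forall>x\<in>R. \<forall>y\<in>I. x * y \<in> I"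
  have "c * x - c * y \<in> (*) c ` I" if "x \<in> I" "y \<in> I" for x y
    using additive_setD(2)[OF I(1) that] by (metis imageI right_diff_distrib)
  moreover have "0 \<in> (*) c ` I" using additive_setD(1)[OF I(1)] by force
  ultimately show "additive_set ((*) c ` I)" unfolding additive_set_def by auto
  show "\<forall>x\<in>R. \<forall>y\<in>(*) c ` I. x * y \<in> (*) c ` I"
    using I(2) by (auto simp: mult.left_commute)
qed

lemma idl_image: "idl I \<Longrightarrow> c \<in> R \<Longrightarrow> c \<noteq> 0 \<Longrightarrow> idl ((*) c ` I)"
proof -
  assume I: "idl I" and c: "c \<in> R" "c \<noteq> 0"
  obtain y where "y \<in> I" "y \<noteq> 0" using I modl_closed(1)[OF idlD(1)[OF I]] unfolding idl_def by auto
  hence "c * y \<in> (*) c ` I" "c * y \<noteq> 0" using c by auto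
  hence "(*) c ` I \<noteq> {0}" by blast
  moreover have "(*) c ` I \<subseteq> R" using idlD(3)[OF I] c mult_closed by auto
  ultimately show ?thesis using modl_image[OF idlD(1)[OF I]] unfolding idl_def by auto
qed

lemma modl_sprod:
  assumes "modl I" "modl J"
  shows "modl (sprod I J)"
proof -
  have 0: "0 \<in> sprod I J"
    using sprod.base[OF modl_closed(1)[OF assms(1)] modl_closed(1)[OF assms(2)]] by simp
  have m: "c * x \<in> sprod I J" if "x \<in> sprod I J" "c \<in> R" for c x
    using that(1)
  proof induction
    case (base a b)
    thus ?case using modlD(2)[OF assms(1) that(2)] by (metis mult.assoc sprod.base)
  next
    case (add x y)
    thus ?case by (simp add: distrib_left sprod.add)
  qed
  have "x - y \<in> sprod I J" if "x \<in> sprod I J" "y \<in> sprod I J" for x y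
    using sprod.add[OF that(1) m[OF that(2), of "-1"]] of_int_closed[of "-1"] by simp
  thus ?thesis using 0 m unfolding modl_def additive_set_def by blast
qed

lemma sprod_subset:
  assumes "modl J" "I \<subseteq> R"
  shows "sprod I J \<subseteq> J"
  by (rule sprod_least) (use assms modlD[OF assms(1)] modl_closed[OF assms(1)] in auto)

lemma sprod_R:
  assumes "modl I"
  shows "sprod R I = I"
proof
  show "sprod R I \<subseteq> I" by (rule sprod_subset[OF assms]) simp
  show "I \<subseteq> sprod R I"
    using sprod.base[OF one_closed] by fastforce
qed

lemma sprod_R_right: "modl I \<Longrightarrow> sprod I R = I"
  using sprod_R sprod_commute by metis

lemma idl_nonzero: "idl I \<Longrightarrow> \<exists>x\<in>I. x \<noteq> 0"
  using modl_closed(1)[OF idlD(1)] unfolding idl_def by blast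

lemma idl_sprod:
  assumes "idl I" "idl J"
  shows "idl (sprod I J)"
proof -
  obtain x y where xy: "x \<in> I" "x \<noteq> 0" "y \<in> J" "y \<noteq> 0" using idl_nonzero assms by metis
  have "x * y \<in> sprod I J" using sprod.base[OF xy(1,3)] .
  moreover have "x * y \<noteq> 0" using xy by simp
  moreover have "sprod I J \<subseteq> R"
    using sprod_subset[OF idlD(1)[OF assms(2)] idlD(4)[OF assms(1)]] idlD(4)[OF assms(2)] by blast
  ultimately show ?thesis
    unfolding idl_def using modl_sprod[OF idlD(1)[OF assms(1)] idlD(1)[OF assms(2)]] by blast
qed

definition plus_ideal :: "complex set \<Rightarrow> complex \<Rightarrow> complex set" where
  "plus_ideal I x = {y + x * r |y r. y \<in> I \<and> r \<in> R}"

lemma plus_ideal: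
  assumes "modl I"
  shows "modl (plus_ideal I x)" "I \<subseteq> plus_ideal I x" "x \<in> plus_ideal I x"
    "idl I \<Longrightarrow> x \<in> R \<Longrightarrow> idl (plus_ideal I x)"
proof -
  note I = modl_closed[OF assms] modlD[OF assms]
  have "u - v \<in> plus_ideal I x" if uv: "u \<in> plus_ideal I x" "v \<in> plus_ideal I x" for u v
  proof -
    from uv obtain y r y' r' where "u = y + x * r" "v = y' + x * r'" "y \<in> I" "y' \<in> I" "r \<in> R" "r' \<in> R"
      unfolding plus_ideal_def by blast
    hence "u - v = (y - y') + x * (r - r')" "y - y' \<in> I" "r - r' \<in> R"
      using I R_closed by (auto simp: algebra_simps)
    thus ?thesis unfolding plus_ideal_def by blast
  qed
  moreover have "c * u \<in> plus_ideal I x" if uv: "u \<in> plus_ideal I x" "c \<in> R" for u c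
  proof -
    from uv obtain y r where "u = y + x * r" "y \<in> I" "r \<in> R"
      unfolding plus_ideal_def by blast
    hence "c * u = c * y + x * (c * r)" "c * y \<in> I" "c * r \<in> R"
      using I uv mult_closed by (auto simp: algebra_simps)
    thus ?thesis unfolding plus_ideal_def by blast
  qed
  moreover have sub: "y \<in> plus_ideal I x" if "y \<in> I" for y
    unfolding plus_ideal_def using that R_closed(1) by (metis (mono_tags, lifting) CollectI add.right_neutral mult_zero_right)
  ultimately show *: "modl (plus_ideal I x)"
    unfolding modl_def additive_set_def using I(1) by blast
  show "I \<subseteq> plus_ideal I x" using sub by blast
  show x: "x \<in> plus_ideal I x"
    unfolding plus_ideal_def using I(1) one_closed by (metis (mono_tags, lifting) CollectI add.left_neutral mult.right_neutral)
  show "idl (plus_ideal I x)" if "idl I" "x \<in> R"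
  proof -
    have "plus_ideal I x \<subseteq> R"
      using idlD(3)[OF that(1)] that(2) mult_closed R_closed(4) unfolding plus_ideal_def by blast
    thus ?thesis using * sub idl_nonzero[OF that(1)] unfolding idl_def by blast
  qed
qed

lemma idl_nat:
  assumes "idl I" shows "\<exists>m>0. of_nat m \<in> I"
proof -
  obtain x where x: "x \<in> I" "x \<noteq> 0" using idl_nonzero assms by blast
  obtain y m where "y \<in> R" "m > 0" "x * y = of_nat m" using dvd_nat[OF idlD(3)[OF assms x(1)] x(2)] by blast
  thus ?thesis using modlD(3)[OF idlD(1)[OF assms] _ x(1)] by metis
qed

text \<open>In coordinates with respect to the basis \<open>e\<close>, membership in mR means that m
  divides every coordinate, so the vectors with entries in {0..<m} represent the cosets.\<close>

lemma idx_scaled_R: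
  assumes "m > 0"
  shows "idx R ((*) (of_nat m) ` R) = m ^ n"
proof -
  let ?B = "(*) (of_nat m) ` R"
  have B: "additive_set ?B" using modlD(1)[OF modl_image[OF modl_R]] .
  define S where "S = PiE {..<n} (\<lambda>_. {0..<int m})"
  define f where "f a = coset_of ?B (\<Sum>i<n. of_int (a i) * e i)" for a :: "nat \<Rightarrow> int"
  have mem: "(\<Sum>i<n. of_int (a i) * e i) \<in> ?B \<longleftrightarrow> (\<forall>i<n. int m dvd a i)" for a :: "nat \<Rightarrow> int"
  proof
    assume "(\<Sum>i<n. of_int (a i) * e i) \<in> ?B"
    then obtain c where c: "(\<Sum>i<n. of_int (a i) * e i) = of_nat m * (\<Sum>i<n. of_int (c i) * e i)"
      unfolding span by auto
    have "(\<Sum>i<n. of_int ((\<lambda>i. a i - int m * c i) i) * e i) = 0"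
      using c by (simp add: sum_subtractf left_diff_distrib sum_distrib_left mult.assoc)
    from indep[OF this] show "\<forall>i<n. int m dvd a i" by (auto simp: dvd_def)
  next
    assume dvd: "\<forall>i<n. int m dvd a i"
    have "of_int (a i) = (of_nat m * of_int (a i div int m) :: complex)" if "i < n" for i
      using dvd that by (metis dvd_mult_div_cancel of_int_mult of_int_of_nat_eq)
    hence "(\<Sum>i<n. of_int (a i) * e i) = (\<Sum>i<n. of_nat m * (of_int (a i div int m) * e i))"
      by (intro sum.cong refl) (simp only: mult.assoc lessThan_iff)
    also have "\<dots> = of_nat m * (\<Sum>i<n. of_int (a i div int m) * e i)" by (simp add: sum_distrib_left)
    finally show "(\<Sum>i<n. of_int (a i) * e i) \<in> ?B" using spanI[of "\<lambda>i. a i div int m"] by blast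
  qed
  have eq: "f a = f b \<longleftrightarrow> (\<forall>i<n. int m dvd a i - b i)" for a b
    unfolding f_def coset_of_eq_iff[OF B] mem[symmetric, of "\<lambda>i. a i - b i"]
    by (simp add: sum_subtractf left_diff_distrib)
  have "bij_betw f S (cosets R ?B)"
  proof (rule bij_betw_imageI)
    show "inj_on f S"
    proof (rule inj_onI)
      fix a b assume ab: "a \<in> S" "b \<in> S" "f a = f b"
      have "a i = b i" if "i < n" for i
      proof -
        have "int m dvd a i - b i" using ab that eq by blast
        hence "a i mod int m = b i mod int m" by (simp add: mod_eq_dvd_iff)
        moreover have "a i \<in> {0..<int m}" "b i \<in> {0..<int m}" using ab that by (auto simp: S_def PiE_iff)
        ultimately show ?thesis by simp
      qed
      thus "a = b" using ab unfolding S_def by (intro PiE_ext) auto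
    qed
    show "f ` S = cosets R ?B"
    proof (intro equalityI subsetI)
      fix Y assume "Y \<in> f ` S"
      thus "Y \<in> cosets R ?B" unfolding f_def cosets_def span by blast
    next
      fix Y assume "Y \<in> cosets R ?B"
      then obtain a where a: "Y = f a" unfolding f_def cosets_def span by blast
      define b where "b = restrict (\<lambda>i. a i mod int m) {..<n}"
      have "f a = f b" unfolding eq b_def by (auto simp: mod_eq_dvd_iff[symmetric])
      moreover have "b \<in> S" using assms unfolding S_def b_def by auto
      ultimately show "Y \<in> f ` S" using a by blast
    qed
  qed
  hence "idx R ?B = card S" unfolding idx_def by (metis bij_betw_same_card)
  also have "\<dots> = m ^ n" unfolding S_def by (simp add: card_PiE)
  finally show ?thesis .
qed

text \<open>An ideal contains some positive integer m, hence lies between mR and R, and mR has the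
  finite index m^n.\<close>

lemma idx_pos:
  assumes "idl I"
  shows "idx R I > 0"
proof -
  obtain m where m: "m > 0" "of_nat m \<in> I" using idl_nat[OF assms] by blast
  let ?B = "(*) (of_nat m) ` R"
  have "?B \<subseteq> I" using modlD(3)[OF idlD(1)[OF assms] _ m(2)] by blast
  hence "idx R ?B = idx R I * idx I ?B"
    by (intro idx_tower R_additive idlD(2,4)[OF assms] modlD(1)[OF modl_image[OF modl_R]])
  hence "idx R I * idx I ?B = m ^ n" using idx_scaled_R[OF m(1)] by (simp only:)
  moreover have "m ^ n > 0" using m(1) by simp
  ultimately have "idx R I * idx I ?B > 0" by (simp only:)
  thus ?thesis by (metis mult_0 neq0_conv)
qed

text \<open>The norm drops strictly when an ideal grows. It serves as the induction measure in place
  of a noetherian argument.\<close>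

lemma idx_less:
  assumes "idl I" "idl J" "I \<subset> J"
  shows "idx R J < idx R I"
proof -
  have "idx R I = idx R J * idx J I"
    using assms(3) idlD(4)[OF assms(2)]
    by (intro idx_tower R_additive idlD(2)[OF assms(1)] idlD(2)[OF assms(2)]) auto
  moreover have "idx J I \<noteq> 1"
    using idx_eq_1_iff[OF idlD(2)[OF assms(2)] idlD(2)[OF assms(1)]] assms(3) by auto
  moreover have "idx R I > 0" by (rule idx_pos) fact
  moreover have "idx R J > 0" by (rule idx_pos) fact
  ultimately show ?thesis by (cases "idx J I") (simp_all only: mult_0_right, simp)
qed

end

section \<open>Unique factorisation of ideals and multiplicativity of the norm\<close>

context number_ring
begin

definition maxid :: "complex set \<Rightarrow> bool" where
  "maxid P \<longleftrightarrow> idl P \<and> P \<noteq> R \<and> (\<forall>J. idl J \<longrightarrow> P \<subseteq> J \<longrightarrow> J = P \<or> J = R)"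

lemma maxidD:
  assumes "maxid P"
  shows "idl P" "P \<noteq> R" "modl P" "P \<subseteq> R" "1 \<notin> P" "idl J \<Longrightarrow> P \<subseteq> J \<Longrightarrow> J = P \<or> J = R"
proof -
  show P: "idl P" "P \<noteq> R" "idl J \<Longrightarrow> P \<subseteq> J \<Longrightarrow> J = P \<or> J = R"
    using assms unfolding maxid_def by auto
  show "modl P" "P \<subseteq> R" using idlD(1,4)[OF P(1)] .
  show "1 \<notin> P" using idl_eq_R[OF P(1)] P(2) by auto
qed

lemma maxid_prime:
  assumes P: "maxid P" and xy: "x \<in> R" "y \<in> R" "x * y \<in> P"
  shows "x \<in> P \<or> y \<in> P"
proof (rule disjCI)
  assume "y \<notin> P"
  note Q = plus_ideal[OF maxidD(3)[OF P], of y]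
  have "plus_ideal P y = R"
    using maxidD(6)[OF P Q(4)[OF maxidD(1)[OF P] xy(2)] Q(2)] Q(3) \<open>y \<notin> P\<close> by auto
  hence "1 \<in> plus_ideal P y" using one_closed by simp
  then obtain p r where pr: "1 = p + y * r" "p \<in> P" "r \<in> R"
    unfolding plus_ideal_def by blast
  hence "x = x * p + (x * y) * r" by (metis distrib_left mult.assoc mult.right_neutral)
  thus "x \<in> P"
    using modlD(2)[OF maxidD(3)[OF P] xy(1) pr(2)] modlD(3)[OF maxidD(3)[OF P] pr(3) xy(3)]
      modl_closed(4)[OF maxidD(3)[OF P]] by metis
qed

lemma maxid_exists: "idl I \<Longrightarrow> I \<noteq> R \<Longrightarrow> \<exists>P. maxid P \<and> I \<subseteq> P"
proof (induction "idx R I" arbitrary: I rule: less_induct)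
  case less
  show ?case
  proof (cases "maxid I")
    case False
    then obtain J where J: "idl J" "I \<subseteq> J" "J \<noteq> I" "J \<noteq> R"
      using less.prems unfolding maxid_def by blast
    have "idx R J < idx R I" using J less.prems by (intro idx_less) auto
    from less.hyps[OF this J(1,4)] show ?thesis using J(2) by blast
  qed blast
qed

lemma maxid_prime_sprod:
  assumes P: "maxid P" and I: "idl I" "idl J" "sprod I J \<subseteq> P"
  shows "I \<subseteq> P \<or> J \<subseteq> P"
proof (rule disjCI)
  assume "\<not> J \<subseteq> P"
  then obtain y where y: "y \<in> J" "y \<notin> P" by blast
  show "I \<subseteq> P"
  proof
    fix x assume x: "x \<in> I"
    have "x * y \<in> P" using sprod.base[OF x y(1)] I(3) by blast
    thus "x \<in> P" using maxid_prime[OF P idlD(3)[OF I(1) x] idlD(3)[OF I(2) y(1)]] y(2) by blast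
  qed
qed

definition iprod :: "complex set multiset \<Rightarrow> complex set" where
  "iprod M = fold_mset sprod R M"

lemma iprod_empty [simp]: "iprod {#} = R"
  by (simp add: iprod_def)

lemma iprod_add [simp]: "iprod (add_mset P M) = sprod P (iprod M)"
proof -
  interpret comp_fun_commute "sprod :: complex set \<Rightarrow> _"
    by standard (rule ext, simp only: o_apply, rule sprod_left_commute)
  show ?thesis by (simp add: iprod_def)
qed

lemma idl_iprod: "(\<And>P. P \<in># M \<Longrightarrow> idl P) \<Longrightarrow> idl (iprod M)"
  by (induction M) (auto intro: idl_R idl_sprod)

lemma iprod_union:
  assumes "\<And>P. P \<in># N \<Longrightarrow> idl P"
  shows "iprod (M + N) = sprod (iprod M) (iprod N)"
proof -
  have "sprod R (iprod N) = iprod N"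
    by (rule sprod_R[OF idlD(1)[OF idl_iprod]]) (rule assms)
  thus ?thesis by (induction M) (simp_all add: sprod_assoc)
qed

lemma iprod_subset_maxid:
  assumes "maxid P" "\<And>Q. Q \<in># M \<Longrightarrow> maxid Q" "iprod M \<subseteq> P"
  shows "P \<in># M"
  using assms(2,3)
proof (induction M)
  case empty
  thus ?case using maxidD(2,4)[OF assms(1)] by auto
next
  case (add Q M)
  have Q: "maxid Q" "idl Q" using add.prems(1) maxidD(1) by auto
  have M: "idl (iprod M)" using add.prems(1) maxidD(1) by (intro idl_iprod) auto
  from maxid_prime_sprod[OF assms(1) Q(2) M] add.prems(2)
  consider "Q \<subseteq> P" | "iprod M \<subseteq> P" by auto
  thus ?case
  proof cases
    case 1
    hence "P = Q" using maxidD(6)[OF Q(1) maxidD(1)[OF assms(1)]] maxidD(2)[OF assms(1)] by blast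
    thus ?thesis by simp
  next
    case 2
    thus ?thesis using add by auto
  qed
qed

text \<open>The fact that finite domains are fields, in contrapositive form. For x in a strictly
  larger proper ideal J but outside I, the powers of x repeat modulo I, so some x^i (1 - x^k) lies
  in I. The least such i is positive, for otherwise 1 would lie in J; splitting off one factor x
  then gives the two elements.\<close>

lemma nonmaximal_zero_divisors:
  assumes I: "idl I" "I \<noteq> R" "\<not> maxid I"
  shows "\<exists>x\<in>R. \<exists>y\<in>R. x \<notin> I \<and> y \<notin> I \<and> x * y \<in> I"
proof -
  obtain J where J: "idl J" "I \<subseteq> J" "J \<noteq> I" "J \<noteq> R"
    using I unfolding maxid_def by blast
  then obtain x where x: "x \<in> J" "x \<notin> I" by blast
  have xR: "x \<in> R" using idlD(3)[OF J(1) x(1)] .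
  define Q where "Q i \<longleftrightarrow> (\<exists>k>0. x ^ i * (1 - x ^ k) \<in> I)" for i :: nat
  have "finite (cosets R I)" using idx_pos[OF I(1)] card_ge_0_finite unfolding idx_def by blast
  moreover have "(\<lambda>i. coset_of I (x ^ i)) ` UNIV \<subseteq> cosets R I"
    using power_closed[OF xR] by (auto simp: cosets_def)
  ultimately have "\<not> inj (\<lambda>i. coset_of I (x ^ i))"
    by (metis finite_imageD finite_subset infinite_UNIV_nat)
  then obtain i j where "i < j" and eq: "coset_of I (x ^ i) = coset_of I (x ^ j)"
    by (auto simp: inj_def) (metis nat_neq_iff)
  from eq have "x ^ i - x ^ j \<in> I" using coset_of_eq_iff[OF idlD(2)[OF I(1)]] by blast
  moreover have "x ^ i - x ^ j = x ^ i * (1 - x ^ (j - i))"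
    using \<open>i < j\<close> by (simp add: right_diff_distrib flip: power_add)
  ultimately have "Q i" unfolding Q_def using \<open>i < j\<close> by (intro exI[of _ "j - i"]) simp
  \<comment> \<open>Minimality is what keeps \<open>x ^ i1 * (1 - x ^ k)\<close> outside I, where
    \<open>i0 = Suc i1\<close>.\<close>
  define i0 where "i0 = (LEAST i. Q i)"
  have i0: "Q i0" "\<And>i. i < i0 \<Longrightarrow> \<not> Q i"
    unfolding i0_def using LeastI[of Q, OF \<open>Q i\<close>] not_less_Least[of _ Q] by blast+
  then obtain k where k: "k > 0" "x ^ i0 * (1 - x ^ k) \<in> I" by (auto simp: Q_def)
  have "i0 > 0"
  proof (rule ccontr)
    assume "\<not> i0 > 0"
    hence "1 - x ^ k \<in> J" using k J(2) by auto
    moreover have "x ^ k = x ^ (k - 1) * x" using k(1) by (metis power_minus_mult)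
    hence "x ^ k \<in> J" using modlD(2)[OF idlD(1)[OF J(1)] power_closed[OF xR] x(1)] by metis
    ultimately have "1 \<in> J" using modl_closed(4)[OF idlD(1)[OF J(1)], of "1 - x ^ k" "x ^ k"] by simp
    thus False using idl_eq_R[OF J(1)] J(4) by blast
  qed
  then obtain i1 where i1: "i0 = Suc i1" using gr0_conv_Suc by blast
  have "x ^ i1 * (1 - x ^ k) \<notin> I" using i0(2)[of i1] k(1) unfolding Q_def i1 by blast
  moreover have "x * (x ^ i1 * (1 - x ^ k)) \<in> I"
    using k(2) by (simp add: i1 mult.assoc)
  moreover have "x ^ i1 * (1 - x ^ k) \<in> R"
    by (intro mult_closed power_closed R_closed(2) one_closed xR)
  ultimately show ?thesis using x(2) xR by blast
qed

text \<open>If I is neither R nor maximal, pick x and y outside I with xy in I. Both I + xR and I +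
  yR have smaller norm, and their product lies in I, so the two products of maximal ideals found
  inside them can be multiplied.\<close>

lemma iprod_subset_exists:
  "idl I \<Longrightarrow> \<exists>M. (\<forall>P. P \<in># M \<longrightarrow> maxid P) \<and> iprod M \<subseteq> I"
proof (induction "idx R I" arbitrary: I rule: less_induct)
  case less
  consider "I = R" | "maxid I" | "I \<noteq> R" "\<not> maxid I" by blast
  thus ?case
  proof cases
    case 1
    thus ?thesis by (intro exI[of _ "{#}"]) auto
  next
    case 2
    thus ?thesis using sprod_R_right[OF idlD(1)[OF less.prems]] by (intro exI[of _ "{#I#}"]) auto
  next
    case 3
    from nonmaximal_zero_divisors[OF less.prems 3] obtain x y
      where xy: "x \<in> R" "y \<in> R" "x \<notin> I" "y \<notin> I" "x * y \<in> I" by blast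
    note I = idlD(1)[OF less.prems]
    have *: "\<exists>M. (\<forall>P. P \<in># M \<longrightarrow> maxid P) \<and> iprod M \<subseteq> plus_ideal I z" if "z \<in> R" "z \<notin> I" for z
    proof -
      note J = plus_ideal[OF I, of z]
      have "I \<subset> plus_ideal I z" using J(2,3) that by blast
      from idx_less[OF less.prems J(4)[OF less.prems that(1)] this] show ?thesis
        using less.hyps J(4)[OF less.prems that(1)] by blast
    qed
    obtain M where M: "\<forall>P. P \<in># M \<longrightarrow> maxid P" "iprod M \<subseteq> plus_ideal I x" using *[OF xy(1,3)] by blast
    obtain N where N: "\<forall>P. P \<in># N \<longrightarrow> maxid P" "iprod N \<subseteq> plus_ideal I y" using *[OF xy(2,4)] by blast
    have "sprod (plus_ideal I x) (plus_ideal I y) \<subseteq> I"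
    proof (rule sprod_least)
      fix a b assume "a \<in> plus_ideal I x" "b \<in> plus_ideal I y"
      then obtain u r v s where ab: "a = u + x * r" "b = v + y * s" "u \<in> I" "v \<in> I" "r \<in> R" "s \<in> R"
        unfolding plus_ideal_def by blast
      have "b \<in> R" unfolding ab using ab idlD(3)[OF less.prems] xy mult_closed R_closed(4) by blast
      have "a * b = u * b + ((x * r) * v + (x * y) * (r * s))" by (simp add: ab algebra_simps)
      thus "a * b \<in> I"
        using modlD(3)[OF I \<open>b \<in> R\<close> ab(3)] modlD(2)[OF I mult_closed[OF xy(1) ab(5)] ab(4)]
          modlD(3)[OF I mult_closed[OF ab(5,6)] xy(5)] modl_closed(4)[OF I] by metis
    qed (rule modl_closed(4)[OF I])
    moreover have "iprod (M + N) = sprod (iprod M) (iprod N)"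
      using N(1) maxidD(1) by (intro iprod_union) auto
    ultimately have "iprod (M + N) \<subseteq> I" using sprod_mono[OF M(2) N(2)] by blast
    thus ?thesis using M(1) N(1) by (intro exI[of _ "M + N"]) auto
  qed
qed

text \<open>With a positive integer m in I, every m x^k stays in I and hence in R. This is exactly
  the hypothesis of \<open>int_closed\<close>, and it is the only way in which integral closedness
  enters the ideal theory.\<close>

lemma multiplier_closed:
  assumes "idl I" "\<And>y. y \<in> I \<Longrightarrow> x * y \<in> I"
  shows "x \<in> R"
proof -
  obtain m where m: "m > 0" "of_nat m \<in> I" using idl_nat[OF assms(1)] by blast
  have "of_nat m * x ^ k \<in> I" for k
  proof (induction k)
    case (Suc k)
    thus ?case using assms(2)[OF Suc] by (simp add: mult_ac)
  qed (use m in auto)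
  thus ?thesis using int_closed[OF m(1)] idlD(3)[OF assms(1)] by blast
qed

text \<open>For a maximal ideal this is the inverse fractional ideal.\<close>
definition pinv :: "complex set \<Rightarrow> complex set" where
  "pinv P = {x. \<forall>y\<in>P. x * y \<in> R}"

lemma modl_pinv: "modl (pinv P)"
  unfolding modl_def additive_set_def pinv_def
  using R_closed mult_closed by (auto simp: left_diff_distrib mult.assoc)

text \<open>For a in P choose a product of maximal ideals inside aR with the fewest factors. P is
  one of them; without it the product is no longer contained in aR, and any b in it but outside aR
  gives the element b / a.\<close>

lemma maxid_inverse_exists:
  assumes P: "maxid P"
  shows "\<exists>x\<in>pinv P. x \<notin> R"
proof -
  obtain a where a: "a \<in> P" "a \<noteq> 0" using idl_nonzero[OF maxidD(1)[OF P]] by blast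
  let ?I = "(*) a ` R"
  have aR: "a \<in> R" using a maxidD(4)[OF P] by blast
  have I: "idl ?I" using idl_image[OF idl_R aR a(2)] .
  define Q where "Q M \<longleftrightarrow> (\<forall>P. P \<in># M \<longrightarrow> maxid P) \<and> iprod M \<subseteq> ?I" for M
  obtain M where M: "Q M" "\<And>N. Q N \<Longrightarrow> size M \<le> size N"
    using iprod_subset_exists[OF I] ex_has_least_nat[of Q _ size] unfolding Q_def by metis
  have "?I \<subseteq> P" using modlD(3)[OF maxidD(3)[OF P] _ a(1)] by blast
  hence "P \<in># M" using M(1) unfolding Q_def by (intro iprod_subset_maxid[OF P]) auto
  then obtain N where N: "M = add_mset P N" by (metis insert_DiffM)
  have "\<not> Q N" using M(2)[of N] N by auto
  then obtain b where b: "b \<in> iprod N" "b \<notin> ?I" using M(1) N unfolding Q_def by auto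
  have "b / a \<notin> R" using b(2) a(2) by (metis image_eqI nonzero_mult_div_cancel_left times_divide_eq_right)
  moreover have "b / a * y \<in> R" if "y \<in> P" for y
  proof -
    have "y * b \<in> ?I" using sprod.base[OF that b(1)] M(1) N unfolding Q_def by auto
    then obtain r where "r \<in> R" "y * b = a * r" by blast
    thus ?thesis using a(2) by (simp add: field_simps)
  qed
  ultimately show ?thesis unfolding pinv_def by blast
qed

lemma subset_sprod_pinv: "I \<subseteq> sprod (pinv P) I" if "P \<subseteq> R"
proof
  fix x assume "x \<in> I"
  moreover have "1 \<in> pinv P" using that by (auto simp: pinv_def)
  ultimately show "x \<in> sprod (pinv P) I" using sprod.base[of 1 "pinv P" x I] by simp
qed

text \<open>The product lies between P and R, so by maximality it is one of the two. If it were P,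
  an element of \<open>pinv P\<close> outside R would map P into itself, against
  \<open>multiplier_closed\<close>.\<close>

lemma sprod_pinv:
  assumes P: "maxid P"
  shows "sprod (pinv P) P = R"
proof -
  let ?J = "sprod (pinv P) P"
  have sub: "P \<subseteq> ?J" by (rule subset_sprod_pinv) (rule maxidD(4)[OF P])
  have "?J \<subseteq> R" by (rule sprod_least) (auto simp: pinv_def intro: R_closed)
  hence J: "idl ?J"
    using sub idl_nonzero[OF maxidD(1)[OF P]] modl_sprod[OF modl_pinv maxidD(3)[OF P]]
    unfolding idl_def by blast
  have "?J \<noteq> P"
  proof
    assume eq: "?J = P"
    obtain x where x: "x \<in> pinv P" "x \<notin> R" using maxid_inverse_exists[OF P] by blast
    have "x * y \<in> P" if "y \<in> P" for y using sprod.base[OF x(1) that] eq by simp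
    thus False using multiplier_closed[OF maxidD(1)[OF P]] x(2) by blast
  qed
  thus ?thesis using maxidD(6)[OF P J sub] by blast
qed

lemma sprod_pinv_cancel: "maxid P \<Longrightarrow> modl I \<Longrightarrow> sprod (pinv P) (sprod P I) = I"
  by (simp only: sprod_assoc[symmetric] sprod_pinv sprod_R)

lemma sprod_maxid_psubset:
  assumes P: "maxid P" and I: "idl I"
  shows "sprod P I \<subset> I"
proof -
  have "sprod P I \<noteq> I"
  proof
    assume "sprod P I = I"
    hence eq: "sprod (pinv P) I = I" using sprod_pinv_cancel[OF P idlD(1)[OF I]] by simp
    obtain x where x: "x \<in> pinv P" "x \<notin> R" using maxid_inverse_exists[OF P] by blast
    have "x * y \<in> I" if "y \<in> I" for y using sprod.base[OF x(1) that] eq by simp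
    thus False using multiplier_closed[OF I] x(2) by blast
  qed
  thus ?thesis using sprod_subset[OF idlD(1)[OF I] maxidD(4)[OF P]] by blast
qed

text \<open>Division of I by a maximal ideal containing it: the quotient is an honest ideal,
  strictly larger than I, which lets the induction for the factorisation proceed.\<close>

lemma sprod_pinv_ideal:
  assumes P: "maxid P" and I: "idl I" "I \<subseteq> P"
  shows "idl (sprod (pinv P) I)" "sprod P (sprod (pinv P) I) = I" "I \<subset> sprod (pinv P) I"
proof -
  let ?J = "sprod (pinv P) I"
  have "I \<subseteq> ?J" by (rule subset_sprod_pinv) (rule maxidD(4)[OF P])
  moreover have "?J \<subseteq> R" by (rule sprod_least) (use I(2) in \<open>auto simp: pinv_def intro: R_closed\<close>)
  ultimately show J: "idl ?J"
    using idl_nonzero[OF I(1)] modl_sprod[OF modl_pinv idlD(1)[OF I(1)]] unfolding idl_def by blast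
  show PJ: "sprod P ?J = I"
    using sprod_assoc[of P "pinv P" I] sprod_pinv[OF P] sprod_R[OF idlD(1)[OF I(1)]] sprod_commute[of P "pinv P"] by simp
  show "I \<subset> ?J" using sprod_maxid_psubset[OF P J] PJ by simp
qed

lemma factorization_exists:
  "idl I \<Longrightarrow> \<exists>M. (\<forall>P. P \<in># M \<longrightarrow> maxid P) \<and> iprod M = I"
proof (induction "idx R I" arbitrary: I rule: less_induct)
  case less
  show ?case
  proof (cases "I = R")
    case True
    thus ?thesis by (intro exI[of _ "{#}"]) auto
  next
    case False
    then obtain P where P: "maxid P" "I \<subseteq> P" using maxid_exists less.prems by blast
    note J = sprod_pinv_ideal[OF P(1) less.prems P(2)]
    obtain N where "\<forall>P. P \<in># N \<longrightarrow> maxid P" "iprod N = sprod (pinv P) I"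
      using less.hyps[OF idx_less[OF less.prems J(1,3)] J(1)] by blast
    thus ?thesis using P J(2) by (intro exI[of _ "add_mset P N"]) auto
  qed
qed

lemma factorization_unique:
  assumes "\<And>P. P \<in># M \<Longrightarrow> maxid P" "\<And>P. P \<in># N \<Longrightarrow> maxid P" "iprod M = iprod N"
  shows "M = N"
  using assms
proof (induction M arbitrary: N)
  case empty
  show ?case
  proof (rule ccontr)
    assume "{#} \<noteq> N"
    then obtain P N' where N: "N = add_mset P N'" by (metis multiset_cases)
    have "sprod P (iprod N') \<subseteq> P"
      using sprod_subset[OF maxidD(3)[of P], of "iprod N'"] idlD(4)[OF idl_iprod[of N']] empty.prems(2) maxidD(1) N
      by (auto simp: sprod_commute[of P])
    thus False using empty.prems(2,3) N maxidD(2,4)[of P] by auto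
  qed
next
  case (add P M)
  have P: "maxid P" using add.prems by simp
  have M: "idl (iprod M)" using add.prems(1) maxidD(1) by (intro idl_iprod) auto
  have "iprod N \<subseteq> P"
    using sprod_subset[OF maxidD(3)[OF P] idlD(4)[OF M]] add.prems(3) by (simp add: sprod_commute)
  hence "P \<in># N" using add.prems(2) by (intro iprod_subset_maxid[OF P]) auto
  then obtain N' where N: "N = add_mset P N'" by (metis insert_DiffM)
  have N': "idl (iprod N')" using add.prems(2) maxidD(1) N by (intro idl_iprod) auto
  have "sprod P (iprod M) = sprod P (iprod N')" using add.prems(3) N by simp
  hence "sprod (pinv P) (sprod P (iprod M)) = sprod (pinv P) (sprod P (iprod N'))" by (rule arg_cong)
  hence eq: "iprod M = iprod N'"
    by (simp only: sprod_pinv_cancel[OF P idlD(1)[OF M]] sprod_pinv_cancel[OF P idlD(1)[OF N']])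
  have "M = N'"
  proof (rule add.IH[OF _ _ eq])
    show "maxid Q" if "Q \<in># M" for Q using add.prems(1) that by simp
    show "maxid Q" if "Q \<in># N'" for Q using add.prems(2) that N by simp
  qed
  thus ?case using N by simp
qed

text \<open>Inverses of the maximal factors are multiplied together. General ideals have to be
  cancelled in \<open>idx_sprod_maxid\<close>, where \<open>pinv\<close> alone would not do.\<close>

lemma idl_invertible:
  assumes "idl I"
  shows "\<exists>J. modl J \<and> sprod I J = R"
proof -
  have "\<exists>J. modl J \<and> sprod (iprod M) J = R" if "\<And>P. P \<in># M \<Longrightarrow> maxid P" for M
    using that
  proof (induction M)
    case empty
    show ?case by (rule exI[of _ R]) (simp add: modl_R sprod_R[OF modl_R])
  next
    case (add P M)
    have "maxid Q" if "Q \<in># M" for Q using add.prems that by simp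
    from add.IH[OF this] obtain J where J: "modl J" "sprod (iprod M) J = R" by blast
    have P: "maxid P" using add.prems by simp
    have "sprod (sprod P (iprod M)) (sprod J (pinv P)) = sprod P (sprod (sprod (iprod M) J) (pinv P))"
      by (simp add: sprod_assoc)
    also have "\<dots> = R"
      by (simp only: J(2) sprod_R[OF modl_pinv] sprod_commute[of P "pinv P"] sprod_pinv[OF P])
    finally show ?case using modl_sprod[OF J(1) modl_pinv[of P]] by auto
  qed
  thus ?thesis using factorization_exists[OF assms] by metis
qed

text \<open>Multiplication by an element a of J outside PJ induces R/P = J/PJ. Injectivity: the x
  with ax in PJ form an ideal that contains P but not 1, hence equal P. Surjectivity: PJ + aR,
  multiplied by the inverse of J, lies strictly above P, hence is R, so PJ + aR = J.\<close>

lemma idx_sprod_maxid: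
  assumes P: "maxid P" and J: "idl J"
  shows "idx R (sprod P J) = idx R P * idx R J"
proof -
  let ?K = "sprod P J"
  have K: "idl ?K" using idl_sprod[OF maxidD(1)[OF P] J] .
  have KJ: "?K \<subset> J" by (rule sprod_maxid_psubset[OF P J])
  then obtain a where a: "a \<in> J" "a \<notin> ?K" by blast
  have aR: "a \<in> R" using idlD(3)[OF J a(1)] .
  have "idx R P = idx J ?K"
  proof (rule idx_cong_map[where f = "\<lambda>x. a * x"])
    show "additive_set P" "additive_set ?K" using idlD(2)[OF maxidD(1)[OF P]] idlD(2)[OF K] .
    show "a * x \<in> J" if "x \<in> R" for x using modlD(3)[OF idlD(1)[OF J] that a(1)] .
    define L where "L = {x \<in> R. a * x \<in> ?K}"
    have PL: "P \<subseteq> L"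
    proof
      fix x assume x: "x \<in> P"
      thus "x \<in> L" using sprod.base[OF x a(1)] maxidD(4)[OF P] by (auto simp: L_def mult.commute)
    qed
    have "modl L"
      unfolding modl_def additive_set_def L_def
      using R_closed mult_closed modl_closed[OF idlD(1)[OF K]] modlD[OF idlD(1)[OF K]]
      by (auto simp: right_diff_distrib mult.left_commute)
    hence "idl L" unfolding idl_def using PL idl_nonzero[OF maxidD(1)[OF P]] by (auto simp: L_def)
    moreover have "1 \<notin> L" using a by (simp add: L_def)
    ultimately have L: "L = P" using maxidD(6)[OF P _ PL] one_closed by blast
    show "a * x - a * y \<in> ?K \<longleftrightarrow> x - y \<in> P" if "x \<in> R" "y \<in> R" for x y
    proof -
      have "x - y \<in> P \<longleftrightarrow> x - y \<in> L" using L by simp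
      thus ?thesis using R_closed(2)[OF that] by (simp add: L_def right_diff_distrib)
    qed
    note Q = plus_ideal[OF idlD(1)[OF K], of a]
    let ?Q = "plus_ideal ?K a"
    have "?Q \<subseteq> J"
    proof
      fix z assume "z \<in> ?Q"
      then obtain y r where z: "z = y + a * r" "y \<in> ?K" "r \<in> R"
        unfolding plus_ideal_def by blast
      have "y \<in> J" using KJ z(2) by blast
      thus "z \<in> J" using modl_closed(4)[OF idlD(1)[OF J]] modlD(3)[OF idlD(1)[OF J] z(3) a(1)] z(1) by simp
    qed
    obtain J' where J': "modl J'" "sprod J J' = R" using idl_invertible[OF J] by blast
    have "sprod ?K J' = P"
      using J'(2) sprod_R_right[OF maxidD(3)[OF P]] by (simp add: sprod_assoc)
    hence PQ: "P \<subseteq> sprod ?Q J'" using sprod_mono[OF Q(2) order.refl, of J'] by simp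
    have "sprod ?Q J' \<subseteq> R" using sprod_mono[OF \<open>?Q \<subseteq> J\<close> order.refl, of J'] J'(2) by simp
    hence QJ: "idl (sprod ?Q J')"
      using PQ idl_nonzero[OF maxidD(1)[OF P]] modl_sprod[OF Q(1) J'(1)] unfolding idl_def by blast
    have *: "sprod (sprod ?Q J') J = ?Q"
      by (simp only: sprod_assoc sprod_commute[of J' J] J'(2) sprod_R_right[OF Q(1)])
    have "sprod ?Q J' \<noteq> P" using * Q(3) a(2) by auto
    hence "sprod ?Q J' = R" using maxidD(6)[OF P QJ PQ] by blast
    hence "?Q = J" using * sprod_R[OF idlD(1)[OF J]] by simp
    show "\<exists>x\<in>R. z - a * x \<in> ?K" if "z \<in> J" for z
    proof -
      have "z \<in> ?Q" using that \<open>?Q = J\<close> by simp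
      then obtain y r where z: "z = y + a * r" "y \<in> ?K" "r \<in> R"
        unfolding plus_ideal_def by blast
      thus ?thesis by (intro bexI[of _ r]) simp_all
    qed
  qed
  moreover have "idx R ?K = idx R J * idx J ?K"
    using KJ by (intro idx_tower R_additive idlD(2)[OF J] idlD(2)[OF K] idlD(4)[OF J]) auto
  ultimately show ?thesis by simp
qed

lemma idx_iprod:
  "(\<And>P. P \<in># M \<Longrightarrow> maxid P) \<Longrightarrow> idx R (iprod M) = (\<Prod>P\<in>#M. idx R P)"
proof (induction M)
  case empty
  show ?case by (simp add: R_additive)
next
  case (add P M)
  thus ?case using idx_sprod_maxid[of P "iprod M"] idl_iprod[of M] maxidD(1) by auto
qed

text \<open>Unique factorisation in the form that turns the sum over all ideals into a sum over
  multisets of maximal ideals.\<close>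

lemma bij_iprod: "bij_betw iprod {M. set_mset M \<subseteq> Collect maxid} (Collect idl)"
proof (rule bij_betw_imageI)
  show "inj_on iprod {M. set_mset M \<subseteq> Collect maxid}"
    by (intro inj_onI factorization_unique) auto
  show "iprod ` {M. set_mset M \<subseteq> Collect maxid} = Collect idl"
    using factorization_exists maxidD(1) by (auto intro!: idl_iprod)
qed

end

section \<open>Residue fields and the primes above a rational prime\<close>

context number_ring
begin

abbreviation A :: "complex ring" where
  "A \<equiv> ring_of_type_algebra\<lparr>carrier := R\<rparr>"

lemma A_simps [simp]:
  "carrier A = R" "mult A = (*)" "one A = 1" "zero A = 0" "add A = (+)"
  by (simp_all add: ring_of_type_algebra_def)

lemma cring_A: "cring A"
proof (rule cringI)
  show "abelian_group A"
  proof (rule abelian_groupI)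
    fix x assume "x \<in> carrier A"
    thus "\<exists>y\<in>carrier A. y \<oplus>\<^bsub>A\<^esub> x = \<zero>\<^bsub>A\<^esub>"
      using R_closed(3)[of x] by (intro bexI[of _ "-x"]) simp_all
  qed (auto simp: add_ac R_closed)
  show "comm_monoid A"
    by (rule comm_monoidI) (auto simp: mult_ac mult_closed one_closed)
qed (simp add: distrib_right)

lemma nat_pow_A [simp]: "x [^]\<^bsub>A\<^esub> (k::nat) = x ^ k"
proof (induction k)
  case 0
  show ?case by (simp add: nat_pow_def)
next
  case (Suc k)
  have "x [^]\<^bsub>A\<^esub> Suc k = x [^]\<^bsub>A\<^esub> k \<otimes>\<^bsub>A\<^esub> x" by (simp add: nat_pow_def)
  thus ?case using Suc by simp
qed

lemma a_inv_A [simp]: "x \<in> R \<Longrightarrow> \<ominus>\<^bsub>A\<^esub> x = - x"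
proof -
  interpret cring A by (rule cring_A)
  assume "x \<in> R"
  thus ?thesis using R_closed(3)[of x] by (intro minus_equality) auto
qed

lemma ideal_A_iff: "ideal I A \<longleftrightarrow> modl I \<and> I \<subseteq> R"
proof
  assume I: "ideal I A"
  note add = ideal.axioms(1)[OF I]
  have sub: "I \<subseteq> R" using additive_subgroup.a_subset[OF add] by simp
  have m: "x * y \<in> I" if "x \<in> R" "y \<in> I" for x y
    using ideal.I_l_closed[OF I that(2), of x] that(1) by simp
  have p: "x + y \<in> I" if "x \<in> I" "y \<in> I" for x y
    using additive_subgroup.a_closed[OF add that] by simp
  have "-1 \<in> R" using R_closed(3)[OF one_closed] .
  hence "x - y \<in> I" if "x \<in> I" "y \<in> I" for x y
    using p[OF that(1) m[OF _ that(2), of "-1"]] by simp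
  moreover have "0 \<in> I" using additive_subgroup.zero_closed[OF add] by simp
  ultimately show "modl I \<and> I \<subseteq> R" using sub m by (simp add: modl_def additive_set_def)
next
  assume I: "modl I \<and> I \<subseteq> R"
  interpret cring A by (rule cring_A)
  show "ideal I A"
  proof (rule idealI[OF ring_axioms])
    show "subgroup I (add_monoid A)"
    proof (rule group.subgroupI[OF add.is_group])
      show "inv\<^bsub>add_monoid A\<^esub> a \<in> I" if "a \<in> I" for a
      proof -
        have "inv\<^bsub>add_monoid A\<^esub> a = \<ominus>\<^bsub>A\<^esub> a" by (simp add: a_inv_def)
        thus ?thesis using that I modl_closed(3)[of I a] a_inv_A[of a] by auto
      qed
    qed (use I modl_closed[of I] in auto)
  qed (use I modlD(2,3)[of I] in auto)
qed

lemma a_r_coset_A: "I +>\<^bsub>A\<^esub> x = coset_of I x"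
  unfolding a_r_coset_def' coset_of_def by auto

lemma carrier_Quot: "carrier (A Quot I) = cosets R I"
  unfolding FactRing_def by (auto simp: A_RCOSETS_def' a_r_coset_A cosets_def)

lemma ideal_norm_A: "card (carrier (A Quot I)) = idx R I"
  by (simp add: carrier_Quot idx_def)

lemma ideals_A: "{I. ideal I A \<and> I \<noteq> {0}} = Collect idl"
  unfolding ideal_A_iff idl_def by auto

lemma maximalideal_A:
  assumes P: "maxid P"
  shows "maximalideal P A"
proof (rule maximalidealI)
  show "ideal P A" unfolding ideal_A_iff using maxidD(3,4)[OF P] by simp
  show "carrier A \<noteq> P" using maxidD(2)[OF P] by simp
  fix J assume J: "ideal J A" "P \<subseteq> J" "J \<subseteq> carrier A"
  hence "idl J" using idl_nonzero[OF maxidD(1)[OF P]] unfolding ideal_A_iff idl_def by auto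
  thus "J = P \<or> J = carrier A" using maxidD(6)[OF P _ J(2)] by simp
qed

lemma residue_field:
  assumes P: "maxid P"
  shows "field (A Quot P)" "finite (carrier (A Quot P))" "order (A Quot P) = idx R P"
    "x \<in> R \<Longrightarrow> coset_of P x [^]\<^bsub>A Quot P\<^esub> (k::nat) = coset_of P (x ^ k)"
    "\<one>\<^bsub>A Quot P\<^esub> = coset_of P 1" "\<zero>\<^bsub>A Quot P\<^esub> = coset_of P 0"
proof -
  interpret maximalideal P A by (rule maximalideal_A) fact
  show F: "field (A Quot P)" by (rule quotient_is_field) (rule cring_A)
  show "order (A Quot P) = idx R P" by (simp add: order_def ideal_norm_A)
  thus "finite (carrier (A Quot P))"
    using idx_pos[OF maxidD(1)[OF P]] unfolding order_def by (intro card_ge_0_finite) simp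
  show 1: "\<one>\<^bsub>A Quot P\<^esub> = coset_of P 1" by (simp add: FactRing_def a_r_coset_A)
  show "\<zero>\<^bsub>A Quot P\<^esub> = coset_of P 0" by (simp add: FactRing_def coset_of_def)
  interpret h: ring_hom_ring A "A Quot P" "(+>\<^bsub>A\<^esub>) P" by (rule rcos_ring_hom_ring)
  show "coset_of P x [^]\<^bsub>A Quot P\<^esub> k = coset_of P (x ^ k)" if "x \<in> R"
    using h.hom_nat_pow[of x k] that by (simp add: a_r_coset_A)
qed

lemma coset_of_maxid_eq_iff: "maxid P \<Longrightarrow> coset_of P x = coset_of P y \<longleftrightarrow> x - y \<in> P"
  by (rule coset_of_eq_iff[OF idlD(2)[OF maxidD(1)]])

lemma residue_fermat:
  assumes P: "maxid P" and x: "x \<in> R" "x \<notin> P"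
  shows "x ^ (idx R P - 1) - 1 \<in> P"
proof -
  note Q = residue_field[OF P]
  interpret field "A Quot P" by (rule Q)
  interpret G: group "Multiplicative_Group.mult_of (A Quot P)" by (rule field_mult_group)
  have "coset_of P x \<noteq> coset_of P 0" using x coset_of_maxid_eq_iff[OF P, of x 0] by simp
  hence "coset_of P x \<in> carrier (Multiplicative_Group.mult_of (A Quot P))"
    using x(1) by (simp add: carrier_Quot cosets_def Q(6))
  from G.pow_order_eq_1[OF this]
  have "coset_of P x [^]\<^bsub>A Quot P\<^esub> (idx R P - 1) = \<one>\<^bsub>A Quot P\<^esub>"
    using order_mult_of[OF Q(2)] Q(3) by (simp add: Multiplicative_Group.nat_pow_mult_of)
  hence "coset_of P (x ^ (idx R P - 1)) = coset_of P 1" using Q(4)[OF x(1)] Q(5) by simp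
  thus ?thesis using coset_of_maxid_eq_iff[OF P] by blast
qed

text \<open>All nonzero residue classes are roots of X^d - 1, and a field contains at most d of
  these.\<close>

lemma idx_le_of_roots:
  assumes P: "maxid P" and d: "d > 0" "\<And>x. x \<in> R \<Longrightarrow> x \<notin> P \<Longrightarrow> x ^ d - 1 \<in> P"
  shows "idx R P \<le> d + 1"
proof -
  note Q = residue_field[OF P]
  interpret field "A Quot P" by (rule Q)
  have sub: "carrier (A Quot P) - {\<zero>\<^bsub>A Quot P\<^esub>} \<subseteq> {x \<in> carrier (A Quot P). x [^]\<^bsub>A Quot P\<^esub> d = \<one>\<^bsub>A Quot P\<^esub>}"
  proof
    fix y assume "y \<in> carrier (A Quot P) - {\<zero>\<^bsub>A Quot P\<^esub>}"
    then obtain x where x: "x \<in> R" "y = coset_of P x" "coset_of P x \<noteq> coset_of P 0"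
      by (auto simp: carrier_Quot cosets_def Q(6))
    hence "x \<notin> P" using coset_of_maxid_eq_iff[OF P, of x 0] by simp
    from d(2)[OF x(1) this] have "coset_of P (x ^ d) = coset_of P 1"
      using coset_of_maxid_eq_iff[OF P] by blast
    thus "y \<in> {x \<in> carrier (A Quot P). x [^]\<^bsub>A Quot P\<^esub> d = \<one>\<^bsub>A Quot P\<^esub>}"
      using x(1,2) Q(4)[OF x(1)] Q(5) by (simp add: carrier_Quot cosets_def)
  qed
  have "idx R P - 1 = card (carrier (A Quot P) - {\<zero>\<^bsub>A Quot P\<^esub>})"
    using Q(2,3) by (simp add: order_def)
  also have "\<dots> \<le> card {x \<in> carrier (A Quot P). x [^]\<^bsub>A Quot P\<^esub> d = \<one>\<^bsub>A Quot P\<^esub>}"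
    using sub Q(2) by (intro card_mono) auto
  also have "\<dots> \<le> d" using num_roots_le_deg[OF Q(2)] d(1) by simp
  finally show ?thesis by simp
qed

lemma maxid_power:
  assumes P: "maxid P" and x: "x \<in> R" "x ^ k \<in> P"
  shows "x \<in> P"
  using x(2)
proof (induction k)
  case 0
  thus ?case using maxidD(5)[OF P] by simp
next
  case (Suc k)
  hence "x * x ^ k \<in> P" by simp
  thus ?case using maxid_prime[OF P x(1) power_closed[OF x(1), of k]] Suc.IH by blast
qed

lemma of_nat_scaled: "of_nat m \<in> P \<Longrightarrow> modl P \<Longrightarrow> (*) (of_nat m) ` R \<subseteq> P"
  using modlD(3) by blast

lemma maxid_contains_prime:
  assumes P: "maxid P"
  shows "\<exists>p. prime (p::nat) \<and> of_nat p \<in> P"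
proof -
  define m where "m = (LEAST m. m > 0 \<and> (of_nat m :: complex) \<in> P)"
  have m: "m > 0" "of_nat m \<in> P" and least: "\<And>k. k > 0 \<Longrightarrow> of_nat k \<in> P \<Longrightarrow> m \<le> k"
    using LeastI_ex[OF idl_nat[OF maxidD(1)[OF P]]] Least_le[of "\<lambda>m. m > 0 \<and> (of_nat m :: complex) \<in> P"]
    unfolding m_def by auto
  have "m \<noteq> 1" using m(2) maxidD(5)[OF P] by auto
  then obtain p where p: "prime p" "p dvd m" using prime_factor_nat by blast
  then obtain k where k: "m = p * k" by blast
  have "k > 0" "k < m" using k m(1) p(1) prime_gt_1_nat[OF p(1)] by auto
  hence "of_nat k \<notin> P" using least[of k] by auto
  moreover have "of_nat p * of_nat k \<in> P" using m(2) k by simp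
  ultimately have "of_nat p \<in> P" using maxid_prime[OF P of_nat_closed of_nat_closed] by blast
  thus ?thesis using p(1) by blast
qed

lemma idl_scaled: "m > 0 \<Longrightarrow> idl ((*) (of_nat m) ` R)"
  by (rule idl_image[OF idl_R of_nat_closed]) simp

text \<open>P contains pR, whose index is p^n, so by the tower law the norm of P divides p^n; it is
  not 1 because P is proper.\<close>

lemma maxid_idx_power:
  assumes P: "maxid P" and p: "prime p" "of_nat p \<in> P"
  shows "\<exists>f. f > 0 \<and> f \<le> n \<and> idx R P = p ^ f"
proof -
  have sub: "(*) (of_nat p) ` R \<subseteq> P" using of_nat_scaled p(2) maxidD(3)[OF P] by blast
  have "p ^ n = idx R P * idx P ((*) (of_nat p) ` R)"
    using idx_scaled_R[OF prime_gt_0_nat[OF p(1)]]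
      idx_tower[OF R_additive idlD(2)[OF maxidD(1)[OF P]] idlD(2)[OF idl_scaled[OF prime_gt_0_nat[OF p(1)]]] sub maxidD(4)[OF P]]
    by simp
  hence "idx R P dvd p ^ n" by simp
  then obtain f where f: "f \<le> n" "idx R P = p ^ f" using divides_primepow_nat[OF p(1)] by blast
  have "idx R P \<noteq> 1"
    using idx_eq_1_iff[OF R_additive idlD(2)[OF maxidD(1)[OF P]] maxidD(4)[OF P]] maxidD(2)[OF P] by auto
  hence "f > 0" using f by (cases f) auto
  thus ?thesis using f by blast
qed

lemma maxid_idx_gt_1: "maxid P \<Longrightarrow> idx R P > 1"
  using maxid_contains_prime maxid_idx_power one_less_power prime_gt_1_nat by metis

lemma prime_mem_maxid_iff:
  assumes P: "maxid P" and p: "prime p"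
  shows "of_nat p \<in> P \<longleftrightarrow> p dvd idx R P"
proof
  assume "of_nat p \<in> P"
  then obtain f where "f > 0" "idx R P = p ^ f" using maxid_idx_power[OF P p] by blast
  thus "p dvd idx R P" by simp
next
  assume dvd: "p dvd idx R P"
  obtain r where r: "prime r" "of_nat r \<in> P" using maxid_contains_prime[OF P] by blast
  obtain f where "idx R P = r ^ f" using maxid_idx_power[OF P r] by blast
  hence "p dvd r" using dvd p prime_dvd_power by metis
  hence "p = r" using p r(1) by (simp add: primes_dvd_imp_eq)
  thus "of_nat p \<in> P" using r(2) by simp
qed

definition primes_over :: "nat \<Rightarrow> complex set set" where
  "primes_over p = {P. maxid P \<and> of_nat p \<in> P}"

lemma iprod_subset_member:
  assumes "\<And>Q. Q \<in># M \<Longrightarrow> maxid Q" "P \<in># M"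
  shows "iprod M \<subseteq> P"
proof -
  obtain N where N: "M = add_mset P N" using assms(2) by (metis insert_DiffM)
  have "idl (iprod N)" using assms(1) N by (intro idl_iprod maxidD(1)) auto
  hence "sprod (iprod N) P \<subseteq> P" using assms by (intro sprod_subset maxidD(3) idlD(4)) auto
  thus ?thesis using N by (simp add: sprod_commute)
qed

lemma prime_factorization:
  assumes p: "prime p"
  shows "\<exists>M. (\<forall>P. P \<in># M \<longrightarrow> maxid P) \<and> iprod M = (*) (of_nat p) ` R \<and>
    set_mset M = primes_over p \<and> (\<Prod>P\<in>#M. idx R P) = p ^ n"
proof -
  have pos: "p > 0" using p prime_gt_0_nat by blast
  obtain M where M: "\<forall>P. P \<in># M \<longrightarrow> maxid P" "iprod M = (*) (of_nat p) ` R"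
    using factorization_exists[OF idl_scaled[OF pos]] by blast
  have "P \<in># M \<longleftrightarrow> P \<in> primes_over p" for P
  proof
    assume P: "P \<in># M"
    have "of_nat p * 1 \<in> (*) (of_nat p :: complex) ` R" using one_closed by blast
    hence "of_nat p \<in> P" using iprod_subset_member[of M P] M P by auto
    thus "P \<in> primes_over p" using M(1) P by (auto simp: primes_over_def)
  next
    assume "P \<in> primes_over p"
    hence P: "maxid P" "of_nat p \<in> P" by (auto simp: primes_over_def)
    have "iprod M \<subseteq> P" using of_nat_scaled[OF P(2) maxidD(3)[OF P(1)]] M(2) by simp
    thus "P \<in># M" using iprod_subset_maxid[OF P(1)] M(1) by blast
  qed
  moreover have "(\<Prod>P\<in>#M. idx R P) = p ^ n"
    using idx_iprod[of M] M idx_scaled_R[OF pos] by simp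
  ultimately show ?thesis using M by blast
qed

text \<open>The norms of the factors of pR multiply to p^n, and each of them is at least p, so there
  are at most n factors even with multiplicity.\<close>

lemma primes_over_finite:
  assumes p: "prime p"
  shows "finite (primes_over p)" "card (primes_over p) \<le> n"
proof -
  obtain M where M: "\<And>P. P \<in># M \<Longrightarrow> maxid P"
    "set_mset M = primes_over p" "(\<Prod>P\<in>#M. idx R P) = p ^ n" using prime_factorization[OF p] by blast
  show "finite (primes_over p)" using M(2) by (metis finite_set_mset)
  have ge: "p \<le> idx R P" if "P \<in># M" for P
  proof -
    have "maxid P" "of_nat p \<in> P" using M(2) that by (auto simp: primes_over_def)
    thus ?thesis using prime_mem_maxid_iff[of P p] p maxid_idx_gt_1[of P] by (auto intro: dvd_imp_le)
  qed
  have "p ^ size N \<le> (\<Prod>P\<in>#N. idx R P)" if "N \<subseteq># M" for N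
    using that
  proof (induction N)
    case (add P N)
    have "P \<in># M" using add.prems by (simp add: insert_subset_eq_iff)
    moreover have "N \<subseteq># M" using add.prems by (meson mset_subset_eq_insertD subset_mset.less_imp_le)
    ultimately show ?case using add.IH ge by (simp add: mult_mono)
  qed simp
  hence "p ^ size M \<le> p ^ n" using M(3) by force
  hence "size M \<le> n" using prime_gt_1_nat[OF p] by simp
  moreover have "card (set_mset M) \<le> size M"
    using size_mset_mono[OF mset_set_set_mset_msubset[of M]] by simp
  ultimately show "card (primes_over p) \<le> n" using M(2) by simp
qed

text \<open>Complete splitting read off from a trivial Frobenius. Every residue is a root of X^p -
  X, so residue fields have p elements. No factor is repeated: if pR lay inside P^2, then for x in P
  outside P^2 both x^p and x^p - x would lie in P^2. Comparing norms leaves exactly n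
  factors.\<close>

lemma primes_over_split:
  assumes p: "prime p" and frob: "\<And>x. x \<in> R \<Longrightarrow> x ^ p - x \<in> (*) (of_nat p) ` R"
  shows "\<And>P. P \<in> primes_over p \<Longrightarrow> idx R P = p" "card (primes_over p) = n"
proof -
  obtain M where M: "\<And>P. P \<in># M \<Longrightarrow> maxid P" "iprod M = (*) (of_nat p) ` R"
    "set_mset M = primes_over p" "(\<Prod>P\<in>#M. idx R P) = p ^ n" using prime_factorization[OF p] by blast
  have p1: "p > 1" using p prime_gt_1_nat by blast
  show idx: "idx R P = p" if "P \<in> primes_over p" for P
  proof -
    have P: "maxid P" "of_nat p \<in> P" using that by (auto simp: primes_over_def)
    have "x ^ (p - 1) - 1 \<in> P" if x: "x \<in> R" "x \<notin> P" for x
    proof -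
      have "x ^ p - x \<in> P" using frob[OF x(1)] of_nat_scaled[OF P(2) maxidD(3)[OF P(1)]] by blast
      moreover have "x ^ p - x = x * (x ^ (p - 1) - 1)"
        using p1 by (cases p) (auto simp: algebra_simps)
      moreover have "x ^ (p - 1) - 1 \<in> R" by (intro R_closed(2) power_closed x(1) one_closed)
      ultimately show ?thesis using maxid_prime[OF P(1) x(1)] x(2) by auto
    qed
    from idx_le_of_roots[OF P(1) _ this] have "idx R P \<le> p" using p1 by simp
    moreover have "p dvd idx R P" using prime_mem_maxid_iff[OF P(1) p] P(2) by blast
    ultimately show ?thesis using maxid_idx_gt_1[OF P(1)] dvd_imp_le[of p "idx R P"] by linarith
  qed
  have count: "count M P = 1" if P: "P \<in># M" for P
  proof (rule ccontr)
    assume "count M P \<noteq> 1"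
    hence "count M P \<ge> 2" using P by (simp add: Suc_le_eq le_neq_implies_less numeral_2_eq_2)
    hence "{#P, P#} \<subseteq># M" by (auto simp: subseteq_mset_def)
    then obtain N where N: "M = N + {#P, P#}" by (metis subset_mset.diff_add)
    have mP: "maxid P" using M(1) P by blast
    have N': "idl (iprod N)" using M(1) N by (intro idl_iprod maxidD(1)) auto
    have "iprod M = sprod (iprod N) (sprod P P)"
      using N sprod_R_right[OF maxidD(3)[OF mP]] by (simp add: sprod_left_commute sprod_commute sprod_assoc)
    hence sub: "(*) (of_nat p) ` R \<subseteq> sprod P P"
      using M(2) sprod_subset[OF modl_sprod[OF maxidD(3)[OF mP] maxidD(3)[OF mP]] idlD(4)[OF N']] by simp
    obtain x where x: "x \<in> P" "x \<notin> sprod P P"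
      using sprod_maxid_psubset[OF mP maxidD(1)[OF mP]] by blast
    have xR: "x \<in> R" using x(1) maxidD(4)[OF mP] by blast
    note PP = modl_sprod[OF maxidD(3)[OF mP] maxidD(3)[OF mP]]
    define k where "k = p - 2"
    have "p = Suc (Suc k)" using p1 by (simp add: k_def)
    hence "x ^ p = (x * x) * x ^ (p - 2)" by (simp add: mult.assoc)
    moreover have "(x * x) * x ^ (p - 2) \<in> sprod P P"
      by (rule modlD(3)[OF PP power_closed[OF xR] sprod.base[OF x(1) x(1)]])
    moreover have "x ^ p - x \<in> sprod P P" using frob[OF xR] sub by blast
    ultimately show False using x(2) modl_closed(2)[OF PP, of "x ^ p" "x ^ p - x"] by simp
  qed
  have "M = mset_set (set_mset M)"
  proof (rule multiset_eqI)
    fix P show "count M P = count (mset_set (set_mset M)) P"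
      using count[of P] by (cases "P \<in># M") (simp_all add: count_mset_set' not_in_iff)
  qed
  hence "M = mset_set (primes_over p)" by (simp only: M(3))
  hence "(\<Prod>P\<in>primes_over p. idx R P) = p ^ n" using M(4) by (simp add: prod_unfold_prod_mset)
  hence "p ^ card (primes_over p) = p ^ n" using idx by simp
  thus "card (primes_over p) = n" using p1 by simp
qed

lemma idx_scaled_mult:
  assumes "a \<in> R" "b \<in> R" "a \<noteq> 0" "b \<noteq> 0"
  shows "idx R ((*) (a * b) ` R) = idx R ((*) a ` R) * idx R ((*) b ` R)"
proof -
  have a: "idl ((*) a ` R)" and b: "idl ((*) b ` R)" and ab: "idl ((*) (a * b) ` R)"
    using assms mult_closed by (auto intro!: idl_image[OF idl_R])
  have "idx R ((*) b ` R) = idx ((*) a ` R) ((*) (a * b) ` R)"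
  proof (rule idx_cong_map[where f = "\<lambda>x. a * x"])
    show "additive_set ((*) b ` R)" "additive_set ((*) (a * b) ` R)" using idlD(2)[OF b] idlD(2)[OF ab] .
    show "a * x - a * y \<in> (*) (a * b) ` R \<longleftrightarrow> x - y \<in> (*) b ` R" for x y
      using assms(3) by (auto simp: image_iff mult.assoc simp flip: right_diff_distrib)
    show "\<exists>x\<in>R. z - a * x \<in> (*) (a * b) ` R" if z: "z \<in> (*) a ` R" for z
    proof -
      obtain x where x: "x \<in> R" "z = a * x" using z by blast
      have "z - a * x \<in> (*) (a * b) ` R" using additive_setD(1)[OF idlD(2)[OF ab]] x(2) by simp
      thus ?thesis using x(1) by blast
    qed
  qed auto
  moreover have "(*) (a * b) ` R \<subseteq> (*) a ` R" using assms(2) mult_closed by (auto simp: mult.assoc)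
  ultimately show ?thesis
    using idx_tower[OF R_additive idlD(2)[OF a] idlD(2)[OF ab]] idlD(4)[OF a] by simp
qed

text \<open>Since l^n and p generate the same ideal, the norm of (l) has n-th power p^n and equals
  p; an ideal of prime norm is maximal. Any maximal ideal containing p contains l^n and therefore
  l.\<close>

lemma primes_over_ramified:
  assumes p: "prime p" and l: "l \<in> R" and u: "u \<in> R" "v \<in> R" "u * v = 1"
    and eq: "of_nat p = u * l ^ n"
  shows "primes_over p = {(*) l ` R}" "idx R ((*) l ` R) = p"
proof -
  let ?L = "(*) l ` R"
  have l0: "l \<noteq> 0" using eq n_pos p by (auto simp: power_0_left)
  have L: "idl ?L" using idl_image[OF idl_R l l0] .
  have pow: "idx R ((*) (l ^ k) ` R) = idx R ?L ^ k" for k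
    using idx_scaled_mult[OF l power_closed[OF l] l0] l0 by (induction k) (auto simp: R_additive)
  have "(*) (l ^ n) ` R = (*) (of_nat p) ` R"
  proof (intro equalityI subsetI)
    fix z assume "z \<in> (*) (l ^ n) ` R"
    then obtain r where r: "r \<in> R" "z = l ^ n * r" by blast
    have "of_nat p * (v * r) = (u * v) * z" by (simp add: r eq mult_ac)
    hence "z = of_nat p * (v * r)" using u(3) by simp
    thus "z \<in> (*) (of_nat p) ` R" using r u mult_closed by blast
  next
    fix z assume "z \<in> (*) (of_nat p) ` R"
    then obtain r where r: "r \<in> R" "z = of_nat p * r" by blast
    have "z = l ^ n * (u * r)" by (simp add: r eq mult_ac)
    thus "z \<in> (*) (l ^ n) ` R" using r u mult_closed by blast
  qed
  hence "idx R ?L ^ n = p ^ n" using pow[of n] idx_scaled_R[OF prime_gt_0_nat[OF p]] by simp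
  thus idx: "idx R ?L = p" using n_pos by (simp add: power_eq_iff_eq_base)
  have max: "maxid ?L"
    unfolding maxid_def
  proof (intro conjI allI impI L)
    show "?L \<noteq> R" using idx p R_additive by (metis idx_self not_prime_1)
    fix J assume J: "idl J" "?L \<subseteq> J"
    have "p = idx R J * idx J ?L"
      using idx_tower[OF R_additive idlD(2)[OF J(1)] idlD(2)[OF L] J(2) idlD(4)[OF J(1)]] idx by simp
    hence "idx R J = 1 \<or> idx J ?L = 1" using p prime_product by metis
    thus "J = ?L \<or> J = R"
      using idx_eq_1_iff[OF R_additive idlD(2)[OF J(1)] idlD(4)[OF J(1)]]
        idx_eq_1_iff[OF idlD(2)[OF J(1)] idlD(2)[OF L] J(2)] by auto
  qed
  show "primes_over p = {?L}"
  proof (intro equalityI subsetI)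
    fix P assume "P \<in> primes_over p"
    hence P: "maxid P" "of_nat p \<in> P" by (auto simp: primes_over_def)
    have "v * of_nat p = (u * v) * l ^ n" by (simp add: eq mult_ac)
    hence "l ^ n = v * of_nat p" using u(3) by simp
    hence "l ^ n \<in> P" using modlD(2)[OF maxidD(3)[OF P(1)] u(2) P(2)] by simp
    hence "l \<in> P" by (rule maxid_power[OF P(1) l])
    hence "?L \<subseteq> P" using modlD(3)[OF maxidD(3)[OF P(1)]] by blast
    thus "P \<in> {?L}" using maxidD(6)[OF max maxidD(1)[OF P(1)]] maxidD(2)[OF P(1)] by blast
  next
    fix P assume "P \<in> {?L}"
    moreover have "of_nat p \<in> ?L"
      using prime_mem_maxid_iff[OF max p] idx by simp
    ultimately show "P \<in> primes_over p" using max by (simp add: primes_over_def)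
  qed
qed

end

section \<open>Cyclotomic integers and their real subring\<close>

text \<open>Weaker than \<open>number_ring\<close>: congruences modulo principal ideals and the
  Frobenius are needed while linear independence and integral closedness of the cyclotomic ring are
  still to be proved.\<close>

locale complex_subring =
  fixes R :: "complex set"
  assumes additive: "additive_set R"
    and one_mem: "1 \<in> R"
    and mult_mem: "x \<in> R \<Longrightarrow> y \<in> R \<Longrightarrow> x * y \<in> R"
begin

lemmas add_mem = additive_setD[OF additive]

lemma power_mem: "x \<in> R \<Longrightarrow> x ^ k \<in> R"
  by (induction k) (auto intro: one_mem mult_mem)

lemma of_int_mem: "of_int k \<in> R"
  using additive_set_of_int[OF additive one_mem, of k] by simp

lemma of_nat_mem: "of_nat k \<in> R"
  using of_int_mem[of "int k"] by simp

lemma sum_mem: "(\<And>i. i \<in> I \<Longrightarrow> f i \<in> R) \<Longrightarrow> sum f I \<in> R"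
  by (rule additive_set_sum[OF additive])

lemma prod_mem: "(\<And>i. i \<in> I \<Longrightarrow> f i \<in> R) \<Longrightarrow> prod f I \<in> R"
  by (induction I rule: infinite_finite_induct) (auto intro: one_mem mult_mem)

definition princ :: "complex \<Rightarrow> complex set" where
  "princ c = (*) c ` R"

lemma princI: "r \<in> R \<Longrightarrow> c * r \<in> princ c"
  by (auto simp: princ_def)

lemma princE: "x \<in> princ c \<Longrightarrow> (\<And>r. r \<in> R \<Longrightarrow> x = c * r \<Longrightarrow> thesis) \<Longrightarrow> thesis"
  by (auto simp: princ_def)

lemma princ_additive: "additive_set (princ c)"
  unfolding additive_set_def
proof (intro conjI ballI)
  show "0 \<in> princ c" using princI[OF add_mem(1), of c] by simp
  fix x y assume "x \<in> princ c" "y \<in> princ c"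
  then obtain r s where "r \<in> R" "x = c * r" "s \<in> R" "y = c * s" by (auto elim!: princE)
  thus "x - y \<in> princ c" using princI[OF add_mem(2), of r s c] by (simp add: right_diff_distrib)
qed

lemmas princ_mem = additive_setD[OF princ_additive]

lemma princ_mult: "x \<in> princ c \<Longrightarrow> r \<in> R \<Longrightarrow> r * x \<in> princ c"
proof (erule princE)
  fix s assume "r \<in> R" "s \<in> R" "x = c * s"
  thus "r * x \<in> princ c" using princI[OF mult_mem, of r s c] by (simp add: mult.left_commute)
qed

lemma princ_mult': "x \<in> princ c \<Longrightarrow> r \<in> R \<Longrightarrow> x * r \<in> princ c"
  using princ_mult[of x c r] by (simp add: mult.commute)

lemma princ_sum: "(\<And>i. i \<in> I \<Longrightarrow> f i \<in> princ c) \<Longrightarrow> sum f I \<in> princ c"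
  by (rule additive_set_sum[OF princ_additive])

lemma power_diff_princ:
  assumes "x \<in> R" "y \<in> R" "x - y \<in> princ c"
  shows "x ^ k - y ^ k \<in> princ c"
proof (induction k)
  case 0
  show ?case using princ_mem(1) by simp
next
  case (Suc k)
  have "x ^ Suc k - y ^ Suc k = x ^ k * (x - y) + (x ^ k - y ^ k) * y"
    by (simp add: algebra_simps)
  thus ?case using princ_mem(4)[OF princ_mult[OF assms(3) power_mem[OF assms(1)]] princ_mult'[OF Suc assms(2)]]
    by simp
qed

lemma freshman:
  assumes p: "prime p" and xy: "x \<in> R" "y \<in> R"
  shows "(x + y) ^ p - (x ^ p + y ^ p) \<in> princ (of_nat p)"
proof -
  have p0: "p > 0" using p prime_gt_0_nat by blast
  have "(x + y) ^ p = (\<Sum>k\<le>p. of_nat (p choose k) * x ^ k * y ^ (p - k))"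
    by (rule binomial_ring)
  also have "\<dots> = (\<Sum>k\<in>{1..<p}. of_nat (p choose k) * x ^ k * y ^ (p - k)) + (y ^ p + x ^ p)"
  proof -
    have "{..p} = insert 0 (insert p {1..<p})" using p0 by auto
    thus ?thesis using p0 by (simp add: add_ac)
  qed
  finally have "(x + y) ^ p - (x ^ p + y ^ p) = (\<Sum>k\<in>{1..<p}. of_nat (p choose k) * x ^ k * y ^ (p - k))"
    by simp
  moreover have "of_nat (p choose k) * x ^ k * y ^ (p - k) \<in> princ (of_nat p)" if "k \<in> {1..<p}" for k
  proof -
    have "p dvd (p choose k)" using that p by (intro dvd_choose_prime) auto
    then obtain d where "p choose k = p * d" by blast
    hence "of_nat (p choose k) * x ^ k * y ^ (p - k) = of_nat p * (of_nat d * x ^ k * y ^ (p - k))"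
      by (simp add: mult.assoc)
    thus ?thesis by (simp only:) (intro princI mult_mem of_nat_mem power_mem xy)
  qed
  ultimately show ?thesis using princ_sum[of "{1..<p}"] by simp
qed

lemma freshman_sum:
  assumes p: "prime p" and f: "\<And>i. i \<in> I \<Longrightarrow> f i \<in> R" and I: "finite I"
  shows "(\<Sum>i\<in>I. f i) ^ p - (\<Sum>i\<in>I. f i ^ p) \<in> princ (of_nat p)"
  using I f
proof (induction I)
  case empty
  show ?case using princ_mem(1) prime_gt_0_nat[OF p] by (simp add: power_0_left)
next
  case (insert i I)
  have m: "f i \<in> R" "sum f I \<in> R" using insert.prems by (auto intro!: sum_mem)
  have IH: "(\<Sum>i\<in>I. f i) ^ p - (\<Sum>i\<in>I. f i ^ p) \<in> princ (of_nat p)"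
    by (rule insert.IH) (use insert.prems in auto)
  have "(\<Sum>j\<in>insert i I. f j) ^ p - (\<Sum>j\<in>insert i I. f j ^ p) =
      ((f i + sum f I) ^ p - (f i ^ p + sum f I ^ p)) + (sum f I ^ p - (\<Sum>i\<in>I. f i ^ p))"
    using insert.hyps by simp
  thus ?case using princ_mem(4)[OF freshman[OF p m] IH] by simp
qed

lemma of_int_fermat:
  assumes p: "prime p"
  shows "(of_int a :: complex) ^ p - of_int a \<in> princ (of_nat p)"
proof -
  have "[a ^ p = a] (mod int p)"
  proof (cases "int p dvd a")
    case True
    hence "int p dvd a ^ p" using prime_gt_0_nat[OF p] by (meson dvd_power dvd_trans)
    thus ?thesis using True by (simp add: cong_def mod_eq_0_iff_dvd[THEN iffD2])
  next
    case False
    define b where "b = nat (a mod int p)"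
    have pos: "int p > 0" using prime_gt_0_nat[OF p] by simp
    have b: "int b = a mod int p" using pos by (simp add: b_def)
    have "\<not> p dvd b"
    proof
      assume "p dvd b"
      hence "int p dvd int b" by simp
      thus False using False b by (simp add: dvd_mod_iff)
    qed
    hence "[b ^ (p - 1) = 1] (mod p)" using p by (rule fermat_theorem[rotated])
    hence "[b ^ (p - 1) * b = 1 * b] (mod p)" by (intro cong_mult cong_refl)
    moreover have "b ^ (p - 1) * b = b ^ p" using prime_gt_0_nat[OF p] by (rule power_minus_mult)
    ultimately have "[b ^ p = b] (mod p)" by simp
    hence "[int (b ^ p) = int b] (mod int p)" by (simp only: cong_int_iff)
    hence bp: "[int b ^ p = int b] (mod int p)" by simp
    have ba: "[int b = a] (mod int p)" by (simp add: b cong_def)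
    show ?thesis by (rule cong_trans[OF cong_trans[OF cong_pow[OF cong_sym[OF ba]] bp] ba])
  qed
  then obtain d where "a ^ p - a = int p * d" by (auto simp: cong_iff_dvd_diff)
  hence "(of_int (a ^ p - a) :: complex) = of_int (int p * d)" by simp
  hence "(of_int a :: complex) ^ p - of_int a = of_nat p * of_int d" by simp
  thus ?thesis using princI[OF of_int_mem, of "of_nat p" d] by simp
qed

text \<open>Let D be the degree of a monic equation of x. Then m^D clears the denominators of x^k
  for k < D directly, and for larger k by reducing with the equation.\<close>

lemma integral_common_denominator:
  assumes x: "algebraic_int x" and m: "m > 0" "of_nat m * x \<in> R"
  shows "\<exists>d>0. \<forall>k. of_nat d * x ^ k \<in> R"
proof -
  obtain p :: "int poly" where p: "poly (map_poly of_int p) x = 0" "Polynomial.lead_coeff p = 1"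
    using x unfolding algebraic_int_altdef_ipoly by blast
  define D where "D = Polynomial.degree p"
  define c where "c i = poly.coeff p i" for i
  have "(\<Sum>i\<le>D. of_int (c i) * x ^ i) = 0"
    using p(1) by (simp add: poly_altdef D_def c_def)
  hence "(\<Sum>i<D. of_int (c i) * x ^ i) + x ^ D = 0"
    using p(2) by (simp add: lessThan_Suc_atMost[symmetric] D_def c_def)
  hence xD: "x ^ D = - (\<Sum>i<D. of_int (c i) * x ^ i)" by (simp add: add_eq_0_iff)
  have "of_nat (m ^ D) * x ^ k \<in> R" for k
  proof (induction k rule: less_induct)
    case (less k)
    show ?case
    proof (cases "k < D")
      case True
      have "of_nat (m ^ D) * x ^ k = of_nat (m ^ (D - k)) * (of_nat m * x) ^ k"
        using True by (simp add: power_mult_distrib flip: power_add mult.assoc)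
      thus ?thesis using m by (auto intro!: mult_mem of_nat_mem power_mem)
    next
      case False
      have "x ^ k = x ^ D * x ^ (k - D)" using False by (simp flip: power_add)
      hence "of_nat (m ^ D) * x ^ k = - (\<Sum>i<D. of_int (c i) * (of_nat (m ^ D) * x ^ (i + (k - D))))"
        by (simp add: xD sum_distrib_left sum_distrib_right power_add mult_ac)
      moreover have "of_nat (m ^ D) * x ^ (i + (k - D)) \<in> R" if "i \<in> {..<D}" for i
        by (rule less.IH) (use that False in auto)
      hence "- (\<Sum>i<D. of_int (c i) * (of_nat (m ^ D) * x ^ (i + (k - D)))) \<in> R"
        by (intro add_mem(3) sum_mem mult_mem[OF of_int_mem])
      ultimately show ?thesis by (simp only:)
    qed
  qed
  thus ?thesis using m(1) by (intro exI[of _ "m ^ D"]) auto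
qed

end

lemma additive_set_int_span:
  "additive_set (range (\<lambda>a :: nat \<Rightarrow> int. \<Sum>i<n. of_int (a i) * (e i :: complex)))"
  unfolding additive_set_def
proof (intro conjI ballI)
  show "0 \<in> range (\<lambda>a :: nat \<Rightarrow> int. \<Sum>i<n. of_int (a i) * e i)"
    by (rule image_eqI[of _ _ "\<lambda>_. 0"]) simp_all
  fix x y assume "x \<in> range (\<lambda>a :: nat \<Rightarrow> int. \<Sum>i<n. of_int (a i) * e i)"
    "y \<in> range (\<lambda>a :: nat \<Rightarrow> int. \<Sum>i<n. of_int (a i) * e i)"
  then obtain a b where "x = (\<Sum>i<n. of_int (a i) * e i)" "y = (\<Sum>i<n. of_int (b i) * e i)"
    by auto
  thus "x - y \<in> range (\<lambda>a :: nat \<Rightarrow> int. \<Sum>i<n. of_int (a i) * e i)"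
    by (intro image_eqI[of _ _ "\<lambda>i. a i - b i"]) (simp_all add: sum_subtractf left_diff_distrib)
qed

locale cyclotomic =
  fixes q :: nat
  assumes q: "prime q" "odd q"
begin

abbreviation z :: complex where "z \<equiv> zeta_root q"

lemma q_gt: "q > 2"
  using q prime_gt_1_nat[of q] by (cases "q = 2") auto

lemma z_exp: "z ^ k = exp (2 * of_real pi * \<i> * of_nat k / of_nat q)"
proof -
  have "z ^ k = cis (real k * (2 * pi / real q))"
    unfolding zeta_root_def by (rule Complex.DeMoivre)
  thus ?thesis by (simp add: cis_conv_exp mult_ac)
qed

lemma z_power_eq_1_iff: "z ^ k = 1 \<longleftrightarrow> q dvd k"
  unfolding z_exp using q_gt by (intro complex_root_unity_eq_1) auto

lemma z_power_q [simp]: "z ^ q = 1"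
  by (simp add: z_power_eq_1_iff)

lemma z_nonzero [simp]: "z \<noteq> 0"
  by (simp add: zeta_root_def)

lemma z_power_mod: "z ^ (k mod q) = z ^ k"
proof -
  have "z ^ k = z ^ (q * (k div q)) * z ^ (k mod q)" by (simp flip: power_add)
  thus ?thesis by (simp add: power_mult)
qed

lemma z_power_cong: "[i = j] (mod q) \<Longrightarrow> z ^ i = z ^ j"
  by (metis cong_def z_power_mod)

lemma cnj_z: "cnj z = z ^ (q - 1)"
proof -
  have "z * cnj z = 1" by (simp add: zeta_root_def cis_cnj cis_mult)
  moreover have "z * z ^ (q - 1) = 1" using q_gt z_power_q by (metis power_eq_if not_gr_zero not_less_zero)
  ultimately show ?thesis by (metis mult_cancel_left z_nonzero)
qed

lemma inverse_z: "inverse z = z ^ (q - 1)"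
  using cnj_z by (simp add: zeta_root_def cis_cnj)

lemma cnj_z_power: "i \<le> q \<Longrightarrow> cnj (z ^ i) = z ^ (q - i)"
proof -
  assume i: "i \<le> q"
  have "z ^ i * cnj (z ^ i) = 1" by (simp add: zeta_root_def cis_cnj cis_mult flip: power_mult_distrib)
  moreover have "z ^ i * z ^ (q - i) = 1" using i by (simp flip: power_add)
  ultimately show ?thesis by (metis mult_cancel_left power_not_zero z_nonzero)
qed

lemma sum_z_powers: "(\<Sum>i<q. z ^ i) = 0"
proof -
  have "z \<noteq> 1" using z_power_eq_1_iff[of 1] q_gt by auto
  moreover have "(z - 1) * (\<Sum>i<q. z ^ i) = z ^ q - 1" by (rule power_diff_1_eq[symmetric])
  ultimately show ?thesis by simp
qed

definition R :: "complex set" where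
  "R = range (\<lambda>a :: nat \<Rightarrow> int. \<Sum>i<q-1. of_int (a i) * z ^ i)"

lemma R_add: "additive_set R"
  unfolding R_def by (rule additive_set_int_span)

lemma z_power_mem: "z ^ k \<in> R"
proof -
  have small: "z ^ i \<in> R" if "i < q - 1" for i
  proof -
    have "z ^ i = (\<Sum>j<q-1. of_int (if j = i then 1 else 0) * z ^ j)"
      using that by (simp add: if_distrib[of "\<lambda>c. c * _"] if_distrib[of of_int] cong: if_cong)
    thus ?thesis unfolding R_def by (intro image_eqI[of _ _ "\<lambda>j. if j = i then 1 else 0"]) auto
  qed
  have "{..<q} = insert (q - 1) {..<q-1}" using q_gt by auto
  hence "(\<Sum>i<q. z ^ i) = (\<Sum>i\<in>insert (q - 1) {..<q-1}. z ^ i)" by (simp only:)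
  also have "\<dots> = z ^ (q - 1) + (\<Sum>i<q-1. z ^ i)" by (rule sum.insert) auto
  finally have "(\<Sum>i<q. z ^ i) = z ^ (q - 1) + (\<Sum>i<q-1. z ^ i)" .
  hence "z ^ (q - 1) = - (\<Sum>i<q-1. z ^ i)" using sum_z_powers by (simp add: eq_neg_iff_add_eq_0)
  hence "z ^ (q - 1) \<in> R"
    using additive_setD(3)[OF R_add additive_set_sum[OF R_add, of "{..<q-1}" "\<lambda>i. z ^ i"]] small by simp
  moreover have "k mod q < q" using q_gt by simp
  hence "k mod q = q - 1 \<or> k mod q < q - 1" by linarith
  ultimately have "z ^ (k mod q) \<in> R" using small by auto
  thus ?thesis by (simp add: z_power_mod)
qed

sublocale S: complex_subring R
proof
  show "additive_set R" by (rule R_add)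
  show "1 \<in> R" using z_power_mem[of 0] by simp
  fix x y assume "x \<in> R" "y \<in> R"
  then obtain a b where x: "x = (\<Sum>i<q-1. of_int (a i) * z ^ i)" and y: "y = (\<Sum>i<q-1. of_int (b i) * z ^ i)"
    unfolding R_def by auto
  have "x * y = (\<Sum>i<q-1. \<Sum>j<q-1. of_int (a i * b j) * z ^ (i + j))"
    unfolding x y by (simp add: sum_product power_add mult_ac)
  thus "x * y \<in> R"
    by (simp only:) (intro additive_set_sum[OF R_add] additive_set_of_int[OF R_add] z_power_mem)
qed

lemma algebraic_int_R:
  assumes "x \<in> R"
  shows "algebraic_int x"
proof -
  have "\<forall>i. \<exists>a :: nat \<Rightarrow> int. x * z ^ i = (\<Sum>j<q-1. of_int (a j) * z ^ j)"
    using S.mult_mem[OF assms z_power_mem] unfolding R_def by blast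
  from choice[OF this] obtain M :: "nat \<Rightarrow> nat \<Rightarrow> int"
    where "\<And>i. x * z ^ i = (\<Sum>j<q-1. of_int (M i j) * z ^ j)"
    by blast
  thus ?thesis using q_gt by (intro algebraic_int_eigenvalue[of "q - 1" x "\<lambda>i. z ^ i" M 0]) auto
qed

text \<open>Elements of R are integral, and 1/q is rational but not an integer. This is the reason
  why \<open>lam\<close> is not a unit.\<close>

lemma inverse_q_notin_R: "1 / of_nat q \<notin> R"
proof
  assume "1 / of_nat q \<in> R"
  hence "algebraic_int (1 / of_nat q :: complex)" by (rule algebraic_int_R)
  moreover have "(1 / of_nat q :: complex) \<in> \<rat>" by simp
  ultimately have "(1 / of_nat q :: complex) \<in> \<int>" by (rule rational_algebraic_int_is_int)
  then obtain k where "1 / of_nat q = (of_int k :: complex)" by (elim Ints_cases)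
  hence "(of_int (k * int q) :: complex) = of_int 1" using q_gt by (simp add: field_simps)
  hence "k * int q = 1" by (simp only: of_int_eq_iff)
  hence "int q dvd 1" by (metis dvd_triv_right)
  thus False using q_gt by simp
qed

definition lam :: complex where "lam = 1 - z"

text \<open>The quotient (1 - z^k) / (1 - z), a cyclotomic unit when q does not divide k.\<close>

definition qt :: "nat \<Rightarrow> complex" where "qt k = (\<Sum>i<k. z ^ i)"

lemma lam_mem: "lam \<in> R"
  unfolding lam_def using S.add_mem(2)[OF S.one_mem z_power_mem[of 1]] by simp

lemma lam_nonzero: "lam \<noteq> 0"
  using z_power_eq_1_iff[of 1] q_gt by (auto simp: lam_def)

lemma qt_mem: "qt k \<in> R"
  unfolding qt_def by (intro S.sum_mem z_power_mem)

lemma one_minus_z_power: "1 - z ^ k = lam * qt k"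
  unfolding lam_def qt_def using power_diff_1_eq[of z k] by (simp add: algebra_simps)

text \<open>With kj congruent to 1 modulo q, 1 - z = 1 - (z^k)^j is itself a multiple of 1 - z^k in
  R.\<close>

lemma qt_unit:
  assumes "\<not> q dvd k"
  shows "\<exists>v\<in>R. qt k * v = 1"
proof -
  have "Rings.coprime k q" using assms q(1) by (metis coprime_commute prime_imp_coprime)
  then obtain j where j: "[k * j = 1] (mod q)" using cong_solve_coprime_nat by auto
  have e: "z ^ (k * j) - 1 = (z ^ k - 1) * (\<Sum>i<j. z ^ (k * i))"
    unfolding power_mult by (rule power_diff_1_eq)
  have "lam = 1 - z ^ (k * j)" using z_power_cong[OF j] by (simp add: lam_def)
  also have "\<dots> = (1 - z ^ k) * (\<Sum>i<j. z ^ (k * i))"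
    using arg_cong[OF e, of uminus] by (simp only: minus_mult_left minus_diff_eq)
  also have "\<dots> = lam * (qt k * (\<Sum>i<j. z ^ (k * i)))" by (simp add: one_minus_z_power mult.assoc)
  finally have "qt k * (\<Sum>i<j. z ^ (k * i)) = 1" using lam_nonzero by simp
  thus ?thesis by (intro bexI[of _ "\<Sum>i<j. z ^ (k * i)"] S.sum_mem z_power_mem)
qed

text \<open>The polynomials 1 + X + ... + X^(q - 1) and the product of the X - z^k are monic of
  degree q - 1 and share the q - 1 roots z^k, so they coincide; the identity is their value at
  1.\<close>

lemma q_eq_prod: "of_nat q = (\<Prod>k\<in>{1..<q}. 1 - z ^ k)"
proof -
  define f where "f = (\<Sum>i<q. Polynomial.monom (1::complex) i)"
  define g where "g = (\<Prod>k\<in>{1..<q}. [:- (z ^ k), 1:])"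
  have inj: "inj_on (\<lambda>k. z ^ k) {1..<q}"
  proof (rule linorder_inj_onI)
    fix i j assume ij: "i < j" "i \<in> {1..<q}" "j \<in> {1..<q}"
    show "z ^ i \<noteq> z ^ j"
    proof
      assume "z ^ i = z ^ j"
      moreover have "z ^ j = z ^ i * z ^ (j - i)" using ij by (simp flip: power_add)
      ultimately have "z ^ (j - i) = 1" by simp
      hence "q dvd j - i" by (simp add: z_power_eq_1_iff)
      thus False using ij by (auto dest: dvd_imp_le)
    qed
  qed auto
  have degg: "Polynomial.degree g = q - 1"
    unfolding g_def by (subst degree_prod_eq_sum_degree) auto
  have "f = g"
  proof (rule poly_eqI_degree_lead_coeff[where n = "q - 1" and A = "(\<lambda>k. z ^ k) ` {1..<q}"])
    have "Polynomial.lead_coeff g = 1" unfolding g_def by (simp add: lead_coeff_prod)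
    hence "poly.coeff g (q - 1) = 1" using degg by simp
    moreover have "poly.coeff f (q - 1) = 1" using q_gt by (simp add: f_def coeff_sum)
    ultimately show "poly.coeff f (q - 1) = poly.coeff g (q - 1)" by simp
    show "q - 1 \<le> card ((\<lambda>k. z ^ k) ` {1..<q})" using card_image[OF inj] by simp
    show "Polynomial.degree f \<le> q - 1" unfolding f_def
      by (intro Polynomial.degree_sum_le) (auto intro: order.trans[OF degree_monom_le])
    show "Polynomial.degree g \<le> q - 1" using degg by simp
    fix w assume "w \<in> (\<lambda>k. z ^ k) ` {1..<q}"
    then obtain k where k: "k \<in> {1..<q}" "w = z ^ k" by blast
    have "z ^ k \<noteq> 1" using k(1) by (auto simp: z_power_eq_1_iff dest: dvd_imp_le)
    moreover have "(z ^ k - 1) * (\<Sum>i<q. (z ^ k) ^ i) = (z ^ k) ^ q - 1" by (rule power_diff_1_eq[symmetric])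
    moreover have "(z ^ k) ^ q = 1" by (simp add: z_power_eq_1_iff flip: power_mult)
    ultimately have "poly f w = 0" by (simp add: f_def poly_sum poly_monom k(2))
    moreover have "poly g w = 0" using k by (auto simp: g_def poly_prod)
    ultimately show "poly f w = poly g w" by simp
  qed
  hence "poly f 1 = poly g 1" by simp
  thus ?thesis by (simp add: f_def g_def poly_sum poly_monom poly_prod)
qed

text \<open>Total ramification of q: each of the q - 1 factors 1 - z^k of q is \<open>lam\<close>
  times a unit.\<close>

lemma q_eq_lam_power: "\<exists>u\<in>R. \<exists>v\<in>R. u * v = 1 \<and> of_nat q = u * lam ^ (q - 1)"
proof -
  have "\<exists>v\<in>R. qt k * v = 1" if "k \<in> {1..<q}" for k
    using that by (intro qt_unit) (auto dest: dvd_imp_le)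
  then obtain v where v: "\<And>k. k \<in> {1..<q} \<Longrightarrow> v k \<in> R \<and> qt k * v k = 1" by metis
  have "(\<Prod>k\<in>{1..<q}. qt k) * (\<Prod>k\<in>{1..<q}. v k) = 1"
    using v by (simp flip: prod.distrib)
  moreover have "of_nat q = (\<Prod>k\<in>{1..<q}. qt k) * lam ^ (q - 1)"
    unfolding q_eq_prod one_minus_z_power by (simp add: prod.distrib mult.commute)
  moreover have "(\<Prod>k\<in>{1..<q}. qt k) \<in> R" by (intro S.prod_mem qt_mem)
  moreover have "(\<Prod>k\<in>{1..<q}. v k) \<in> R" using v by (intro S.prod_mem) auto
  ultimately show ?thesis by blast
qed

lemma q_in_princ_lam_power: "j \<le> q - 1 \<Longrightarrow> of_nat q \<in> S.princ (lam ^ j)"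
proof -
  assume j: "j \<le> q - 1"
  obtain u where u: "u \<in> R" "of_nat q = u * lam ^ (q - 1)" using q_eq_lam_power by blast
  have "lam ^ (q - 1) = lam ^ j * lam ^ (q - 1 - j)"
    using j by (simp only: power_add[symmetric] le_add_diff_inverse)
  hence "of_nat q = lam ^ j * (u * lam ^ (q - 1 - j))" using u(2) by (simp add: mult_ac)
  thus ?thesis using u(1) lam_mem by (simp only:) (intro S.princI S.mult_mem S.power_mem)
qed

lemma one_notin_princ_lam: "1 \<notin> S.princ lam"
proof
  assume "1 \<in> S.princ lam"
  then obtain r where r: "r \<in> R" "1 = lam * r" by (rule S.princE)
  obtain u v where uv: "u \<in> R" "v \<in> R" "u * v = 1" "of_nat q = u * lam ^ (q - 1)"
    using q_eq_lam_power by blast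
  have "of_nat q * (v * r ^ (q - 1)) = (u * v) * (lam * r) ^ (q - 1)"
    by (simp add: uv(4) power_mult_distrib mult_ac)
  hence "of_nat q * (v * r ^ (q - 1)) = 1" using uv(3) r(2) by simp
  hence "1 / of_nat q = v * r ^ (q - 1)" using q_gt by (simp add: field_simps)
  thus False using inverse_q_notin_R S.mult_mem[OF uv(2) S.power_mem[OF r(1)]] by metis
qed

lemma of_int_in_princ_lam_iff: "of_int a \<in> S.princ lam \<longleftrightarrow> int q dvd a"
proof
  assume "int q dvd a"
  then obtain d where d: "a = int q * d" by blast
  have "of_nat q \<in> S.princ lam" using q_in_princ_lam_power[of 1] q_gt by simp
  from S.princ_mult'[OF this S.of_int_mem[of d]] show "of_int a \<in> S.princ lam" by (simp add: d)
next
  assume a: "of_int a \<in> S.princ lam"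
  show "int q dvd a"
  proof (rule ccontr)
    assume "\<not> int q dvd a"
    hence "Rings.coprime (int q) a" using q(1) by (intro prime_imp_coprime) auto
    then obtain s t where st: "s * int q + t * a = 1" by (metis bezout_int coprime_imp_gcd_eq_1)
    have "of_nat q \<in> S.princ lam" using q_in_princ_lam_power[of 1] q_gt by simp
    hence "of_int s * of_nat q + of_int t * of_int a \<in> S.princ lam"
      using a by (intro S.princ_mem S.princ_mult S.of_int_mem)
    moreover have "of_int s * of_nat q + of_int t * of_int a = (of_int (s * int q + t * a) :: complex)" by simp
    ultimately show False using st one_notin_princ_lam by simp
  qed
qed

lemma residue_mod_lam:
  assumes "x \<in> R"
  shows "\<exists>a. x - of_int a \<in> S.princ lam"
proof -
  obtain a where x: "x = (\<Sum>i<q-1. of_int (a i) * z ^ i)" using assms unfolding R_def by auto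
  have "x - of_int (\<Sum>i<q-1. a i) = (\<Sum>i<q-1. of_int (- a i) * (lam * qt i))"
    unfolding x one_minus_z_power[symmetric] by (simp add: algebra_simps flip: sum_subtractf sum_negf)
  moreover have "(\<Sum>i<q-1. of_int (- a i) * (lam * qt i)) \<in> S.princ lam"
    by (intro S.princ_sum S.princ_mult S.princI qt_mem S.of_int_mem)
  ultimately show ?thesis by metis
qed

text \<open>Every element of R is congruent to a rational integer modulo \<open>lam\<close>, and a
  rational integer is divisible by \<open>lam\<close> exactly when it is divisible by q. So the
  claim reduces to the primality of q.\<close>

lemma power_in_princ_lam:
  assumes x: "x \<in> R" "x ^ k \<in> S.princ lam"
  shows "x \<in> S.princ lam"
proof -
  obtain a where a: "x - of_int a \<in> S.princ lam" using residue_mod_lam[OF x(1)] by blast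
  have "x ^ k - of_int a ^ k \<in> S.princ lam" by (rule S.power_diff_princ[OF x(1) S.of_int_mem a])
  from S.princ_mem(2)[OF x(2) this] have "of_int (a ^ k) \<in> S.princ lam" by simp
  hence "int q dvd a ^ k" by (simp only: of_int_in_princ_lam_iff)
  hence "int q dvd a" using q(1) by (meson prime_dvd_power prime_nat_int_transfer)
  hence "of_int a \<in> S.princ lam" by (simp add: of_int_in_princ_lam_iff)
  from S.princ_mem(4)[OF a this] show ?thesis by simp
qed

text \<open>An Eisenstein argument at \<open>lam\<close>, which replaces the irreducibility of the
  cyclotomic polynomial. In the primitive part g take the least j whose coefficient is prime to q:
  all other terms of g(lam) are divisible by lam^(j + 1), so \<open>lam\<close> divides that
  coefficient, and hence q does.\<close>

lemma poly_lam_eq_0: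
  fixes f :: "int poly"
  assumes "poly (map_poly of_int f) lam = 0" "Polynomial.degree f < q - 1"
  shows "f = 0"
proof (rule ccontr)
  assume f0: "f \<noteq> 0"
  define g where "g = primitive_part f"
  have fg: "f = Polynomial.smult (content f) g" by (simp add: g_def)
  have c0: "content f \<noteq> 0" using f0 by simp
  have g0: "g \<noteq> 0" using f0 fg by auto
  have "map_poly of_int f = Polynomial.smult (of_int (content f)) (map_poly of_int g :: complex poly)"
  proof (rule poly_eqI)
    fix i
    have "poly.coeff f i = content f * poly.coeff g i"
      using arg_cong[OF fg, of "\<lambda>p. poly.coeff p i"] by simp
    thus "poly.coeff (map_poly of_int f) i = poly.coeff (Polynomial.smult (of_int (content f)) (map_poly of_int g)) i"
      by (simp add: coeff_map_poly)
  qed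
  hence "of_int (content f) * poly (map_poly of_int g) lam = 0" using assms(1) by simp
  hence root: "poly (map_poly of_int g) lam = 0" using c0 by simp
  have deg: "Polynomial.degree g < q - 1" using assms(2) by (simp add: g_def)
  have "content g = 1" using f0 by (simp add: g_def)
  hence "\<exists>j. \<not> int q dvd poly.coeff g j"
    using q_gt const_poly_dvd_iff_dvd_content[of "int q" g] by (auto simp: const_poly_dvd_iff)
  note ex = this
  define j where "j = (LEAST j. \<not> int q dvd poly.coeff g j)"
  have j: "\<not> int q dvd poly.coeff g j" "\<And>i. i < j \<Longrightarrow> int q dvd poly.coeff g i"
  proof -
    show "\<not> int q dvd poly.coeff g j" unfolding j_def by (rule LeastI_ex[OF ex])
    show "int q dvd poly.coeff g i" if "i < j" for i using not_less_Least[OF that[unfolded j_def]] by simp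
  qed
  have jd: "j \<le> Polynomial.degree g" using j(1) by (intro le_degree) auto
  \<comment> \<open>For i < j the coefficient contains q, which is a multiple of every power of
    \<open>lam\<close> up to q - 1, and j + 1 \<le> q - 1 by the degree bound. For i > j the power
    of \<open>lam\<close> is high enough by itself.\<close>
  have summand: "of_int (poly.coeff g i) * lam ^ i \<in> S.princ (lam ^ Suc j)" if "i \<noteq> j" for i
  proof (cases "i < j")
    case True
    then obtain d where d: "poly.coeff g i = int q * d" using j(2) by blast
    have "Suc j \<le> q - 1" using jd deg by simp
    from S.princ_mult'[OF q_in_princ_lam_power[OF this], of "of_int d * lam ^ i"]
    show ?thesis by (simp add: d mult.assoc S.mult_mem S.of_int_mem S.power_mem lam_mem)
  next
    case False
    hence "lam ^ i = lam ^ Suc j * lam ^ (i - Suc j)" using that by (simp flip: power_add power_Suc)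
    hence "lam ^ i \<in> S.princ (lam ^ Suc j)"
      using S.princI[OF S.power_mem[OF lam_mem, of "i - Suc j"], of "lam ^ Suc j"] by (simp only:)
    thus ?thesis by (intro S.princ_mult S.of_int_mem)
  qed
  have "0 = (\<Sum>i\<le>Polynomial.degree g. of_int (poly.coeff g i) * lam ^ i)"
    using root by (simp add: poly_altdef)
  also have "\<dots> = of_int (poly.coeff g j) * lam ^ j + (\<Sum>i\<in>{..Polynomial.degree g} - {j}. of_int (poly.coeff g i) * lam ^ i)"
    using jd by (subst sum.remove[of _ j]) auto
  finally have "of_int (poly.coeff g j) * lam ^ j = - (\<Sum>i\<in>{..Polynomial.degree g} - {j}. of_int (poly.coeff g i) * lam ^ i)"
    by (simp add: add_eq_0_iff2)
  moreover have "- (\<Sum>i\<in>{..Polynomial.degree g} - {j}. of_int (poly.coeff g i) * lam ^ i) \<in> S.princ (lam ^ Suc j)"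
    by (intro S.princ_mem(3) S.princ_sum summand) auto
  ultimately have "of_int (poly.coeff g j) * lam ^ j \<in> S.princ (lam ^ Suc j)" by (simp only:)
  then obtain r where r: "r \<in> R" "of_int (poly.coeff g j) * lam ^ j = lam ^ Suc j * r"
    by (rule S.princE)
  hence "of_int (poly.coeff g j) = lam * r" using lam_nonzero by simp
  hence "of_int (poly.coeff g j) \<in> S.princ lam" using S.princI[OF r(1), of lam] by simp
  thus False using j(1) of_int_in_princ_lam_iff by blast
qed

text \<open>The substitution X = 1 - Y turns a relation between powers of z into one between powers
  of \<open>lam\<close>, without changing the degree.\<close>

lemma indep_z:
  assumes "(\<Sum>i<q-1. of_int (a i) * z ^ i) = 0" "i < q - 1"
  shows "a i = 0"
proof -
  define g where "g = (\<Sum>i<q-1. Polynomial.monom (a i) i)"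
  define f where "f = pcompose g [:1, -1:]"
  have degg: "Polynomial.degree g < q - 1"
    using q_gt unfolding g_def
    by (intro le_less_trans[OF Polynomial.degree_sum_le[of _ _ "q - 2"]]) (auto intro: order.trans[OF degree_monom_le])
  hence "Polynomial.degree f < q - 1" unfolding f_def by (subst degree_pcompose) simp
  moreover have "poly (map_poly of_int f) lam = 0"
  proof -
    have "map_poly of_int f = pcompose (map_poly of_int g) (map_poly of_int [:1, -1:] :: complex poly)"
      unfolding f_def by (rule of_int_hom.map_poly_pcompose)
    moreover have "poly (map_poly of_int [:1, -1:]) lam = z" by (simp add: map_poly_pCons lam_def)
    ultimately have "poly (map_poly of_int f) lam = poly (map_poly of_int g) z" by (simp add: poly_pcompose)
    moreover have "map_poly of_int g = (\<Sum>i<q-1. Polynomial.monom (of_int (a i)) i :: complex poly)"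
      by (rule poly_eqI) (simp add: g_def coeff_map_poly coeff_sum if_distrib[of of_int])
    ultimately show ?thesis using assms(1) by (simp add: poly_sum poly_monom)
  qed
  ultimately have "f = 0" by (intro poly_lam_eq_0)
  hence "g = 0" unfolding f_def by (subst (asm) pcompose_eq_0_iff) auto
  hence "poly.coeff g i = 0" by simp
  thus ?thesis using assms(2) by (simp add: g_def coeff_sum)
qed

end

section \<open>Fraction fields and rings of integers\<close>

context number_ring
begin

sublocale S: complex_subring R
  by standard (auto intro: R_additive one_closed mult_closed)

text \<open>Positive integers suffice as denominators: by \<open>dvd_nat\<close> every nonzero
  element of R divides one, so this set is closed under inverses.\<close>

definition frac :: "complex set" where
  "frac = {x. \<exists>m>0. of_nat m * x \<in> R}"

lemma R_subset_frac: "R \<subseteq> frac"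
  unfolding frac_def by (auto intro!: exI[of _ 1])

lemma frac_closed:
  assumes "x \<in> frac" "y \<in> frac"
  shows "x + y \<in> frac" "x * y \<in> frac" "- x \<in> frac" "x \<noteq> 0 \<Longrightarrow> inverse x \<in> frac"
proof -
  obtain m where m: "m > 0" "of_nat m * x \<in> R" using assms unfolding frac_def by blast
  obtain k where k: "k > 0" "of_nat k * y \<in> R" using assms unfolding frac_def by blast
  have "of_nat (m * k) * (x + y) = of_nat k * (of_nat m * x) + of_nat m * (of_nat k * y)"
    by (simp add: algebra_simps)
  also have "\<dots> \<in> R" by (intro R_closed(4) mult_closed of_nat_closed m k)
  finally show "x + y \<in> frac" unfolding frac_def using m(1) k(1) by (auto intro!: exI[of _ "m * k"])
  have "of_nat (m * k) * (x * y) = (of_nat m * x) * (of_nat k * y)"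
    by (simp add: mult_ac)
  also have "\<dots> \<in> R" by (intro mult_closed m k)
  finally show "x * y \<in> frac" unfolding frac_def using m(1) k(1) by (auto intro!: exI[of _ "m * k"])
  show "- x \<in> frac" unfolding frac_def using m R_closed(3)[OF m(2)] by auto
  show "inverse x \<in> frac" if x0: "x \<noteq> 0"
  proof -
    have "of_nat m * x \<noteq> 0" using m(1) x0 by simp
    from dvd_nat[OF m(2) this] obtain w d where w: "w \<in> R" "d > 0" "of_nat m * x * w = of_nat d" by blast
    have "of_nat d * inverse x = of_nat m * w" using w(3)[symmetric] x0 by (simp add: field_simps)
    also have "\<dots> \<in> R" by (intro mult_closed of_nat_closed w)
    finally show ?thesis unfolding frac_def using w(2) by blast
  qed
qed

abbreviation (input) CC :: "complex ring" where "CC \<equiv> ring_of_type_algebra"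

lemma CC_field: "field CC"
  by (rule field_from_type_algebra)

lemma CC_simps: "carrier CC = UNIV" "mult CC = (*)" "one CC = 1" "zero CC = 0" "add CC = (+)"
  by (simp_all add: ring_of_type_algebra_def)

lemma CC_a_inv: "\<ominus>\<^bsub>CC\<^esub> x = - x"
proof -
  interpret field CC by (rule CC_field)
  show ?thesis by (intro minus_equality) (simp_all add: CC_simps)
qed

lemma CC_m_inv: "x \<noteq> 0 \<Longrightarrow> inv\<^bsub>CC\<^esub> x = inverse x"
proof -
  interpret field CC by (rule CC_field)
  show "x \<noteq> 0 \<Longrightarrow> inv\<^bsub>CC\<^esub> x = inverse x"
    by (intro comm_inv_char) (simp_all add: CC_simps)
qed

lemma adjoin_rat_subset:
  assumes "w \<in> R"
  shows "adjoin_rat w \<subseteq> frac"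
proof
  fix x assume "x \<in> adjoin_rat w"
  hence "x \<in> generate_field CC {w}" by (simp add: adjoin_rat_def)
  thus "x \<in> frac"
  proof induction
    case one
    show ?case using one_closed R_subset_frac by (auto simp: CC_simps)
  next
    case (incl h)
    thus ?case using assms R_subset_frac by auto
  next
    case (a_inv h)
    thus ?case using frac_closed(3)[OF a_inv.IH a_inv.IH] by (simp add: CC_a_inv)
  next
    case (m_inv h)
    thus ?case using frac_closed(4)[OF m_inv.IH m_inv.IH] by (simp add: CC_simps CC_m_inv)
  next
    case (eng_add h k)
    thus ?case using frac_closed(1) by (simp add: CC_simps)
  next
    case (eng_mult h k)
    thus ?case using frac_closed(2) by (simp add: CC_simps)
  qed
qed

lemma adjoin_rat_closed:
  "1 \<in> adjoin_rat w" "w \<in> adjoin_rat w"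
  "x \<in> adjoin_rat w \<Longrightarrow> y \<in> adjoin_rat w \<Longrightarrow> x + y \<in> adjoin_rat w"
  "x \<in> adjoin_rat w \<Longrightarrow> y \<in> adjoin_rat w \<Longrightarrow> x * y \<in> adjoin_rat w"
  "x \<in> adjoin_rat w \<Longrightarrow> - x \<in> adjoin_rat w"
  "x \<in> adjoin_rat w \<Longrightarrow> x \<noteq> 0 \<Longrightarrow> inverse x \<in> adjoin_rat w"
proof -
  show "1 \<in> adjoin_rat w" "w \<in> adjoin_rat w"
    using generate_field.one[of CC "{w}"] generate_field.incl[of w "{w}" CC]
    by (simp_all add: adjoin_rat_def CC_simps)
  show "x \<in> adjoin_rat w \<Longrightarrow> y \<in> adjoin_rat w \<Longrightarrow> x + y \<in> adjoin_rat w"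
    "x \<in> adjoin_rat w \<Longrightarrow> y \<in> adjoin_rat w \<Longrightarrow> x * y \<in> adjoin_rat w"
    using generate_field.eng_add[of x CC "{w}" y] generate_field.eng_mult[of x CC "{w}" y]
    by (simp_all add: adjoin_rat_def CC_simps)
  show "x \<in> adjoin_rat w \<Longrightarrow> - x \<in> adjoin_rat w"
    using generate_field.a_inv[of x CC "{w}"] by (simp add: adjoin_rat_def CC_a_inv)
  show "x \<in> adjoin_rat w \<Longrightarrow> x \<noteq> 0 \<Longrightarrow> inverse x \<in> adjoin_rat w"
    using generate_field.m_inv[of x CC "{w}"] by (simp add: adjoin_rat_def CC_simps CC_m_inv)
qed

lemma adjoin_rat_additive: "additive_set (adjoin_rat w)"
  unfolding additive_set_def
proof (intro conjI ballI)
  show "0 \<in> adjoin_rat w"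
    using adjoin_rat_closed(3)[OF adjoin_rat_closed(1) adjoin_rat_closed(5)[OF adjoin_rat_closed(1)], of w] by simp
  show "x - y \<in> adjoin_rat w" if "x \<in> adjoin_rat w" "y \<in> adjoin_rat w" for x y
    using adjoin_rat_closed(3)[OF that(1) adjoin_rat_closed(5)[OF that(2)]] by simp
qed

lemma adjoin_rat_eq_frac:
  assumes w: "w \<in> R" and e: "\<And>i. i < n \<Longrightarrow> e i \<in> adjoin_rat w"
  shows "adjoin_rat w = frac"
proof
  show "adjoin_rat w \<subseteq> frac" by (rule adjoin_rat_subset) fact
  have R: "x \<in> adjoin_rat w" if x: "x \<in> R" for x
  proof -
    obtain a where "x = (\<Sum>i<n. of_int (a i) * e i)" using x span by auto
    thus ?thesis
      by (simp only:) (intro additive_set_sum[OF adjoin_rat_additive] additive_set_of_int[OF adjoin_rat_additive] e; simp)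
  qed
  show "frac \<subseteq> adjoin_rat w"
  proof
    fix x assume "x \<in> frac"
    then obtain m where m: "m > 0" "of_nat m * x \<in> R" unfolding frac_def by blast
    have "inverse (of_nat m) * (of_nat m * x) \<in> adjoin_rat w"
      using m by (intro adjoin_rat_closed(4,6) R of_nat_closed) auto
    thus "x \<in> adjoin_rat w" using m(1) by (simp flip: mult.assoc)
  qed
qed

lemma algebraic_int_frac:
  assumes "x \<in> frac" "Polynomial.algebraic_int x"
  shows "x \<in> R"
proof -
  obtain m where m: "m > 0" "of_nat m * x \<in> R" using assms(1) unfolding frac_def by blast
  obtain d where "d > 0" "\<forall>k. of_nat d * x ^ k \<in> R"
    using S.integral_common_denominator[OF assms(2) m] by blast
  thus ?thesis by (intro int_closed[of d x]) auto
qed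

text \<open>The link to the number fields of the theorem. Once the basis lies in the generated
  field, that field is \<open>frac\<close>, and integral elements of \<open>frac\<close> belong to R
  by integral closedness.\<close>

lemma ring_of_integers_eq:
  assumes w: "w \<in> R" and e: "\<And>i. i < n \<Longrightarrow> e i \<in> adjoin_rat w"
  shows "ring_of_integers (adjoin_rat w) = A"
proof -
  have "{x \<in> adjoin_rat w. Polynomial.algebraic_int x} = R"
    using adjoin_rat_eq_frac[OF assms] algebraic_int_frac algebraic_int R_subset_frac by auto
  thus ?thesis by (simp add: ring_of_integers_def)
qed

end

section \<open>Frobenius and integral closedness of the cyclotomic ring\<close>

context cyclotomic
begin

text \<open>For \<open>c\<close> prime to \<open>q\<close> this is the image of \<open>tw a 1\<close> under the Galois automorphism \<open>z \<mapsto> z ^ c\<close>.\<close>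
definition tw :: "(nat \<Rightarrow> int) \<Rightarrow> nat \<Rightarrow> complex" where
  "tw a c = (\<Sum>i<q-1. of_int (a i) * z ^ (i * c))"

lemma tw_mem: "tw a c \<in> R"
  unfolding tw_def by (intro S.sum_mem S.mult_mem S.of_int_mem z_power_mem)

lemma tw_1: "x \<in> R \<Longrightarrow> \<exists>a. x = tw a 1"
  unfolding R_def tw_def by auto

lemma tw_cong: "[c = d] (mod q) \<Longrightarrow> tw a c = tw a d"
  unfolding tw_def by (intro sum.cong refl arg_cong2[where f = "(*)"] z_power_cong cong_mult cong_refl)

lemma tw_frobenius:
  assumes p: "prime p"
  shows "tw a c ^ p - tw a (c * p) \<in> S.princ (of_nat p)"
proof -
  define f where "f i = of_int (a i) * z ^ (i * c)" for i
  have "(\<Sum>i<q-1. f i) ^ p - (\<Sum>i<q-1. f i ^ p) \<in> S.princ (of_nat p)"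
    using p unfolding f_def by (intro S.freshman_sum S.mult_mem S.of_int_mem z_power_mem) auto
  moreover have "(\<Sum>i<q-1. f i ^ p) - tw a (c * p) = (\<Sum>i<q-1. (of_int (a i) ^ p - of_int (a i)) * z ^ (i * c * p))"
    unfolding f_def tw_def sum_subtractf[symmetric]
    by (intro sum.cong) (simp_all add: power_mult_distrib power_mult left_diff_distrib mult.assoc)
  moreover have "(\<Sum>i<q-1. (of_int (a i) ^ p - of_int (a i)) * z ^ (i * c * p)) \<in> S.princ (of_nat p)"
    by (intro S.princ_sum S.princ_mult' S.of_int_fermat p z_power_mem)
  ultimately have "((\<Sum>i<q-1. f i) ^ p - (\<Sum>i<q-1. f i ^ p)) + ((\<Sum>i<q-1. f i ^ p) - tw a (c * p)) \<in> S.princ (of_nat p)"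
    by (intro S.princ_mem(4)) simp_all
  thus ?thesis by (simp add: tw_def f_def)
qed

lemma tw_frobenius_power:
  assumes p: "prime p"
  shows "tw a c ^ (p ^ f) - tw a (c * p ^ f) \<in> S.princ (of_nat p)"
proof (induction f)
  case 0
  show ?case using S.princ_mem(1) by simp
next
  case (Suc f)
  have "(tw a c ^ (p ^ f)) ^ p - tw a (c * p ^ f) ^ p \<in> S.princ (of_nat p)"
    by (intro S.power_diff_princ S.power_mem tw_mem Suc)
  from S.princ_mem(4)[OF this tw_frobenius[OF p, of a "c * p ^ f"]]
  show ?case by (simp add: mult_ac flip: power_mult)
qed

lemma frobenius_order:
  assumes p: "prime p" "p \<noteq> q" and x: "x \<in> R"
  shows "x ^ (p ^ (q - 1)) - x \<in> S.princ (of_nat p)"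
proof -
  obtain a where a: "x = tw a 1" using tw_1[OF x] by blast
  have "\<not> q dvd p" using p q(1) primes_dvd_imp_eq by blast
  hence "[p ^ (q - 1) = 1] (mod q)" using q(1) by (intro fermat_theorem)
  hence "tw a (1 * p ^ (q - 1)) = tw a 1" by (intro tw_cong) simp
  thus ?thesis using tw_frobenius_power[OF p(1), of a 1 "q - 1"] a by simp
qed

text \<open>R/pR has no nilpotents for p different from q. With P = p^(q - 1) one has y^P = y modulo
  p, so an exponent k > P may be replaced by k - P + 1; and if k \<le> P, then y = y^P = 0 modulo
  p.\<close>

lemma reduced_mod_prime:
  assumes p: "prime p" "p \<noteq> q" and y: "y \<in> R" "y ^ k \<in> S.princ (of_nat p)"
  shows "y \<in> S.princ (of_nat p)"
  using y(2)
proof (induction k rule: less_induct)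
  case (less k)
  define P where "P = p ^ (q - 1)"
  have P: "P \<ge> 2"
  proof -
    have "p ^ 1 \<le> p ^ (q - 1)" using q_gt prime_gt_0_nat[OF p(1)] by (intro power_increasing) auto
    thus ?thesis using prime_ge_2_nat[OF p(1)] by (simp add: P_def)
  qed
  have frob: "y ^ P - y \<in> S.princ (of_nat p)" unfolding P_def by (rule frobenius_order[OF p y(1)])
  show ?case
  proof (cases "k \<le> P")
    case True
    have "y ^ k * y ^ (P - k) \<in> S.princ (of_nat p)"
      using less.prems by (intro S.princ_mult' S.power_mem y)
    hence "y ^ P \<in> S.princ (of_nat p)" using True by (simp flip: power_add)
    from S.princ_mem(2)[OF this frob] show ?thesis by simp
  next
    case False
    have "y ^ k = y ^ (k - P) * y ^ P" using False by (simp flip: power_add)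
    hence "y ^ (k - P) * (y ^ P - y) = y ^ k - y ^ (Suc (k - P))"
      by (simp only: right_diff_distrib power_Suc2)
    moreover have "y ^ (k - P) * (y ^ P - y) \<in> S.princ (of_nat p)"
      by (intro S.princ_mult frob S.power_mem y)
    ultimately have "y ^ k - y ^ (Suc (k - P)) \<in> S.princ (of_nat p)" by (simp only:)
    from S.princ_mem(2)[OF less.prems this] have "y ^ (Suc (k - P)) \<in> S.princ (of_nat p)"
      by (simp del: power_Suc)
    thus ?thesis using less.IH[of "Suc (k - P)"] P False by simp
  qed
qed

lemma cancel_coprime:
  assumes p: "prime p" "of_nat p \<in> S.princ c" and u: "\<not> p dvd u"
    and w: "w \<in> R" "of_nat u * w \<in> S.princ c"
  shows "w \<in> S.princ c"
proof -
  have "Rings.coprime (int p) (int u)" using u p(1) by (simp add: prime_imp_coprime)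
  then obtain s t where st: "s * int p + t * int u = 1" by (metis bezout_int coprime_imp_gcd_eq_1)
  have "of_int s * (of_nat p * w) + of_int t * (of_nat u * w) = of_int (s * int p + t * int u) * w"
    by (simp add: algebra_simps)
  moreover have "of_int s * (of_nat p * w) + of_int t * (of_nat u * w) \<in> S.princ c"
    by (intro S.princ_mem(4) S.princ_mult S.of_int_mem w S.princ_mult'[OF p(2)])
  ultimately show ?thesis using st by simp
qed

lemma of_nat_in_princ: "of_nat p \<in> S.princ (of_nat p)"
  using S.princI[OF S.one_mem, of "of_nat p"] by simp

text \<open>Removal of one prime p from a denominator of x. Put y = pex and let p^v be the exact
  power of p in m. The power y^k is divisible by about p^(k - v). For p different from q this makes
  y nilpotent modulo p, hence divisible by p. For p = q divisibility by lam^j is raised one step at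
  a time up to lam^(q - 1), an associate of q.\<close>

lemma divide_prime_step:
  assumes m: "m > 0" "\<And>k. of_nat m * x ^ k \<in> R" and p: "prime p"
    and y: "of_nat (p * e) * x \<in> R"
  shows "of_nat e * x \<in> R"
proof -
  let ?y = "of_nat (p * e) * x"
  have p0: "p > 0" using p prime_gt_0_nat by blast
  define v where "v = Factorial_Ring.multiplicity p m"
  obtain u where u: "m = p ^ v * u" "\<not> p dvd u"
    unfolding v_def by (rule multiplicity_decompose'[of m p]) (use m(1) p in auto)
  have key: "of_nat u * (of_nat p ^ v * ?y ^ k) = of_nat p ^ k * (of_nat e ^ k * (of_nat m * x ^ k))" for k
    by (simp add: u(1) power_mult_distrib mult_ac)
  show ?thesis
  proof (cases "p = q")
    case False
    have "of_nat p ^ v * (of_nat u * ?y ^ Suc v) = of_nat p ^ v * (of_nat p * (of_nat e ^ Suc v * (of_nat m * x ^ Suc v)))"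
      using key[of "Suc v"] by (simp add: mult_ac)
    hence "of_nat u * ?y ^ Suc v = of_nat p * (of_nat e ^ Suc v * (of_nat m * x ^ Suc v))"
      using p0 by simp
    also have "\<dots> \<in> S.princ (of_nat p)" by (intro S.princI S.mult_mem S.power_mem S.of_nat_mem m)
    finally have "of_nat u * ?y ^ Suc v \<in> S.princ (of_nat p)" .
    hence "?y ^ Suc v \<in> S.princ (of_nat p)"
      by (rule cancel_coprime[OF p of_nat_in_princ u(2) S.power_mem[OF y]])
    hence "?y \<in> S.princ (of_nat p)" by (rule reduced_mod_prime[OF p False y])
    then obtain r where "r \<in> R" "?y = of_nat p * r" by (rule S.princE)
    thus ?thesis using p0 by simp
  next
    case True
    obtain U V where UV: "U \<in> R" "V \<in> R" "U * V = 1" "of_nat q = U * lam ^ (q - 1)"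
      using q_eq_lam_power by blast
    have "?y \<in> S.princ (lam ^ j)" if "j \<le> q - 1" for j
      using that
    proof (induction j)
      case 0
      show ?case using S.princI[OF y, of "lam ^ 0"] by (simp only: power_0 mult_1)
    next
      case (Suc j)
      hence "?y \<in> S.princ (lam ^ j)" by simp
      then obtain w where w: "w \<in> R" "?y = lam ^ j * w" by (rule S.princE)
      \<comment> \<open>One more than (q - 1)v: since j < q - 1, the exponent (q - 1)k of
        \<open>lam\<close> on the right exceeds the exponent (q - 1)v + jk on the left by at least
        1, and this surplus puts w^k into the ideal of \<open>lam\<close>.\<close>
      define k where "k = (q - 1) * v + 1"
      define r where "r = of_nat e ^ k * (of_nat m * x ^ k)"
      have r: "r \<in> R" unfolding r_def by (intro S.mult_mem S.power_mem S.of_nat_mem m)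
      obtain i where i: "q - 1 = Suc j + i" using Suc.prems le_iff_add by blast
      have "(q - 1) * k = j * k + k + i * k" unfolding i by (simp add: algebra_simps)
      moreover have "k = (q - 1) * v + 1" by (rule k_def)
      ultimately have c: "(q - 1) * k = (q - 1) * v + j * k + (1 + i * k)" by linarith
      define c where "c = i * k"
      note c = c[folded c_def]
      have "of_nat u * (of_nat q ^ v * ?y ^ k) = of_nat q ^ k * r"
        using key[of k] unfolding r_def True .
      hence "of_nat u * ((U * lam ^ (q - 1)) ^ v * (lam ^ j * w) ^ k) = (U * lam ^ (q - 1)) ^ k * r"
        unfolding w(2) UV(4) .
      hence "lam ^ ((q - 1) * v + j * k) * (of_nat u * U ^ v * w ^ k) = lam ^ ((q - 1) * k) * (U ^ k * r)"
        by (simp only: power_mult_distrib power_mult power_add, simp only: mult_ac)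
      also have "\<dots> = lam ^ ((q - 1) * v + j * k) * (lam * (lam ^ c * (U ^ k * r)))"
        unfolding c by (simp only: power_add power_one_right mult.assoc)
      finally have "of_nat u * U ^ v * w ^ k = lam * (lam ^ c * (U ^ k * r))"
        using lam_nonzero by simp
      hence "of_nat u * w ^ k * (U * V) ^ v = lam * (lam ^ c * (U ^ k * r)) * V ^ v"
        by (simp add: power_mult_distrib mult_ac)
      also have "\<dots> = lam * (lam ^ c * (U ^ k * r) * V ^ v)" by (simp add: mult.assoc)
      also have "\<dots> \<in> S.princ lam" by (intro S.princI S.mult_mem S.power_mem lam_mem UV r)
      finally have uw: "of_nat u * w ^ k \<in> S.princ lam" using UV(3) by simp
      have "of_nat q \<in> S.princ lam" using q_in_princ_lam_power[of 1] q_gt by simp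
      moreover have "\<not> q dvd u" using u(2) True by simp
      ultimately have "w ^ k \<in> S.princ lam"
        using cancel_coprime[OF q(1) _ _ S.power_mem[OF w(1)] uw] by blast
      hence "w \<in> S.princ lam" by (rule power_in_princ_lam[OF w(1)])
      then obtain s where "s \<in> R" "w = lam * s" by (rule S.princE)
      have "?y = lam ^ j * (lam * s)" using w(2) unfolding \<open>w = lam * s\<close> .
      also have "\<dots> = lam ^ Suc j * s" by (simp only: power_Suc mult_ac)
      finally have "?y = lam ^ Suc j * s" .
      thus ?case using S.princI[OF \<open>s \<in> R\<close>, of "lam ^ Suc j"] by (simp only:)
    qed
    from this[OF order.refl] obtain r where r: "r \<in> R" "?y = lam ^ (q - 1) * r" by (rule S.princE)
    have "of_nat q * (V * r) = (U * V) * (lam ^ (q - 1) * r)" by (simp add: UV(4) mult_ac)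
    also have "\<dots> = of_nat q * (of_nat e * x)" using UV(3) r(2) True by (simp add: mult.assoc)
    finally have "V * r = of_nat e * x" using q_gt by simp
    thus ?thesis using S.mult_mem[OF UV(2) r(1)] by simp
  qed
qed

text \<open>A prime factor of the least denominator of x could be removed by
  \<open>divide_prime_step\<close>, so the least denominator is 1.\<close>

lemma int_closed_R:
  assumes m: "m > 0" "\<And>k. of_nat m * x ^ k \<in> R"
  shows "x \<in> R"
proof -
  define d where "d = (LEAST d. d > 0 \<and> of_nat d * x \<in> R)"
  have ex: "\<exists>d. d > 0 \<and> of_nat d * x \<in> R" using m(1) m(2)[of 1] by auto
  have d: "d > 0" "of_nat d * x \<in> R" using LeastI_ex[OF ex] unfolding d_def by auto
  have least: "d \<le> k" if "k > 0" "of_nat k * x \<in> R" for k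
    unfolding d_def using that by (intro Least_le) simp
  have "d = 1"
  proof (rule ccontr)
    assume "d \<noteq> 1"
    then obtain p where p: "prime p" "p dvd d" using prime_factor_nat by blast
    then obtain e where e: "d = p * e" by blast
    have "of_nat e * x \<in> R" using d(2) unfolding e by (rule divide_prime_step[OF m p(1)])
    moreover have "e > 0" using d(1) e by auto
    ultimately have "d \<le> e" by (intro least)
    thus False using e \<open>e > 0\<close> prime_gt_1_nat[OF p(1)] by simp
  qed
  thus ?thesis using d(2) by simp
qed

end

sublocale cyclotomic \<subseteq> K: number_ring "cyclotomic.R q" "q - 1" "\<lambda>i. zeta_root q ^ i"
proof
  show "1 \<in> R" by (rule S.one_mem)
  show "x * y \<in> R" if "x \<in> R" "y \<in> R" for x y by (rule S.mult_mem[OF that])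
  show "R = range (\<lambda>a :: nat \<Rightarrow> int. \<Sum>i<q-1. of_int (a i) * z ^ i)" by (rule R_def)
  show "a i = 0" if "(\<Sum>i<q-1. of_int (a i) * z ^ i) = 0" "i < q - 1" for a i
    by (rule indep_z[OF that])
  show "x \<in> R" if "m > 0" "\<And>k. of_nat m * x ^ k \<in> R" for m x
    by (rule int_closed_R[OF that])
qed

lemma sum_lessThan_double:
  fixes f :: "nat \<Rightarrow> 'a::comm_monoid_add"
  shows "(\<Sum>j<2*n. f j) = (\<Sum>j<n. f j + f (2 * n - 1 - j))"
proof -
  have inj: "inj_on (\<lambda>j. 2 * n - 1 - j) {..<n}" by (auto simp: inj_on_def)
  have img: "(\<lambda>j. 2 * n - 1 - j) ` {..<n} = {n..<2*n}"
  proof (intro equalityI subsetI)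
    fix k assume "k \<in> {n..<2*n}"
    thus "k \<in> (\<lambda>j. 2 * n - 1 - j) ` {..<n}" by (intro image_eqI[of _ _ "2 * n - 1 - k"]) auto
  qed auto
  have "{..<2*n} = {..<n} \<union> {n..<2*n}" by auto
  hence "(\<Sum>j<2*n. f j) = (\<Sum>j\<in>{..<n} \<union> {n..<2*n}. f j)" by (simp only:)
  also have "\<dots> = (\<Sum>j<n. f j) + (\<Sum>j\<in>{n..<2*n}. f j)"
    by (rule sum.union_disjoint) auto
  also have "(\<Sum>j\<in>{n..<2*n}. f j) = (\<Sum>j<n. f (2 * n - 1 - j))"
    unfolding img[symmetric] by (subst sum.reindex[OF inj]) (simp only: o_def)
  finally show ?thesis by (simp add: sum.distrib)
qed

section \<open>The maximal real subring\<close>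

context cyclotomic
begin

definition Rp :: "complex set" where "Rp = R \<inter> \<real>"

definition np :: nat where "np = (q - 1) div 2"

text \<open>The sum of z^(i + 1) and its conjugate. Starting at exponent 1 makes the
  \<open>np\<close> values use each of z, ..., z^(q - 1) once; 1 is minus the sum of all of
  them.\<close>

definition eta :: "nat \<Rightarrow> complex" where "eta i = z ^ Suc i + z ^ (q - Suc i)"

lemma q_np: "q = 2 * np + 1"
  using q(2) q_gt by (auto simp: np_def elim: oddE)

lemma q_pred: "q - 1 = 2 * np" "q - 2 = 2 * np - 1"
  using q_np by simp_all

lemma np_pos: "np > 0"
  using q_np q_gt by simp

lemma z_z': "z * z ^ (q - 1) = 1"
proof -
  have "z * z ^ (q - 1) = z ^ Suc (q - 1)" by simp
  also have "Suc (q - 1) = q" using q_gt by simp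
  finally show ?thesis by simp
qed

lemma real_iff_cnj: "x \<in> \<real> \<longleftrightarrow> cnj x = x"
  by (rule Reals_cnj_iff)

lemma real_add_cnj: "x + cnj x \<in> \<real>"
  by (simp add: real_iff_cnj)

lemma eta_mem: "i < np \<Longrightarrow> eta i \<in> Rp"
proof -
  assume i: "i < np"
  have "cnj (z ^ Suc i) = z ^ (q - Suc i)"
    by (rule cnj_z_power) (use i q_pred(1) in linarith)
  hence "eta i = z ^ Suc i + cnj (z ^ Suc i)" unfolding eta_def by (simp only:)
  hence "eta i \<in> \<real>" using real_add_cnj by metis
  moreover have "eta i \<in> R" unfolding eta_def by (intro S.add_mem(4) z_power_mem)
  ultimately show ?thesis by (simp add: Rp_def)
qed

lemma Rp_additive: "additive_set Rp"
  unfolding Rp_def by (rule additive_set_Int[OF R_add]) (simp add: additive_set_def)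

text \<open>Factoring out one z shifts the exponents 1, ..., q - 1 to the basis exponents 0, ..., q
  - 2; conjugate pairs become j and q - 2 - j. Both spanning and independence of \<open>eta\<close>
  are read off from this.\<close>

lemma sum_eta: "(\<Sum>i<np. of_int (a i) * eta i) =
    z * (\<Sum>j<q-1. of_int (if j < np then a j else a (q - 2 - j)) * z ^ j)"
proof -
  have "(\<Sum>j<q-1. of_int (if j < np then a j else a (q - 2 - j)) * z ^ j) =
      (\<Sum>j<2*np. of_int (if j < np then a j else a (q - 2 - j)) * z ^ j)"
    by (simp only: q_pred(1))
  also have "\<dots> = (\<Sum>j<np. of_int (a j) * z ^ j + of_int (a j) * z ^ (q - 2 - j))"
    unfolding sum_lessThan_double q_pred(2) by (intro sum.cong refl) auto
  also have "z * \<dots> = (\<Sum>j<np. of_int (a j) * eta j)"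
    unfolding sum_distrib_left
  proof (intro sum.cong refl)
    fix j assume "j \<in> {..<np}"
    hence "j < np" by simp
    hence "q - Suc j = Suc (q - 2 - j)" using q_pred(1) by linarith
    thus "z * (of_int (a j) * z ^ j + of_int (a j) * z ^ (q - 2 - j)) = of_int (a j) * eta j"
      unfolding eta_def by (simp add: algebra_simps)
  qed
  finally show ?thesis by simp
qed

text \<open>Write x as z times a combination of the basis. Conjugation reverses the coefficients, so
  for real x linear independence forces them to be symmetric under j to q - 2 - j, which is the
  shape in \<open>sum_eta\<close>.\<close>

lemma Rp_span: "Rp = range (\<lambda>a :: nat \<Rightarrow> int. \<Sum>i<np. of_int (a i) * eta i)"
proof (intro equalityI subsetI)
  fix x assume "x \<in> range (\<lambda>a :: nat \<Rightarrow> int. \<Sum>i<np. of_int (a i) * eta i)"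
  then obtain a where "x = (\<Sum>i<np. of_int (a i) * eta i)" by blast
  thus "x \<in> Rp"
    by (simp only:) (intro additive_set_sum[OF Rp_additive] additive_set_of_int[OF Rp_additive] eta_mem; simp)
next
  fix x assume "x \<in> Rp"
  hence x: "x \<in> R" "cnj x = x" by (auto simp: Rp_def real_iff_cnj)
  have "z ^ (q - 1) * x \<in> R" by (intro S.mult_mem z_power_mem x)
  then obtain b where b: "z ^ (q - 1) * x = (\<Sum>j<q-1. of_int (b j) * z ^ j)" unfolding R_def by blast
  have "x = z * (z ^ (q - 1) * x)" by (simp only: mult.assoc[symmetric] z_z' mult_1)
  hence xb: "x = z * (\<Sum>j<q-1. of_int (b j) * z ^ j)" unfolding b .
  have "cnj x = (\<Sum>j<q-1. of_int (b j) * cnj (z ^ Suc j))"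
    unfolding xb by (simp add: sum_distrib_left mult_ac)
  also have "\<dots> = (\<Sum>j<q-1. of_int (b j) * z ^ (q - Suc j))"
    by (intro sum.cong refl arg_cong2[where f = "(*)"] cnj_z_power) auto
  also have "\<dots> = (\<Sum>j<q-1. of_int (b (q - 2 - j)) * z ^ Suc j)"
    by (rule sum.reindex_bij_witness[of _ "\<lambda>j. q - 2 - j" "\<lambda>j. q - 2 - j"]) (auto simp: Suc_diff_Suc)
  also have "\<dots> = z * (\<Sum>j<q-1. of_int (b (q - 2 - j)) * z ^ j)"
    by (simp add: sum_distrib_left mult_ac)
  finally have "z * (\<Sum>j<q-1. of_int (b j) * z ^ j) = z * (\<Sum>j<q-1. of_int (b (q - 2 - j)) * z ^ j)"
    using x(2) xb by simp
  hence "(\<Sum>j<q-1. of_int (b j) * z ^ j) = (\<Sum>j<q-1. of_int (b (q - 2 - j)) * z ^ j)" by simp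
  hence "(\<Sum>j<q-1. of_int (b j - b (q - 2 - j)) * z ^ j) = 0"
    by (simp add: sum_subtractf left_diff_distrib)
  from indep_z[OF this] have sym: "b j = b (q - 2 - j)" if "j < q - 1" for j
    using that by fastforce
  have "x = (\<Sum>i<np. of_int (b i) * eta i)"
    unfolding sum_eta xb
    by (intro arg_cong2[where f = "(*)"] refl sum.cong) (use sym[symmetric] in auto)
  thus "x \<in> range (\<lambda>a :: nat \<Rightarrow> int. \<Sum>i<np. of_int (a i) * eta i)" by blast
qed

lemma real_div_nat: "of_nat m * x \<in> \<real> \<Longrightarrow> m > 0 \<Longrightarrow> x \<in> (\<real> :: complex set)"
  using Reals_divide[of "of_nat m * x" "of_nat m"] by simp

end

sublocale cyclotomic \<subseteq> P: number_ring "cyclotomic.Rp q" "cyclotomic.np q" "cyclotomic.eta q"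
proof
  show "1 \<in> Rp" using S.one_mem by (simp add: Rp_def)
  show "x * y \<in> Rp" if "x \<in> Rp" "y \<in> Rp" for x y using that S.mult_mem by (auto simp: Rp_def)
  show "Rp = range (\<lambda>a :: nat \<Rightarrow> int. \<Sum>i<np. of_int (a i) * eta i)" by (rule Rp_span)
  show "a i = 0" if 0: "(\<Sum>i<np. of_int (a i) * eta i) = 0" and i: "i < np" for a i
  proof -
    have "(\<Sum>j<q-1. of_int (if j < np then a j else a (q - 2 - j)) * z ^ j) = 0"
      using 0 unfolding sum_eta by simp
    moreover have "i < q - 1" using i q_pred(1) by linarith
    ultimately show ?thesis using indep_z[of _ i] i by fastforce
  qed
  show "x \<in> Rp" if m: "m > 0" "\<And>k. of_nat m * x ^ k \<in> Rp" for m x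
  proof -
    have "of_nat m * x ^ k \<in> R" for k using m(2)[of k] by (simp add: Rp_def)
    hence "x \<in> R" by (rule int_closed_R[OF m(1)])
    moreover have "of_nat m * x \<in> \<real>" using m(2)[of 1] by (simp add: Rp_def)
    hence "x \<in> \<real>" by (rule real_div_nat[OF _ m(1)])
    ultimately show ?thesis by (simp add: Rp_def)
  qed
qed

section \<open>Decomposition of primes in both rings\<close>

context cyclotomic
begin

lemma ring_of_integers_K: "ring_of_integers (adjoin_rat z) = K.A"
proof (rule K.ring_of_integers_eq)
  show "z \<in> R" using z_power_mem[of 1] by simp
  show "z ^ i \<in> adjoin_rat z" for i
    by (induction i) (auto intro: K.adjoin_rat_closed)
qed

abbreviation alpha :: complex where "alpha \<equiv> z + z ^ (q - 1)"

lemma alpha_eta: "alpha = eta 0"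
  by (simp add: eta_def)

lemma alpha_mem: "alpha \<in> Rp"
  unfolding alpha_eta by (rule eta_mem[OF np_pos])

lemma ring_of_integers_P: "ring_of_integers (adjoin_rat (z + inverse z)) = P.A"
proof (rule P.ring_of_integers_eq)
  show w: "z + inverse z \<in> Rp" using alpha_mem by (simp add: inverse_z)
  define w where "w = z + inverse z"
  \<comment> \<open>Chebyshev recursion: with t(k) = z^k + z^(-k) one has t(k + 2) = w t(k + 1) -
    t(k), so all t(k) lie in the field generated by w = t(1).\<close>
  have T: "z ^ k + inverse z ^ k \<in> adjoin_rat w" for k
  proof (induction k rule: induct_nat_012)
    case 0
    show ?case using P.adjoin_rat_closed(3)[OF P.adjoin_rat_closed(1,1)] by simp
  next
    case 1
    show ?case using P.adjoin_rat_closed(2)[of w] by (simp add: w_def)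
  next
    case (ge2 k)
    have "(z + v) * (z * a + v * b) = z * (z * a) + v * (v * b) + (z * v) * (a + b)" for v a b :: complex
      by (simp add: algebra_simps)
    from this[of "inverse z" "z ^ k" "inverse z ^ k"]
    have "z ^ Suc (Suc k) + inverse z ^ Suc (Suc k) =
        w * (z ^ Suc k + inverse z ^ Suc k) + - (z ^ k + inverse z ^ k)"
      unfolding w_def power_Suc by simp
    thus ?case
      by (simp only:) (rule P.adjoin_rat_closed(3)[OF
        P.adjoin_rat_closed(4)[OF P.adjoin_rat_closed(2) ge2(2)] P.adjoin_rat_closed(5)[OF ge2(1)]])
  qed
  show "eta i \<in> adjoin_rat (z + inverse z)" if i: "i < np" for i
  proof -
    have "z ^ (q - Suc i) = inverse z ^ Suc i"
    proof -
      have "inverse z ^ Suc i = cnj (z ^ Suc i)" by (simp add: inverse_z cnj_z)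
      also have "\<dots> = z ^ (q - Suc i)" using i q_pred(1) by (intro cnj_z_power) linarith
      finally show ?thesis by simp
    qed
    thus ?thesis using T[of "Suc i"] by (simp only: eta_def w_def)
  qed
qed

lemma princ_eq_scaled: "S.princ c = (*) c ` R"
  by (simp add: S.princ_def)

lemma z_power_in_maxid: "K.maxid P \<Longrightarrow> z ^ k \<notin> P"
proof
  assume P: "K.maxid P" "z ^ k \<in> P"
  have "z ^ k * (z ^ (q - 1)) ^ k = 1" using z_z' by (simp flip: power_mult_distrib)
  hence "1 \<in> P" using K.modlD(3)[OF K.maxidD(3)[OF P(1)] S.power_mem[OF z_power_mem] P(2)] by metis
  thus False using K.maxidD(5)[OF P(1)] by simp
qed

text \<open>For N the norm of P, z^(N - 1) is 1 modulo P. If q did not divide N - 1, then 1 - z^(N -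
  1) would be \<open>lam\<close> times a unit, forcing \<open>lam\<close> and with it q into
  P.\<close>

lemma K_norm_cong:
  assumes P: "K.maxid P" "of_nat q \<notin> P"
  shows "q dvd idx R P - 1"
proof (rule ccontr)
  assume nd: "\<not> q dvd idx R P - 1"
  have "z \<in> R" "z \<notin> P" using z_power_mem[of 1] z_power_in_maxid[OF P(1), of 1] by simp_all
  from K.residue_fermat[OF P(1) this] have "- (z ^ (idx R P - 1) - 1) \<in> P"
    by (rule K.modl_closed(3)[OF K.maxidD(3)[OF P(1)]])
  hence mem: "lam * qt (idx R P - 1) \<in> P" by (simp flip: one_minus_z_power)
  obtain v where v: "v \<in> R" "qt (idx R P - 1) * v = 1" using qt_unit[OF nd] by blast
  have "lam * qt (idx R P - 1) * v \<in> P" by (rule K.modlD(3)[OF K.maxidD(3)[OF P(1)] v(1) mem])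
  hence l: "lam \<in> P" using v(2) by (simp add: mult.assoc)
  have "of_nat q \<in> S.princ lam" using q_in_princ_lam_power[of 1] q_gt by simp
  then obtain r where "r \<in> R" "of_nat q = lam * r" by (rule S.princE)
  hence "of_nat q \<in> P" using K.modlD(3)[OF K.maxidD(3)[OF P(1)] _ l] by simp
  thus False using P(2) by simp
qed

lemma K_split:
  assumes p: "prime p" "[p = 1] (mod q)"
  shows "\<And>P. P \<in> K.primes_over p \<Longrightarrow> idx R P = p" "card (K.primes_over p) = q - 1"
proof -
  have "x ^ p - x \<in> (*) (of_nat p) ` R" if x: "x \<in> R" for x
  proof -
    obtain a where a: "x = tw a 1" using tw_1[OF x] by blast
    have "tw a (1 * p) = tw a 1" using p(2) by (intro tw_cong) simp
    thus ?thesis using tw_frobenius[OF p(1), of a 1] a by (simp add: princ_eq_scaled)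
  qed
  from K.primes_over_split[OF p(1) this]
  show "\<And>P. P \<in> K.primes_over p \<Longrightarrow> idx R P = p" "card (K.primes_over p) = q - 1" by auto
qed

lemma K_ramified: "\<exists>L. K.primes_over q = {L} \<and> idx R L = q"
proof -
  obtain U V where "U \<in> R" "V \<in> R" "U * V = 1" "of_nat q = U * lam ^ (q - 1)"
    using q_eq_lam_power by blast
  from K.primes_over_ramified[OF q(1) lam_mem this] show ?thesis by blast
qed

text \<open>Modulo p the Frobenius acts as z to z^p, which is the identity or complex conjugation
  for the two classes; real elements are fixed by both.\<close>

lemma P_split:
  assumes p: "prime p" "[p = 1] (mod q) \<or> [p = q - 1] (mod q)"
  shows "\<And>Q. Q \<in> P.primes_over p \<Longrightarrow> idx Rp Q = p" "card (P.primes_over p) = np"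
proof -
  have "x ^ p - x \<in> (*) (of_nat p) ` Rp" if x: "x \<in> Rp" for x
  proof -
    have xR: "x \<in> R" "x \<in> \<real>" using x by (auto simp: Rp_def)
    obtain a where a: "x = tw a 1" using tw_1[OF xR(1)] by blast
    have "tw a (1 * p) = x"
    proof (cases "[p = 1] (mod q)")
      case True
      hence "tw a (1 * p) = tw a 1" by (intro tw_cong) simp
      thus ?thesis using a by simp
    next
      case False
      hence "tw a (1 * p) = tw a (q - 1)" using p(2) by (intro tw_cong) simp
      also have "\<dots> = cnj (tw a 1)"
        unfolding tw_def by (simp add: cnj_z mult.commute flip: power_mult)
      also have "\<dots> = x" using xR(2) a by (simp add: real_iff_cnj)
      finally show ?thesis .
    qed
    hence "x ^ p - x \<in> S.princ (of_nat p)" using tw_frobenius[OF p(1), of a 1] a by simp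
    then obtain r where r: "r \<in> R" "x ^ p - x = of_nat p * r" by (rule S.princE)
    have "x ^ p - x \<in> \<real>" using xR(2) by simp
    hence "r \<in> \<real>" using r(2) real_div_nat[of p r] prime_gt_0_nat[OF p(1)] by simp
    thus ?thesis using r by (auto simp: Rp_def)
  qed
  from P.primes_over_split[OF p(1) this]
  show "\<And>Q. Q \<in> P.primes_over p \<Longrightarrow> idx Rp Q = p" "card (P.primes_over p) = np" by auto
qed

text \<open>The generator is l = 2 - alpha = (1 - z)(1 - 1/z), an associate of lam^2 in the
  cyclotomic ring, so l^np is an associate of q there.\<close>

lemma P_ramified: "\<exists>L. P.primes_over q = {L} \<and> idx Rp L = q"
proof -
  obtain U V where UV: "U \<in> R" "V \<in> R" "U * V = 1" "of_nat q = U * lam ^ (q - 1)"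
    using q_eq_lam_power by blast
  define w where "w = z ^ (q - 1)"
  have zw: "z * w = 1" unfolding w_def by (rule z_z')
  have zR: "z \<in> R" "w \<in> R" using z_power_mem[of 1] z_power_mem by (auto simp: w_def)
  define l where "l = 2 - alpha"
  have "l \<in> Rp" unfolding l_def using P.R_closed(2)[OF P.of_nat_closed[of 2] alpha_mem] by simp
  have "(- w) * (1 - z) ^ 2 = 2 * (z * w) - (z * (z * w) + w)"
    by (simp add: power2_eq_square algebra_simps)
  hence l: "l = (- w) * lam ^ 2" unfolding l_def lam_def w_def[symmetric] using zw by simp
  have lnp: "l ^ np = (- w) ^ np * lam ^ (q - 1)"
  proof -
    have "lam ^ (q - 1) = (lam ^ 2) ^ np" by (simp only: q_pred(1) power_mult)
    thus ?thesis by (simp only: l power_mult_distrib)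
  qed
  define U' where "U' = U * (- z) ^ np"
  define V' where "V' = V * (- w) ^ np"
  have zwn: "(- z) ^ np * (- w) ^ np = 1" using zw by (simp flip: power_mult_distrib)
  have "U' * V' = (U * V) * ((- z) ^ np * (- w) ^ np)" unfolding U'_def V'_def by (simp only: mult_ac)
  hence UV': "U' * V' = 1" using zwn UV(3) by simp
  have "U' * l ^ np = U * lam ^ (q - 1) * ((- z) ^ np * (- w) ^ np)"
    unfolding U'_def lnp by (simp only: mult_ac)
  hence eq: "of_nat q = U' * l ^ np" using zwn UV(4) by simp
  have "l \<noteq> 0" using l lam_nonzero zw by auto
  \<comment> \<open>The unit relating q and l^np is a quotient of real numbers, so it and its
    inverse lie in \<open>Rp\<close>, although \<open>U\<close> and \<open>V\<close> need
    not.\<close>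
  hence "U' = of_nat q / l ^ np" using eq by simp
  moreover have "l \<in> \<real>" using \<open>l \<in> Rp\<close> by (simp add: Rp_def)
  ultimately have "U' \<in> \<real>" by simp
  moreover have "U' \<noteq> 0" using UV' by auto
  hence "V' = 1 / U'" using UV' by (simp add: eq_divide_eq mult.commute)
  ultimately have "V' \<in> \<real>" by simp
  have mz: "(- z) ^ np \<in> R" "(- w) ^ np \<in> R" by (intro S.power_mem S.add_mem(3) zR)+
  have "U' \<in> R" "V' \<in> R"
    unfolding U'_def V'_def using S.mult_mem[OF UV(1) mz(1)] S.mult_mem[OF UV(2) mz(2)] .
  hence "U' \<in> Rp" "V' \<in> Rp" using \<open>U' \<in> \<real>\<close> \<open>V' \<in> \<real>\<close> unfolding Rp_def by blast+
  from P.primes_over_ramified[OF q(1) \<open>l \<in> Rp\<close> this UV' eq] show ?thesis by blast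
qed

lemma freshman_power:
  assumes p: "prime p" and x: "x \<in> R" "y \<in> R"
  shows "(x + y) ^ (p ^ f) - (x ^ (p ^ f) + y ^ (p ^ f)) \<in> S.princ (of_nat p)"
proof (induction f)
  case 0
  show ?case using S.princ_mem(1) by simp
next
  case (Suc f)
  note m = S.add_mem(4)[OF x] S.power_mem
  have "((x + y) ^ (p ^ f)) ^ p - (x ^ (p ^ f) + y ^ (p ^ f)) ^ p \<in> S.princ (of_nat p)"
    by (intro S.power_diff_princ Suc m S.add_mem(4) x)
  from S.princ_mem(4)[OF this S.freshman[OF p m(2)[OF x(1)] m(2)[OF x(2)]], of "p ^ f" "p ^ f"]
  show ?case by (simp only: power_Suc2 power_mult diff_add_cancel add_diff_eq)
qed

text \<open>Modulo Q, alpha^N is alpha by the residue field and z^N + z^(-N) by the Frobenius. So Q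
  contains their difference b = z^(-N) (1 - z^(N + 1)) (1 - z^(N - 1)). If q divided neither N - 1
  nor N + 1, b would be an associate of lam^2 in the cyclotomic ring and hence divide q.\<close>

lemma P_norm_cong:
  assumes Q: "P.maxid Q" "of_nat q \<notin> Q"
  shows "q dvd idx Rp Q - 1 \<or> q dvd idx Rp Q + 1"
proof (rule ccontr)
  assume nd: "\<not> (q dvd idx Rp Q - 1 \<or> q dvd idx Rp Q + 1)"
  define N where "N = idx Rp Q"
  define w where "w = z ^ (q - 1)"
  have zw: "z * w = 1" unfolding w_def by (rule z_z')
  have zR: "z \<in> R" "w \<in> R" using z_power_mem[of 1] z_power_mem by (auto simp: w_def)
  have N1: "N > 1" unfolding N_def by (rule P.maxid_idx_gt_1[OF Q(1)])
  note Qm = P.maxidD(3)[OF Q(1)]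
  have "alpha ^ N - alpha \<in> Q"
  proof -
    have e: "alpha ^ N - alpha = alpha * (alpha ^ (N - 1) - 1)"
      using N1 by (cases N) (auto simp: right_diff_distrib)
    show ?thesis
    proof (cases "alpha \<in> Q")
      case True
      have "alpha ^ (N - 1) - 1 \<in> Rp" by (intro P.R_closed(2) P.power_closed alpha_mem P.one_closed)
      thus ?thesis unfolding e by (rule P.modlD(3)[OF Qm _ True])
    next
      case False
      have "alpha * (alpha ^ (N - 1) - 1) \<in> Q"
        unfolding N_def by (rule P.modlD(2)[OF Qm alpha_mem P.residue_fermat[OF Q(1) alpha_mem False]])
      thus ?thesis by (simp only: e)
    qed
  qed
  moreover have "alpha ^ N - (z ^ N + w ^ N) \<in> Q"
  proof -
    obtain p where p: "prime p" "of_nat p \<in> Q" using P.maxid_contains_prime[OF Q(1)] by blast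
    obtain f where f: "N = p ^ f" using P.maxid_idx_power[OF Q(1) p] unfolding N_def by blast
    have "alpha ^ N - (z ^ N + w ^ N) \<in> S.princ (of_nat p)"
      using freshman_power[OF p(1) zR, of f] by (simp add: f w_def)
    then obtain r where r: "r \<in> R" "alpha ^ N - (z ^ N + w ^ N) = of_nat p * r" by (rule S.princE)
    have "w ^ N = cnj (z ^ N)" by (simp add: w_def cnj_z)
    hence "z ^ N + w ^ N \<in> \<real>" by (simp only: real_add_cnj)
    moreover have "alpha \<in> \<real>" using alpha_mem by (simp add: Rp_def)
    ultimately have "alpha ^ N - (z ^ N + w ^ N) \<in> \<real>" by (intro Reals_diff Reals_power)
    hence "r \<in> \<real>" using r(2) real_div_nat[of p r] prime_gt_0_nat[OF p(1)] by simp
    hence "r \<in> Rp" using r(1) by (simp add: Rp_def)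
    thus ?thesis unfolding r(2) by (rule P.modlD(3)[OF Qm _ p(2)])
  qed
  ultimately have "(alpha ^ N - alpha) - (alpha ^ N - (z ^ N + w ^ N)) \<in> Q"
    by (rule P.modl_closed(2)[OF Qm])
  moreover have "(a - c) - (a - d) = d - c" for a c d :: complex by simp
  ultimately have diff: "z ^ N + w ^ N - alpha \<in> Q" by (simp only:)
  define b where "b = z ^ N + w ^ N - alpha"
  have b: "b \<in> Q" unfolding b_def by (rule diff)
  have bfac: "b = w ^ N * ((1 - z ^ (N + 1)) * (1 - z ^ (N - 1)))"
  proof -
    obtain M where M: "N = Suc M" using N1 by (cases N) auto
    have "w ^ M * z ^ M = 1" using zw by (simp add: mult.commute flip: power_mult_distrib)
    moreover have "w * w ^ M * ((1 - z * (z * z ^ M)) * (1 - z ^ M)) =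
        w * w ^ M - w * (w ^ M * z ^ M) - (z * w) * z * (w ^ M * z ^ M)
        + (z * w) * z * (w ^ M * z ^ M) * z ^ M"
      by (simp add: algebra_simps)
    ultimately have "z * z ^ M + w * w ^ M - (z + w) = w * w ^ M * ((1 - z * (z * z ^ M)) * (1 - z ^ M))"
      using zw by (simp add: algebra_simps)
    thus ?thesis unfolding b_def w_def[symmetric] M by simp
  qed
  obtain v1 where v1: "v1 \<in> R" "qt (N + 1) * v1 = 1" using qt_unit[of "N + 1"] nd by (auto simp: N_def)
  obtain v2 where v2: "v2 \<in> R" "qt (N - 1) * v2 = 1" using qt_unit[of "N - 1"] nd by (auto simp: N_def)
  obtain U where U: "U \<in> R" "of_nat q = U * lam ^ (q - 1)" using q_eq_lam_power by blast
  have lamq: "lam ^ (q - 1) = lam ^ (q - 3) * (lam * lam)"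
  proof -
    have "q - 1 = Suc (Suc (q - 3))" using q_gt by simp
    thus ?thesis by (simp only: power_Suc mult_ac)
  qed
  \<comment> \<open>The cofactor q / b, assembled from inverses of the units in b and the remaining
    q - 3 powers of \<open>lam\<close>. As a real quotient it lies in \<open>Rp\<close>, so that
    divisibility holds inside the smaller ring.\<close>
  define g where "g = z ^ N * v1 * v2 * U * lam ^ (q - 3)"
  have gR: "g \<in> R" unfolding g_def by (intro S.mult_mem S.power_mem zR lam_mem v1 v2 U)
  have "b * g = (z * w) ^ N * (qt (N + 1) * v1) * (qt (N - 1) * v2) * (U * (lam ^ (q - 3) * (lam * lam)))"
    unfolding bfac g_def one_minus_z_power power_mult_distrib by (simp only: mult_ac)
  also have "\<dots> = of_nat q" unfolding zw v1 v2 U(2) lamq by simp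
  finally have bg: "b * g = of_nat q" .
  hence "b \<noteq> 0" using q_gt by auto
  hence "g = of_nat q / b" using bg by (simp add: field_simps)
  moreover have "b \<in> \<real>" using b P.maxidD(4)[OF Q(1)] by (auto simp: Rp_def)
  ultimately have "g \<in> \<real>" by simp
  hence "g \<in> Rp" using gR by (simp add: Rp_def)
  from P.modlD(3)[OF Qm this b] show False using bg Q(2) by simp
qed

end

section \<open>Euler products and Dirichlet series\<close>

lemma bij_betw_fibers: "bij_betw (\<lambda>x. (g x, x)) V (SIGMA y:UNIV. {x \<in> V. g x = y})"
  by (rule bij_betwI[where g = snd]) auto

lemma summable_on_fibers:
  fixes h :: "'a \<Rightarrow> 'c::banach"
  assumes "(\<lambda>x. norm (h x)) summable_on V"
  shows "(\<lambda>y. \<Sum>\<^sub>\<infinity>x\<in>{x \<in> V. g x = y}. norm (h x)) summable_on UNIV"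
    "(\<lambda>y. norm (\<Sum>\<^sub>\<infinity>x\<in>{x \<in> V. g x = y}. h x)) summable_on UNIV"
    "(\<Sum>\<^sub>\<infinity>y. \<Sum>\<^sub>\<infinity>x\<in>{x \<in> V. g x = y}. h x) = infsum h V"
proof -
  let ?S = "SIGMA y:UNIV. {x \<in> V. g x = y}"
  define f where "f = (\<lambda>p::'b \<times> 'a. h (snd p))"
  have abs: "(\<lambda>p. norm (f p)) summable_on ?S"
    using summable_on_reindex_bij_betw[OF bij_betw_fibers, of "\<lambda>p. norm (f p)" g V] assms
    by (simp add: f_def)
  note S = abs[unfolded Infinite_Sum.abs_summable_on_Sigma_iff]
  have 1: "(\<lambda>x. norm (f (y, x))) summable_on {x \<in> V. g x = y}" for y
    using S by blast
  have one: "(\<lambda>y. norm (\<Sum>\<^sub>\<infinity>x\<in>{x \<in> V. g x = y}. norm (f (y, x)))) summable_on UNIV"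
    using S by blast
  have 2: "norm (\<Sum>\<^sub>\<infinity>x\<in>{x \<in> V. g x = y}. norm (h x)) = (\<Sum>\<^sub>\<infinity>x\<in>{x \<in> V. g x = y}. norm (h x))" for y
    by (simp add: infsum_nonneg)
  show *: "(\<lambda>y. \<Sum>\<^sub>\<infinity>x\<in>{x \<in> V. g x = y}. norm (h x)) summable_on UNIV"
    using one by (simp only: f_def snd_conv 2)
  show "(\<lambda>y. norm (\<Sum>\<^sub>\<infinity>x\<in>{x \<in> V. g x = y}. h x)) summable_on UNIV"
  proof (rule summable_on_comparison_test[OF *])
    show "norm (\<Sum>\<^sub>\<infinity>x\<in>{x \<in> V. g x = y}. h x) \<le> (\<Sum>\<^sub>\<infinity>x\<in>{x \<in> V. g x = y}. norm (h x))" for y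
      using 1[of y] by (intro norm_infsum_bound) (simp add: f_def)
  qed simp
  have "infsum h V = infsum f ?S"
    using infsum_reindex_bij_betw[OF bij_betw_fibers, of f g V] by (simp add: f_def)
  also have "\<dots> = (\<Sum>\<^sub>\<infinity>y. \<Sum>\<^sub>\<infinity>x\<in>{x \<in> V. g x = y}. f (y, x))"
    by (rule infsum_Sigma_banach[symmetric]) (rule abs_summable_summable[OF abs])
  finally show "(\<Sum>\<^sub>\<infinity>y. \<Sum>\<^sub>\<infinity>x\<in>{x \<in> V. g x = y}. h x) = infsum h V" by (simp add: f_def)
qed

text \<open>A multiset over T with x added is a multiplicity k of x together with a multiset over T;
  the sum over k is geometric.\<close>

lemma infsum_multisets_insert:
  fixes w :: "'a \<Rightarrow> 'c::{real_normed_field,banach}"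
  assumes x: "x \<notin> T" and lt: "norm (w x) < 1"
    and abs: "(\<lambda>M. norm (\<Prod>y\<in>#M. w y)) summable_on {M. set_mset M \<subseteq> T}"
  shows "(\<lambda>M. norm (\<Prod>y\<in>#M. w y)) summable_on {M. set_mset M \<subseteq> insert x T}"
    and "(\<Sum>\<^sub>\<infinity>M\<in>{M. set_mset M \<subseteq> insert x T}. \<Prod>y\<in>#M. w y) =
      (\<Sum>\<^sub>\<infinity>M\<in>{M. set_mset M \<subseteq> T}. \<Prod>y\<in>#M. w y) / (1 - w x)"
proof -
  define MT where "MT = {M. set_mset M \<subseteq> T}"
  define F where "F M = (\<Prod>y\<in>#M. w y)" for M
  have bij: "bij_betw (\<lambda>(k, M). replicate_mset k x + M) ((UNIV :: nat set) \<times> MT) {M. set_mset M \<subseteq> insert x T}"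
  proof (rule bij_betwI[where g = "\<lambda>M. (count M x, filter_mset (\<lambda>y. y \<noteq> x) M)"])
    show "(\<lambda>(k, M). replicate_mset k x + M) \<in> (UNIV :: nat set) \<times> MT \<rightarrow> {M. set_mset M \<subseteq> insert x T}"
      by (auto simp: MT_def split: if_splits dest: subsetD)
    show "(\<lambda>M. (count M x, filter_mset (\<lambda>y. y \<noteq> x) M)) \<in> {M. set_mset M \<subseteq> insert x T} \<rightarrow> (UNIV :: nat set) \<times> MT"
      by (auto simp: MT_def)
    fix p assume "p \<in> (UNIV :: nat set) \<times> MT"
    then obtain k M where p: "p = (k, M)" "set_mset M \<subseteq> T" by (auto simp: MT_def)
    have "count M x = 0" using p(2) x by (auto simp: count_eq_zero_iff)
    moreover have "filter_mset (\<lambda>y. y \<noteq> x) M = M"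
      using p(2) x by (intro filter_mset_eq_conv[THEN iffD2]) auto
    ultimately show "(\<lambda>M. (count M x, filter_mset (\<lambda>y. y \<noteq> x) M)) ((\<lambda>(k, M). replicate_mset k x + M) p) = p"
      by (simp add: p)
  next
    fix M assume "M \<in> {M. set_mset M \<subseteq> insert x T}"
    show "(\<lambda>(k, M). replicate_mset k x + M) (count M x, filter_mset (\<lambda>y. y \<noteq> x) M) = M"
      by (auto intro!: multiset_eqI)
  qed
  have F: "F (replicate_mset k x + M) = w x ^ k * F M" for k M
    by (simp add: F_def)
  have geo: "(\<lambda>k. norm (w x ^ k)) summable_on (UNIV :: nat set)"
    using lt by (subst summable_on_UNIV_nonneg_real_iff) (auto simp: norm_power intro: summable_geometric)
  have "(\<lambda>p. norm ((\<lambda>(k, M). w x ^ k * F M) p)) summable_on ((UNIV :: nat set) \<times> MT)"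
    unfolding Infinite_Sum.abs_summable_on_Sigma_iff
  proof (intro conjI ballI)
    fix k :: nat
    show "(\<lambda>M. norm ((\<lambda>(k, M). w x ^ k * F M) (k, M))) summable_on MT"
      using summable_on_cmult_right[OF abs, of "norm (w x ^ k)"] by (simp add: norm_mult F_def MT_def)
  next
    have "(\<Sum>\<^sub>\<infinity>M\<in>MT. norm ((\<lambda>(k, M). w x ^ k * F M) (k, M))) = norm (w x ^ k) * (\<Sum>\<^sub>\<infinity>M\<in>MT. norm (F M))" for k
      by (simp add: norm_mult infsum_cmult_right')
    moreover have "(\<lambda>k. norm (norm (w x ^ k) * (\<Sum>\<^sub>\<infinity>M\<in>MT. norm (F M)))) summable_on UNIV"
      using summable_on_cmult_left[OF geo, of "norm (\<Sum>\<^sub>\<infinity>M\<in>MT. norm (F M))"] by (simp add: abs_mult norm_power)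
    ultimately show "(\<lambda>k. norm (\<Sum>\<^sub>\<infinity>M\<in>MT. norm ((\<lambda>(k, M). w x ^ k * F M) (k, M)))) summable_on UNIV"
      by (simp only:)
  qed
  hence abs2: "(\<lambda>(k, M). norm (F (replicate_mset k x + M))) summable_on ((UNIV :: nat set) \<times> MT)"
    by (simp add: F case_prod_unfold)
  thus "(\<lambda>M. norm (\<Prod>y\<in>#M. w y)) summable_on {M. set_mset M \<subseteq> insert x T}"
    using summable_on_reindex_bij_betw[OF bij, of "\<lambda>M. norm (F M)"] by (simp add: F_def case_prod_unfold)
  have summ: "(\<lambda>p. (\<lambda>(k, M). w x ^ k * F M) p) summable_on ((UNIV :: nat set) \<times> MT)"
    by (rule abs_summable_summable) (use abs2 in \<open>simp add: F case_prod_unfold\<close>)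
  have "(\<Sum>\<^sub>\<infinity>M\<in>{M. set_mset M \<subseteq> insert x T}. F M) = (\<Sum>\<^sub>\<infinity>p\<in>(UNIV :: nat set) \<times> MT. (\<lambda>(k, M). w x ^ k * F M) p)"
    using infsum_reindex_bij_betw[OF bij, of F] by (simp add: F case_prod_unfold)
  also have "\<dots> = (\<Sum>\<^sub>\<infinity>k. \<Sum>\<^sub>\<infinity>M\<in>MT. w x ^ k * F M)"
    using infsum_Sigma_banach[OF summ] by simp
  also have "\<dots> = (\<Sum>\<^sub>\<infinity>k. w x ^ k * (\<Sum>\<^sub>\<infinity>M\<in>MT. F M))"
    by (simp add: infsum_cmult_right')
  also have "\<dots> = (\<Sum>\<^sub>\<infinity>k. w x ^ k) * (\<Sum>\<^sub>\<infinity>M\<in>MT. F M)"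
    by (simp add: infsum_cmult_left')
  also have "(\<Sum>\<^sub>\<infinity>k. w x ^ k) = 1 / (1 - w x)"
  proof (rule infsumI)
    have "summable (\<lambda>k. norm (w x ^ k))" using lt by (simp add: norm_power)
    moreover have "(\<lambda>k. w x ^ k) sums (1 / (1 - w x))" using lt by (rule geometric_sums)
    ultimately show "((\<lambda>k. w x ^ k) has_sum (1 / (1 - w x))) UNIV" by (rule norm_summable_imp_has_sum)
  qed
  finally show "(\<Sum>\<^sub>\<infinity>M\<in>{M. set_mset M \<subseteq> insert x T}. \<Prod>y\<in>#M. w y) =
      (\<Sum>\<^sub>\<infinity>M\<in>{M. set_mset M \<subseteq> T}. \<Prod>y\<in>#M. w y) / (1 - w x)"
    by (simp add: F_def MT_def)
qed

lemma infsum_multisets_finite: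
  fixes w :: "'a \<Rightarrow> 'c::{real_normed_field,banach}"
  assumes "finite T" "\<And>x. x \<in> T \<Longrightarrow> norm (w x) < 1"
  shows "(\<lambda>M. norm (\<Prod>y\<in>#M. w y)) summable_on {M. set_mset M \<subseteq> T} \<and>
    (\<Sum>\<^sub>\<infinity>M\<in>{M. set_mset M \<subseteq> T}. \<Prod>y\<in>#M. w y) = (\<Prod>x\<in>T. 1 / (1 - w x))"
  using assms
proof (induction T)
  case empty
  have "{M. set_mset M \<subseteq> {}} = {{#}}" by auto
  thus ?case by (simp add: summable_on_finite)
next
  case (insert x T)
  have IH: "(\<lambda>M. norm (\<Prod>y\<in>#M. w y)) summable_on {M. set_mset M \<subseteq> T}"
    "(\<Sum>\<^sub>\<infinity>M\<in>{M. set_mset M \<subseteq> T}. \<Prod>y\<in>#M. w y) = (\<Prod>x\<in>T. 1 / (1 - w x))"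
    using insert.IH insert.prems by auto
  have "norm (w x) < 1" using insert.prems by simp
  from infsum_multisets_insert[OF insert.hyps(2) this IH(1)] IH(2) insert.hyps
  show ?case by simp
qed

lemma norm_prod_mset: "norm (\<Prod>y\<in>#M. w y :: 'c::real_normed_field) = (\<Prod>y\<in>#M. norm (w y))"
  by (induction M) (simp_all add: norm_mult)

lemma inverse_one_minus_le_exp:
  fixes a :: real assumes "0 \<le> a" "a \<le> 1/2"
  shows "1 / (1 - a) \<le> exp (2 * a)"
proof -
  have "1 \<le> (1 - a) * (1 + 2 * a)" using assms mult_nonneg_nonneg[of a "1 - 2 * a"] by (simp add: algebra_simps)
  also have "\<dots> \<le> (1 - a) * exp (2 * a)" using assms exp_ge_add_one_self[of "2 * a"] by (intro mult_left_mono) auto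
  finally show ?thesis using assms by (simp add: field_simps)
qed

text \<open>Finitely many multisets live on a finite set T, over which the full sum is the product
  of the 1/(1 - |w|). The bound 1/2 allows each factor to be estimated by exp(2|w|), so the total is
  bounded independently of T.\<close>

lemma norm_summable_multisets:
  fixes w :: "'a \<Rightarrow> complex"
  assumes abs: "(\<lambda>x. norm (w x)) summable_on S" and lt: "\<And>x. x \<in> S \<Longrightarrow> norm (w x) \<le> 1/2"
  shows "(\<lambda>M. norm (\<Prod>y\<in>#M. w y)) summable_on {M. set_mset M \<subseteq> S}"
  unfolding abs_summable_iff_bdd_above
proof (rule bdd_aboveI2)
  fix F assume "F \<in> {F. F \<subseteq> {M. set_mset M \<subseteq> S} \<and> finite F}"
  hence F: "finite F" "\<And>M. M \<in> F \<Longrightarrow> set_mset M \<subseteq> S" by auto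
  define T where "T = (\<Union>M\<in>F. set_mset M)"
  have T: "finite T" "T \<subseteq> S" using F by (auto simp: T_def)
  have half: "norm (w x) \<le> 1/2" if "x \<in> T" for x using lt T that by auto
  have "\<And>x. x \<in> T \<Longrightarrow> norm (norm (w x)) < 1" using half by fastforce
  note aux = infsum_multisets_finite[OF T(1), of "\<lambda>x. norm (w x)", OF this]
  have nonneg: "(\<Prod>y\<in>#M. norm (w y)) \<ge> 0" for M by (induction M) auto
  from aux have fin: "(\<lambda>M. \<Prod>y\<in>#M. norm (w y)) summable_on {M. set_mset M \<subseteq> T}"
    "(\<Sum>\<^sub>\<infinity>M\<in>{M. set_mset M \<subseteq> T}. \<Prod>y\<in>#M. norm (w y)) = (\<Prod>x\<in>T. 1 / (1 - norm (w x)))"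
    by (simp_all add: nonneg)
  have "(\<Sum>M\<in>F. norm (\<Prod>y\<in>#M. w y)) = (\<Sum>M\<in>F. \<Prod>y\<in>#M. norm (w y))"
    by (simp add: norm_prod_mset)
  also have "\<dots> \<le> (\<Sum>\<^sub>\<infinity>M\<in>{M. set_mset M \<subseteq> T}. \<Prod>y\<in>#M. norm (w y))"
    using F fin(1) by (intro finite_sum_le_infsum) (auto simp: T_def simp flip: norm_prod_mset)
  also have "\<dots> \<le> (\<Prod>x\<in>T. exp (2 * norm (w x)))"
    unfolding fin(2) using half by (intro prod_mono conjI inverse_one_minus_le_exp) force+
  also have "\<dots> = exp (2 * (\<Sum>x\<in>T. norm (w x)))"
    using T(1) by (simp add: exp_sum sum_distrib_left)
  also have "\<dots> \<le> exp (2 * (\<Sum>\<^sub>\<infinity>x\<in>S. norm (w x)))"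
    using T abs by (simp add: finite_sum_le_infsum)
  finally show "(\<Sum>M\<in>F. norm (\<Prod>y\<in>#M. w y)) \<le> exp (2 * (\<Sum>\<^sub>\<infinity>x\<in>S. norm (w x)))" .
qed

lemma log_series_has_sum:
  fixes a :: complex
  assumes "norm a < 1"
  shows "((\<lambda>k. a ^ k / of_nat k) has_sum (- Ln (1 - a))) {1..}"
    "(\<lambda>k. norm (a ^ k / of_nat k)) summable_on {1..}"
    "(\<Sum>\<^sub>\<infinity>k\<in>{1..}. norm (a ^ k / of_nat k)) \<le> norm a / (1 - norm a)"
proof -
  have s: "(\<lambda>k. a ^ k / of_nat k) sums (- Ln (1 - a))"
    using sums_minus[OF Ln_series'[of "-a"]] assms by simp
  have le: "norm (a ^ k / of_nat k) \<le> norm a ^ k" for k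
  proof (cases "k = 0")
    case False
    have "norm a ^ k * 1 \<le> norm a ^ k * real k" using False by (intro mult_left_mono) auto
    thus ?thesis using False by (simp add: norm_divide norm_power field_simps)
  qed simp
  have geo: "summable (\<lambda>k. norm a ^ k)" using assms by simp
  have summ: "summable (\<lambda>k. norm (a ^ k / of_nat k))"
    by (rule summable_comparison_test_ev[OF _ geo]) (use le in auto)
  have zero: "{1..} = UNIV - {0::nat}" by auto
  \<comment> \<open>The term k = 0 is 1/0 = 0, so it makes no difference whether the sum starts at 0
    or 1.\<close>
  have "((\<lambda>k. a ^ k / of_nat k) has_sum (- Ln (1 - a))) {1..} \<longleftrightarrow>
      ((\<lambda>k. a ^ k / of_nat k) has_sum (- Ln (1 - a))) UNIV"
    by (rule has_sum_cong_neutral) (auto simp: zero)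
  thus "((\<lambda>k. a ^ k / of_nat k) has_sum (- Ln (1 - a))) {1..}"
    using norm_summable_imp_has_sum[OF summ s] by simp
  have "(\<lambda>k. norm (a ^ k / of_nat k)) summable_on UNIV"
    by (subst summable_on_UNIV_nonneg_real_iff) (simp, rule summ)
  thus summ': "(\<lambda>k. norm (a ^ k / of_nat k)) summable_on {1..}"
    by (rule summable_on_subset_banach) simp
  have "((\<lambda>k. norm a ^ k) has_sum (1 / (1 - norm a) - 1)) (UNIV - {0})"
  proof -
    have "((\<lambda>k. norm a ^ k) has_sum (1 / (1 - norm a))) UNIV"
      using assms by (intro norm_summable_imp_has_sum geometric_sums) (auto simp: norm_power)
    from has_sum_Diff[OF this has_sum_finite[of "{0::nat}"]] show ?thesis by simp
  qed
  hence h: "((\<lambda>k. norm a ^ k) has_sum (norm a / (1 - norm a))) {1..}"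
  proof -
    have "1 / (1 - norm a) - 1 = norm a / (1 - norm a)" using assms by (simp add: field_simps)
    thus ?thesis using \<open>(_ has_sum (1 / (1 - norm a) - 1)) _\<close> by (simp only: zero)
  qed
  have "(\<Sum>\<^sub>\<infinity>k\<in>{1..}. norm (a ^ k / of_nat k)) \<le> (\<Sum>\<^sub>\<infinity>k\<in>{1..}. norm a ^ k)"
    using le summ' has_sum_imp_summable[OF h] by (intro infsum_mono) auto
  thus "(\<Sum>\<^sub>\<infinity>k\<in>{1..}. norm (a ^ k / of_nat k)) \<le> norm a / (1 - norm a)"
    using infsumI[OF h] by simp
qed

lemma log_family_summable:
  fixes w :: "'a \<Rightarrow> complex"
  assumes abs: "(\<lambda>x. norm (w x)) summable_on S" and lt: "\<And>x. x \<in> S \<Longrightarrow> norm (w x) \<le> 1/2"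
  shows "(\<lambda>(x, k). norm (w x ^ k / of_nat k)) summable_on S \<times> {1..}"
    "(\<lambda>x. - Ln (1 - w x)) summable_on S"
    "(\<Sum>\<^sub>\<infinity>x\<in>S. - Ln (1 - w x)) = (\<Sum>\<^sub>\<infinity>(x, k)\<in>S \<times> {1..}. w x ^ k / of_nat k)"
proof -
  define f where "f = (\<lambda>p. w (fst p) ^ snd p / of_nat (snd p))"
  have lt1: "norm (w x) < 1" if "x \<in> S" for x using lt[OF that] by simp
  have "(\<lambda>p. norm (f p)) summable_on S \<times> {1..}"
    unfolding Infinite_Sum.abs_summable_on_Sigma_iff
  proof (intro conjI ballI)
    show "(\<lambda>k. norm (f (x, k))) summable_on {1..}" if "x \<in> S" for x
      using log_series_has_sum(2)[OF lt1[OF that]] by (simp add: f_def)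
    show "(\<lambda>x. norm (\<Sum>\<^sub>\<infinity>k\<in>{1..}. norm (f (x, k)))) summable_on S"
    proof (rule summable_on_comparison_test[OF summable_on_cmult_right[OF abs, of 2]])
      fix x assume x: "x \<in> S"
      have "norm (\<Sum>\<^sub>\<infinity>k\<in>{1..}. norm (f (x, k))) = (\<Sum>\<^sub>\<infinity>k\<in>{1..}. norm (f (x, k)))"
        by (simp add: infsum_nonneg)
      also have "\<dots> \<le> norm (w x) / (1 - norm (w x))"
        using log_series_has_sum(3)[OF lt1[OF x]] by (simp add: f_def)
      also have "\<dots> \<le> 2 * norm (w x)"
        using lt[OF x] mult_left_mono[OF lt[OF x], of "2 * norm (w x)"] by (simp add: field_simps)
      finally show "norm (\<Sum>\<^sub>\<infinity>k\<in>{1..}. norm (f (x, k))) \<le> 2 * norm (w x)" .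
    qed simp
  qed
  note f = this
  show "(\<lambda>(x, k). norm (w x ^ k / of_nat k)) summable_on S \<times> {1..}"
    using f by (simp add: f_def case_prod_unfold)
  have "((\<lambda>x. - Ln (1 - w x)) has_sum infsum f (S \<times> {1..})) S"
  proof (rule has_sum_SigmaD)
    show "(f has_sum infsum f (S \<times> {1..})) (S \<times> {1..})"
      using abs_summable_summable[OF f] by (rule has_sum_infsum)
    show "((\<lambda>k. f (x, k)) has_sum - Ln (1 - w x)) {1..}" if "x \<in> S" for x
      using log_series_has_sum(1)[OF lt1[OF that]] by (simp add: f_def)
  qed
  thus "(\<lambda>x. - Ln (1 - w x)) summable_on S"
    "(\<Sum>\<^sub>\<infinity>x\<in>S. - Ln (1 - w x)) = (\<Sum>\<^sub>\<infinity>(x, k)\<in>S \<times> {1..}. w x ^ k / of_nat k)"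
    by (auto simp: f_def case_prod_unfold dest: has_sum_imp_summable infsumI)
qed

text \<open>The Euler product in exponential form. For a finite subset T both sides are the same
  product, and both converge to the full expressions along the finite subsets of S.\<close>

theorem infsum_multisets:
  fixes w :: "'a \<Rightarrow> complex"
  assumes abs: "(\<lambda>x. norm (w x)) summable_on S" and lt: "\<And>x. x \<in> S \<Longrightarrow> norm (w x) \<le> 1/2"
  shows "(\<Sum>\<^sub>\<infinity>M\<in>{M. set_mset M \<subseteq> S}. \<Prod>y\<in>#M. w y) = exp (\<Sum>\<^sub>\<infinity>x\<in>S. - Ln (1 - w x))"
proof -
  define F where "F = (\<lambda>M. \<Prod>y\<in>#M. w y)"
  define V where "V = {M. set_mset M \<subseteq> S}"
  have absF: "(\<lambda>M. norm (F M)) summable_on V"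
    using norm_summable_multisets[OF assms] by (simp add: F_def V_def)
  have lt1: "norm (w x) < 1" if "x \<in> S" for x using lt[OF that] by simp
  have fin: "exp (\<Sum>x\<in>T. - Ln (1 - w x)) = (\<Sum>\<^sub>\<infinity>M\<in>{M. set_mset M \<subseteq> T}. F M)" if T: "finite T" "T \<subseteq> S" for T
  proof -
    have "exp (\<Sum>x\<in>T. - Ln (1 - w x)) = (\<Prod>x\<in>T. 1 / (1 - w x))"
      unfolding exp_sum[OF T(1)]
    proof (intro prod.cong refl)
      fix x assume "x \<in> T"
      hence "1 - w x \<noteq> 0" using lt1[of x] T(2) by auto
      thus "exp (- Ln (1 - w x)) = 1 / (1 - w x)" by (simp add: exp_minus field_simps)
    qed
    moreover have "\<And>x. x \<in> T \<Longrightarrow> norm (w x) < 1" using T(2) lt1 by blast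
    ultimately show ?thesis using infsum_multisets_finite[OF T(1), of w] by (simp add: F_def)
  qed
  have lim1: "((\<lambda>T. exp (\<Sum>x\<in>T. - Ln (1 - w x))) \<longlongrightarrow> exp (\<Sum>\<^sub>\<infinity>x\<in>S. - Ln (1 - w x))) (finite_subsets_at_top S)"
    by (intro tendsto_exp infsum_tendsto log_family_summable(2)[OF assms])
  have lim2: "((\<lambda>T. exp (\<Sum>x\<in>T. - Ln (1 - w x))) \<longlongrightarrow> infsum F V) (finite_subsets_at_top S)"
  proof (rule tendstoI)
    fix e :: real assume e: "e > 0"
    have "((\<lambda>G. \<Sum>M\<in>G. norm (F M)) \<longlongrightarrow> infsum (\<lambda>M. norm (F M)) V) (finite_subsets_at_top V)"
      by (rule infsum_tendsto[OF absF])
    from tendstoD[OF this e] obtain G where G: "finite G" "G \<subseteq> V"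
      "dist (\<Sum>M\<in>G. norm (F M)) (infsum (\<lambda>M. norm (F M)) V) < e"
      unfolding eventually_finite_subsets_at_top by blast
    \<comment> \<open>As soon as T contains this set, every multiset of G is supported in T, and the
      multisets not supported in T contribute less than e.\<close>
    define T0 where "T0 = (\<Union>M\<in>G. set_mset M)"
    have T0: "finite T0" "T0 \<subseteq> S" using G by (auto simp: T0_def V_def)
    show "\<forall>\<^sub>F T in finite_subsets_at_top S. dist (exp (\<Sum>x\<in>T. - Ln (1 - w x))) (infsum F V) < e"
      unfolding eventually_finite_subsets_at_top
    proof (intro exI[of _ T0] conjI T0 allI impI; (elim conjE)?)
      fix T assume T: "finite T" "T0 \<subseteq> T" "T \<subseteq> S"
      define Y where "Y = {M. set_mset M \<subseteq> T}"
      have Y: "G \<subseteq> Y" "Y \<subseteq> V" using T by (auto simp: Y_def V_def T0_def)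
      have sF: "F summable_on V" "F summable_on Y" "(\<lambda>M. norm (F M)) summable_on (V - Y)"
        using absF abs_summable_summable Y summable_on_subset_banach by (blast intro: summable_on_subset_banach)+
      have "infsum F V - infsum F Y = infsum F (V - Y)"
        using infsum_Diff[OF sF(1,2) Y(2)] by simp
      hence "dist (infsum F Y) (infsum F V) = norm (infsum F (V - Y))"
        by (simp add: dist_norm norm_minus_commute)
      also have "\<dots> \<le> infsum (\<lambda>M. norm (F M)) (V - Y)"
        by (rule norm_infsum_bound[OF sF(3)])
      also have "\<dots> \<le> infsum (\<lambda>M. norm (F M)) (V - G)"
        using Y absF by (intro infsum_mono_neutral) (auto intro: summable_on_subset_banach[OF absF])
      also have "\<dots> = infsum (\<lambda>M. norm (F M)) V - (\<Sum>M\<in>G. norm (F M))"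
        using infsum_Diff[OF absF _ G(2)] G(1) by (simp add: summable_on_finite)
      also have "\<dots> < e" using G(3) by (simp add: dist_real_def abs_less_iff)
      finally show "dist (exp (\<Sum>x\<in>T. - Ln (1 - w x))) (infsum F V) < e"
        using fin[OF T(1,3)] by (simp add: Y_def)
    qed
  qed
  have "infsum F V = exp (\<Sum>\<^sub>\<infinity>x\<in>S. - Ln (1 - w x))"
    by (rule tendsto_unique[OF finite_subsets_at_top_neq_bot lim2 lim1])
  thus ?thesis by (simp add: F_def V_def)
qed

section \<open>Absolutely convergent Dirichlet series\<close>

definition dser :: "(nat \<Rightarrow> complex) \<Rightarrow> complex \<Rightarrow> complex" where
  "dser a s = (\<Sum>\<^sub>\<infinity>m. a m * of_nat m powr (-s))"

text \<open>As in \<open>dser\<close>, m runs over all naturals: 0 powr anything is 0, so the value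
  of the coefficient at 0 is irrelevant.\<close>

definition dsummable :: "(nat \<Rightarrow> complex) \<Rightarrow> real \<Rightarrow> bool" where
  "dsummable a \<sigma> \<longleftrightarrow> (\<lambda>m. norm (a m) * real m powr (-\<sigma>)) summable_on UNIV"

lemma norm_of_nat_powr: "norm (of_nat m powr (-s) :: complex) = real m powr (- Re s)"
  by (cases "m = 0") (simp_all add: norm_powr_real powr_def)

lemma of_nat_powr_exp: "m > 0 \<Longrightarrow> of_nat m powr s = exp (s * complex_of_real (ln (real m)))"
  using Ln_of_real[of "real m"] by (simp add: powr_def)

lemma of_nat_powr_mult: "of_nat (m * k) powr s = of_nat m powr s * (of_nat k powr s :: complex)"
proof (cases "m = 0 \<or> k = 0")
  case False
  hence "complex_of_real (ln (real (m * k))) = of_real (ln (real m)) + of_real (ln (real k))"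
    by (simp add: ln_mult)
  thus ?thesis using False by (simp only: of_nat_powr_exp exp_add distrib_left mult_pos_pos neq0_conv de_Morgan_disj)
qed auto

lemma of_nat_powr_power: "of_nat (m ^ k) powr s = (of_nat m powr s :: complex) ^ k"
  by (induction k) (simp_all add: of_nat_powr_mult del: of_nat_mult of_nat_power)

lemma dsummable_mono:
  assumes "dsummable a \<sigma>" "\<sigma> \<le> \<tau>"
  shows "dsummable a \<tau>"
  unfolding dsummable_def
proof (rule summable_on_comparison_test[OF assms(1)[unfolded dsummable_def]])
  fix m :: nat
  show "norm (a m) * real m powr (-\<tau>) \<le> norm (a m) * real m powr (-\<sigma>)"
    by (cases "m = 0") (use assms(2) in \<open>auto intro!: mult_left_mono powr_mono\<close>)
qed simp

lemma dsummable_abs: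
  assumes "dsummable a \<sigma>" "\<sigma> \<le> Re s"
  shows "(\<lambda>m. norm (a m * of_nat m powr (-s))) summable_on UNIV"
  using dsummable_mono[OF assms] by (simp add: dsummable_def norm_mult norm_of_nat_powr)

lemma dser_sums:
  assumes "dsummable a \<sigma>" "\<sigma> \<le> Re s"
  shows "(\<lambda>m. a m * of_nat m powr (-s)) sums dser a s"
  unfolding dser_def
  by (intro has_sum_imp_sums has_sum_infsum abs_summable_summable[OF dsummable_abs[OF assms]])

lemma dsummable_iff: "dsummable a \<sigma> \<longleftrightarrow> summable (\<lambda>m. norm (a m) * real m powr (-\<sigma>))"
  unfolding dsummable_def by (rule summable_on_UNIV_nonneg_real_iff) simp

lemma ln_le_powr:
  assumes "x \<ge> 1" "e > 0"
  shows "ln (x::real) \<le> x powr e / e"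
proof -
  have "e * ln x = ln (x powr e)" using assms by (simp add: ln_powr)
  also have "\<dots> \<le> x powr e" using assms by (intro order.trans[OF ln_le_minus_one]) auto
  finally show ?thesis using assms by (simp add: field_simps)
qed

lemma dsummable_ln:
  assumes "dsummable a \<sigma>" "\<sigma> < \<tau>"
  shows "dsummable (\<lambda>m. a m * of_real (ln (real m))) \<tau>"
  unfolding dsummable_def
proof (rule summable_on_comparison_test[OF summable_on_cmult_right[OF assms(1)[unfolded dsummable_def], of "1 / (\<tau> - \<sigma>)"]])
  fix m :: nat
  show "norm (a m * of_real (ln (real m))) * real m powr (-\<tau>) \<le> 1 / (\<tau> - \<sigma>) * (norm (a m) * real m powr (-\<sigma>))"
  proof (cases "m = 0")
    case False
    have "ln (real m) * real m powr (-\<tau>) \<le> (real m powr (\<tau> - \<sigma>) / (\<tau> - \<sigma>)) * real m powr (-\<tau>)"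
      using False assms(2) by (intro mult_right_mono ln_le_powr) auto
    also have "\<dots> = 1 / (\<tau> - \<sigma>) * real m powr (-\<sigma>)"
      using False by (simp flip: powr_add)
    finally have "norm (a m) * (ln (real m) * real m powr (-\<tau>)) \<le> norm (a m) * (1 / (\<tau> - \<sigma>) * real m powr (-\<sigma>))"
      by (rule mult_left_mono) simp
    thus ?thesis using False by (simp add: norm_mult mult_ac)
  qed simp
qed simp

text \<open>Termwise differentiation of a locally uniformly convergent series: on the half-plane Re
  s > \<sigma> the terms are majorised by those at \<sigma>.\<close>

lemma dser_has_field_derivative:
  assumes a: "dsummable a \<sigma>" and s: "Re s > \<sigma>"
  shows "(dser a has_field_derivative - dser (\<lambda>m. a m * of_real (ln (real m))) s) (at s)"
proof -
  let ?S = "{s. Re s > \<sigma>}"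
  define f where "f m s = a m * of_nat m powr (-s)" for m s
  define f' where "f' m s = - (a m * of_real (ln (real m))) * of_nat m powr (-s)" for m s
  have S: "open ?S" by (rule open_halfspace_Re_gt)
  have der: "(f m has_field_derivative f' m s) (at s)" for m s
  proof (cases "m = 0")
    case True
    have "f m = (\<lambda>_. 0)" "f' m s = 0" using True by (auto simp: f_def f'_def)
    thus ?thesis by simp
  next
    case False
    have "((\<lambda>s. of_nat m powr (-s)) has_field_derivative (Ln (of_nat m) * of_nat m powr (-s)) * (- 1)) (at s)"
      by (rule DERIV_chain2[OF has_field_derivative_powr_right])
         (use False in \<open>auto intro!: derivative_eq_intros\<close>)
    from DERIV_cmult[OF this, of "a m"]
    have "((\<lambda>s. a m * of_nat m powr (-s)) has_field_derivative a m * ((Ln (of_nat m) * of_nat m powr (-s)) * (- 1))) (at s)" .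
    moreover have "ln (of_nat m :: complex) = of_real (ln (real m))"
      using False Ln_of_real[of "real m"] by simp
    ultimately show ?thesis by (simp add: f_def[abs_def] f'_def mult_ac)
  qed
  define h where "h = (\<lambda>m. complex_of_real (norm (a m) * real m powr (-\<sigma>)))"
  have h: "summable h"
    using a unfolding dsummable_iff h_def by (subst summable_complex_of_real)
  have to_h: "\<exists>d (h :: nat \<Rightarrow> complex). 0 < d \<and> summable h \<and> range h \<subseteq> \<real>\<^sub>\<ge>\<^sub>0 \<and> (\<forall>\<^sub>F n in sequentially. \<forall>y\<in>ball x d \<inter> ?S. norm (f n y) \<le> norm (h n))" for x
  proof -
    have "\<forall>y\<in>ball x 1 \<inter> ?S. norm (f n y) \<le> norm (h n)" for n
    proof
      fix y assume "y \<in> ball x 1 \<inter> ?S"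
      hence y: "Re y > \<sigma>" by simp
      have "real n powr (- Re y) \<le> real n powr (- \<sigma>)"
        by (cases "n = 0") (use y in \<open>auto intro!: powr_mono\<close>)
      thus "norm (f n y) \<le> norm (h n)"
        by (simp add: f_def h_def norm_mult norm_of_nat_powr mult_left_mono)
    qed
    moreover have "range h \<subseteq> \<real>\<^sub>\<ge>\<^sub>0"
      by (force simp: h_def)
    ultimately show ?thesis
      using h by (intro exI[of _ 1] exI[of _ h]) simp
  qed
  have "\<exists>g g'. \<forall>x\<in>?S. ((\<lambda>n. f n x) sums g x) \<and> ((\<lambda>n. f' n x) sums g' x) \<and> (g has_field_derivative g' x) (at x)"
    by (rule series_and_derivative_comparison_complex[OF S der to_h])
  then obtain g g' where g: "\<And>x. Re x > \<sigma> \<Longrightarrow> (\<lambda>n. f n x) sums g x"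
    "\<And>x. Re x > \<sigma> \<Longrightarrow> (\<lambda>n. f' n x) sums g' x" "\<And>x. Re x > \<sigma> \<Longrightarrow> (g has_field_derivative g' x) (at x)"
    by auto
  have gd: "g x = dser a x" if "Re x > \<sigma>" for x
    using sums_unique2[OF g(1)[OF that]] dser_sums[OF a, of x] that by (simp add: f_def)
  have "g' s = - dser (\<lambda>m. a m * of_real (ln (real m))) s"
  proof (rule sums_unique2[OF g(2)[OF s]])
    define \<tau> where "\<tau> = (\<sigma> + Re s) / 2"
    have "dsummable (\<lambda>m. a m * of_real (ln (real m))) \<tau>"
      using s by (intro dsummable_ln[OF a]) (simp add: \<tau>_def)
    from sums_minus[OF dser_sums[OF this, of s]] s
    show "(\<lambda>n. f' n s) sums - dser (\<lambda>m. a m * of_real (ln (real m))) s"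
      by (simp add: f'_def \<tau>_def)
  qed
  moreover have "(g has_field_derivative g' s) (at s) \<longleftrightarrow> (dser a has_field_derivative g' s) (at s)"
  proof (rule DERIV_cong_ev[OF refl _ refl])
    have "\<forall>\<^sub>F x in nhds s. x \<in> ?S" using S s by (intro eventually_nhds_in_open) auto
    thus "\<forall>\<^sub>F x in nhds s. g x = dser a x" by eventually_elim (use gd in auto)
  qed
  ultimately show ?thesis using g(3)[OF s] by simp
qed

lemma dser_holomorphic:
  assumes "dsummable a \<sigma>"
  shows "dser a holomorphic_on {s. Re s > \<sigma>}"
  using dser_has_field_derivative[OF assms]
  by (auto simp: holomorphic_on_open open_halfspace_Re_gt)

lemma dsummable_1: "\<sigma> > 1 \<Longrightarrow> dsummable (\<lambda>_. 1) \<sigma>"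
  unfolding dsummable_iff using summable_real_powr_iff[of "-\<sigma>"] by simp

lemma dsummable_bounded:
  assumes "\<And>m. norm (a m) \<le> B" "\<sigma> > 1"
  shows "dsummable a \<sigma>"
  unfolding dsummable_def
proof (rule summable_on_comparison_test[OF summable_on_cmult_right[OF dsummable_1[OF assms(2), unfolded dsummable_def], of B]])
  fix m show "norm (a m) * real m powr (-\<sigma>) \<le> B * (norm (1::complex) * real m powr (-\<sigma>))"
    using assms(1)[of m] by (auto intro!: mult_right_mono)
qed simp

lemma dsummable_add: "dsummable a \<sigma> \<Longrightarrow> dsummable b \<sigma> \<Longrightarrow> dsummable (\<lambda>m. a m + b m) \<sigma>"
  unfolding dsummable_def
proof (rule summable_on_comparison_test[OF summable_on_add[of "\<lambda>m. norm (a m) * real m powr (-\<sigma>)" _ "\<lambda>m. norm (b m) * real m powr (-\<sigma>)"]])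
  fix m :: nat
  show "norm (a m + b m) * real m powr (-\<sigma>) \<le> norm (a m) * real m powr (-\<sigma>) + norm (b m) * real m powr (-\<sigma>)"
    unfolding distrib_right[symmetric] by (intro mult_right_mono norm_triangle_ineq) simp
qed simp_all

lemma dsummable_uminus: "dsummable a \<sigma> \<Longrightarrow> dsummable (\<lambda>m. - a m) \<sigma>"
  by (simp add: dsummable_def)

lemma dser_add:
  assumes "dsummable a (Re s)" "dsummable b (Re s)"
  shows "dser (\<lambda>m. a m + b m) s = dser a s + dser b s"
  unfolding dser_def distrib_right
  by (rule infsum_add[OF abs_summable_summable[OF dsummable_abs[OF assms(1) order.refl]]
        abs_summable_summable[OF dsummable_abs[OF assms(2) order.refl]]])

lemma dser_uminus: "dser (\<lambda>m. - a m) s = - dser a s"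
  unfolding dser_def by (simp add: infsum_uminus)

lemma dser_diff:
  assumes "dsummable a (Re s)" "dsummable b (Re s)"
  shows "dser (\<lambda>m. a m - b m) s = dser a s - dser b s"
  using dser_add[OF assms(1) dsummable_uminus[OF assms(2)]] by (simp add: dser_uminus)

lemma dser_sum:
  assumes "finite I" "\<And>i. i \<in> I \<Longrightarrow> dsummable (a i) (Re s)"
  shows "dser (\<lambda>m. \<Sum>i\<in>I. a i m) s = (\<Sum>i\<in>I. dser (a i) s) \<and> dsummable (\<lambda>m. \<Sum>i\<in>I. a i m) (Re s)"
  using assms
proof (induction I)
  case empty
  show ?case by (simp add: dser_def dsummable_def)
next
  case (insert i I)
  thus ?case by (auto simp: dser_add dsummable_add)
qed

text \<open>Covers rational primes twisted by a character and maximal ideals with \<open>c\<close>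
  equal to 1. The bound \<open>B\<close> on the number of members of equal norm makes the sum of
  N(x)^(-\<sigma>) converge for \<sigma> > 1, and norms \<ge> 2 keep the terms below 1/2.\<close>

locale euler_family =
  fixes S :: "'a set" and N :: "'a \<Rightarrow> nat" and c :: "'a \<Rightarrow> complex" and B :: nat
  assumes N_ge_2: "x \<in> S \<Longrightarrow> N x \<ge> 2"
    and c_le: "x \<in> S \<Longrightarrow> norm (c x) \<le> 1"
    and fin: "finite {x \<in> S. N x = m}" and card_le: "card {x \<in> S. N x = m} \<le> B"
begin

text \<open>The coefficients of the logarithm of the Euler product: the terms c(x)^k / k collected
  by the value of N(x)^k.\<close>

definition bcoef :: "nat \<Rightarrow> complex" where
  "bcoef m = (\<Sum>\<^sub>\<infinity>(x, k)\<in>{p \<in> S \<times> {1..}. N (fst p) ^ snd p = m}. c x ^ k / of_nat k)"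

lemma summable_N:
  assumes "\<sigma> > 1"
  shows "(\<lambda>x. real (N x) powr (-\<sigma>)) summable_on S"
proof -
  let ?S = "SIGMA m:UNIV. {x \<in> S. N x = m}"
  have "(\<lambda>p. norm (real (N (snd p)) powr (-\<sigma>))) summable_on ?S"
    unfolding Infinite_Sum.abs_summable_on_Sigma_iff
  proof (intro conjI ballI)
    show "(\<lambda>x. norm (real (N (snd (m, x))) powr (-\<sigma>))) summable_on {x \<in> S. N x = m}" for m
      using fin by (intro summable_on_finite)
    have eq: "norm (\<Sum>\<^sub>\<infinity>x\<in>{x \<in> S. N x = m}. norm (real (N (snd (m, x))) powr (-\<sigma>))) =
        real (card {x \<in> S. N x = m}) * real m powr (-\<sigma>)" for m
      using fin[of m] by (simp add: infsum_nonneg cong: infsum_cong)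
    show "(\<lambda>m. norm (\<Sum>\<^sub>\<infinity>x\<in>{x \<in> S. N x = m}. norm (real (N (snd (m, x))) powr (-\<sigma>)))) summable_on UNIV"
      unfolding eq
    proof (rule summable_on_comparison_test[OF summable_on_cmult_right[OF dsummable_1[OF assms, unfolded dsummable_def], of "real B"]])
      show "real (card {x \<in> S. N x = m}) * real m powr (-\<sigma>) \<le> real B * (norm (1::complex) * real m powr (-\<sigma>))" for m
        using card_le[of m] by (auto intro!: mult_right_mono)
    qed simp
  qed
  thus ?thesis
    using summable_on_reindex_bij_betw[OF bij_betw_fibers[of N S], of "\<lambda>p. norm (real (N (snd p)) powr (-\<sigma>))"] by simp
qed

context
  fixes s :: complex assumes s: "Re s > 1"
begin

definition "w x = c x * of_nat (N x) powr (-s)"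

lemma w_le: "x \<in> S \<Longrightarrow> norm (w x) \<le> real (N x) powr (- Re s)"
  using c_le[of x] by (auto simp: w_def norm_mult norm_of_nat_powr intro!: mult_left_le_one_le)

lemma w_half: "x \<in> S \<Longrightarrow> norm (w x) \<le> 1/2"
proof -
  assume x: "x \<in> S"
  have "real (N x) powr (- Re s) \<le> real (N x) powr (- 1)"
    using N_ge_2[OF x] s by (intro powr_mono) auto
  also have "\<dots> \<le> 1/2" using N_ge_2[OF x] by (simp add: powr_minus field_simps)
  finally show ?thesis using w_le[OF x] by simp
qed

lemma w_summable: "(\<lambda>x. norm (w x)) summable_on S"
  by (rule summable_on_comparison_test[OF summable_N[OF s]]) (use w_le in auto)

lemma euler_product:
  "(\<Sum>\<^sub>\<infinity>M\<in>{M. set_mset M \<subseteq> S}. \<Prod>x\<in>#M. c x * of_nat (N x) powr (-s)) = exp (dser bcoef s)"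
  "(\<lambda>m. norm (bcoef m * of_nat m powr (-s))) summable_on UNIV"
proof -
  define h where "h = (\<lambda>p. w (fst p) ^ snd p / of_nat (snd p))"
  define g where "g = (\<lambda>p::'a \<times> nat. N (fst p) ^ snd p)"
  have abs: "(\<lambda>p. norm (h p)) summable_on S \<times> {1..}"
    using log_family_summable(1)[OF w_summable w_half] by (simp add: h_def case_prod_unfold)
  have fib: "(\<Sum>\<^sub>\<infinity>p\<in>{p \<in> S \<times> {1..}. g p = m}. h p) = bcoef m * of_nat m powr (-s)" for m
  proof -
    have "h p = (c (fst p) ^ snd p / of_nat (snd p)) * of_nat m powr (-s)"
      if "p \<in> {p \<in> S \<times> {1..}. g p = m}" for p
    proof -
      have "(of_nat (N (fst p)) powr (-s)) ^ snd p = (of_nat m powr (-s) :: complex)"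
        using that of_nat_powr_power[of "N (fst p)" "snd p" "-s"] by (simp add: g_def)
      thus ?thesis by (simp add: h_def w_def power_mult_distrib)
    qed
    hence "(\<Sum>\<^sub>\<infinity>p\<in>{p \<in> S \<times> {1..}. g p = m}. h p) =
        (\<Sum>\<^sub>\<infinity>p\<in>{p \<in> S \<times> {1..}. g p = m}. (c (fst p) ^ snd p / of_nat (snd p)) * of_nat m powr (-s))"
      by (intro infsum_cong)
    also have "\<dots> = bcoef m * of_nat m powr (-s)"
      by (simp only: infsum_cmult_left' bcoef_def g_def case_prod_unfold)
    finally show ?thesis .
  qed
  show "(\<lambda>m. norm (bcoef m * of_nat m powr (-s))) summable_on UNIV"
    using summable_on_fibers(2)[OF abs, of g] unfolding fib .
  have "(\<Sum>\<^sub>\<infinity>M\<in>{M. set_mset M \<subseteq> S}. \<Prod>x\<in>#M. w x) = exp (\<Sum>\<^sub>\<infinity>x\<in>S. - Ln (1 - w x))"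
    by (rule infsum_multisets[OF w_summable w_half])
  also have "(\<Sum>\<^sub>\<infinity>x\<in>S. - Ln (1 - w x)) = infsum h (S \<times> {1..})"
    using log_family_summable(3)[OF w_summable w_half] by (simp add: h_def case_prod_unfold)
  also have "\<dots> = dser bcoef s"
    using summable_on_fibers(3)[OF abs, of g] unfolding fib dser_def by simp
  finally show "(\<Sum>\<^sub>\<infinity>M\<in>{M. set_mset M \<subseteq> S}. \<Prod>x\<in>#M. c x * of_nat (N x) powr (-s)) = exp (dser bcoef s)"
    by (simp add: w_def)
qed

end

end

section \<open>Dirichlet L-functions modulo a prime\<close>

lemma norm_powr_diff_le:
  fixes a b :: nat and s :: complex
  assumes "0 < a" "a \<le> b" "Re s > 0"
  shows "norm (of_nat b powr (-s) - of_nat a powr (-s)) \<le> norm s * real a powr (- Re s - 1) * real (b - a)"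
proof -
  let ?S = "closed_segment (of_real (real a)) (of_real (real b)) :: complex set"
  have bd: "((\<lambda>z. z powr (-s)) has_field_derivative (- s * z powr (- s - 1))) (at z within ?S) \<and>
      norm (- s * z powr (- s - 1)) \<le> norm s * real a powr (- Re s - 1)" if "z \<in> ?S" for z
  proof -
    have "\<exists>t. z = of_real t \<and> real a \<le> t"
    proof -
      have "z \<in> of_real ` closed_segment (real a) (real b)"
        using that by (simp only: closed_segment_of_real)
      thus ?thesis using assms(2) by (auto simp: closed_segment_eq_real_ivl)
    qed
    then obtain t where t: "z = of_real t" "real a \<le> t" by blast
    have t0: "t > 0" using t assms(1) by linarith
    have "z \<notin> \<real>\<^sub>\<le>\<^sub>0" using t t0 by (auto simp: complex_nonpos_Reals_iff)
    hence "((\<lambda>z. z powr (-s)) has_field_derivative (- s * z powr (- s - 1))) (at z)"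
      by (rule has_field_derivative_powr)
    moreover have "norm (z powr (- s - 1)) = t powr (- Re s - 1)"
      using t t0 by (simp add: norm_powr_real_powr)
    moreover have "t powr (- Re s - 1) \<le> real a powr (- Re s - 1)"
      using t assms by (intro powr_mono2') auto
    ultimately show ?thesis
      by (auto simp: norm_mult intro: has_field_derivative_at_within mult_left_mono)
  qed
  have "norm (of_real (real b) powr (-s) - of_real (real a) powr (-s) :: complex)
      \<le> norm s * real a powr (- Re s - 1) * norm (of_real (real b) - of_real (real a) :: complex)"
    by (rule field_differentiable_bound[of ?S "\<lambda>z. z powr (-s)" "\<lambda>z. - s * z powr (- s - 1)"]) (use bd in auto)
  also have "norm (of_real (real b) - of_real (real a) :: complex) = real (b - a)"
    using assms(2) norm_of_real[of "real b - real a", where 'a = complex] by (simp add: of_nat_diff)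
  finally show ?thesis by simp
qed

text \<open>Grouping the series into blocks of length one period gives absolute convergence for \<open>Re s > 0\<close>.\<close>
lemma periodic_dser_continuation:
  fixes f :: "nat \<Rightarrow> complex" and N :: nat
  assumes N: "N > 0" and per: "\<And>n. f (n + N) = f n" and mean: "(\<Sum>n<N. f n) = 0"
    and le: "\<And>n. norm (f n) \<le> 1"
  shows "\<exists>L. L holomorphic_on {s. Re s > 0} \<and> (\<forall>s. Re s > 1 \<longrightarrow> L s = dser f s)"
proof -
  let ?S = "{s. Re s > 0}"
  define G where "G m s = (\<Sum>n\<in>{m*N..<m*N+N}. f n * of_nat n powr (-s))" for m s
  have per': "f (m * N + i) = f i" for m i
  proof (induction m)
    case (Suc m)
    have "f (Suc m * N + i) = f ((m * N + i) + N)" by (simp add: algebra_simps)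
    thus ?case by (simp only: per Suc.IH)
  qed simp
  have G_le: "norm (G m s) \<le> real N * real N * norm s * real m powr (- Re s - 1)" if m: "m > 0" and s: "Re s > 0" for m s
  proof -
    have "G m s = (\<Sum>i<N. f (m * N + i) * of_nat (m * N + i) powr (-s))"
      unfolding G_def by (rule sum.reindex_bij_witness[of _ "\<lambda>i. m * N + i" "\<lambda>i. i - m * N"]) auto
    \<comment> \<open>The subtracted term vanishes because f has mean zero over a period. It
      replaces each power by a difference, which is smaller by a factor of order 1/m.\<close>
    also have "\<dots> = (\<Sum>i<N. f i * of_nat (m * N + i) powr (-s)) - (\<Sum>i<N. f i) * of_nat (m * N) powr (-s)"
      by (simp only: per' mean mult_zero_left diff_zero)
    also have "\<dots> = (\<Sum>i<N. f i * (of_nat (m * N + i) powr (-s) - of_nat (m * N) powr (-s)))"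
      by (simp only: sum_distrib_right sum_subtractf right_diff_distrib)
    also have "norm \<dots> \<le> (\<Sum>i<N. real N * norm s * real m powr (- Re s - 1))"
    proof (intro sum_norm_le)
      fix i assume "i \<in> {..<N}"
      hence i: "i < N" by simp
      have "norm (of_nat (m * N + i) powr (-s) - of_nat (m * N) powr (-s) :: complex)
          \<le> norm s * real (m * N) powr (- Re s - 1) * real ((m * N + i) - m * N)"
        by (rule norm_powr_diff_le) (use m N s in auto)
      also have "\<dots> \<le> norm s * real m powr (- Re s - 1) * real N"
      proof (intro mult_mono mult_left_mono)
        show "real (m * N) powr (- Re s - 1) \<le> real m powr (- Re s - 1)"
          using m N s by (intro powr_mono2') (auto simp del: of_nat_mult)
      qed (use i in auto)
      finally have *: "norm (of_nat (m * N + i) powr (-s) - of_nat (m * N) powr (-s) :: complex)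
          \<le> norm s * real m powr (- Re s - 1) * real N" .
      have "norm (f i * (of_nat (m * N + i) powr (-s) - of_nat (m * N) powr (-s)))
          \<le> 1 * (norm s * real m powr (- Re s - 1) * real N)"
        unfolding norm_mult by (rule mult_mono[OF le *]) auto
      thus "norm (f i * (of_nat (m * N + i) powr (-s) - of_nat (m * N) powr (-s)))
          \<le> real N * norm s * real m powr (- Re s - 1)" by (simp add: mult_ac)
    qed
    finally show ?thesis by (simp add: mult_ac)
  qed
  have G_diff: "G m field_differentiable (at x)" for m x
  proof -
    have "G m holomorphic_on UNIV"
      unfolding G_def[abs_def] by (intro holomorphic_intros)
    thus ?thesis by (simp add: holomorphic_on_def)
  qed
  have S: "open ?S" by (rule open_halfspace_Re_gt)
  have "\<exists>d (h :: nat \<Rightarrow> complex). 0 < d \<and> summable h \<and> range h \<subseteq> \<real>\<^sub>\<ge>\<^sub>0 \<and>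
      (\<forall>\<^sub>F n in sequentially. \<forall>y\<in>ball x d \<inter> ?S. norm (G n y) \<le> norm (h n))" if "x \<in> ?S" for x
  proof -
    define d where "d = Re x / 2"
    have d: "d > 0" using that by (simp add: d_def)
    define C where "C = real N * real N * (norm x + d)"
    define h where "h n = complex_of_real (C * real n powr (- d - 1))" for n :: nat
    have "summable (\<lambda>n. C * real n powr (- d - 1))"
      using d by (intro summable_mult) (simp add: summable_real_powr_iff)
    hence h: "summable h" unfolding h_def by (subst summable_complex_of_real)
    have C: "C \<ge> 0" using d by (simp add: C_def)
    have "norm (G n y) \<le> norm (h n)" if n: "n \<ge> 1" and y: "y \<in> ball x d \<inter> ?S" for n y
    proof -
      have "\<bar>Re x - Re y\<bar> \<le> norm (x - y)" using abs_Re_le_cmod[of "x - y"] by simp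
      also have "\<dots> < d" using y by (simp add: dist_norm)
      finally have Re: "Re y > d" using d_def by linarith
      have "norm y \<le> norm x + norm (x - y)" using norm_triangle_ineq4[of x "x - y"] by simp
      also have "\<dots> \<le> norm x + d" using y by (simp add: dist_norm)
      finally have ny: "norm y \<le> norm x + d" .
      have "norm (G n y) \<le> real N * real N * norm y * real n powr (- Re y - 1)"
        using n y by (intro G_le) auto
      also have "\<dots> \<le> real N * real N * (norm x + d) * real n powr (- d - 1)"
        using ny n Re d by (intro mult_mono mult_left_mono powr_mono) auto
      also have "\<dots> = norm (h n)"
        using C unfolding h_def norm_of_real C_def by (simp only: abs_of_nonneg mult_nonneg_nonneg powr_ge_zero)
      finally show ?thesis .
    qed
    hence "\<forall>\<^sub>F n in sequentially. \<forall>y\<in>ball x d \<inter> ?S. norm (G n y) \<le> norm (h n)"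
      by (intro eventually_sequentiallyI[of 1]) blast
    moreover have "range h \<subseteq> \<real>\<^sub>\<ge>\<^sub>0" using C by (force simp: h_def)
    ultimately show ?thesis using h d by (intro exI[of _ d] exI[of _ h]) simp
  qed
  from series_differentiable_comparison_complex[OF S G_diff this]
  obtain L where L: "\<forall>x\<in>?S. (\<lambda>n. G n x) sums L x \<and> L field_differentiable (at x)" by blast
  have "L s = dser f s" if s: "Re s > 1" for s
  proof -
    have "(\<lambda>n. f n * of_nat n powr (-s)) sums dser f s"
      by (rule dser_sums[OF dsummable_bounded[of f 1, OF le s]]) simp
    from sums_group[OF this N] have "(\<lambda>m. G m s) sums dser f s" by (simp add: G_def)
    moreover have "(\<lambda>m. G m s) sums L s" using L s by auto
    ultimately show ?thesis by (rule sums_unique2[THEN sym])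
  qed
  moreover have "L holomorphic_on ?S"
    using L by (auto simp: holomorphic_on_def intro: field_differentiable_at_within)
  ultimately show ?thesis by blast
qed

text \<open>The von Mangoldt function divided by the logarithm: 1/k at p^k. These are the
  coefficients of the logarithm of the Riemann zeta function.\<close>

definition prime_power_weight :: "nat \<Rightarrow> real" where
  "prime_power_weight m = (if primepow m then 1 / real (multiplicity (aprimedivisor m) m) else 0)"

lemma prime_power_weight_power:
  "prime p \<Longrightarrow> k > 0 \<Longrightarrow> prime_power_weight (p ^ k) = 1 / real k"
  by (simp add: prime_power_weight_def aprimedivisor_prime_power)

lemma prime_power_weight_nonneg: "prime_power_weight m \<ge> 0"
  by (simp add: prime_power_weight_def)

lemma prime_power_weight_le_1: "prime_power_weight m \<le> 1"
  by (cases "multiplicity (aprimedivisor m) m") (auto simp: prime_power_weight_def)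

definition mult_char :: "(nat \<Rightarrow> complex) \<Rightarrow> bool" where
  "mult_char c \<longleftrightarrow> c 1 = 1 \<and> (\<forall>m n. c (m * n) = c m * c n) \<and> (\<forall>n. norm (c n) \<le> 1) \<and> c 0 = 0"

lemma mult_char_power: "mult_char c \<Longrightarrow> c (m ^ k) = c m ^ k"
  by (induction k) (simp_all add: mult_char_def)

lemma mult_char_prod_mset: "mult_char c \<Longrightarrow> c (\<Prod>p\<in>#M. p) = (\<Prod>p\<in>#M. c p)"
  by (induction M) (simp_all add: mult_char_def)

lemma bij_prod_mset_primes:
  "bij_betw (\<lambda>M. \<Prod>p\<in>#M. p) {M. set_mset M \<subseteq> Collect prime} {m::nat. m > 0}"
proof (rule bij_betw_byWitness[of _ prime_factorization])
  show "\<forall>M\<in>{M. set_mset M \<subseteq> Collect prime}. prime_factorization (\<Prod>p\<in>#M. p) = M"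
    by (auto intro!: prime_factorization_prod_mset_primes)
  show "\<forall>m\<in>{m::nat. m > 0}. (\<Prod>p\<in>#prime_factorization m. p) = m"
    by (auto simp: prod_mset_prime_factorization)
  show "(\<lambda>M. \<Prod>p\<in>#M. p) ` {M. set_mset M \<subseteq> Collect prime} \<subseteq> {m::nat. m > 0}"
    by (auto simp: prod_mset_zero_iff intro!: Nat.gr0I)
  show "prime_factorization ` {m::nat. m > 0} \<subseteq> {M. set_mset M \<subseteq> Collect prime}"
    by (auto dest: in_prime_factors_imp_prime)
qed

text \<open>Unique factorisation identifies positive integers with multisets of primes, so the
  series is an Euler product; each prime power p^k comes from the single pair (p, k) and contributes
  c(p)^k / k to the logarithm.\<close>

lemma mult_char_dser_exp:
  assumes c: "mult_char c" and s: "Re s > 1"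
  shows "dser c s = exp (dser (\<lambda>m. c m * of_real (prime_power_weight m)) s)"
proof -
  let ?P = "Collect prime :: nat set"
  interpret euler_family ?P "\<lambda>p. p" c 1
  proof
    fix m :: nat
    have "{x \<in> ?P. x = m} \<subseteq> {m}" by auto
    from card_mono[OF _ this] finite_subset[OF this]
    show "card {x \<in> ?P. x = m} \<le> 1" "finite {x \<in> ?P. x = m}" by simp_all
  qed (use c in \<open>auto simp: mult_char_def prime_ge_2_nat\<close>)
  have b: "bcoef m = c m * of_real (prime_power_weight m)" for m :: nat
  proof (cases "primepow m")
    case True
    then obtain p k where p: "prime p" "k > 0" "m = p ^ k" by (auto simp: primepow_def)
    have "{x \<in> ?P \<times> {1..}. fst x ^ snd x = m} = {(p, k)}"
    proof (intro equalityI subsetI)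
      fix x assume x: "x \<in> {x \<in> ?P \<times> {1..}. fst x ^ snd x = m}"
      obtain p' k' where x': "x = (p', k')" by (cases x)
      have "aprimedivisor (p' ^ k') = p'" by (rule aprimedivisor_prime_power) (use x x' in auto)
      moreover have "aprimedivisor (p ^ k) = p" by (rule aprimedivisor_prime_power) (use p in auto)
      ultimately
      have "p' = p" using x x' p by simp
      moreover have "k' = k" using x x' p \<open>p' = p\<close> prime_gt_1_nat[OF p(1)] by simp
      ultimately show "x \<in> {(p, k)}" using x' by simp
    qed (use p in auto)
    thus ?thesis using p prime_power_weight_power[OF p(1,2)] by (simp add: bcoef_def mult_char_power[OF c])
  next
    case False
    have "m \<noteq> p ^ k" if "prime p" "1 \<le> k" for p k
      using False primepow_prime_power[OF that(1), of k] that(2) by auto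
    hence empty: "{x \<in> ?P \<times> {1..}. fst x ^ snd x = m} = {}" by auto
    show ?thesis using False unfolding bcoef_def empty by (simp add: prime_power_weight_def)
  qed
  have "dser c s = (\<Sum>\<^sub>\<infinity>m\<in>{m. m > 0}. c m * of_nat m powr (-s))"
    unfolding dser_def by (rule infsum_cong_neutral) auto
  also have "\<dots> = (\<Sum>\<^sub>\<infinity>M\<in>{M. set_mset M \<subseteq> ?P}. c (\<Prod>p\<in>#M. p) * of_nat (\<Prod>p\<in>#M. p) powr (-s))"
    by (rule infsum_reindex_bij_betw[OF bij_prod_mset_primes, symmetric])
  also have "\<dots> = (\<Sum>\<^sub>\<infinity>M\<in>{M. set_mset M \<subseteq> ?P}. \<Prod>p\<in>#M. c p * of_nat p powr (-s))"
  proof (rule infsum_cong)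
    fix M :: "nat multiset"
    have "of_nat (\<Prod>p\<in>#M. p) powr (-s) = (\<Prod>p\<in>#M. of_nat p powr (-s) :: complex)"
      by (induction M) (simp_all add: of_nat_powr_mult del: of_nat_mult)
    thus "c (\<Prod>p\<in>#M. p) * of_nat (\<Prod>p\<in>#M. p) powr (-s) = (\<Prod>p\<in>#M. c p * of_nat p powr (-s))"
      using mult_char_prod_mset[OF c, of M] by (simp add: prod_mset.distrib)
  qed
  also have "\<dots> = exp (dser bcoef s)"
    by (rule euler_product(1)[OF s])
  finally show ?thesis by (simp only: b[abs_def])
qed

lemma sum_lessThan_add: "(\<Sum>n<a+b::nat. h n) = (\<Sum>n<a. h n) + (\<Sum>n<b. h (a + n) :: 'a :: comm_monoid_add)"
  by (induction b) (simp_all add: add.assoc)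

text \<open>Isolates the even integers, in order to insert an alternating sign into the series of
  the trivial character.\<close>

lemma dser_even_part:
  assumes c: "dsummable c (Re s)" and c0: "c 0 = 0"
  shows "dser (\<lambda>n. if even n then c (n div 2) else 0) s = 2 powr (-s) * dser c s"
    and "dsummable (\<lambda>n. if even n then c (n div 2) else 0) (Re s)"
proof -
  have inj: "inj ((*) (2::nat))" by (auto simp: inj_on_def)
  have rng: "range ((*) (2::nat)) = {n. even n}" by (auto elim: evenE)
  have "dser (\<lambda>n. if even n then c (n div 2) else 0) s = (\<Sum>\<^sub>\<infinity>n\<in>range ((*) 2). c (n div 2) * of_nat n powr (-s))"
    unfolding dser_def rng by (rule infsum_cong_neutral) auto
  also have "\<dots> = (\<Sum>\<^sub>\<infinity>n. 2 powr (-s) * (c n * of_nat n powr (-s)))"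
    unfolding infsum_reindex[OF inj]
    by (rule infsum_cong) (use of_nat_powr_mult[of 2 _ "-s"] in \<open>simp add: o_def\<close>)
  also have "\<dots> = 2 powr (-s) * dser c s"
    unfolding dser_def by (rule infsum_cmult_right')
  finally show "dser (\<lambda>n. if even n then c (n div 2) else 0) s = 2 powr (-s) * dser c s" .
  have "(\<lambda>n. norm (c n) * real n powr (- Re s) * 2 powr (- Re s)) summable_on UNIV"
    using c unfolding dsummable_def by (rule summable_on_cmult_left)
  hence "((\<lambda>n. norm (c (n div 2)) * real n powr (- Re s)) \<circ> (*) 2) summable_on UNIV"
    by (simp add: o_def powr_mult mult_ac)
  hence "(\<lambda>n. norm (c (n div 2)) * real n powr (- Re s)) summable_on {n. even n}"
    unfolding rng[symmetric] by (subst summable_on_reindex[OF inj])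
  thus "dsummable (\<lambda>n. if even n then c (n div 2) else 0) (Re s)"
    unfolding dsummable_def by (rule summable_on_cong_neutral[THEN iffD1, rotated -1]) auto
qed

section \<open>Characters modulo q from a primitive root\<close>

locale dirichlet_characters =
  fixes q r g :: nat
  assumes prime_q: "prime q" and odd_q: "odd q" and q_eq: "q = Suc r"
    and primroot: "residue_primroot q g"
begin

lemma r_pos: "r > 0" and r_ge_2: "r \<ge> 2"
  using prime_gt_1_nat[OF prime_q] odd_q by (auto simp: q_eq elim!: oddE)

lemma coprime_g: "coprime q g" and ord_g: "ord q g = r"
  using primroot prime_q by (auto simp: residue_primroot_def totient_prime q_eq)

text \<open>The discrete logarithm to base g modulo q; meaningful only if q does not divide
  n.\<close>

definition ind :: "nat \<Rightarrow> nat" where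
  "ind n = inv_into {..<r} (\<lambda>i. g ^ i mod q) (n mod q)"

abbreviation \<omega> :: complex where "\<omega> \<equiv> zeta_root r"

text \<open>For k < r these are all Dirichlet characters modulo q, each a power of one generator; k
  = 0 is the trivial one.\<close>

definition \<psi> :: "nat \<Rightarrow> nat \<Rightarrow> complex" where
  "\<psi> k n = (if q dvd n then 0 else \<omega> ^ (k * ind n))"

lemma bij_g: "bij_betw (\<lambda>i. g ^ i mod q) {..<r} {0<..<q}"
  using residue_primroot_is_generator[OF _ primroot] prime_q prime_gt_1_nat[OF prime_q]
  by (simp add: totatives_prime totient_prime q_eq)

lemma ind_spec: "\<not> q dvd n \<Longrightarrow> [g ^ ind n = n] (mod q)"
proof -
  assume "\<not> q dvd n"
  hence "n mod q \<in> {0<..<q}" using r_pos q_eq by (auto simp: mod_greater_zero_iff_not_dvd)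
  hence "n mod q \<in> (\<lambda>i. g ^ i mod q) ` {..<r}" using bij_betw_imp_surj_on[OF bij_g] by simp
  from f_inv_into_f[OF this] show ?thesis by (simp add: ind_def cong_def)
qed

lemma \<omega>_power_eq_1_iff: "\<omega> ^ k = 1 \<longleftrightarrow> r dvd k"
proof -
  have "\<omega> ^ k = exp (2 * of_real pi * \<i> * of_nat k / of_nat r)"
    unfolding zeta_root_def Complex.DeMoivre by (simp add: cis_conv_exp mult_ac)
  thus ?thesis using r_pos by (simp add: complex_root_unity_eq_1)
qed

lemma \<omega>_power_cong: "[i = j] (mod r) \<Longrightarrow> \<omega> ^ i = \<omega> ^ j"
proof -
  have "\<omega> ^ i = \<omega> ^ (i mod r)" for i
  proof -
    have "\<omega> ^ i = \<omega> ^ (r * (i div r) + i mod r)" by simp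
    also have "\<dots> = (\<omega> ^ r) ^ (i div r) * \<omega> ^ (i mod r)" by (simp only: power_add power_mult)
    also have "\<omega> ^ r = 1" by (simp add: \<omega>_power_eq_1_iff)
    finally show ?thesis by simp
  qed
  thus "[i = j] (mod r) \<Longrightarrow> \<omega> ^ i = \<omega> ^ j" unfolding cong_def by metis
qed

lemma ind_cong: "[g ^ i = g ^ j] (mod q) \<Longrightarrow> [i = j] (mod r)"
  using order_divides_expdiff[OF coprime_g] by (simp add: ord_g)

lemma ind_mult:
  assumes "\<not> q dvd m" "\<not> q dvd n"
  shows "[ind (m * n) = ind m + ind n] (mod r)"
proof (rule ind_cong)
  have "\<not> q dvd m * n" using assms prime_dvd_mult_iff[OF prime_q] by simp
  from cong_trans[OF ind_spec[OF this] cong_sym[OF cong_mult[OF ind_spec ind_spec]]] assms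
  show "[g ^ ind (m * n) = g ^ (ind m + ind n)] (mod q)" by (simp add: power_add)
qed

lemma mult_char_\<psi>: "mult_char (\<psi> k)"
proof -
  have "[ind 1 = 0] (mod r)"
    by (rule ind_cong) (use ind_spec[of 1] prime_gt_1_nat[OF prime_q] in auto)
  hence one: "\<psi> k 1 = 1"
    using prime_gt_1_nat[OF prime_q] \<omega>_power_cong[of "k * ind 1" 0] by (simp add: \<psi>_def cong_0_iff)
  have mult: "\<psi> k (m * n) = \<psi> k m * \<psi> k n" for m n
  proof (cases "q dvd m \<or> q dvd n")
    case False
    hence "\<omega> ^ (k * ind (m * n)) = \<omega> ^ (k * (ind m + ind n))"
      by (intro \<omega>_power_cong cong_mult ind_mult) auto
    moreover have "\<not> q dvd m * n" using False prime_dvd_mult_iff[OF prime_q] by simp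
    ultimately show ?thesis using False by (simp add: \<psi>_def distrib_left power_add)
  qed (auto simp: \<psi>_def)
  have "norm (\<psi> k n) \<le> 1" for n
    by (simp add: \<psi>_def norm_power zeta_root_def)
  moreover have "\<psi> k 0 = 0" by (simp add: \<psi>_def)
  ultimately show ?thesis using one mult unfolding mult_char_def by blast
qed

lemma \<psi>_le: "norm (\<psi> k n) \<le> 1" and \<psi>_zero: "\<psi> k 0 = 0"
  using mult_char_\<psi> by (auto simp: mult_char_def)

lemma \<psi>_mod: "\<psi> k (n mod q) = \<psi> k n"
  by (simp add: \<psi>_def ind_def dvd_mod_iff)

lemma \<psi>_periodic: "\<psi> k (n + q) = \<psi> k n"
  using \<psi>_mod[of k "n + q"] \<psi>_mod[of k n] by simp

lemma power_cong_1_iff: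
  assumes "\<not> q dvd n"
  shows "r dvd d * ind n \<longleftrightarrow> [n ^ d = 1] (mod q)"
proof -
  have "[n ^ d = g ^ (ind n * d)] (mod q)"
    using cong_pow[OF cong_sym[OF ind_spec[OF assms]], of d] by (simp only: power_mult)
  hence "[n ^ d = 1] (mod q) \<longleftrightarrow> [g ^ (ind n * d) = 1] (mod q)"
    using cong_trans cong_sym by blast
  thus ?thesis using ord_divides[of g "ind n * d" q] by (simp add: ord_g mult.commute)
qed

text \<open>The characters with index divisible by d are those trivial on the solutions of n^d = 1,
  and the sum over them is a geometric sum in \<omega>^(d ind n). For n divisible by q both sides
  are 0.\<close>

lemma sum_\<psi>:
  assumes d: "d dvd r"
  shows "(\<Sum>j<r div d. \<psi> (d * j) n) = (if [n ^ d = 1] (mod q) then of_nat (r div d) else 0)"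
proof (cases "q dvd n")
  case True
  have "d > 0" using d r_pos by (auto intro!: Nat.gr0I)
  have "\<not> [n ^ d = 1] (mod q)"
  proof
    assume *: "[n ^ d = 1] (mod q)"
    have "q dvd n ^ d" using True \<open>d > 0\<close> by (auto intro: dvd_trans[OF _ dvd_power])
    hence "q dvd 1" using cong_dvd_iff[OF *] cong_dvd_modulus_nat by (metis * cong_0_iff cong_sym cong_trans)
    thus False using prime_gt_1_nat[OF prime_q] by simp
  qed
  thus ?thesis using True by (simp add: \<psi>_def)
next
  case False
  define x where "x = \<omega> ^ (d * ind n)"
  have \<psi>x: "\<psi> (d * j) n = x ^ j" for j
    using False by (simp add: \<psi>_def x_def mult_ac flip: power_mult)
  have x: "x ^ (r div d) = 1"
  proof -
    have "d * ind n * (r div d) = d * (r div d) * ind n" by (simp only: mult_ac)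
    also have "d * (r div d) = r" using d by (rule dvd_mult_div_cancel)
    finally show ?thesis by (simp only: x_def power_mult[symmetric] \<omega>_power_eq_1_iff dvd_triv_left)
  qed
  have "x = 1 \<longleftrightarrow> [n ^ d = 1] (mod q)"
    unfolding x_def \<omega>_power_eq_1_iff using power_cong_1_iff[OF False] by simp
  thus ?thesis using x by (cases "x = 1") (auto simp: \<psi>x sum_gp_strict)
qed

lemma \<psi>_mean:
  assumes "0 < k" "k < r"
  shows "(\<Sum>n<q. \<psi> k n) = 0"
proof -
  have "(\<Sum>n<q. \<psi> k n) = (\<Sum>n\<in>{0<..<q}. \<psi> k n)"
    by (rule sum.mono_neutral_right) (auto simp: \<psi>_zero)
  also have "\<dots> = (\<Sum>i<r. \<psi> k (g ^ i mod q))"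
    by (rule sum.reindex_bij_betw[OF bij_g, symmetric])
  also have "\<dots> = (\<Sum>i<r. (\<omega> ^ k) ^ i)"
  proof (rule sum.cong[OF refl])
    fix i
    have nd: "\<not> q dvd g ^ i"
      using coprime_g prime_q by (metis coprime_power_right_iff coprime_absorb_left not_prime_unit)
    have "[ind (g ^ i) = i] (mod r)" by (rule ind_cong[OF ind_spec[OF nd]])
    hence "\<omega> ^ (k * ind (g ^ i)) = \<omega> ^ (k * i)" by (intro \<omega>_power_cong cong_mult) auto
    thus "\<psi> k (g ^ i mod q) = (\<omega> ^ k) ^ i" using nd by (simp add: \<psi>_mod) (simp add: \<psi>_def power_mult)
  qed
  also have "\<dots> = 0"
  proof -
    have "\<omega> ^ k \<noteq> 1" using assms by (auto simp: \<omega>_power_eq_1_iff dest: dvd_imp_le)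
    moreover have "(\<omega> ^ k) ^ r = 1" by (simp add: \<omega>_power_eq_1_iff flip: power_mult)
    ultimately show ?thesis by (simp add: sum_gp_strict)
  qed
  finally show ?thesis .
qed

lemma dsummable_\<psi>: "\<sigma> > 1 \<Longrightarrow> dsummable (\<psi> k) \<sigma>"
  by (rule dsummable_bounded[OF \<psi>_le])

lemma L_exists:
  assumes "0 < k" "k < r"
  shows "\<exists>L. L holomorphic_on {s. Re s > 0} \<and> (\<forall>s. Re s > 1 \<longrightarrow> L s = dser (\<psi> k) s)"
  by (rule periodic_dser_continuation[OF _ \<psi>_periodic \<psi>_mean \<psi>_le]) (use assms q_eq in auto)

text \<open>For the trivial character the twisted coefficients \<open>\<psi>\<^sub>0(n) (-1)^(n+1)\<close> have mean zero.\<close>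
lemma L0_exists:
  "\<exists>L. L holomorphic_on {s. Re s > 0} \<and> (\<forall>s. Re s > 1 \<longrightarrow> L s = (1 - 2 powr (1 - s)) * dser (\<psi> 0) s)"
proof -
  define h where "h n = \<psi> 0 n * (if even n then - 1 else 1)" for n
  \<comment> \<open>Here q odd matters: a shift by q keeps \<psi>_0 and reverses parity, so the two
    halves of the period 2q cancel.\<close>
  have flip: "h (q + n) = - h n" for n
    using \<psi>_periodic[of 0 n] odd_q by (simp add: h_def add.commute)
  have "\<exists>L. L holomorphic_on {s. Re s > 0} \<and> (\<forall>s. Re s > 1 \<longrightarrow> L s = dser h s)"
  proof (rule periodic_dser_continuation)
    show "h (n + (q + q)) = h n" for n
      using flip[of n] flip[of "q + n"] by (simp add: add_ac)
    show "(\<Sum>n<q+q. h n) = 0"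
      unfolding sum_lessThan_add flip by (simp add: sum_negf)
    show "norm (h n) \<le> 1" for n using \<psi>_le[of 0 n] by (simp add: h_def)
  qed (use q_eq in simp)
  then obtain L where L: "L holomorphic_on {s. Re s > 0}" "\<And>s. Re s > 1 \<Longrightarrow> L s = dser h s" by blast
  have "L s = (1 - 2 powr (1 - s)) * dser (\<psi> 0) s" if s: "Re s > 1" for s
  proof -
    define e where "e n = (if even n then \<psi> 0 (n div 2) else 0)" for n
    have q2: "\<not> q dvd 2" using r_ge_2 q_eq by (auto dest: dvd_imp_le)
    \<comment> \<open>The sign change at even n amounts to subtracting the even part twice, and the
      even part is 2^(-s) times the whole since 2 is prime to q.\<close>
    have h: "h = (\<lambda>n. \<psi> 0 n - (e n + e n))"
    proof
      fix n
      show "h n = \<psi> 0 n - (e n + e n)"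
      proof (cases "even n")
        case True
        then obtain m where "n = 2 * m" by (elim evenE)
        thus ?thesis using q2 prime_dvd_mult_iff[OF prime_q, of 2 m] by (auto simp: h_def e_def \<psi>_def)
      qed (auto simp: h_def e_def)
    qed
    note e = dser_even_part[OF dsummable_\<psi>[OF s, of 0] \<psi>_zero, folded e_def]
    have "dser h s = dser (\<psi> 0) s - (dser e s + dser e s)"
      unfolding h dser_diff[OF dsummable_\<psi>[OF s] dsummable_add[OF e(2) e(2)]] dser_add[OF e(2) e(2)] ..
    also have "dser e s + dser e s = (2 * 2 powr (-s)) * dser (\<psi> 0) s"
      unfolding e(1) by (simp add: algebra_simps)
    also have "2 * 2 powr (-s) = (2 powr (1 - s) :: complex)"
      using powr_add[of "2::complex" 1 "-s"] by simp
    finally show ?thesis using L(2)[OF s] by (simp add: algebra_simps)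
  qed
  thus ?thesis using L(1) by blast
qed

end

section \<open>Landau's theorem and the factor that removes the pole\<close>

lemma holomorphic_factor_zero:
  assumes f: "f holomorphic_on S" and S: "open S" "a \<in> S" and 0: "f a = 0"
  shows "\<exists>f1. f1 holomorphic_on S \<and> f1 a = deriv f a \<and> (\<forall>z\<in>S. f z = (z - a) * f1 z)"
proof -
  let ?f1 = "\<lambda>z. if z = a then deriv f a else f z / (z - a) - f a / (z - a)"
  have "?f1 holomorphic_on S"
    by (rule pole_theorem[OF f]) (use S in \<open>auto simp: interior_open\<close>)
  thus ?thesis using 0 by (intro exI[of _ ?f1]) auto
qed

lemma dser_of_real:
  fixes b :: "nat \<Rightarrow> real"
  assumes "(\<lambda>m. b m * real m powr (-x)) summable_on UNIV"
  shows "dser (\<lambda>m. of_real (b m)) (of_real x) = of_real (\<Sum>\<^sub>\<infinity>m. b m * real m powr (-x))"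
proof -
  have eq: "of_real (b m) * of_nat m powr (- complex_of_real x) = of_real (b m * real m powr (-x))" for m
    by (cases "m = 0") (simp_all add: powr_of_real[of "real m" "-x", symmetric] del: powr_of_real)
  show ?thesis
    unfolding dser_def eq by (rule infsumI[OF has_sum_of_real[OF has_sum_infsum[OF assms]]])
qed

lemma dsummable_ln_power:
  assumes "\<And>\<tau>. \<tau> > \<sigma> \<Longrightarrow> dsummable a \<tau>" and "\<tau> > \<sigma>"
  shows "dsummable (\<lambda>m. a m * of_real (ln (real m) ^ n)) \<tau>"
  using assms(2)
proof (induction n arbitrary: \<tau>)
  case 0
  thus ?case using assms(1) by simp
next
  case (Suc n)
  have "dsummable (\<lambda>m. a m * of_real (ln (real m) ^ n)) ((\<sigma> + \<tau>) / 2)" by (rule Suc.IH) (use Suc.prems in auto)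
  from dsummable_ln[OF this, of \<tau>] show ?case using Suc.prems by (simp add: mult_ac)
qed

text \<open>Writing s = c - z absorbs the sign (-1)^n from differentiating m^(-s), so that
  nonnegative coefficients give nonnegative derivatives in z.\<close>

lemma higher_deriv_dser:
  assumes a: "\<And>\<tau>. \<tau> > \<sigma> \<Longrightarrow> dsummable a \<tau>" and z: "Re (c - z) > \<sigma>"
  shows "(deriv ^^ n) (\<lambda>z. dser a (c - z)) z = dser (\<lambda>m. a m * of_real (ln (real m) ^ n)) (c - z)"
  using z
proof (induction n arbitrary: z)
  case (Suc n)
  let ?a = "\<lambda>m. a m * of_real (ln (real m) ^ n)"
  have "open {z. Re z < Re c - \<sigma>}" by (rule open_halfspace_Re_lt)
  hence "\<forall>\<^sub>F w in nhds z. w \<in> {z. Re z < Re c - \<sigma>}"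
    using Suc.prems by (intro eventually_nhds_in_open) auto
  hence "\<forall>\<^sub>F w in nhds z. (deriv ^^ n) (\<lambda>z. dser a (c - z)) w = dser ?a (c - w)"
    by eventually_elim (rule Suc.IH, simp)
  hence "(deriv ^^ Suc n) (\<lambda>z. dser a (c - z)) z = deriv (\<lambda>w. dser ?a (c - w)) z"
    by (simp add: deriv_cong_ev)
  also have "\<dots> = dser (\<lambda>m. ?a m * of_real (ln (real m))) (c - z)"
  proof (rule DERIV_imp_deriv)
    have "dsummable ?a ((\<sigma> + Re (c - z)) / 2)"
      by (rule dsummable_ln_power[OF a]) (use Suc.prems in auto)
    hence "(dser ?a has_field_derivative - dser (\<lambda>m. ?a m * of_real (ln (real m))) (c - z)) (at (c - z))"
      by (rule dser_has_field_derivative) (use Suc.prems in auto)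
    from DERIV_chain2[where g = "\<lambda>w. c - w" and x = z and Db = "-1", OF this]
    moreover have "((\<lambda>w. c - w) has_field_derivative -1) (at z)" by (auto intro!: derivative_eq_intros)
    ultimately show "((\<lambda>w. dser ?a (c - w)) has_field_derivative dser (\<lambda>m. ?a m * of_real (ln (real m))) (c - z)) (at z)"
      by (simp only: mult_minus_left mult_minus_right minus_minus mult_1_right)
  qed
  finally show ?case by (simp add: mult_ac)
qed simp

text \<open>Landau's theorem for the exponential of a Dirichlet series with nonnegative coefficients:
  the Taylor coefficients of the exponential at 2 dominate those of the series.\<close>
lemma landau_exp:
  fixes b :: "nat \<Rightarrow> real"
  assumes b: "\<And>m. b m \<ge> 0" and sb: "\<And>\<tau>. \<tau> > 1 \<Longrightarrow> dsummable (\<lambda>m. of_real (b m)) \<tau>"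
    and F: "F holomorphic_on ball 2 2" and Fb: "\<And>s. Re s > 1 \<Longrightarrow> s \<in> ball 2 2 \<Longrightarrow> F s = exp (dser (\<lambda>m. of_real (b m)) s)"
    and \<sigma>: "0 < \<sigma>" "\<sigma> \<le> 1"
  shows "dsummable (\<lambda>m. of_real (b m)) \<sigma>"
proof -
  let ?b = "\<lambda>m. complex_of_real (b m)"
  define G where "G z = dser ?b (2 - z)" for z
  define f where "f z = F (2 - z)" for z
  define \<gamma> where "\<gamma> n = (\<Sum>\<^sub>\<infinity>m. b m * ln (real m) ^ n * real m powr (-2))" for n
  have summ: "(\<lambda>m. b m * ln (real m) ^ n * real m powr (-2)) summable_on UNIV" for n
  proof -
    have "dsummable (\<lambda>m. ?b m * of_real (ln (real m) ^ n)) 2" by (rule dsummable_ln_power[OF sb]) auto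
    moreover have "norm (?b m * of_real (ln (real m) ^ n)) = b m * ln (real m) ^ n" for m
      using b[of m] by (cases "m = 0") (auto simp: norm_mult norm_power)
    ultimately show ?thesis by (simp add: dsummable_def)
  qed
  have nonneg: "b m * ln (real m) ^ n * real m powr (-2) \<ge> 0" for m n
    using b[of m] by (cases "m = 0") auto
  have \<gamma>: "\<gamma> n \<ge> 0" for n
    unfolding \<gamma>_def by (rule infsum_nonneg) (rule nonneg)
  have Gd: "(deriv ^^ n) G 0 = of_real (\<gamma> n)" for n
    using higher_deriv_dser[of 1 ?b 2 0 n] sb dser_of_real[OF summ, of n]
    by (simp add: G_def[abs_def] \<gamma>_def)
  have fhol: "f holomorphic_on ball 0 2"
    unfolding f_def[abs_def]
    by (rule holomorphic_on_compose_gen[OF _ F, of "\<lambda>z. 2 - z", unfolded o_def])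
       (auto intro!: holomorphic_intros simp: dist_norm)
  have Re2: "Re (2 - z) > 1" if "z \<in> ball 0 1" for z
    using that abs_Re_le_cmod[of z] by auto
  have Ghas: "(G has_field_derivative dser (\<lambda>m. ?b m * of_real (ln (real m))) (2 - z)) (at z)" if "z \<in> ball 0 1" for z
  proof -
    have "dsummable ?b ((1 + Re (2 - z)) / 2)" by (rule sb) (use Re2[OF that] in auto)
    hence "(dser ?b has_field_derivative - dser (\<lambda>m. ?b m * of_real (ln (real m))) (2 - z)) (at (2 - z))"
      by (rule dser_has_field_derivative) (use Re2[OF that] in auto)
    from DERIV_chain2[where g = "\<lambda>w. 2 - w" and x = z and Db = "-1", OF this]
    moreover have "((\<lambda>w. 2 - w) has_field_derivative -1) (at z)" by (auto intro!: derivative_eq_intros)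
    ultimately show ?thesis
      unfolding G_def by (simp only: mult_minus_left mult_minus_right minus_minus mult_1_right)
  qed
  have Ghol: "G holomorphic_on ball 0 1" unfolding holomorphic_on_open[OF open_ball] using Ghas by blast
  have fG: "f z = exp (G z)" if "z \<in> ball 0 1" for z
    unfolding f_def G_def by (rule Fb) (use Re2[OF that] that in \<open>auto simp: dist_norm\<close>)
  have df: "deriv f z = f z * deriv G z" if z: "z \<in> ball 0 1" for z
  proof -
    have "\<forall>\<^sub>F w in nhds z. w \<in> ball 0 1" by (rule eventually_nhds_in_open[OF open_ball z])
    hence "\<forall>\<^sub>F w in nhds z. f w = exp (G w)" by eventually_elim (rule fG)
    hence "deriv f z = deriv (\<lambda>w. exp (G w)) z" by (rule deriv_cong_ev) simp
    also have "\<dots> = exp (G z) * deriv G z"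
      by (rule DERIV_imp_deriv, rule DERIV_chain2[OF DERIV_exp])
         (use Ghas[OF z] DERIV_imp_deriv[OF Ghas[OF z]] in simp)
    finally show ?thesis using fG[OF z] by simp
  qed
  \<comment> \<open>Leibniz's rule for f' = f G'. All quantities turn out nonnegative, so \<phi> n
    is at least its summand i = 0, which is f(0) \<gamma> n, and f(0) = exp(\<gamma> 0) \<ge>
    1.\<close>
  have rec: "(deriv ^^ Suc n) f 0 = (\<Sum>i=0..n. of_nat (n choose i) * (deriv ^^ i) f 0 * of_real (\<gamma> (Suc (n - i))))" for n
  proof -
    have fhol1: "f holomorphic_on ball 0 1" using fhol by (rule holomorphic_on_subset) (auto simp: subset_ball)
    have "(deriv ^^ Suc n) f 0 = (deriv ^^ n) (deriv f) 0" by (simp only: funpow_Suc_right o_apply)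
    also have "\<dots> = (deriv ^^ n) (\<lambda>w. f w * deriv G w) 0"
      by (rule higher_deriv_transform_within_open[where S = "ball 0 1"])
         (use df fhol1 Ghol in \<open>auto intro!: holomorphic_deriv holomorphic_on_mult\<close>)
    also have "\<dots> = (\<Sum>i=0..n. of_nat (n choose i) * (deriv ^^ i) f 0 * (deriv ^^ (n-i)) (deriv G) 0)"
      by (rule higher_deriv_mult[of _ "ball 0 1"]) (use fhol1 Ghol in \<open>auto intro!: holomorphic_deriv\<close>)
    also have "\<dots> = (\<Sum>i=0..n. of_nat (n choose i) * (deriv ^^ i) f 0 * of_real (\<gamma> (Suc (n - i))))"
      by (simp only: Gd[symmetric] funpow_Suc_right o_apply)
    finally show ?thesis .
  qed
  define \<phi> where "\<phi> n = Re ((deriv ^^ n) f 0)" for n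
  have f0: "f 0 = of_real (exp (\<gamma> 0))" using fG[of 0] Gd[of 0] by (simp add: exp_of_real)
  have "(deriv ^^ n) f 0 = of_real (\<phi> n) \<and> \<phi> n \<ge> 0 \<and> (n > 0 \<longrightarrow> \<phi> n \<ge> \<gamma> n)" for n
  proof (induction n rule: less_induct)
    case (less n)
    show ?case
    proof (cases n)
      case 0
      thus ?thesis using f0 by (simp add: \<phi>_def)
    next
      case (Suc k)
      have IH: "(deriv ^^ i) f 0 = of_real (\<phi> i)" "\<phi> i \<ge> 0" if "i \<le> k" for i using less.IH[of i] Suc that by auto
      have "(deriv ^^ n) f 0 = (\<Sum>i=0..k. of_nat (k choose i) * of_real (\<phi> i) * of_real (\<gamma> (Suc (k - i))))"
        unfolding Suc rec by (rule sum.cong) (use IH in auto)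
      also have "\<dots> = of_real (\<Sum>i=0..k. real (k choose i) * \<phi> i * \<gamma> (Suc (k - i)))" by simp
      finally have eq: "(deriv ^^ n) f 0 = of_real (\<Sum>i=0..k. real (k choose i) * \<phi> i * \<gamma> (Suc (k - i)))" .
      hence \<phi>n: "\<phi> n = (\<Sum>i=0..k. real (k choose i) * \<phi> i * \<gamma> (Suc (k - i)))" by (simp add: \<phi>_def)
      have "\<phi> 0 = exp (\<gamma> 0)" using f0 by (simp add: \<phi>_def)
      hence "\<phi> 0 \<ge> 1" using \<gamma>[of 0] by simp
      hence "\<gamma> n \<le> \<phi> 0 * \<gamma> n" using \<gamma>[of n] by (simp add: mult_le_cancel_right1)
      also have "\<dots> = (\<Sum>i\<in>{0}. real (k choose i) * \<phi> i * \<gamma> (Suc (k - i)))" using Suc by simp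
      also have "\<dots> \<le> \<phi> n"
        unfolding \<phi>n by (rule sum_mono2) (use IH \<gamma> in \<open>auto intro!: mult_nonneg_nonneg\<close>)
      finally show ?thesis using eq \<phi>n \<gamma>[of n] by simp
    qed
  qed
  hence \<phi>: "(deriv ^^ n) f 0 = of_real (\<phi> n)" "\<phi> n \<ge> 0" "n > 0 \<Longrightarrow> \<phi> n \<ge> \<gamma> n" for n by blast+
  define x where "x = 2 - \<sigma>"
  have x: "0 \<le> x" "x < 2" using \<sigma> by (auto simp: x_def)
  \<comment> \<open>Here m^(-\<sigma>) = m^(-2) exp(x ln m) is expanded in powers of x. The
    resulting coefficients are at most those of f, whose Taylor series converges at x < 2. The added
    \<gamma> 0 takes care of index 0, since \<gamma> n was compared with \<phi> n for n > 0
    only.\<close>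
  have bound: "(\<Sum>m\<in>A. b m * real m powr (-\<sigma>)) \<le> \<gamma> 0 + Re (f (of_real x))" if A: "finite A" for A :: "nat set"
  proof (rule sums_le)
    define t where "t n = (\<Sum>m\<in>A. b m * ln (real m) ^ n * real m powr (-2))" for n
    have t: "t n \<le> \<gamma> n" for n
      unfolding t_def \<gamma>_def by (rule finite_sum_le_infsum[OF summ A]) (use nonneg in auto)
    have "(\<lambda>n::nat. b m * real m powr (-2) * ((x * ln (real m)) ^ n / fact n)) sums (b m * real m powr (-\<sigma>))" for m :: nat
    proof (cases "m = 0")
      case False
      have "(\<lambda>n. (x * ln (real m)) ^ n / fact n) sums exp (x * ln (real m))"
        using exp_converges[of "x * ln (real m)"] by (simp add: field_simps)
      from sums_mult[OF this, of "b m * real m powr (-2)"]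
      show ?thesis using False by (simp add: x_def powr_def mult.assoc algebra_simps flip: exp_add)
    qed simp
    hence "(\<lambda>n. \<Sum>m\<in>A. b m * real m powr (-2) * ((x * ln (real m)) ^ n / fact n)) sums (\<Sum>m\<in>A. b m * real m powr (-\<sigma>))"
      by (intro sums_sum)
    moreover have "(\<Sum>m\<in>A. b m * real m powr (-2) * ((x * ln (real m)) ^ n / fact n)) = t n * (x ^ n / fact n)" for n
      unfolding t_def sum_distrib_right by (rule sum.cong) (simp_all add: power_mult_distrib)
    ultimately show "(\<lambda>n. t n * (x ^ n / fact n)) sums (\<Sum>m\<in>A. b m * real m powr (-\<sigma>))" by simp
    have *: "of_real x \<in> ball (0::complex) 2" using x by simp
    have "(\<lambda>n. \<phi> n / fact n * x ^ n) sums Re (f (of_real x))"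
    proof -
      have "Re ((deriv ^^ n) f 0 / fact n * (of_real x - 0) ^ n) = \<phi> n / fact n * x ^ n" for n
      proof -
        have "(deriv ^^ n) f 0 / fact n * (of_real x - 0) ^ n = of_real (\<phi> n / fact n * x ^ n)"
          unfolding \<phi>(1) by simp
        thus ?thesis by (simp only: Re_complex_of_real)
      qed
      thus ?thesis using sums_Re[OF holomorphic_power_series[OF fhol *]] by (simp only:)
    qed
    from sums_add[OF sums_single[of "0::nat" "\<lambda>_. \<gamma> 0"] this]
    show "(\<lambda>n. (if n = 0 then \<gamma> 0 else 0) + \<phi> n / fact n * x ^ n) sums (\<gamma> 0 + Re (f (of_real x)))" .
    show "t n * (x ^ n / fact n) \<le> (if n = 0 then \<gamma> 0 else 0) + \<phi> n / fact n * x ^ n" for n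
    proof (cases "n = 0")
      case True
      thus ?thesis using t[of 0] \<phi>(2)[of 0] by simp
    next
      case False
      have "t n * (x ^ n / fact n) \<le> \<phi> n * (x ^ n / fact n)"
        using t[of n] \<phi>(3)[of n] False x by (intro mult_right_mono) auto
      thus ?thesis using False by simp
    qed
  qed
  have "(\<lambda>m. b m * real m powr (-\<sigma>)) summable_on UNIV"
    by (rule nonneg_bounded_partial_sums_imp_summable_on[of _ _ "\<gamma> 0 + Re (f (of_real x))"])
       (use b bound in \<open>auto intro!: always_eventually eventually_finite_subsets_at_top_weakI\<close>)
  thus ?thesis using b by (simp add: dsummable_def)
qed

text \<open>Multiplying by this factor removes the pole of the L-series of the trivial character at 1.\<close>
abbreviation pole_factor :: "complex \<Rightarrow> complex" where
  "pole_factor s \<equiv> 1 - 2 powr (1 - s)"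

lemma pole_factor_exp: "pole_factor s = 1 - exp ((1 - s) * of_real (ln 2))"
  using Ln_of_real[of 2] by (simp add: powr_def)

lemma pole_factor_holomorphic: "pole_factor holomorphic_on S"
  unfolding pole_factor_exp by (intro holomorphic_intros)

text \<open>The zeros are 1 + 2 pi i n / ln 2. The crude bound 2 is enough, since the discs used
  later have real centre and radius at most 2.\<close>

lemma pole_factor_eq_0:
  assumes "pole_factor s = 0"
  shows "s = 1 \<or> \<bar>Im s\<bar> \<ge> 2"
proof -
  have "exp ((1 - s) * of_real (ln 2)) = exp 0" using assms by (simp add: pole_factor_exp)
  then obtain n :: int where n: "(1 - s) * of_real (ln 2) = of_int (2 * n) * (of_real pi * \<i>)"
    unfolding exp_eq by (auto simp: mult_ac)
  have l: "0 < ln (2::real)" "ln (2::real) < 1" using ln_2_less_1 by auto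
  have re: "(1 - Re s) * ln 2 = 0" and im: "- Im s * ln 2 = 2 * real_of_int n * pi"
    using arg_cong[OF n, of Re] arg_cong[OF n, of Im] by (simp_all add: mult_ac)
  show ?thesis
  proof (cases "n = 0")
    case True
    thus ?thesis using re im l by (auto simp: complex_eq_iff)
  next
    case False
    hence "1 \<le> \<bar>real_of_int n\<bar>" by linarith
    have "2 \<le> 2 * 1 * pi" using pi_gt3 by simp
    also have "\<dots> \<le> 2 * \<bar>real_of_int n\<bar> * pi"
      using \<open>1 \<le> \<bar>real_of_int n\<bar>\<close> by (intro mult_right_mono mult_left_mono) auto
    also have "\<dots> = \<bar>- Im s * ln 2\<bar>" unfolding im by (simp add: abs_mult)
    also have "\<dots> = \<bar>Im s\<bar> * ln 2" using l by (simp add: abs_mult)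
    also have "\<dots> \<le> \<bar>Im s\<bar> * 1" using l by (intro mult_left_mono) auto
    finally show ?thesis by simp
  qed
qed

lemma pole_factor_decomp:
  "\<exists>e. e holomorphic_on UNIV \<and> (\<forall>z. pole_factor z = (z - 1) * e z) \<and> (\<forall>z. \<bar>Im z\<bar> < 2 \<longrightarrow> e z \<noteq> 0)"
proof -
  have "(pole_factor has_field_derivative of_real (ln 2)) (at 1)"
    unfolding pole_factor_exp by (auto intro!: derivative_eq_intros)
  hence "deriv pole_factor 1 = of_real (ln 2)" by (rule DERIV_imp_deriv)
  moreover from holomorphic_factor_zero[OF pole_factor_holomorphic open_UNIV, of 1]
  obtain e where e: "e holomorphic_on UNIV" "e 1 = deriv pole_factor 1" "\<And>z. pole_factor z = (z - 1) * e z"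
    by auto
  ultimately have "e 1 \<noteq> 0" by simp
  moreover have "e z \<noteq> 0" if "\<bar>Im z\<bar> < 2" "z \<noteq> 1" for z
    using pole_factor_eq_0[of z] e(3)[of z] that by auto
  ultimately show ?thesis using e by blast
qed

section \<open>Products of L-functions and their nonvanishing at 1\<close>

context dirichlet_characters
begin

text \<open>The coefficients of the logarithm of the product of the L-series of all \<open>\<psi> k\<close> with \<open>d dvd k\<close>, see
  \<open>prod_dser_\<psi>\<close>; only \<open>d = 1\<close> (all characters) and \<open>d = 2\<close> (the even ones) are needed.\<close>
definition bd :: "nat \<Rightarrow> nat \<Rightarrow> real" where
  "bd d m = (if [m ^ d = 1] (mod q) then real (r div d) * prime_power_weight m else 0)"

lemma bd_nonneg: "bd d m \<ge> 0"
  by (simp add: bd_def prime_power_weight_nonneg)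

lemma bd_le: "bd d m \<le> real (r div d)"
  using prime_power_weight_le_1[of m] by (auto simp: bd_def intro!: mult_left_le)

lemma dsummable_bd: "\<tau> > 1 \<Longrightarrow> dsummable (\<lambda>m. of_real (bd d m)) \<tau>"
  by (rule dsummable_bounded[of _ "real (r div d)"]) (use bd_le bd_nonneg in auto)

lemma L_family:
  "\<exists>L. (\<forall>k<r. L k holomorphic_on {s. Re s > 0}) \<and>
     (\<forall>k<r. \<forall>s. Re s > 1 \<longrightarrow> L k s = (if k = 0 then pole_factor s else 1) * dser (\<psi> k) s)"
proof -
  have "\<forall>k. \<exists>L. k < r \<longrightarrow> L holomorphic_on {s. Re s > 0} \<and>
     (\<forall>s. Re s > 1 \<longrightarrow> L s = (if k = 0 then pole_factor s else 1) * dser (\<psi> k) s)"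
  proof
    fix k
    show "\<exists>L. k < r \<longrightarrow> L holomorphic_on {s. Re s > 0} \<and>
     (\<forall>s. Re s > 1 \<longrightarrow> L s = (if k = 0 then pole_factor s else 1) * dser (\<psi> k) s)"
      using L0_exists L_exists[of k] by (cases "k = 0") auto
  qed
  from choice[OF this] show ?thesis by blast
qed

lemma prod_dser_\<psi>:
  assumes d: "d dvd r" and s: "Re s > 1"
  shows "(\<Prod>j<r div d. (if d * j = 0 then pole_factor s else 1) * dser (\<psi> (d * j)) s) =
    pole_factor s * exp (dser (\<lambda>m. of_real (bd d m)) s)"
proof -
  have d0: "d > 0" "r div d > 0"
    using r_pos nat_0_less_mult_iff[of d "r div d"] unfolding dvd_mult_div_cancel[OF d] by blast+
  have dw: "dsummable (\<lambda>m. \<psi> k m * of_real (prime_power_weight m)) (Re s)" for k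
  proof (rule dsummable_bounded[OF _ s])
    show "norm (\<psi> k m * of_real (prime_power_weight m)) \<le> 1" for m
      using \<psi>_le[of k m] prime_power_weight_nonneg[of m] prime_power_weight_le_1[of m]
      by (auto simp: norm_mult intro!: mult_le_one)
  qed
  have "(\<Sum>j<r div d. \<psi> (d * j) m * of_real (prime_power_weight m)) = of_real (bd d m)" for m
    unfolding sum_distrib_right[symmetric] sum_\<psi>[OF d] by (simp add: bd_def)
  with dser_sum[of "{..<r div d}" "\<lambda>j m. \<psi> (d * j) m * of_real (prime_power_weight m)" s] dw
  have sum: "dser (\<lambda>m. of_real (bd d m)) s = (\<Sum>j<r div d. dser (\<lambda>m. \<psi> (d * j) m * of_real (prime_power_weight m)) s)"
    by simp
  have "(\<Prod>j<r div d. (if d * j = 0 then pole_factor s else 1) * dser (\<psi> (d * j)) s)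
     = (\<Prod>j<r div d. if j = 0 then pole_factor s else 1) * (\<Prod>j<r div d. exp (dser (\<lambda>m. \<psi> (d * j) m * of_real (prime_power_weight m)) s))"
    unfolding prod.distrib[symmetric] using d0 mult_char_dser_exp[OF mult_char_\<psi> s] by (intro prod.cong) auto
  also have "(\<Prod>j<r div d. if j = 0 then pole_factor s else 1) = pole_factor s"
    using d0 by (simp add: prod.delta)
  finally show ?thesis by (simp only: sum exp_sum finite_lessThan)
qed

lemma bd_prime_power:
  assumes "prime p" "p \<noteq> q"
  shows "bd 1 (p ^ r) = 1"
proof -
  have "\<not> q dvd p" using assms prime_q primes_dvd_imp_eq by blast
  hence "[p ^ (q - 1) = 1] (mod q)" using prime_q by (rule fermat_theorem[rotated])
  moreover have "q - 1 = r" using q_eq by simp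
  ultimately have "[p ^ r = 1] (mod q)" by simp
  thus ?thesis using prime_power_weight_power[OF assms(1) r_pos] r_pos by (simp add: bd_def)
qed

text \<open>If P(1) = 0, the quotient of P by \<open>pole_factor\<close> extends the exponential of
  the logarithmic series holomorphically to the disc of radius 2 about 2. By
  \<open>landau_exp\<close> the logarithmic series converges far to the left of 1, which contradicts
  the divergence hypothesis through its terms at p^r.\<close>

lemma L_product_nonvanishing:
  assumes div: "\<not> (\<lambda>p. real p powr (-1/2)) summable_on Collect prime"
    and P: "P holomorphic_on {s. Re s > 0}"
    and eq: "\<And>s. Re s > 1 \<Longrightarrow> P s = pole_factor s * exp (dser (\<lambda>m. of_real (bd 1 m)) s)"
  shows "P 1 \<noteq> 0"
proof
  assume 0: "P 1 = 0"
  let ?B = "ball (2::complex) 2"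
  have sub: "?B \<subseteq> {s. Re s > 0}"
  proof
    fix s :: complex assume "s \<in> ?B"
    moreover have "2 - Re s \<le> norm (2 - s)" using complex_Re_le_cmod[of "2 - s"] by simp
    ultimately show "s \<in> {s. Re s > 0}" by (simp add: dist_norm)
  qed
  have im: "\<bar>Im s\<bar> < 2" if "s \<in> ?B" for s
    using that abs_Im_le_cmod[of "2 - s"] by (simp add: dist_norm)
  have one: "1 \<in> ?B" by (simp add: dist_norm)
  obtain P1 where P1: "P1 holomorphic_on ?B" "\<And>z. z \<in> ?B \<Longrightarrow> P z = (z - 1) * P1 z"
    using holomorphic_factor_zero[OF holomorphic_on_subset[OF P sub] open_ball one 0] by blast
  obtain e where e: "e holomorphic_on UNIV" "\<And>z. pole_factor z = (z - 1) * e z" "\<And>z. \<bar>Im z\<bar> < 2 \<Longrightarrow> e z \<noteq> 0"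
    using pole_factor_decomp by blast
  \<comment> \<open>Chosen so that the term at p^r, which has coefficient 1 for p different from q,
    equals p^(-1/2).\<close>
  define \<sigma> where "\<sigma> = 1 / (2 * real r)"
  have "dsummable (\<lambda>m. of_real (bd 1 m)) \<sigma>"
  proof (rule landau_exp[of _ "\<lambda>z. P1 z / e z"])
    show "(\<lambda>z. P1 z / e z) holomorphic_on ?B"
      using P1(1) holomorphic_on_subset[OF e(1)] e(3) im by (intro holomorphic_on_divide) auto
    fix s assume s: "Re s > 1" "s \<in> ?B"
    have "s \<noteq> 1" using s by auto
    have "(s - 1) * P1 s = (s - 1) * (e s * exp (dser (\<lambda>m. of_real (bd 1 m)) s))"
      using eq[OF s(1)] P1(2)[OF s(2)] e(2)[of s] by (simp only: mult.assoc)
    thus "P1 s / e s = exp (dser (\<lambda>m. of_real (bd 1 m)) s)"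
      using \<open>s \<noteq> 1\<close> e(3)[OF im[OF s(2)]] by simp
  qed (use bd_nonneg dsummable_bd r_pos in \<open>auto simp: \<sigma>_def\<close>)
  hence "(\<lambda>m. bd 1 m * real m powr (-\<sigma>)) summable_on UNIV"
    by (simp add: dsummable_def bd_nonneg)
  hence "(\<lambda>m. bd 1 m * real m powr (-\<sigma>)) summable_on (\<lambda>p. p ^ r) ` (Collect prime - {q})"
    by (rule summable_on_subset_banach) simp
  moreover have inj: "inj_on (\<lambda>p. p ^ r) (Collect prime - {q})"
    using r_pos by (auto simp: inj_on_def power_eq_iff_eq_base)
  ultimately have "((\<lambda>m. bd 1 m * real m powr (-\<sigma>)) \<circ> (\<lambda>p. p ^ r)) summable_on (Collect prime - {q})"
    by (simp only: summable_on_reindex)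
  also have "?this \<longleftrightarrow> (\<lambda>p. real p powr (-1/2)) summable_on (Collect prime - {q})"
  proof (rule summable_on_cong)
    fix p assume "p \<in> Collect prime - {q}"
    hence p: "prime p" "p \<noteq> q" by auto
    have "real (p ^ r) powr (-\<sigma>) = real p powr (real r * (- \<sigma>))"
      using prime_gt_0_nat[OF p(1)] by (simp add: powr_powr flip: powr_realpow)
    also have "real r * (- \<sigma>) = -1/2" using r_pos by (simp add: \<sigma>_def)
    finally show "((\<lambda>m. bd 1 m * real m powr (-\<sigma>)) \<circ> (\<lambda>p. p ^ r)) p = real p powr (-1/2)"
      by (simp only: o_apply bd_prime_power[OF p] mult_1)
  qed
  finally have "(\<lambda>p. real p powr (-1/2)) summable_on insert q (Collect prime - {q})"
    by (subst summable_on_insert_iff) auto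
  moreover have "insert q (Collect prime - {q}) = Collect prime" using prime_q by auto
  ultimately show False using div by simp
qed

text \<open>The product over all characters does not vanish at 1, so none of its factors does; the
  product over any smaller set of characters inherits this.\<close>

theorem L_product:
  assumes div: "\<not> (\<lambda>p. real p powr (-1/2)) summable_on Collect prime"
    and d: "d dvd r"
  shows "\<exists>h. h holomorphic_on {s. Re s > 0} \<and> h 1 \<noteq> 0 \<and>
     (\<forall>s. Re s > 1 \<longrightarrow> h s = pole_factor s * exp (dser (\<lambda>m. of_real (bd d m)) s))"
proof -
  obtain L where L: "\<And>k. k < r \<Longrightarrow> L k holomorphic_on {s. Re s > 0}"
    "\<And>k s. k < r \<Longrightarrow> Re s > 1 \<Longrightarrow> L k s = (if k = 0 then pole_factor s else 1) * dser (\<psi> k) s"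
    using L_family by blast
  define P where "P d s = (\<Prod>j<r div d. L (d * j) s)" for d s
  have less: "d * j < r" if "j < r div d" "d dvd r" for d j
  proof -
    have "d > 0" using that r_pos by (auto intro!: Nat.gr0I)
    hence "d * j < d * (r div d)" using that(1) by (rule mult_strict_left_mono[rotated])
    thus ?thesis by (simp only: dvd_mult_div_cancel[OF that(2)])
  qed
  have hol: "P d holomorphic_on {s. Re s > 0}" if "d dvd r" for d
    unfolding P_def[abs_def] using L(1) less that by (intro holomorphic_on_prod) auto
  have eq: "P d s = pole_factor s * exp (dser (\<lambda>m. of_real (bd d m)) s)" if "Re s > 1" "d dvd r" for d s
    unfolding prod_dser_\<psi>[OF that(2,1), symmetric] P_def
    by (rule prod.cong) (use L(2) less that in auto)
  have "P 1 1 \<noteq> 0" by (rule L_product_nonvanishing[OF div hol eq]) auto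
  hence "L k 1 \<noteq> 0" if "k < r" for k using that by (auto simp: P_def)
  hence "P d 1 \<noteq> 0" using less d by (auto simp: P_def)
  thus ?thesis using hol[OF d] eq d by blast
qed

end

section \<open>Euler--Kronecker constants as limits of Dirichlet series\<close>

definition proper_prime_powers :: "nat set" where
  "proper_prime_powers = {p ^ k | p k. prime p \<and> k \<ge> 2}"

lemma primepow_cases:
  assumes "primepow (m :: nat)"
  shows "prime m \<or> m \<in> proper_prime_powers"
proof -
  obtain p k where pk: "prime p" "k > 0" "m = p ^ k" using assms by (auto simp: primepow_def)
  show ?thesis
  proof (cases "k = 1")
    case False
    hence "k \<ge> 2" using pk(2) by simp
    thus ?thesis unfolding proper_prime_powers_def using pk by blast
  qed (use pk in simp)
qed

text \<open>Every proper prime power has the form \<open>a\<^sup>2 b\<^sup>3\<close>.\<close>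
lemma proper_prime_powers_summable:
  assumes "\<sigma> > 1/2"
  shows "(\<lambda>m. real m powr (-\<sigma>)) summable_on proper_prime_powers"
proof -
  define w where "w x = real (fst x ^ 2 * snd x ^ 3) powr (-\<sigma>)" for x :: "nat \<times> nat"
  have ex: "\<exists>x. fst x ^ 2 * snd x ^ 3 = m" if m: "m \<in> proper_prime_powers" for m
  proof -
    obtain p k where pk: "m = p ^ k" "k \<ge> 2" using m by (auto simp: proper_prime_powers_def)
    show ?thesis
    proof (cases "even k")
      case True
      then obtain j where "k = 2 * j" by (elim evenE)
      thus ?thesis using pk by (intro exI[of _ "(p ^ j, 1)"]) (simp add: mult.commute flip: power_mult)
    next
      case False
      then obtain j where j: "k = 2 * j + 1" by (elim oddE)
      then obtain i where "j = Suc i" using pk(2) by (cases j) auto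
      hence "k = i * 2 + 3" using j by simp
      thus ?thesis using pk by (intro exI[of _ "(p ^ i, p)"]) (simp add: power_add flip: power_mult)
    qed
  qed
  define g where "g m = (SOME x. fst x ^ 2 * snd x ^ 3 = m)" for m :: nat
  have g: "fst (g m) ^ 2 * snd (g m) ^ 3 = m" if "m \<in> proper_prime_powers" for m
    unfolding g_def by (rule someI_ex[OF ex[OF that]])
  have inj: "inj_on g proper_prime_powers"
    using g by (metis inj_onI)
  have "(\<lambda>x. real (fst x) powr (-2*\<sigma>) * real (snd x) powr (-3*\<sigma>)) summable_on UNIV \<times> UNIV"
  proof (rule summable_on_SigmaI)
    have s2: "(\<lambda>a. real a powr (-2*\<sigma>)) summable_on UNIV"
      and s3: "(\<lambda>b. real b powr (-3*\<sigma>)) summable_on UNIV"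
      using assms by (auto simp: summable_on_UNIV_nonneg_real_iff summable_real_powr_iff)
    show "(\<lambda>a. real a powr (-2*\<sigma>) * (\<Sum>\<^sub>\<infinity>b. real b powr (-3*\<sigma>))) summable_on UNIV"
      by (rule summable_on_cmult_left[OF s2])
    show "((\<lambda>b. real (fst (a, b)) powr (-2*\<sigma>) * real (snd (a, b)) powr (-3*\<sigma>)) has_sum
        real a powr (-2*\<sigma>) * (\<Sum>\<^sub>\<infinity>b. real b powr (-3*\<sigma>))) UNIV" for a
      using has_sum_cmult_right[OF has_sum_infsum[OF s3], of "real a powr (-2*\<sigma>)"] by simp
  qed auto
  moreover have "real (fst x) powr (-2*\<sigma>) * real (snd x) powr (-3*\<sigma>) = w x" for x
  proof (cases "fst x = 0 \<or> snd x = 0")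
    case False
    have "real (fst x ^ 2) powr (-\<sigma>) = real (fst x) powr (-2*\<sigma>)"
      "real (snd x ^ 3) powr (-\<sigma>) = real (snd x) powr (-3*\<sigma>)"
      using False by (simp_all add: powr_powr flip: powr_numeral)
    thus ?thesis by (simp add: w_def powr_mult)
  qed (auto simp: w_def)
  ultimately have "w summable_on UNIV" by simp
  hence "w summable_on g ` proper_prime_powers" by (rule summable_on_subset_banach) simp
  hence "(w \<circ> g) summable_on proper_prime_powers" by (subst (asm) summable_on_reindex[OF inj])
  also have "?this \<longleftrightarrow> (\<lambda>m. real m powr (-\<sigma>)) summable_on proper_prime_powers"
    by (rule summable_on_cong) (simp add: w_def g del: of_nat_mult of_nat_power)
  finally show ?thesis .
qed

text \<open>The Laurent expansion of Z at 1 is the Taylor expansion of g shifted by one place, with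
  residue g(1) and constant term g'(1). The existence of Z makes the choice in
  \<open>dedekind_zeta\<close> meaningful, and uniqueness of the expansion transfers the result to
  it.\<close>

lemma euler_kronecker_eqI:
  assumes Z: "continues_dedekind_series K Z"
    and g: "g holomorphic_on ball 1 \<epsilon>" "\<epsilon> > 0" "g 1 \<noteq> 0"
    and eq: "\<And>s. s \<in> ball 1 \<epsilon> \<Longrightarrow> s \<noteq> 1 \<Longrightarrow> Z s = g s / (s - 1)"
  shows "euler_kronecker K = deriv g 1 / g 1"
proof -
  have "continues_dedekind_series K (dedekind_zeta K)"
    unfolding dedekind_zeta_def by (rule someI[of "continues_dedekind_series K", OF Z])
  hence L: "laurent_expansion (dedekind_zeta K) 1 = laurent_expansion Z 1"
    using Z by (rule laurent_expansion_continuation_unique)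
  have "g analytic_on {1}"
    using g(1,2) by (auto simp: analytic_on_def)
  hence G: "(\<lambda>w. g (1 + w)) has_fps_expansion fps_expansion g 1"
    by (rule analytic_at_imp_has_fps_expansion)
  define F where "F = fls_shift 1 (fps_to_fls (fps_expansion g 1))"
  have "(\<lambda>w. g (1 + w) * inverse w) has_laurent_expansion (fps_to_fls (fps_expansion g 1) * inverse fls_X)"
    by (intro has_laurent_expansion_mult has_laurent_expansion_fps G has_laurent_expansion_inverse has_laurent_expansion_fps_X)
  hence gl: "(\<lambda>w. g (1 + w) * inverse w) has_laurent_expansion F"
    by (simp add: F_def fls_inverse_X fls_X_inv_times_conv_shift)
  have "\<forall>\<^sub>F w in at 0. w \<in> ball 0 \<epsilon> - {0}"
    using g(2) by (intro eventually_at_in_open) auto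
  hence ev: "\<forall>\<^sub>F w in at 0. g (1 + w) * inverse w = Z (1 + w)"

  proof eventually_elim
    case (elim w)
    hence "Z (1 + w) = g (1 + w) / (1 + w - 1)" by (intro eq) (auto simp: dist_norm)
    thus ?case by (simp add: divide_inverse)
  qed
  then have "(\<lambda>w. Z (1 + w)) has_laurent_expansion F"
    by (rule has_laurent_expansion_cong[OF _ refl, THEN iffD1, OF _ gl])
  hence "laurent_expansion Z 1 = F"
    by (rule laurent_expansion_eqI)
  thus ?thesis
    by (simp add: euler_kronecker_def L F_def fps_expansion_def)
qed

section \<open>Logarithmic coefficients of Dedekind zeta functions\<close>

context number_ring
begin

definition prime_ideal_powers :: "nat \<Rightarrow> (complex set \<times> nat) set" where
  "prime_ideal_powers m = {x \<in> Collect maxid \<times> {1..}. idx R (fst x) ^ snd x = m}"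

text \<open>The coefficients of the logarithm of the zeta function, see
  \<open>dedekind_series_exp\<close>.\<close>

definition log_coeff :: "nat \<Rightarrow> real" where
  "log_coeff m = (\<Sum>x\<in>prime_ideal_powers m. 1 / real (snd x))"

lemma prime_ideal_powers_prime_power:
  assumes "x \<in> prime_ideal_powers m"
  obtains p k where "prime p" "fst x \<in> primes_over p" "k > 0" "m = p ^ k"
proof -
  have P: "maxid (fst x)" "snd x \<ge> 1" "idx R (fst x) ^ snd x = m"
    using assms by (auto simp: prime_ideal_powers_def)
  obtain p where p: "prime p" "of_nat p \<in> fst x" using maxid_contains_prime[OF P(1)] by blast
  obtain f where f: "f > 0" "idx R (fst x) = p ^ f" using maxid_idx_power[OF P(1) p] by blast
  show ?thesis
    by (rule that[of p "f * snd x"]) (use p f P in \<open>auto simp: primes_over_def power_mult\<close>)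
qed

lemma prime_ideal_powers_over:
  assumes "x \<in> prime_ideal_powers (p ^ k)" "prime p" "k > 0"
  shows "fst x \<in> primes_over p"
proof -
  obtain p' k' where p': "prime p'" "fst x \<in> primes_over p'" "k' > 0" "p ^ k = p' ^ k'"
    using prime_ideal_powers_prime_power[OF assms(1)] .
  have "p' dvd p ^ k" using p'(3,4) by simp
  hence "p' dvd p" using prime_dvd_power[OF p'(1)] by blast
  hence "p' = p" using primes_dvd_imp_eq[OF p'(1) assms(2)] by simp
  thus ?thesis using p'(2) by simp
qed

lemma prime_ideal_powers_inj: "inj_on fst (prime_ideal_powers m)"
proof (rule inj_onI)
  fix x y assume xy: "x \<in> prime_ideal_powers m" "y \<in> prime_ideal_powers m" "fst x = fst y"
  hence "idx R (fst x) ^ snd x = idx R (fst x) ^ snd y" "idx R (fst x) > 1"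
    using maxid_idx_gt_1 by (auto simp: prime_ideal_powers_def)
  hence "snd x = snd y" by (simp add: power_inject_exp)
  thus "x = y" using xy(3) by (simp add: prod_eq_iff)
qed

text \<open>An m with a contribution is a power of one prime p; the ideal lies above p and
  determines the exponent, so there are at most as many pairs as primes above p.\<close>

lemma prime_ideal_powers_finite: "finite (prime_ideal_powers m)" "card (prime_ideal_powers m) \<le> n"
proof -
  have "finite (prime_ideal_powers m) \<and> card (prime_ideal_powers m) \<le> n"
  proof (cases "prime_ideal_powers m = {}")
    case False
    then obtain x where "x \<in> prime_ideal_powers m" by blast
    then obtain p k where p: "prime p" "k > 0" "m = p ^ k"
      by (elim prime_ideal_powers_prime_power)
    have sub: "fst ` prime_ideal_powers m \<subseteq> primes_over p"
      using prime_ideal_powers_over[of _ p k] p by auto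
    have fin: "finite (prime_ideal_powers m)"
      using finite_imageD[OF finite_subset[OF sub primes_over_finite(1)[OF p(1)]] prime_ideal_powers_inj] .
    have "card (prime_ideal_powers m) = card (fst ` prime_ideal_powers m)"
      by (rule card_image[OF prime_ideal_powers_inj, symmetric])
    also have "\<dots> \<le> card (primes_over p)" by (rule card_mono[OF primes_over_finite(1)[OF p(1)] sub])
    finally show ?thesis using fin primes_over_finite(2)[OF p(1)] by linarith
  qed auto
  thus "finite (prime_ideal_powers m)" "card (prime_ideal_powers m) \<le> n" by auto
qed

lemma log_coeff_bounds: "0 \<le> log_coeff m" "log_coeff m \<le> real n"
proof -
  show "0 \<le> log_coeff m" unfolding log_coeff_def by (intro sum_nonneg) auto
  have "log_coeff m \<le> (\<Sum>x\<in>prime_ideal_powers m. 1)"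
    unfolding log_coeff_def by (intro sum_mono) (auto simp: prime_ideal_powers_def)
  thus "log_coeff m \<le> real n" using prime_ideal_powers_finite(2)[of m] by simp
qed

lemma dsummable_log_coeff: "\<tau> > 1 \<Longrightarrow> dsummable (\<lambda>m. of_real (log_coeff m)) \<tau>"
  by (rule dsummable_bounded[of _ "real n"]) (use log_coeff_bounds in auto)

lemma infsum_ideals:
  assumes s: "Re s > 1"
  shows "(\<Sum>\<^sub>\<infinity>I\<in>Collect idl. of_nat (idx R I) powr (-s)) = exp (dser (\<lambda>m. of_real (log_coeff m)) s)"
proof -
  interpret E: euler_family "Collect maxid" "idx R" "\<lambda>_. 1" n
  proof
    fix m
    have sub: "(\<lambda>P. (P, 1)) ` {P \<in> Collect maxid. idx R P = m} \<subseteq> prime_ideal_powers m"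
      by (auto simp: prime_ideal_powers_def)
    have inj: "inj_on (\<lambda>P. (P, 1::nat)) {P \<in> Collect maxid. idx R P = m}" by (auto simp: inj_on_def)
    show "finite {P \<in> Collect maxid. idx R P = m}"
      by (rule finite_imageD[OF finite_subset[OF sub prime_ideal_powers_finite(1)] inj])
    show "card {P \<in> Collect maxid. idx R P = m} \<le> n"
      using card_mono[OF prime_ideal_powers_finite(1) sub] prime_ideal_powers_finite(2)[of m]
      unfolding card_image[OF inj] by linarith
  qed (use maxid_idx_gt_1 in fastforce)+
  have b: "E.bcoef m = of_real (log_coeff m)" for m
  proof -
    have "E.bcoef m = (\<Sum>\<^sub>\<infinity>x\<in>prime_ideal_powers m. of_real (1 / real (snd x)))"
      unfolding E.bcoef_def prime_ideal_powers_def by (rule infsum_cong) (auto simp: case_prod_unfold)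
    thus ?thesis using prime_ideal_powers_finite(1) by (simp add: log_coeff_def)
  qed
  have "(\<Sum>\<^sub>\<infinity>I\<in>Collect idl. of_nat (idx R I) powr (-s) :: complex)
      = (\<Sum>\<^sub>\<infinity>M\<in>{M. set_mset M \<subseteq> Collect maxid}. of_nat (idx R (iprod M)) powr (-s))"
    by (rule infsum_reindex_bij_betw[OF bij_iprod, symmetric])
  also have "\<dots> = (\<Sum>\<^sub>\<infinity>M\<in>{M. set_mset M \<subseteq> Collect maxid}. \<Prod>P\<in>#M. 1 * of_nat (idx R P) powr (-s))"
  proof (rule infsum_cong)
    fix M assume M: "M \<in> {M. set_mset M \<subseteq> Collect maxid}"
    have "of_nat (\<Prod>P\<in>#M. idx R P) powr (-s) = (\<Prod>P\<in>#M. of_nat (idx R P) powr (-s) :: complex)"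
      by (induction M) (simp_all add: of_nat_powr_mult del: of_nat_mult)
    moreover have "idx R (iprod M) = (\<Prod>P\<in>#M. idx R P)" by (rule idx_iprod) (use M in auto)
    ultimately show "of_nat (idx R (iprod M)) powr (-s) = (\<Prod>P\<in>#M. 1 * of_nat (idx R P) powr (-s) :: complex)"
      by simp
  qed
  also have "\<dots> = exp (dser E.bcoef s)" by (rule E.euler_product(1)[OF s])
  finally show ?thesis by (simp only: b[abs_def])
qed

lemma dedekind_series_exp:
  assumes "ring_of_integers K = A" and "Re s > 1"
  shows "dedekind_series K s = exp (dser (\<lambda>m. of_real (log_coeff m)) s)"
proof -
  have "nonzero_ideals K = Collect idl" "ideal_norm K I = idx R I" for I
    using ideals_A ideal_norm_A by (simp_all add: nonzero_ideals_def ideal_norm_def assms(1))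
  thus ?thesis by (simp add: dedekind_series_def infsum_ideals[OF assms(2)])
qed

end

text \<open>One setting for both fields: d = 1 for the cyclotomic field, d = 2 for its real
  subfield. Primes with p^d = 1 modulo q split completely. About other primes only the congruence
  for the norm is recorded, which shows that no ideal has norm p itself.\<close>

locale split_ring = number_ring R n e + dirichlet_characters q r g
  for R n e q r g +
  fixes d :: nat
  assumes d_dvd: "d dvd r" and n_eq: "n = r div d"
    and norm_cong: "maxid P \<Longrightarrow> of_nat q \<notin> P \<Longrightarrow> [idx R P ^ d = 1] (mod q)"
    and split_norm: "prime p \<Longrightarrow> [p ^ d = 1] (mod q) \<Longrightarrow> P \<in> primes_over p \<Longrightarrow> idx R P = p"
    and split_card: "prime p \<Longrightarrow> [p ^ d = 1] (mod q) \<Longrightarrow> card (primes_over p) = n"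
    and ramified: "\<exists>L. primes_over q = {L} \<and> idx R L = q"
begin

lemma log_coeff_q_power:
  assumes "k > 0"
  shows "log_coeff (q ^ k) = 1 / real k"
proof -
  obtain L where L: "primes_over q = {L}" "idx R L = q" using ramified by blast
  have "prime_ideal_powers (q ^ k) = {(L, k)}"
  proof (intro equalityI subsetI)
    fix x assume x: "x \<in> prime_ideal_powers (q ^ k)"
    have f: "fst x = L" using prime_ideal_powers_over[OF x prime_q assms] L(1) by simp
    hence "q ^ snd x = q ^ k" using x L(2) by (simp add: prime_ideal_powers_def)
    hence "snd x = k" using prime_gt_1_nat[OF prime_q] by simp
    thus "x \<in> {(L, k)}" using f by (simp add: prod_eq_iff)
  next
    fix x assume "x \<in> {(L, k)}"
    moreover have "maxid L" using L(1) by (auto simp: primes_over_def)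
    ultimately show "x \<in> prime_ideal_powers (q ^ k)" using L assms by (simp add: prime_ideal_powers_def)
  qed
  thus ?thesis by (simp add: log_coeff_def)
qed

lemma log_coeff_nonzero:
  assumes p: "prime p" "p \<noteq> q" "k > 0" and nz: "log_coeff (p ^ k) \<noteq> 0"
  shows "[(p ^ k) ^ d = 1] (mod q)"
proof -
  have "prime_ideal_powers (p ^ k) \<noteq> {}" using nz by (auto simp: log_coeff_def)
  then obtain x where x: "x \<in> prime_ideal_powers (p ^ k)" by blast
  have P: "maxid (fst x)" "idx R (fst x) ^ snd x = p ^ k" using x by (auto simp: prime_ideal_powers_def)
  have "of_nat q \<notin> fst x"
  proof
    assume "of_nat q \<in> fst x"
    hence "q dvd idx R (fst x)" using prime_mem_maxid_iff[OF P(1) prime_q] by simp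
    moreover have "snd x > 0" using x by (auto simp: prime_ideal_powers_def)
    ultimately have "q dvd p ^ k" unfolding P(2)[symmetric] by (rule dvd_trans[OF _ dvd_power[OF disjI1]])
    hence "q dvd p" using prime_dvd_power[OF prime_q] by blast
    thus False using primes_dvd_imp_eq[OF prime_q p(1)] p(2) by simp
  qed
  from cong_pow[OF norm_cong[OF P(1) this], of "snd x"]
  have "[(idx R (fst x) ^ snd x) ^ d = 1] (mod q)"
    by (simp add: mult.commute flip: power_mult)
  thus ?thesis by (simp only: P(2))
qed

lemma log_coeff_prime:
  assumes p: "prime p" "p \<noteq> q"
  shows "log_coeff p = (if [p ^ d = 1] (mod q) then real n else 0)"
proof (cases "[p ^ d = 1] (mod q)")
  case True
  have "prime_ideal_powers p = (\<lambda>P. (P, 1)) ` primes_over p"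
  proof (intro equalityI subsetI)
    fix x assume x: "x \<in> prime_ideal_powers p"
    have f: "fst x \<in> primes_over p" using prime_ideal_powers_over[of x p 1] x p by simp
    hence "p ^ snd x = p ^ 1" using x split_norm[OF p(1) True] by (simp add: prime_ideal_powers_def)
    hence "snd x = 1" using prime_gt_1_nat[OF p(1)] by (simp only: power_inject_exp)
    thus "x \<in> (\<lambda>P. (P, 1)) ` primes_over p" using f by (auto simp: prod_eq_iff image_iff)
  next
    fix x assume "x \<in> (\<lambda>P. (P, 1::nat)) ` primes_over p"
    thus "x \<in> prime_ideal_powers p"
      using split_norm[OF p(1) True] by (auto simp: prime_ideal_powers_def primes_over_def)
  qed
  hence "log_coeff p = real (card (primes_over p))"
    by (simp add: log_coeff_def sum.reindex inj_on_def)
  thus ?thesis using True split_card[OF p(1) True] by simp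
next
  case False
  thus ?thesis using log_coeff_nonzero[OF p, of 1] by auto
qed

lemma log_coeff_not_primepow: "\<not> primepow m \<Longrightarrow> log_coeff m = 0"
proof -
  assume np: "\<not> primepow m"
  have "x \<notin> prime_ideal_powers m" for x
    using np by (auto elim!: prime_ideal_powers_prime_power)
  hence "prime_ideal_powers m = {}" by blast
  thus "log_coeff m = 0" by (simp add: log_coeff_def)
qed

text \<open>The discrepancy between the zeta function and the product of L-series, on the level of
  logarithms. It compensates for the missing Euler factor at q and for unequal coefficients at
  proper prime powers.\<close>

definition \<delta> :: "nat \<Rightarrow> real" where "\<delta> m = log_coeff m - bd d m"

lemma \<delta>_zero:
  assumes "m \<noteq> q" "m \<notin> proper_prime_powers"
  shows "\<delta> m = 0"
proof (cases "primepow m")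
  case True
  hence m: "prime m" using primepow_cases assms(2) by blast
  show ?thesis
    using log_coeff_prime[OF m assms(1)] prime_power_weight_power[OF m, of 1] n_eq
    by (simp add: \<delta>_def bd_def)
next
  case False
  thus ?thesis using log_coeff_not_primepow by (simp add: \<delta>_def bd_def prime_power_weight_def)
qed

lemma \<delta>_le: "\<bar>\<delta> m\<bar> \<le> real n"
  using log_coeff_bounds[of m] bd_nonneg[of d m] bd_le[of d m] n_eq by (auto simp: \<delta>_def abs_if)

text \<open>Apart from q the support consists of proper prime powers, and the values are bounded by
  n. The abscissa 3/4 is one choice between 1/2 and 1; any such value gives a correction factor
  holomorphic near 1.\<close>

lemma dsummable_\<delta>: "dsummable (\<lambda>m. of_real (\<delta> m)) (3/4)"
proof -
  have "(\<lambda>m. real n * real m powr (-(3/4))) summable_on proper_prime_powers"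
    by (intro summable_on_cmult_right proper_prime_powers_summable) simp
  hence "(\<lambda>m. norm (complex_of_real (\<delta> m)) * real m powr (-(3/4))) summable_on proper_prime_powers"
    by (rule summable_on_comparison_test) (auto intro!: mult_right_mono \<delta>_le)
  hence "(\<lambda>m. norm (complex_of_real (\<delta> m)) * real m powr (-(3/4))) summable_on insert q proper_prime_powers"
    by (subst summable_on_insert_iff)
  moreover have "(\<lambda>m. norm (complex_of_real (\<delta> m)) * real m powr (-(3/4))) summable_on UNIV \<longleftrightarrow>
      (\<lambda>m. norm (complex_of_real (\<delta> m)) * real m powr (-(3/4))) summable_on insert q proper_prime_powers"
    by (rule summable_on_cong_neutral) (use \<delta>_zero in auto)
  ultimately show ?thesis unfolding dsummable_def by blast
qed

text \<open>With G(s) = (s - 1) Z(s), holomorphic and nonzero at 1, the constant is the logarithmic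
  derivative of G at 1. By continuity it is the limit from the right, where Z is the exponential of
  the logarithmic series and the derivative can be taken term by term.\<close>

theorem euler_kronecker_limit:
  assumes div: "\<not> (\<lambda>p. real p powr (-1/2)) summable_on Collect prime"
    and K: "ring_of_integers K = A"
  shows "((\<lambda>x. 1 / (of_real x - 1) - dser (\<lambda>m. of_real (log_coeff m * ln (real m))) (of_real x))
      \<longlongrightarrow> euler_kronecker K) (at_right 1)"
proof -
  let ?l = "\<lambda>m. complex_of_real (log_coeff m)"
  obtain h where h: "h holomorphic_on {s. Re s > 0}" "h 1 \<noteq> 0"
    "\<And>s. Re s > 1 \<Longrightarrow> h s = pole_factor s * exp (dser (\<lambda>m. of_real (bd d m)) s)"
    using L_product[OF div d_dvd] by blast
  obtain ee where ee: "ee holomorphic_on UNIV" "\<And>z. pole_factor z = (z - 1) * ee z" "\<And>z. \<bar>Im z\<bar> < 2 \<Longrightarrow> ee z \<noteq> 0"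
    using pole_factor_decomp by blast
  define D where "D s = dser (\<lambda>m. of_real (\<delta> m)) s" for s
  have D: "D holomorphic_on {s. Re s > 3/4}"
    unfolding D_def[abs_def] by (rule dser_holomorphic[OF dsummable_\<delta>])
  \<comment> \<open>Away from 1 this formula may fail at isolated points of the line Re s = 1,
    namely at other zeros of \<open>pole_factor\<close>; a continuation is only asked to be
    meromorphic there.\<close>
  define Z where "Z s = exp (D s) * h s / pole_factor s" for s
  define G where "G s = exp (D s) * h s / ee s" for s
  have split: "dser ?l s = D s + dser (\<lambda>m. of_real (bd d m)) s" if "Re s > 1" for s
  proof -
    have "dser (\<lambda>m. complex_of_real (\<delta> m) + of_real (bd d m)) s = D s + dser (\<lambda>m. of_real (bd d m)) s"
      unfolding D_def by (rule dser_add[OF dsummable_mono[OF dsummable_\<delta>] dsummable_bd]) (use that in auto)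
    thus ?thesis by (simp add: \<delta>_def)
  qed
  have Zexp: "Z s = exp (dser ?l s)" if s: "Re s > 1" for s
  proof -
    have "pole_factor s \<noteq> 0"
    proof
      assume "pole_factor s = 0"
      hence "exp ((1 - s) * of_real (ln 2)) = 1" by (simp add: pole_factor_exp)
      hence "norm (exp ((1 - s) * complex_of_real (ln 2))) = 1" by simp
      thus False using s by simp
    qed
    thus ?thesis by (simp add: Z_def h(3)[OF s] split[OF s] exp_add)
  qed
  have Zc: "continues_dedekind_series K Z"
    unfolding continues_dedekind_series_def
  proof
    have "(\<lambda>s. exp (D s) * h s) holomorphic_on {s. Re s > 3/4}"
      by (intro holomorphic_intros D holomorphic_on_subset[OF h(1)]) auto
    hence "(\<lambda>s. exp (D s) * h s) analytic_on {s. Re s > 3/4}" "pole_factor analytic_on {s. Re s > 3/4}"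
      by (simp_all only: analytic_on_open[OF open_halfspace_Re_gt] pole_factor_holomorphic)
    hence "Z meromorphic_on {s. Re s > 3/4}"
      unfolding Z_def[abs_def] by (intro meromorphic_on_divide analytic_on_imp_meromorphic_on)
    thus "Z meromorphic_on {s. Re s \<ge> 1}" by (rule meromorphic_on_subset) auto
    show "\<forall>s. Re s > 1 \<longrightarrow> Z s = dedekind_series K s"
      using Zexp dedekind_series_exp[OF K] by simp
  qed
  let ?B = "ball (1::complex) (1/4)"
  have B: "Re s > 3/4" "\<bar>Im s\<bar> < 2" if "s \<in> ?B" for s
  proof -
    have "1 - Re s \<le> norm (1 - s)" "\<bar>Im s\<bar> \<le> norm (1 - s)"
      using complex_Re_le_cmod[of "1 - s"] abs_Im_le_cmod[of "1 - s"] by simp_all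
    thus "Re s > 3/4" "\<bar>Im s\<bar> < 2" using that by (auto simp: dist_norm)
  qed
  have sub: "?B \<subseteq> {s. Re s > 3/4}" "?B \<subseteq> {s. Re s > 0}" using B(1) by force+
  have G: "G holomorphic_on ?B"
    unfolding G_def[abs_def] using holomorphic_on_subset[OF D sub(1)] holomorphic_on_subset[OF h(1) sub(2)]
      holomorphic_on_subset[OF ee(1)] ee(3) B(2) by (intro holomorphic_intros) auto
  have G1: "G 1 \<noteq> 0" using h(2) ee(3)[of 1] by (simp add: G_def)
  have ZG: "Z s = G s / (s - 1)" if "s \<in> ?B" "s \<noteq> 1" for s
    using that ee(3)[OF B(2)[OF that(1)]] by (simp add: Z_def G_def ee(2))
  have ek: "euler_kronecker K = deriv G 1 / G 1"
    by (rule euler_kronecker_eqI[OF Zc G _ G1 ZG]) auto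
  have "isCont (\<lambda>s. deriv G s / G s) 1"
  proof (intro continuous_divide)
    have one: "1 \<in> ?B" by simp
    show "isCont (deriv G) 1"
      using holomorphic_on_imp_continuous_on[OF holomorphic_deriv[OF G open_ball]] one
      by (simp add: continuous_on_eq_continuous_at)
    show "isCont G 1"
      using holomorphic_on_imp_continuous_on[OF G] one by (simp add: continuous_on_eq_continuous_at)
  qed (use G1 in auto)
  hence lim: "((\<lambda>s. deriv G s / G s) \<longlongrightarrow> euler_kronecker K) (at 1)"
    by (simp add: ek isCont_def)
  have "filterlim complex_of_real (at 1) (at_right 1)"
    unfolding filterlim_at
  proof
    show "(complex_of_real \<longlongrightarrow> 1) (at_right 1)"
      using tendsto_of_real[OF tendsto_ident_at[of 1 "{1<..}"], where 'a = complex] by simp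
    show "\<forall>\<^sub>F x in at_right 1. complex_of_real x \<in> UNIV \<and> complex_of_real x \<noteq> 1"
      using eventually_at_right_less[of "1::real"] by eventually_elim auto
  qed
  from filterlim_compose[OF lim this]
  have "((\<lambda>x. deriv G (of_real x) / G (of_real x)) \<longlongrightarrow> euler_kronecker K) (at_right 1)" .
  moreover have "\<forall>\<^sub>F x in at_right 1. deriv G (of_real x) / G (of_real x) =
      1 / (of_real x - 1) - dser (\<lambda>m. of_real (log_coeff m * ln (real m))) (of_real x)"
  proof -
    have "\<forall>\<^sub>F x in at_right (1::real). x \<in> {1<..<5/4}"
      by (rule eventually_at_right_real) simp
    thus ?thesis
    proof eventually_elim
      case (elim x)
      let ?s = "complex_of_real x"
      have "norm (1 - ?s) = \<bar>1 - x\<bar>" using norm_of_real[of "1 - x", where 'a = complex] by simp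
      hence s: "?s \<in> ?B \<inter> {s. Re s > 1}" using elim by (simp add: dist_norm)
      have ev: "\<forall>\<^sub>F w in nhds ?s. w \<in> ?B \<inter> {s. Re s > 1}"
        by (rule eventually_nhds_in_open) (use s in \<open>auto intro!: open_Int open_halfspace_Re_gt\<close>)
      have Geq: "G w = (w - 1) * exp (dser ?l w)" if "w \<in> ?B \<inter> {s. Re s > 1}" for w
      proof -
        have "w \<noteq> 1" using that by auto
        thus ?thesis using ZG[of w] Zexp[of w] that by (simp add: field_simps)
      qed
      have "dsummable ?l ((1 + x) / 2)" by (rule dsummable_log_coeff) (use elim in auto)
      hence dl: "(dser ?l has_field_derivative - dser (\<lambda>m. ?l m * of_real (ln (real m))) ?s) (at ?s)"
        by (rule dser_has_field_derivative) (use elim in auto)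
      have "((\<lambda>w. (w - 1) * exp (dser ?l w)) has_field_derivative
          exp (dser ?l ?s) + (?s - 1) * (exp (dser ?l ?s) * - dser (\<lambda>m. ?l m * of_real (ln (real m))) ?s)) (at ?s)"
        by (rule derivative_eq_intros refl DERIV_chain2[OF DERIV_exp dl])+ simp
      hence "deriv (\<lambda>w. (w - 1) * exp (dser ?l w)) ?s =
          exp (dser ?l ?s) + (?s - 1) * (exp (dser ?l ?s) * - dser (\<lambda>m. ?l m * of_real (ln (real m))) ?s)"
        by (rule DERIV_imp_deriv)
      moreover have "deriv G ?s = deriv (\<lambda>w. (w - 1) * exp (dser ?l w)) ?s"
        by (rule deriv_cong_ev[OF _ refl]) (use ev in \<open>eventually_elim, use Geq in auto\<close>)
      moreover have "?s - 1 \<noteq> 0" using elim by (simp add: complex_eq_iff)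
      moreover have "(E + u * (E * - v)) / (u * E) = 1 / u - v" if "E \<noteq> 0" "u \<noteq> 0" for E u v :: complex
        using that by (simp add: field_simps)
      ultimately show ?case
        by (simp only: Geq[OF s] of_real_mult exp_not_eq_zero not_False_eq_True simp_thms)
    qed
  qed
  ultimately show ?thesis by (rule Lim_transform_eventually)
qed

end

lemma square_cong_1_iff:
  fixes q N :: nat
  assumes q: "prime q" and N: "N > 0"
  shows "[N ^ 2 = 1] (mod q) \<longleftrightarrow> [N = 1] (mod q) \<or> [N = q - 1] (mod q)"
    and "[N ^ 2 = 1] (mod q) \<longleftrightarrow> q dvd N - 1 \<or> q dvd N + 1"
proof -
  obtain M where M: "N = Suc M" using N by (cases N) auto
  have "N ^ 2 - 1 = (N - 1) * (N + 1)" by (simp add: M power2_eq_square)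
  moreover have "[N ^ 2 = 1] (mod q) \<longleftrightarrow> q dvd N ^ 2 - 1"
    using N by (subst cong_altdef_nat) simp_all
  ultimately show 2: "[N ^ 2 = 1] (mod q) \<longleftrightarrow> q dvd N - 1 \<or> q dvd N + 1"
    by (simp only: prime_dvd_mult_iff[OF q])
  have a: "[N = 1] (mod q) \<longleftrightarrow> q dvd N - 1" using N by (subst cong_altdef_nat) simp_all
  have "[N = q - 1] (mod q) \<longleftrightarrow> [N + 1 = q - 1 + 1] (mod q)"
    by (rule cong_add_rcancel_nat[symmetric])
  also have "q - 1 + 1 = q" using prime_gt_0_nat[OF q] by simp
  also have "[N + 1 = q] (mod q) \<longleftrightarrow> q dvd N + 1"
    using cong_0_iff[of "N + 1" q] by (simp add: cong_def)
  finally show "[N ^ 2 = 1] (mod q) \<longleftrightarrow> [N = 1] (mod q) \<or> [N = q - 1] (mod q)" by (simp only: 2 a)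
qed

section \<open>Comparison of the cyclotomic field with its real subfield\<close>

context cyclotomic
begin

definition log_coeff_diff :: "nat \<Rightarrow> real" where
  "log_coeff_diff m = K.log_coeff m - P.log_coeff m"

lemma split_rings:
  "\<exists>g. split_ring R (q - 1) (\<lambda>i. z ^ i) q (q - 1) g 1 \<and> split_ring Rp np eta q (q - 1) g 2"
proof -
  obtain g where g: "residue_primroot q g" using prime_primitive_root_exists[of q] q prime_gt_1_nat by blast
  have chars: "dirichlet_characters q (q - 1) g"
    by unfold_locales (use q g prime_gt_0_nat[of q] in simp_all)
  have 1: "split_ring R (q - 1) (\<lambda>i. z ^ i) q (q - 1) g 1"
  proof (intro split_ring.intro split_ring_axioms.intro)
    show "number_ring R (q - 1) (\<lambda>i. z ^ i)" by (rule K.number_ring_axioms)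
    show "[idx R P ^ 1 = 1] (mod q)" if "K.maxid P" "of_nat q \<notin> P" for P
      using K_norm_cong[OF that] K.maxid_idx_gt_1[OF that(1)] by (simp add: cong_altdef_nat)
    show "idx R P = p" if "prime p" "[p ^ 1 = 1] (mod q)" "P \<in> K.primes_over p" for p P
      using K_split(1)[of p P] that by simp
    show "card (K.primes_over p) = q - 1" if "prime p" "[p ^ 1 = 1] (mod q)" for p
      using K_split(2)[of p] that by simp
  qed (use chars K_ramified in auto)
  have 2: "split_ring Rp np eta q (q - 1) g 2"
  proof (intro split_ring.intro split_ring_axioms.intro)
    show "number_ring Rp np eta" by (rule P.number_ring_axioms)
    show "[idx Rp Q ^ 2 = 1] (mod q)" if "P.maxid Q" "of_nat q \<notin> Q" for Q
      using P_norm_cong[OF that] P.maxid_idx_gt_1[OF that(1)] square_cong_1_iff(2)[OF q(1)] by simp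
    show "idx Rp Q = p" if "prime p" "[p ^ 2 = 1] (mod q)" "Q \<in> P.primes_over p" for p Q
      using P_split(1)[of p Q] that square_cong_1_iff(1)[OF q(1) prime_gt_0_nat[OF that(1)]] by simp
    show "card (P.primes_over p) = np" if "prime p" "[p ^ 2 = 1] (mod q)" for p
      using P_split(2)[of p] that square_cong_1_iff(1)[OF q(1) prime_gt_0_nat[OF that(1)]] by simp
    show "2 dvd q - 1" "np = (q - 1) div 2" by (simp_all only: q_pred(1)) simp_all
  qed (use chars P_ramified in auto)
  show ?thesis using 1 2 by blast
qed

lemma log_coeff_diff_le: "\<bar>log_coeff_diff m\<bar> \<le> real q"
proof -
  have "real (q - 1) \<le> real q" "real np \<le> real q" using q_pred(1) by linarith+
  thus ?thesis
    using K.log_coeff_bounds[of m] P.log_coeff_bounds[of m] by (simp only: log_coeff_diff_def abs_le_iff) linarith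
qed

text \<open>The difference is 2 np - np at p = 1 and 0 - np at p = -1 modulo q. The prime q drops
  out, having one prime of norm q above it in both rings.\<close>

lemma log_coeff_diff_prime:
  assumes p: "prime p"
  shows "log_coeff_diff p = real np * (of_bool ([p = 1] (mod q)) - of_bool ([p = q - 1] (mod q)))"
proof -
  obtain g where "split_ring R (q - 1) (\<lambda>i. z ^ i) q (q - 1) g 1" "split_ring Rp np eta q (q - 1) g 2"
    using split_rings by blast
  then interpret S1: split_ring R "q - 1" "\<lambda>i. z ^ i" q "q - 1" g 1 + S2: split_ring Rp np eta q "q - 1" g 2 .
  have not: "\<not> ([p = 1] (mod q) \<and> [p = q - 1] (mod q))"
  proof
    assume "[p = 1] (mod q) \<and> [p = q - 1] (mod q)"
    hence "[1 = q - 1] (mod q)" using cong_trans cong_sym by blast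
    hence "1 = q - 1" by (rule cong_less_modulus_unique_nat) (use q_gt in auto)
    thus False using q_gt by simp
  qed
  show ?thesis
  proof (cases "p = q")
    case True
    have "\<not> [q = 1] (mod q)" "\<not> [q = q - 1] (mod q)"
      using q_gt by (auto simp: cong_def)
    thus ?thesis
      using S1.log_coeff_q_power[of 1] S2.log_coeff_q_power[of 1] True by (simp add: log_coeff_diff_def)
  next
    case False
    have r: "real (q - 1) = 2 * real np" by (simp only: q_pred(1))
    have "K.log_coeff p = (if [p = 1] (mod q) then 2 * real np else 0)"
      using S1.log_coeff_prime[OF p False] unfolding power_one_right r .
    moreover have "P.log_coeff p = (if [p = 1] (mod q) \<or> [p = q - 1] (mod q) then real np else 0)"
      using S2.log_coeff_prime[OF p False] unfolding square_cong_1_iff(1)[OF q(1) prime_gt_0_nat[OF p]] .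
    ultimately show ?thesis
      unfolding log_coeff_diff_def using not
      by (cases "[p = 1] (mod q)"; cases "[p = q - 1] (mod q)") simp_all
  qed
qed

text \<open>Powers of q cancel, both coefficients being 1/k there. At other prime powers a nonzero
  coefficient in either field forces m^2 = 1 modulo q.\<close>

lemma log_coeff_diff_nonzero:
  assumes "log_coeff_diff m \<noteq> 0" "\<not> prime m"
  shows "m \<in> proper_prime_powers \<and> (q dvd m - 1 \<or> q dvd m + 1)"
proof -
  obtain g where "split_ring R (q - 1) (\<lambda>i. z ^ i) q (q - 1) g 1" "split_ring Rp np eta q (q - 1) g 2"
    using split_rings by blast
  then interpret S1: split_ring R "q - 1" "\<lambda>i. z ^ i" q "q - 1" g 1 + S2: split_ring Rp np eta q "q - 1" g 2 .
  have "primepow m"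
    using assms(1) S1.log_coeff_not_primepow S2.log_coeff_not_primepow by (force simp: log_coeff_diff_def)
  then obtain p k where pk: "prime p" "k > 0" "m = p ^ k" by (auto simp: primepow_def)
  have PP: "m \<in> proper_prime_powers" using primepow_cases \<open>primepow m\<close> assms(2) by blast
  have "p \<noteq> q"
    using assms(1) pk S1.log_coeff_q_power[OF pk(2)] S2.log_coeff_q_power[OF pk(2)] by (auto simp: log_coeff_diff_def)
  have m: "m > 0" using pk prime_gt_0_nat by simp
  have "[m ^ 2 = 1] (mod q)"
  proof (cases "K.log_coeff m = 0")
    case True
    hence "P.log_coeff m \<noteq> 0" using assms(1) by (simp add: log_coeff_diff_def)
    thus ?thesis using S2.log_coeff_nonzero[OF pk(1) \<open>p \<noteq> q\<close> pk(2)] pk(3) by simp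
  next
    case False
    hence "[m = 1] (mod q)" using S1.log_coeff_nonzero[OF pk(1) \<open>p \<noteq> q\<close> pk(2)] pk(3) by simp
    thus ?thesis using square_cong_1_iff(1)[OF q(1) m] by blast
  qed
  thus ?thesis using PP square_cong_1_iff(2)[OF q(1) m] by blast
qed

lemma log_coeff_diff_summable:
  assumes "\<sigma> > 1"
  shows "(\<lambda>m. \<bar>log_coeff_diff m\<bar> * ln (real m) * real m powr (-\<sigma>)) summable_on UNIV"
proof -
  have "dsummable (\<lambda>m. of_real (log_coeff_diff m)) ((1 + \<sigma>) / 2)"
    by (rule dsummable_bounded[of _ "real q"]) (use log_coeff_diff_le assms in auto)
  from dsummable_ln[OF this, of \<sigma>] assms
  have "dsummable (\<lambda>m. of_real (log_coeff_diff m) * of_real (ln (real m))) \<sigma>" by simp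
  moreover have "norm (complex_of_real (log_coeff_diff m) * of_real (ln (real m))) = \<bar>log_coeff_diff m\<bar> * ln (real m)" for m
    by (cases "m = 0") (auto simp: norm_mult)
  ultimately show ?thesis by (simp add: dsummable_def)
qed

text \<open>The polar terms 1/(x - 1) cancel. Each series enters its own constant with a minus sign,
  so \<gamma>^+ - \<gamma> yields the coefficients of the cyclotomic field minus those of the real
  one.\<close>

theorem euler_kronecker_difference:
  assumes div: "\<not> (\<lambda>p. real p powr (-1/2)) summable_on Collect prime"
  shows "((\<lambda>\<sigma>. of_real (\<Sum>\<^sub>\<infinity>m. log_coeff_diff m * ln (real m) * real m powr (-\<sigma>)))
     \<longlongrightarrow> gamma_cyc_plus q - gamma_cyc q) (at_right 1)"
proof -
  obtain g where "split_ring R (q - 1) (\<lambda>i. z ^ i) q (q - 1) g 1" "split_ring Rp np eta q (q - 1) g 2"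
    using split_rings by blast
  then interpret S1: split_ring R "q - 1" "\<lambda>i. z ^ i" q "q - 1" g 1 + S2: split_ring Rp np eta q "q - 1" g 2 .
  have "((\<lambda>x. (1 / (of_real x - 1) - dser (\<lambda>m. of_real (P.log_coeff m * ln (real m))) (of_real x))
      - (1 / (of_real x - 1) - dser (\<lambda>m. of_real (K.log_coeff m * ln (real m))) (of_real x)))
      \<longlongrightarrow> gamma_cyc_plus q - gamma_cyc q) (at_right 1)"
    unfolding gamma_cyc_def gamma_cyc_plus_def
    by (intro tendsto_diff S1.euler_kronecker_limit[OF div ring_of_integers_K] S2.euler_kronecker_limit[OF div ring_of_integers_P])
  moreover have "\<forall>\<^sub>F x in at_right 1.
      (1 / (of_real x - 1) - dser (\<lambda>m. of_real (P.log_coeff m * ln (real m))) (of_real x))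
      - (1 / (of_real x - 1) - dser (\<lambda>m. of_real (K.log_coeff m * ln (real m))) (of_real x))
      = of_real (\<Sum>\<^sub>\<infinity>m. log_coeff_diff m * ln (real m) * real m powr (-x))"
    using eventually_at_right_less[of "1::real"]
  proof eventually_elim
    case (elim x)
    have dK: "dsummable (\<lambda>m. of_real (K.log_coeff m * ln (real m))) (Re (of_real x))"
      using dsummable_ln[OF K.dsummable_log_coeff[of "(1 + x) / 2"], of x] elim by simp
    have dP: "dsummable (\<lambda>m. of_real (P.log_coeff m * ln (real m))) (Re (of_real x))"
      using dsummable_ln[OF P.dsummable_log_coeff[of "(1 + x) / 2"], of x] elim by simp
    have "(\<lambda>m. log_coeff_diff m * ln (real m) * real m powr (-x)) summable_on UNIV"
    proof (rule abs_summable_summable)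
      have "norm (log_coeff_diff m * ln (real m) * real m powr (-x)) = \<bar>log_coeff_diff m\<bar> * ln (real m) * real m powr (-x)" for m
        by (cases "m = 0") (auto simp: abs_mult)
      thus "(\<lambda>m. norm (log_coeff_diff m * ln (real m) * real m powr (-x))) summable_on UNIV"
        using log_coeff_diff_summable[OF elim] by simp
    qed
    from dser_of_real[OF this] dser_diff[OF dK dP] show ?case
      by (simp add: log_coeff_diff_def left_diff_distrib)
  qed
  ultimately show ?thesis by (rule Lim_transform_eventually)
qed

end

section \<open>Chebyshev's lower bound\<close>

definition psi :: "nat \<Rightarrow> real" where "psi m = (\<Sum>d\<in>{1..m}. mangoldt d)"

lemma psi_mono: "m \<le> n \<Longrightarrow> psi m \<le> psi n"
  unfolding psi_def by (rule sum_mono2) (auto simp: mangoldt_nonneg)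

lemma psi_diff:
  assumes "m \<le> N"
  shows "psi N - psi m = (\<Sum>d\<in>{m<..N}. mangoldt d)"
proof -
  have eq: "{1..N} = {1..m} \<union> {m<..N}" using assms by auto
  have "psi N = psi m + (\<Sum>d\<in>{m<..N}. mangoldt d)"
    unfolding psi_def eq by (rule sum.union_disjoint) auto
  thus ?thesis by simp
qed

text \<open>Legendre's formula. The summation range goes up to an arbitrary N \<ge> n, so that the
  formulas for n and 2n can be subtracted term by term.\<close>

lemma ln_fact_mangoldt:
  "n \<le> N \<Longrightarrow> ln (fact n) = (\<Sum>d\<in>{1..N}. mangoldt d * real (n div d))"
proof (induction n)
  case (Suc n)
  have "ln (real (Suc n)) = (\<Sum>d | d dvd Suc n. mangoldt d)"
    using mangoldt_sum[of "Suc n", where 'a = real] by simp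
  also have "\<dots> = (\<Sum>d\<in>{1..N}. if d dvd Suc n then mangoldt d else 0)"
  proof -
    have "{d. d dvd Suc n} = {1..N} \<inter> {d. d dvd Suc n}"
      using Suc.prems dvd_imp_le[of _ "Suc n"] by (force intro!: Suc_leI Nat.gr0I)
    hence "(\<Sum>d | d dvd Suc n. mangoldt d) = (\<Sum>d\<in>{1..N} \<inter> {d. d dvd Suc n}. mangoldt d :: real)" by (rule arg_cong)
    also have "\<dots> = (\<Sum>d\<in>{1..N}. if d dvd Suc n then mangoldt d else 0)"
      by (subst sum.inter_restrict) simp_all
    finally show ?thesis .
  qed
  finally have "ln (fact (Suc n) :: real) = (\<Sum>d\<in>{1..N}. if d dvd Suc n then mangoldt d else 0)
      + (\<Sum>d\<in>{1..N}. mangoldt d * real (n div d))"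
    using Suc by (simp add: ln_mult)
  also have "\<dots> = (\<Sum>d\<in>{1..N}. mangoldt d * real (Suc n div d))"
    unfolding sum.distrib[symmetric]
    by (rule sum.cong) (auto simp: div_Suc dvd_eq_mod_eq_0 algebra_simps)
  finally show ?case .
qed simp

lemma ln_central_binomial:
  "ln (real (2 * n choose n)) = (\<Sum>d\<in>{1..2*n}. mangoldt d * (real (2 * n div d) - 2 * real (n div d)))"
proof -
  have "real (2 * n choose n) = fact (2 * n) / (fact n * fact n)"
    using binomial_fact[of n "2 * n", where 'a = real] by (simp add: mult_2)
  hence "ln (real (2 * n choose n)) = ln (fact (2 * n)) - 2 * ln (fact n)"
    by (simp add: ln_div ln_mult)
  also have "\<dots> = (\<Sum>d\<in>{1..2*n}. mangoldt d * (real (2 * n div d) - 2 * real (n div d)))"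
    using ln_fact_mangoldt[of "2*n" "2*n"] ln_fact_mangoldt[of n "2*n"]
    by (simp add: sum_distrib_left sum_subtractf algebra_simps)
  finally show ?thesis .
qed

lemma double_div_bounds:
  fixes n d :: nat
  shows "2 * (n div d) \<le> 2 * n div d" "2 * n div d \<le> 2 * (n div d) + 1"
proof -
  show "2 * (n div d) \<le> 2 * n div d"
    by (cases "d = 0") (auto simp: less_eq_div_iff_mult_less_eq algebra_simps)
  show "2 * n div d \<le> 2 * (n div d) + 1"
  proof (cases "d = 0")
    case False
    have "n < (n div d + 1) * d" using False by (metis Suc_eq_plus1 dividend_less_div_times mult_Suc neq0_conv add.commute)
    hence "2 * n < (2 * (n div d) + 2) * d" by (simp add: algebra_simps)
    hence "2 * n div d < 2 * (n div d) + 2" by (rule less_mult_imp_div_less)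
    thus ?thesis by simp
  qed simp
qed

text \<open>In the logarithm of the central binomial coefficient, d has weight floor(2n/d) - 2
  floor(n/d), which is 0 or 1. Weight 1 on (n, 2n] gives the upper bound. For the lower bound only
  (n, 2n] and d \<le> 2n/3 can contribute, and the coefficient is at least 4^n / (2n).\<close>

lemma psi_doubling:
  "psi (2 * n) - psi n \<le> 2 * real n * ln 2"
  "n > 0 \<Longrightarrow> 2 * real n * ln 2 - ln (2 * real n) \<le> psi (2 * n) - psi n + psi (2 * n div 3)"
proof -
  define c where "c d = real (2 * n div d) - 2 * real (n div d)" for d
  have c: "0 \<le> c d" "c d \<le> 1" for d
    using double_div_bounds[of n d] by (simp_all add: c_def)
  have c_large: "c d = 1" if "n < d" "d \<le> 2 * n" for d
  proof -
    have "2 * n div d \<ge> 1" using that by (simp add: div_greater_zero_iff Suc_le_eq)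
    moreover have "n div d = 0" using that by simp
    ultimately show ?thesis using double_div_bounds[of n d] by (simp add: c_def)
  qed
  \<comment> \<open>On this range floor(2n/d) = 2 and floor(n/d) = 1.\<close>
  have c_mid: "c d = 0" if "2 * n div 3 < d" "d \<le> n" for d
  proof -
    have "2 * n < 3 * d" using that by (metis div_less_iff_less_mult mult.commute zero_less_numeral)
    hence "2 * n div d < 3" by (simp add: less_mult_imp_div_less mult.commute)
    moreover have "1 \<le> n div d" using that by (simp add: div_greater_zero_iff Suc_le_eq)
    ultimately have "2 * n div d = 2" "n div d = 1" using double_div_bounds[of n d] by linarith+
    thus ?thesis by (simp add: c_def)
  qed
  have split: "psi (2 * n) - psi n = (\<Sum>d\<in>{n<..2*n}. mangoldt d)" by (rule psi_diff) simp
  have eq: "ln (real (2 * n choose n)) = (\<Sum>d\<in>{1..2*n}. mangoldt d * c d)"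
    unfolding ln_central_binomial c_def ..
  show "psi (2 * n) - psi n \<le> 2 * real n * ln 2"
  proof -
    have "(\<Sum>d\<in>{n<..2*n}. mangoldt d) = (\<Sum>d\<in>{n<..2*n}. mangoldt d * c d)"
      by (rule sum.cong) (use c_large in auto)
    also have "\<dots> \<le> (\<Sum>d\<in>{1..2*n}. mangoldt d * c d)"
      by (rule sum_mono2) (use c in \<open>auto simp: mangoldt_nonneg\<close>)
    also have "\<dots> \<le> ln (2 ^ (2 * n))"
    proof -
      have "real (2 * n choose n) \<le> 2 ^ (2 * n)"
        using of_nat_mono[OF binomial_le_pow2[of "2 * n" n], where 'a = real] by simp
      moreover have "real (2 * n choose n) > 0" by simp
      ultimately show ?thesis unfolding eq[symmetric] by (intro ln_mono) auto
    qed
    finally show ?thesis unfolding split by (simp add: ln_realpow)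
  qed
  assume n: "n > 0"
  have "2 * real n * ln 2 - ln (2 * real n) = ln (4 ^ n / (2 * real n))"
  proof -
    have "ln (4 ^ n :: real) = real n * ln (2 ^ 2)" by (subst ln_realpow) simp_all
    also have "ln (2 ^ 2 :: real) = 2 * ln 2" by (subst ln_realpow) simp_all
    finally have "ln (4 ^ n :: real) = 2 * real n * ln 2" by simp
    moreover have "ln (4 ^ n / (2 * real n)) = ln (4 ^ n) - ln (2 * real n)"
      using n by (simp add: ln_div)
    ultimately show ?thesis by simp
  qed
  also have "\<dots> \<le> ln (real (2 * n choose n))"
    using central_binomial_lower_bound[OF n] n by (intro ln_mono) auto
  also have "\<dots> = (\<Sum>d\<in>{1..2*n}. mangoldt d * c d)" by (rule eq)
  also have "\<dots> \<le> (\<Sum>d\<in>{n<..2*n} \<union> {1..2*n div 3}. mangoldt d)"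
  proof -
    have "(\<Sum>d\<in>{1..2*n}. mangoldt d * c d) = (\<Sum>d\<in>{n<..2*n} \<union> {1..2*n div 3}. mangoldt d * c d)"
    proof (rule sum.mono_neutral_right)
      show "\<forall>d\<in>{1..2*n} - ({n<..2*n} \<union> {1..2*n div 3}). mangoldt d * c d = 0"
      proof
        fix d assume "d \<in> {1..2*n} - ({n<..2*n} \<union> {1..2*n div 3})"
        hence "2 * n div 3 < d" "d \<le> n" by auto
        thus "mangoldt d * c d = 0" using c_mid by simp
      qed
    qed auto
    also have "\<dots> \<le> (\<Sum>d\<in>{n<..2*n} \<union> {1..2*n div 3}. mangoldt d)"
      by (rule sum_mono) (use c in \<open>auto simp: mangoldt_nonneg intro!: mult_left_le\<close>)
    finally show ?thesis .
  qed
  also have "\<dots> = psi (2 * n) - psi n + psi (2 * n div 3)"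
    unfolding split psi_def[of "2 * n div 3"] by (rule sum.union_disjoint) auto
  finally show "2 * real n * ln 2 - ln (2 * real n) \<le> psi (2 * n) - psi n + psi (2 * n div 3)" .
qed

text \<open>Repeated halving alone would suggest 2 ln 2; the excess 1/2 ln 2 pays for the logarithm
  of the odd step. The constant has to stay below 3 ln 2, because in \<open>psi_dyadic_lower\<close>
  it enters as 2 ln 2 minus two thirds of it, here ln 2 / 3.\<close>

lemma psi_upper: "\<exists>D. \<forall>m. psi m \<le> 5/2 * ln 2 * real m + D"
proof -
  have "\<forall>\<^sub>F m in sequentially. ln (real m) \<le> ln 2 / 4 * real m" by real_asymp
  then obtain M where M: "\<And>m. m \<ge> M \<Longrightarrow> ln (real m) \<le> ln 2 / 4 * real m" by (auto simp: eventually_sequentially)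
  have "psi m \<le> 5/2 * ln 2 * real m + psi (M + 1)" for m
  proof (induction m rule: less_induct)
    case (less m)
    show ?case
    proof (cases "m \<le> M + 1")
      case True
      thus ?thesis using psi_mono[OF True] by (simp add: add_increasing)
    next
      case False
      define n where "n = m div 2"
      have n: "n < m" "2 * n \<le> m" "m \<le> 2 * n + 1" using False by (auto simp: n_def)
      have "psi m \<le> psi (2 * n) + ln (real m)"
      proof (cases "m = 2 * n")
        case False
        hence "m = Suc (2 * n)" using n by simp
        hence "psi m = psi (2 * n) + mangoldt m" by (simp add: psi_def)
        thus ?thesis using mangoldt_le[of m] \<open>m = Suc (2 * n)\<close> by simp
      qed (use False in simp)
      also have "psi (2 * n) \<le> psi n + 2 * real n * ln 2" using psi_doubling(1)[of n] by simp
      also have "psi n \<le> 5/2 * ln 2 * real n + psi (M + 1)" by (rule less.IH[OF n(1)])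
      also have "ln (real m) \<le> ln 2 / 4 * real m" by (rule M) (use False in simp)
      finally have "psi m \<le> (9/2 * real n) * ln 2 + ln 2 / 4 * real m + psi (M + 1)" by (simp add: algebra_simps)
      also have "(9/2 * real n) * ln 2 \<le> (9/4 * real m) * ln 2"
        using n(2) by (intro mult_right_mono) auto
      finally show ?thesis by (simp add: algebra_simps)
    qed
  qed
  thus ?thesis by blast
qed

lemma psi_dyadic_lower: "\<exists>D. \<forall>n>0. psi (2 * n) - psi n \<ge> ln 2 / 3 * real n - ln (2 * real n) - D"
proof -
  obtain D where D: "\<And>m. psi m \<le> 5/2 * ln 2 * real m + D" using psi_upper by blast
  have "psi (2 * n) - psi n \<ge> ln 2 / 3 * real n - ln (2 * real n) - D" if "n > 0" for n
  proof -
    have "real (2 * n div 3) \<le> 2 * real n / 3" by linarith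
    hence "5/2 * ln 2 * real (2 * n div 3) \<le> 5/2 * ln 2 * (2 * real n / 3)" by (rule mult_left_mono) auto
    also have "\<dots> = 5/3 * (ln 2 * real n)" by simp
    finally have "psi (2 * n div 3) \<le> 5/3 * (ln 2 * real n) + D" using D[of "2 * n div 3"] by linarith
    moreover have "2 * (ln 2 * real n) - ln (2 * real n) \<le> psi (2 * n) - psi n + psi (2 * n div 3)"
      using psi_doubling(2)[OF that] by (simp add: mult_ac)
    moreover have "ln 2 / 3 * real n = (ln 2 * real n) / 3" by simp
    ultimately show ?thesis by linarith
  qed
  thus ?thesis by blast
qed

text \<open>Rankin's trick: up to N each member contributes at least N^(-3/4) to a convergent
  sum.\<close>

lemma proper_prime_powers_count:
  "\<exists>C\<ge>0. \<forall>N. real (card (proper_prime_powers \<inter> {1..N})) \<le> C * real N powr (3/4)"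
proof -
  let ?f = "\<lambda>m. real m powr (-(3/4))"
  define C where "C = infsum ?f proper_prime_powers"
  have sm: "?f summable_on proper_prime_powers" by (rule proper_prime_powers_summable) simp
  have "real (card (proper_prime_powers \<inter> {1..N})) \<le> C * real N powr (3/4)" for N
  proof -
    have "(\<Sum>m\<in>proper_prime_powers \<inter> {1..N}. real N powr (-(3/4))) \<le> (\<Sum>m\<in>proper_prime_powers \<inter> {1..N}. ?f m)"
      by (intro sum_mono powr_mono2') auto
    also have "\<dots> \<le> C"
      unfolding C_def by (rule finite_sum_le_infsum[OF sm]) auto
    finally have "real (card (proper_prime_powers \<inter> {1..N})) * real N powr (-(3/4)) \<le> C" by simp
    thus ?thesis by (cases "N = 0") (simp_all add: powr_minus field_simps)
  qed
  moreover have "C \<ge> 0" unfolding C_def by (rule infsum_nonneg) simp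
  ultimately show ?thesis by blast
qed

abbreviation dyadic_primes :: "nat \<Rightarrow> nat set" where
  "dyadic_primes n \<equiv> {p \<in> {n<..2*n}. prime p}"

lemma dyadic_primes_lower:
  "\<exists>c>0. \<forall>\<^sub>F n in sequentially. real (card (dyadic_primes n)) \<ge> c * real n / ln (real n)"
proof -
  obtain D where D: "\<And>n. n > 0 \<Longrightarrow> psi (2 * n) - psi n \<ge> ln 2 / 3 * real n - ln (2 * real n) - D"
    using psi_dyadic_lower by blast
  obtain C where C: "C \<ge> 0" "\<And>N. real (card (proper_prime_powers \<inter> {1..N})) \<le> C * real N powr (3/4)"
    using proper_prime_powers_count by blast
  have main: "real (card (dyadic_primes n)) * ln (2 * real n) \<ge>
      ln 2 / 3 * real n - ln (2 * real n) - D - C * (2 * real n) powr (3/4) * ln (2 * real n)" if n: "n > 0" for n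
  proof -
    have le: "mangoldt d \<le> ln (2 * real n)" if "d \<in> {n<..2*n}" for d
    proof -
      have "mangoldt d \<le> ln (real d)" using that by (intro mangoldt_le) auto
      also have "ln (real d) \<le> ln (2 * real n)" using that n by (intro ln_mono) auto
      finally show ?thesis .
    qed
    have "psi (2 * n) - psi n = (\<Sum>d\<in>{n<..2*n}. mangoldt d)" by (rule psi_diff) simp
    also have "\<dots> = (\<Sum>d\<in>dyadic_primes n \<union> (proper_prime_powers \<inter> {n<..2*n}). mangoldt d)"
    proof (rule sum.mono_neutral_right)
      show "\<forall>d\<in>{n<..2*n} - (dyadic_primes n \<union> (proper_prime_powers \<inter> {n<..2*n})). mangoldt d = (0::real)"
      proof
        fix d assume d: "d \<in> {n<..2*n} - (dyadic_primes n \<union> (proper_prime_powers \<inter> {n<..2*n}))"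
        have "\<not> primepow d" using primepow_cases[of d] d by auto
        thus "mangoldt d = (0::real)" by (simp add: mangoldt_def)
      qed
    qed auto
    also have "\<dots> \<le> (\<Sum>d\<in>dyadic_primes n \<union> (proper_prime_powers \<inter> {n<..2*n}). ln (2 * real n))"
      by (rule sum_mono) (use le in auto)
    also have "\<dots> = real (card (dyadic_primes n \<union> (proper_prime_powers \<inter> {n<..2*n}))) * ln (2 * real n)" by simp
    also have "\<dots> \<le> (real (card (dyadic_primes n)) + C * (2 * real n) powr (3/4)) * ln (2 * real n)"
    proof (rule mult_right_mono)
      have "card (dyadic_primes n \<union> (proper_prime_powers \<inter> {n<..2*n})) \<le> card (dyadic_primes n) + card (proper_prime_powers \<inter> {n<..2*n})"
        by (rule card_Un_le)
      also have "card (proper_prime_powers \<inter> {n<..2*n}) \<le> card (proper_prime_powers \<inter> {1..2*n})"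
        by (rule card_mono) auto
      finally show "real (card (dyadic_primes n \<union> (proper_prime_powers \<inter> {n<..2*n})))
          \<le> real (card (dyadic_primes n)) + C * (2 * real n) powr (3/4)"
        using C(2)[of "2*n"] by simp
      show "0 \<le> ln (2 * real n)" using n by simp
    qed
    finally show ?thesis using D[OF n] by (simp add: algebra_simps)
  qed
  \<comment> \<open>All terms except (ln 2 / 3) n, which is at least n/5, are o(n). Granting them
    n/10 leaves n/10, and ln(2n) \<le> 2 ln n then costs another factor 2: hence the constant
    1/20.\<close>
  have "((\<lambda>n. ln (2 * real n) / real n + D * (1 / real n) + C * ((2 * real n) powr (3/4) * ln (2 * real n) / real n))
      \<longlongrightarrow> 0 + D * 0 + C * 0) sequentially"
    by (intro tendsto_add tendsto_mult tendsto_const; real_asymp)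
  hence "\<forall>\<^sub>F n in sequentially. ln (2 * real n) / real n + D * (1 / real n)
      + C * ((2 * real n) powr (3/4) * ln (2 * real n) / real n) < 1 / 10"
    by (rule order_tendstoD) simp
  hence "\<forall>\<^sub>F n in sequentially. real (card (dyadic_primes n)) \<ge> 1 / 20 * real n / ln (real n)"
    using eventually_ge_at_top[of 2]
  proof eventually_elim
    case (elim n)
    have n: "real n \<ge> 2" "ln (real n) > 0" "ln (2 * real n) > 0" using elim by simp_all
    have "ln (2 * real n) + D + C * (2 * real n) powr (3/4) * ln (2 * real n) =
        (ln (2 * real n) / real n + D * (1 / real n) + C * ((2 * real n) powr (3/4) * ln (2 * real n) / real n)) * real n"
      using n by (simp add: field_simps)
    also have "\<dots> \<le> 1 / 10 * real n" by (rule mult_right_mono) (use elim in auto)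
    finally have small: "ln (2 * real n) + D + C * (2 * real n) powr (3/4) * ln (2 * real n) \<le> 1 / 10 * real n" .
    have "2/3 * real n \<le> ln 2 * real n" by (rule mult_right_mono[OF ln2_ge_two_thirds]) simp
    moreover have "ln 2 / 3 * real n = (ln 2 * real n) / 3" by simp
    moreover have "n > 0" using elim by simp
    note main[OF this]
    ultimately have "1 / 10 * real n \<le> real (card (dyadic_primes n)) * ln (2 * real n)"
      using small by linarith
    moreover have "1 / 20 * real n / ln (real n) * ln (2 * real n) \<le> 1 / 10 * real n"
    proof -
      have "ln (2 * real n) = ln 2 + ln (real n)" using n by (simp add: ln_mult)
      also have "\<dots> \<le> 2 * ln (real n)" using n by simp
      finally have "1 / 20 * real n / ln (real n) * ln (2 * real n) \<le> 1 / 20 * real n / ln (real n) * (2 * ln (real n))"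
        using n by (intro mult_left_mono) auto
      thus ?thesis using n by simp
    qed
    ultimately have "1 / 20 * real n / ln (real n) * ln (2 * real n) \<le> real (card (dyadic_primes n)) * ln (2 * real n)"
      by linarith
    thus ?case using n(3) by (simp only: mult_le_cancel_right_pos)
  qed
  thus ?thesis by (intro exI[of _ "1/20"]) simp
qed

theorem prime_count_star_lower:
  "\<exists>c>0. \<forall>\<^sub>F Q in at_top. prime_count_star Q \<ge> c * Q / ln Q"
proof -
  obtain c where c: "c > 0" "\<forall>\<^sub>F n in sequentially. real (card (dyadic_primes n)) \<ge> c * real n / ln (real n)"
    using dyadic_primes_lower by blast
  have "filterlim (\<lambda>Q::real. nat \<lfloor>Q / 2\<rfloor>) sequentially at_top" by real_asymp
  with c(2) have "\<forall>\<^sub>F Q::real in at_top. real (card (dyadic_primes (nat \<lfloor>Q / 2\<rfloor>))) \<ge> c * real (nat \<lfloor>Q / 2\<rfloor>) / ln (real (nat \<lfloor>Q / 2\<rfloor>))"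
    by (rule eventually_compose_filterlim)
  hence "\<forall>\<^sub>F Q in at_top. prime_count_star Q \<ge> c / 3 * Q / ln Q"
    using eventually_ge_at_top[of 6]
  proof eventually_elim
    case (elim Q)
    define n where "n = nat \<lfloor>Q / 2\<rfloor>"
    have n: "real n \<le> Q / 2" "Q / 2 < real n + 1" "n \<ge> 3"
      using elim unfolding n_def by linarith+
    let ?A = "\<lambda>x. {p::nat. prime p \<and> real p \<le> x}"
    have fin: "finite (?A x)" for x
      by (rule finite_subset[of _ "{..nat \<lfloor>x\<rfloor>}"]) (auto simp: le_nat_floor)
    have sub: "dyadic_primes n \<subseteq> ?A Q - ?A (Q / 2)" using n by auto
    have "card (dyadic_primes n) \<le> card (?A Q - ?A (Q / 2))" by (rule card_mono) (use fin sub in auto)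
    also have "\<dots> = card (?A Q) - card (?A (Q / 2))"
      by (rule card_Diff_subset[OF fin]) (use elim in auto)
    finally have "card (dyadic_primes n) \<le> card (?A Q) - card (?A (Q / 2))" .
    moreover have "card (?A (Q / 2)) \<le> card (?A Q)" by (rule card_mono[OF fin]) (use elim in auto)
    ultimately have "real (card (dyadic_primes n)) \<le> prime_count_star Q"
      unfolding prime_count_star_def prime_count_def by linarith
    moreover have "c / 3 * Q / ln Q \<le> c * real n / ln (real n)"
    proof (rule frac_le)
      \<comment> \<open>The integer part of Q/2 is at least Q/3 because Q \<ge> 6.\<close>
      show "c / 3 * Q \<le> c * real n" using n c(1) elim by (simp add: field_simps)
      show "0 < ln (real n)" using n by simp
      show "ln (real n) \<le> ln Q" using n elim by (intro ln_mono) auto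
    qed (use c n in auto)
    ultimately show ?case using elim unfolding n_def by linarith
  qed
  thus ?thesis using c(1) by (intro exI[of _ "c/3"]) auto
qed

text \<open>A single dyadic block already contributes on the order of sqrt n / log n. The result
  supplies the divergence that the nonvanishing of the L-functions depends on.\<close>

theorem primes_inverse_sqrt_not_summable:
  "\<not> (\<lambda>p. real p powr (-1/2)) summable_on Collect prime"
proof
  assume sm: "(\<lambda>p. real p powr (-1/2)) summable_on Collect prime"
  define S where "S = (\<Sum>\<^sub>\<infinity>p\<in>Collect prime. real p powr (-1/2))"
  obtain c where c: "c > 0" "\<forall>\<^sub>F n in sequentially. real (card (dyadic_primes n)) \<ge> c * real n / ln (real n)"
    using dyadic_primes_lower by blast
  have le: "real (card (dyadic_primes n)) * (2 * real n) powr (-1/2) \<le> S" for n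
  proof -
    have "(\<Sum>p\<in>dyadic_primes n. (2 * real n) powr (-1/2)) \<le> (\<Sum>p\<in>dyadic_primes n. real p powr (-1/2))"
      by (intro sum_mono powr_mono2') auto
    also have "\<dots> \<le> S" unfolding S_def by (rule finite_sum_le_infsum[OF sm]) auto
    finally show ?thesis by simp
  qed
  have "\<forall>\<^sub>F n in sequentially. c * real n / ln (real n) * (2 * real n) powr (-1/2) > S"
    using c(1) by real_asymp
  with c(2) have "\<forall>\<^sub>F n in sequentially. False"
  proof eventually_elim
    case (elim n)
    have "c * real n / ln (real n) * (2 * real n) powr (-1/2) \<le> real (card (dyadic_primes n)) * (2 * real n) powr (-1/2)"
      by (rule mult_right_mono) (use elim in auto)
    thus False using le[of n] elim by linarith
  qed
  thus False by simp
qed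

section \<open>A sieve for pairs of primes\<close>

lemma sum_crt:
  fixes a b :: nat and f g :: "nat \<Rightarrow> real"
  assumes "coprime a b" "a > 0" "b > 0"
  shows "(\<Sum>n<a*b. f (n mod a) * g (n mod b)) = (\<Sum>i<a. f i) * (\<Sum>j<b. g j)"
proof -
  let ?h = "\<lambda>n. (n mod a, n mod b)"
  have inj: "inj_on ?h {..<a*b}"
  proof (rule inj_onI)
    fix m n assume mn: "m \<in> {..<a*b}" "n \<in> {..<a*b}" "?h m = ?h n"
    hence "[m = n] (mod a)" "[m = n] (mod b)" by (auto simp: cong_def)
    hence "[m = n] (mod a * b)" using assms(1) by (rule coprime_cong_mult_nat)
    thus "m = n" using mn by (simp add: cong_def)
  qed
  have "?h ` {..<a*b} = {..<a} \<times> {..<b}"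
  proof (rule card_subset_eq)
    show "?h ` {..<a*b} \<subseteq> {..<a} \<times> {..<b}" using assms by auto
    show "card (?h ` {..<a*b}) = card ({..<a} \<times> {..<b})" by (simp add: card_image[OF inj])
  qed simp
  hence "bij_betw ?h {..<a*b} ({..<a} \<times> {..<b})" using inj by (simp add: bij_betw_def)
  from sum.reindex_bij_betw[OF this, of "\<lambda>(i, j). f i * g j"]
  have "(\<Sum>n<a*b. f (n mod a) * g (n mod b)) = (\<Sum>(i, j)\<in>{..<a} \<times> {..<b}. f i * g j)" by simp
  also have "\<dots> = (\<Sum>i<a. f i) * (\<Sum>j<b. g j)"
    by (simp add: sum_product sum.cartesian_product)
  finally show ?thesis .
qed

lemma sum_prod_periodic:
  fixes f :: "nat \<Rightarrow> nat \<Rightarrow> real"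
  assumes "finite C" "\<And>p. p \<in> C \<Longrightarrow> prime p" "\<And>p n. p \<in> C \<Longrightarrow> f p (n mod p) = f p n"
  shows "(\<Sum>n<\<Prod>C. \<Prod>p\<in>C. f p n) = (\<Prod>p\<in>C. \<Sum>r<p. f p r)"
  using assms
proof (induction C)
  case (insert p C)
  have p: "prime p" using insert.prems(1) by simp
  have C: "\<Prod>C > 0" using insert.prems(1) by (intro prod_pos) (auto simp: prime_gt_0_nat)
  have "coprime p (\<Prod>C)"
    using insert.prems(1) insert.hyps p by (intro prod_coprime_right primes_coprime) auto
  have red: "(\<Prod>r\<in>C. f r (n mod \<Prod>C)) = (\<Prod>r\<in>C. f r n)" for n
  proof (rule prod.cong)
    fix r assume r: "r \<in> C"
    have "f r (n mod \<Prod>C) = f r (n mod \<Prod>C mod r)" using insert.prems(2)[of r] r by simp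
    also have "n mod \<Prod>C mod r = n mod r"
      by (rule mod_mod_cancel) (use r insert.hyps in \<open>auto intro: dvd_prodI\<close>)
    also have "f r (n mod r) = f r n" using insert.prems(2)[of r] r by simp
    finally show "f r (n mod \<Prod>C) = f r n" .
  qed simp
  have "(\<Sum>n<\<Prod>(insert p C). \<Prod>r\<in>insert p C. f r n) = (\<Sum>n<p * \<Prod>C. f p (n mod p) * (\<Prod>r\<in>C. f r (n mod \<Prod>C)))"
    using insert by (simp add: red)
  also have "\<dots> = (\<Sum>i<p. f p i) * (\<Sum>j<\<Prod>C. \<Prod>r\<in>C. f r j)"
    by (rule sum_crt[OF \<open>coprime p (\<Prod>C)\<close> prime_gt_0_nat[OF p] C])
  also have "(\<Sum>j<\<Prod>C. \<Prod>r\<in>C. f r j) = (\<Prod>r\<in>C. \<Sum>i<r. f r i)"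
    by (rule insert.IH) (use insert.prems in auto)
  finally show ?case using insert.hyps by simp
qed simp

text \<open>Complete periods contribute exactly c per term, whatever their starting point; the
  incomplete last period contributes at most its length.\<close>

lemma sum_periodic_le:
  fixes F :: "nat \<Rightarrow> real"
  assumes P: "P > 0" and per: "\<And>n. F (n + P) = F n" and le: "\<And>n. F n \<le> 1" and full: "(\<Sum>n<P. F n) = real P * c" "c \<ge> 0"
  shows "(\<Sum>n<N. F (M + n)) \<le> real N * c + real P"
proof -
  have shift: "(\<Sum>n<P. F (M + n)) = real P * c" for M
  proof (induction M)
    case (Suc M)
    have "(\<Sum>n<P. F (Suc M + n)) + F M = (\<Sum>n<Suc P. F (M + n))"
      by (subst sum.lessThan_Suc_shift) simp
    also have "\<dots> = (\<Sum>n<P. F (M + n)) + F M" by (simp add: per)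
    finally show ?case using Suc.IH by simp
  qed (use full in simp)
  have blocks: "(\<Sum>n<t*P. F (M + n)) = real t * (real P * c)" for t
  proof (induction t)
    case (Suc t)
    have "(\<Sum>n<t*P+P. F (M + n)) = real t * (real P * c) + real P * c"
      unfolding sum_lessThan_add Suc.IH using shift[of "M + t * P"] by (simp add: add.assoc)
    thus ?case by (simp add: algebra_simps)
  qed simp
  define t where "t = N div P"
  have N: "N = t * P + N mod P" by (simp add: t_def)
  have "(\<Sum>n<N. F (M + n)) = real t * (real P * c) + (\<Sum>n<N mod P. F (M + (t * P + n)))"
    by (subst N) (simp only: sum_lessThan_add blocks)
  also have "(\<Sum>n<N mod P. F (M + (t * P + n))) \<le> (\<Sum>n<N mod P. 1)" by (intro sum_mono le)
  also have "\<dots> \<le> real P" using P by (simp add: less_imp_le)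
  also have "real t * (real P * c) \<le> real N * c"
  proof -
    have "t * P \<le> N" by (simp add: t_def)
    hence "real (t * P) * c \<le> real N * c" using full(2) by (intro mult_right_mono) (simp_all only: of_nat_le_iff)
    thus ?thesis by simp
  qed
  finally show ?thesis by simp
qed

text \<open>Distinct sets of primes have distinct products, so the number of admissible sets is at
  most the level z of the sieve.\<close>

lemma prime_set_prod_inj:
  assumes "\<And>p. p \<in> P \<Longrightarrow> prime (p::nat)" "finite P"
  shows "inj_on \<Prod> (Pow P)"
proof (rule inj_onI)
  fix A B assume AB: "A \<in> Pow P" "B \<in> Pow P" "\<Prod>A = \<Prod>B"
  have "p \<in> C \<longleftrightarrow> p dvd \<Prod>C" if "p \<in> P" "C \<in> Pow P" for p C
  proof -
    have "finite C" using that assms(2) finite_subset by auto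
    hence "p dvd \<Prod>C \<longleftrightarrow> (\<exists>x\<in>C. p dvd x)" using prime_dvd_prod_iff[OF _ assms(1)[OF that(1)], of C "\<lambda>x. x"] by simp
    moreover have "p = x" if "x \<in> C" "p dvd x" for x
      using primes_dvd_imp_eq[OF assms(1) assms(1) that(2)] that(1) \<open>p \<in> P\<close> \<open>C \<in> Pow P\<close> by auto
    moreover have "p dvd p" by simp
    ultimately show ?thesis by metis
  qed
  note mem = this
  show "A = B"
  proof (rule Set.set_eqI)
    fix p
    show "p \<in> A \<longleftrightarrow> p \<in> B"
    proof (cases "p \<in> P")
      case True
      thus ?thesis using mem[OF True AB(1)] mem[OF True AB(2)] AB(3) by simp
    qed (use AB in auto)
  qed
qed

text \<open>Two forbidden residue classes modulo each p. The condition p \<ge> 5 keeps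
  \<open>wt p\<close> at most 1, so that the functions \<open>\<phi> p\<close> are bounded by 1 in
  absolute value.\<close>

locale two_class_sieve =
  fixes P :: "nat set" and bad :: "nat \<Rightarrow> nat \<Rightarrow> bool"
  assumes fin: "finite P" and prime_P: "p \<in> P \<Longrightarrow> prime p" and ge_5: "p \<in> P \<Longrightarrow> p \<ge> 5"
    and bad_mod: "p \<in> P \<Longrightarrow> bad p (n mod p) = bad p n"
    and bad_card: "p \<in> P \<Longrightarrow> card {r \<in> {..<p}. bad p r} = 2"
begin

text \<open>The number of forbidden classes over the number of allowed ones, as in the sums of
  Selberg's sieve and the large sieve.\<close>

definition wt :: "nat \<Rightarrow> real" where "wt p = 2 / (real p - 2)"

definition \<phi> :: "nat \<Rightarrow> nat \<Rightarrow> real" where "\<phi> p n = (if bad p n then -1 else wt p)"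

definition admissible :: "nat \<Rightarrow> nat set set" where "admissible z = {A \<in> Pow P. \<Prod>A \<le> z}"

definition weight :: "nat \<Rightarrow> real" where "weight z = (\<Sum>A\<in>admissible z. \<Prod>p\<in>A. wt p)"

lemma wt_bounds: "p \<in> P \<Longrightarrow> 0 < wt p" "p \<in> P \<Longrightarrow> wt p \<le> 1"
  using ge_5[of p] by (auto simp: wt_def)

lemma wt_mult: "p \<in> P \<Longrightarrow> (real p - 2) * wt p = 2"
proof -
  assume "p \<in> P"
  hence "real p - 2 \<noteq> 0" using ge_5[of p] by auto
  moreover have "x * (2 / x) = 2" if "x \<noteq> 0" for x :: real using that by simp
  ultimately show "(real p - 2) * wt p = 2" unfolding wt_def by blast
qed

lemma \<phi>_abs: "p \<in> P \<Longrightarrow> \<bar>\<phi> p n\<bar> \<le> 1"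
  using wt_bounds[of p] by (auto simp: \<phi>_def)

lemma sum_two_valued:
  assumes "p \<in> P"
  shows "(\<Sum>r<p. if bad p r then x else y) = 2 * x + (real p - 2) * y"
proof -
  have "(\<Sum>r<p. if bad p r then x else y) = real (card {r \<in> {..<p}. bad p r}) * x + real (card {r \<in> {..<p}. \<not> bad p r}) * y"
  proof -
    have "{..<p} \<inter> {r. bad p r} = {r \<in> {..<p}. bad p r}" "{..<p} \<inter> - {r. bad p r} = {r \<in> {..<p}. \<not> bad p r}" by auto
    thus ?thesis by (simp only: sum.If_cases[OF finite_lessThan] sum_constant)
  qed
  also have "card {r \<in> {..<p}. \<not> bad p r} = p - 2"
  proof -
    have "{r \<in> {..<p}. \<not> bad p r} = {..<p} - {r \<in> {..<p}. bad p r}" by auto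
    moreover have "card ({..<p} - {r \<in> {..<p}. bad p r}) = card {..<p} - card {r \<in> {..<p}. bad p r}"
      by (rule card_Diff_subset) auto
    ultimately show ?thesis by (simp only: bad_card[OF assms] card_lessThan)
  qed
  finally show ?thesis using ge_5[OF assms] bad_card[OF assms] by (simp add: of_nat_diff)
qed

text \<open>The functions \<open>\<phi>\<close> are chosen to have mean 0 and mean square \<open>wt p\<close>, so products over distinct
  admissible sets are orthogonal.\<close>
lemma sum_\<phi>: "p \<in> P \<Longrightarrow> (\<Sum>r<p. \<phi> p r) = 0"
  using sum_two_valued[of p "-1" "wt p"] wt_mult[of p] by (simp add: \<phi>_def)

lemma sum_\<phi>_square: "p \<in> P \<Longrightarrow> (\<Sum>r<p. \<phi> p r * \<phi> p r) = real p * wt p"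
proof -
  assume p: "p \<in> P"
  have "(\<Sum>r<p. \<phi> p r * \<phi> p r) = (\<Sum>r<p. if bad p r then 1 else wt p * wt p)"
    by (rule sum.cong) (auto simp: \<phi>_def)
  also have "\<dots> = 2 * 1 + (real p - 2) * (wt p * wt p)" by (rule sum_two_valued[OF p])
  also have "\<dots> = 2 + ((real p - 2) * wt p) * wt p" by simp
  also have "\<dots> = (real p - 2) * wt p + 2 * wt p" by (simp only: wt_mult[OF p])
  also have "\<dots> = real p * wt p" by (simp add: left_diff_distrib)
  finally show ?thesis .
qed

text \<open>The product of the two functions has period the product of the primes in A \<union> B,
  which is at most z^2; this is the error. Over a full period it factors by the Chinese remainder
  theorem: a prime in only one of A and B gives the factor 0, and for A = B the mean squares
  appear.\<close>

lemma correlation: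
  assumes A: "A \<in> admissible z" and B: "B \<in> admissible z"
  shows "(\<Sum>n<N. (\<Prod>p\<in>A. \<phi> p (M + n)) * (\<Prod>p\<in>B. \<phi> p (M + n)))
    \<le> (if A = B then real N * (\<Prod>p\<in>A. wt p) else 0) + real z * real z"
proof -
  have AP: "A \<subseteq> P" "B \<subseteq> P" "finite A" "finite B" "\<Prod>A \<le> z" "\<Prod>B \<le> z"
    using A B fin by (auto simp: admissible_def intro: finite_subset)
  define C where "C = A \<union> B"
  have C: "C \<subseteq> P" "finite C" using AP by (auto simp: C_def)
  define f where "f p n = (if p \<in> A then \<phi> p n else 1) * (if p \<in> B then \<phi> p n else 1)" for p n
  define F where "F n = (\<Prod>p\<in>C. f p n)" for n
  have prod_eq: "(\<Prod>p\<in>A. \<phi> p n) * (\<Prod>p\<in>B. \<phi> p n) = F n" for n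
  proof -
    have "(\<Prod>p\<in>A. \<phi> p n) = (\<Prod>p\<in>C. if p \<in> A then \<phi> p n else 1)"
      using AP C by (intro prod.mono_neutral_cong_left) (auto simp: C_def)
    moreover have "(\<Prod>p\<in>B. \<phi> p n) = (\<Prod>p\<in>C. if p \<in> B then \<phi> p n else 1)"
      using AP C by (intro prod.mono_neutral_cong_left) (auto simp: C_def)
    ultimately show ?thesis by (simp add: F_def f_def prod.distrib)
  qed
  have fm: "f p (n mod p) = f p n" if "p \<in> C" for p n
    using bad_mod[of p n] that C by (auto simp: f_def \<phi>_def)
  have full: "(\<Sum>n<\<Prod>C. F n) = (\<Prod>p\<in>C. \<Sum>r<p. f p r)"
    unfolding F_def by (rule sum_prod_periodic) (use C prime_P fm in auto)
  have Cpos: "\<Prod>C > 0" using C prime_P by (intro prod_pos) (auto simp: prime_gt_0_nat)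
  have "(\<Sum>n<N. F (M + n)) \<le> real N * (if A = B then \<Prod>p\<in>A. wt p else 0) + real (\<Prod>C)"
  proof (rule sum_periodic_le[OF Cpos])
    show "F (n + \<Prod>C) = F n" for n
      unfolding F_def
    proof (rule prod.cong)
      fix p assume p: "p \<in> C"
      have "p dvd \<Prod>C" using p C by (auto intro: dvd_prodI)
      hence "(n + \<Prod>C) mod p = n mod p" by (simp add: mod_add_eq[symmetric] dvd_eq_mod_eq_0)
      thus "f p (n + \<Prod>C) = f p n" using fm[OF p, of "n + \<Prod>C"] fm[OF p, of n] by simp
    qed simp
    show "F n \<le> 1" for n
    proof -
      have "\<bar>f p n\<bar> \<le> 1" if "p \<in> C" for p
      proof -
        have "\<bar>if p \<in> D then \<phi> p n else 1\<bar> \<le> 1" for D using \<phi>_abs[of p n] that C by auto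
        thus ?thesis unfolding f_def abs_mult by (intro mult_le_one) auto
      qed
      hence "\<bar>F n\<bar> \<le> 1" unfolding F_def abs_prod by (intro prod_le_1) auto
      thus ?thesis by simp
    qed
    show "(\<Sum>n<\<Prod>C. F n) = real (\<Prod>C) * (if A = B then \<Prod>p\<in>A. wt p else 0)"
    proof (cases "A = B")
      case True
      have "(\<Prod>p\<in>C. \<Sum>r<p. f p r) = (\<Prod>p\<in>C. real p * wt p)"
        by (rule prod.cong) (use True AP in \<open>auto simp: C_def f_def sum_\<phi>_square\<close>)
      thus ?thesis unfolding full using True by (simp add: prod.distrib C_def)
    next
      case False
      then obtain p where p: "p \<in> C" "p \<notin> A \<or> p \<notin> B" by (auto simp: C_def)
      hence "(\<Sum>r<p. f p r) = (\<Sum>r<p. \<phi> p r)" by (intro sum.cong) (auto simp: f_def C_def)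
      also have "\<dots> = 0" using p C by (intro sum_\<phi>) auto
      finally have "(\<Prod>p\<in>C. \<Sum>r<p. f p r) = 0" using p C by (intro prod_zero) auto
      thus ?thesis unfolding full using False by simp
    qed
    show "0 \<le> (if A = B then \<Prod>p\<in>A. wt p else 0)"
    proof -
      have "0 \<le> wt p" if "p \<in> A" for p using wt_bounds(1)[of p] that AP by auto
      thus ?thesis by (simp add: prod_nonneg)
    qed
  qed
  also have "real (\<Prod>C) \<le> real z * real z"
  proof -
    have "\<Prod>C * \<Prod>(A \<inter> B) = \<Prod>A * \<Prod>B" unfolding C_def using AP by (simp add: prod.union_inter)
    moreover have "\<Prod>(A \<inter> B) \<ge> 1"
    proof -
      have "\<Prod>(A \<inter> B) > 0" using AP prime_P by (intro prod_pos) (auto simp: prime_gt_0_nat)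
      thus ?thesis by simp
    qed
    ultimately have "\<Prod>C \<le> \<Prod>A * \<Prod>B" by (metis mult_le_mono2 mult.right_neutral)
    also have "\<dots> \<le> z * z" using AP by (intro mult_le_mono)
    finally show ?thesis by (simp only: of_nat_mult[symmetric] of_nat_le_iff)
  qed
  finally show ?thesis unfolding prod_eq by (cases "A = B") simp_all
qed

text \<open>At a surviving n every \<open>\<phi> p\<close> equals \<open>wt p\<close>, so h(n) =
  \<open>weight z\<close>. Extending the sum of h^2 to the whole interval and opening the square
  leaves the diagonal N \<open>weight z\<close> and at most z^2 pairs, each with error z^2.\<close>

theorem sieve_inequality:
  assumes "z \<ge> 1"
  shows "real (card {n \<in> {M..<M+N}. \<forall>p\<in>P. \<not> bad p n}) * weight z ^ 2 \<le> real N * weight z + real z ^ 4"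
proof -
  let ?S = "{n \<in> {M..<M+N}. \<forall>p\<in>P. \<not> bad p n}"
  define h where "h n = (\<Sum>A\<in>admissible z. \<Prod>p\<in>A. \<phi> p n)" for n
  have finA: "finite (admissible z)" using fin by (simp add: admissible_def)
  have cardA: "card (admissible z) \<le> z"
  proof -
    have inj: "inj_on \<Prod> (admissible z)"
      by (rule inj_on_subset[OF prime_set_prod_inj[OF prime_P fin]]) (auto simp: admissible_def)
    have "\<Prod> ` admissible z \<subseteq> {1..z}"
    proof
      fix x assume "x \<in> \<Prod> ` admissible z"
      then obtain A where A: "A \<subseteq> P" "x = \<Prod>A" "x \<le> z" by (auto simp: admissible_def)
      have "\<Prod>A > 0" using A prime_P by (intro prod_pos) (auto simp: prime_gt_0_nat)
      thus "x \<in> {1..z}" using A by simp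
    qed
    from card_mono[OF _ this] show ?thesis unfolding card_image[OF inj] by simp
  qed
  have hS: "h n = weight z" if "n \<in> ?S" for n
    unfolding h_def weight_def
    by (intro sum.cong prod.cong) (use that in \<open>auto simp: admissible_def \<phi>_def\<close>)
  have "real (card ?S) * weight z ^ 2 = (\<Sum>n\<in>?S. h n ^ 2)" using hS by simp
  also have "\<dots> \<le> (\<Sum>n\<in>{M..<M+N}. h n ^ 2)" by (rule sum_mono2) auto
  also have "\<dots> = (\<Sum>n<N. h (M + n) ^ 2)"
    by (rule sum.reindex_bij_witness[of _ "\<lambda>n. M + n" "\<lambda>n. n - M"]) auto
  also have "\<dots> = (\<Sum>n<N. \<Sum>A\<in>admissible z. \<Sum>B\<in>admissible z. (\<Prod>p\<in>A. \<phi> p (M + n)) * (\<Prod>p\<in>B. \<phi> p (M + n)))"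
    by (simp add: h_def power2_eq_square sum_product)
  also have "\<dots> = (\<Sum>A\<in>admissible z. \<Sum>B\<in>admissible z. \<Sum>n<N. (\<Prod>p\<in>A. \<phi> p (M + n)) * (\<Prod>p\<in>B. \<phi> p (M + n)))"
    by (subst sum.swap) (intro sum.cong refl sum.swap)
  also have "\<dots> \<le> (\<Sum>A\<in>admissible z. \<Sum>B\<in>admissible z. (if A = B then real N * (\<Prod>p\<in>A. wt p) else 0) + real z * real z)"
    by (intro sum_mono correlation)
  also have "\<dots> = real N * weight z + real (card (admissible z)) * (real (card (admissible z)) * (real z * real z))"
    using finA by (simp add: sum.distrib weight_def sum_distrib_left)
  also have "real (card (admissible z)) * (real (card (admissible z)) * (real z * real z)) \<le> real z * (real z * (real z * real z))"
    using cardA by (intro mult_mono) auto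
  finally show ?thesis by (simp add: power_numeral_reduce mult.assoc)
qed

end

definition ssum :: "(nat \<Rightarrow> real) \<Rightarrow> nat set \<Rightarrow> nat \<Rightarrow> real" where
  "ssum w P x = (\<Sum>A\<in>{A \<in> Pow P. \<Prod>A \<le> x}. \<Prod>p\<in>A. w p)"

text \<open>While \<open>ssum\<close> encodes squarefree integers as sets of primes, this sum runs
  over all integers composed of primes of P. It connects the sieve weights with the harmonic
  series.\<close>

definition smooth_sum :: "nat set \<Rightarrow> nat \<Rightarrow> real" where
  "smooth_sum P x = (\<Sum>n\<in>{n \<in> {1..x}. prime_factors n \<subseteq> P}. 1 / real n)"

lemma ssum_empty: "ssum w {} x = (if 1 \<le> x then 1 else 0)"
proof -
  have "{A \<in> Pow {}. \<Prod>A \<le> x} = (if 1 \<le> x then {{}} else {})" by auto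
  thus ?thesis by (simp add: ssum_def)
qed

lemma ssum_nonneg: "(\<And>p. p \<in> P \<Longrightarrow> w p \<ge> 0) \<Longrightarrow> ssum w P x \<ge> 0"
  unfolding ssum_def by (intro sum_nonneg prod_nonneg) auto

lemma ssum_mono:
  assumes "finite P" "\<And>p. p \<in> P \<Longrightarrow> w p \<ge> 0" "x \<le> y"
  shows "ssum w P x \<le> ssum w P y"
  unfolding ssum_def
proof (rule sum_mono2)
  show "0 \<le> (\<Prod>p\<in>A. w p)" if "A \<in> {A \<in> Pow P. \<Prod>A \<le> y} - {A \<in> Pow P. \<Prod>A \<le> x}" for A
    using that assms(2) by (intro prod_nonneg) auto
qed (use assms in auto)

lemma ssum_insert:
  assumes "finite P" "p \<notin> P" "p > 0"
  shows "ssum w (insert p P) x = ssum w P x + w p * ssum w P (x div p)"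
proof -
  let ?S = "\<lambda>P x. {A \<in> Pow P. \<Prod>A \<le> x}"
  have eq: "?S (insert p P) x = ?S P x \<union> insert p ` ?S P (x div p)"
  proof -
    have prod: "\<Prod>(insert p A) = p * \<Prod>A" if "A \<subseteq> P" for A
    proof -
      have "finite A" "p \<notin> A" using that assms finite_subset by auto
      thus ?thesis by (rule prod.insert)
    qed
    have le: "p * m \<le> x \<longleftrightarrow> m \<le> x div p" for m
      using assms(3) by (simp add: less_eq_div_iff_mult_less_eq mult.commute)
    show ?thesis
    proof (intro equalityI subsetI)
      fix A assume A: "A \<in> ?S (insert p P) x"
      show "A \<in> ?S P x \<union> insert p ` ?S P (x div p)"
      proof (cases "p \<in> A")
        case True
        define B where "B = A - {p}"
        have B: "B \<subseteq> P" "A = insert p B" using A True by (auto simp: B_def)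
        hence "B \<in> ?S P (x div p)" using A prod[OF B(1)] le by auto
        thus ?thesis using B(2) by blast
      qed (use A in auto)
    next
      fix A assume "A \<in> ?S P x \<union> insert p ` ?S P (x div p)"
      thus "A \<in> ?S (insert p P) x" using prod le by fastforce
    qed
  qed
  have disj: "?S P x \<inter> insert p ` ?S P (x div p) = {}" using assms(2) by auto
  have inj: "inj_on (insert p) (?S P (x div p))"
  proof (rule inj_onI)
    fix A B assume "A \<in> ?S P (x div p)" "B \<in> ?S P (x div p)" "insert p A = insert p B"
    moreover from this have "p \<notin> A" "p \<notin> B" using assms(2) by auto
    ultimately show "A = B" by (metis insert_ident)
  qed
  have "ssum w (insert p P) x = ssum w P x + (\<Sum>A\<in>insert p ` ?S P (x div p). \<Prod>p\<in>A. w p)"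
    unfolding ssum_def eq by (rule sum.union_disjoint) (use assms disj in auto)
  also have "(\<Sum>A\<in>insert p ` ?S P (x div p). \<Prod>p\<in>A. w p) = (\<Sum>A\<in>?S P (x div p). \<Prod>p\<in>insert p A. w p)"
    by (subst sum.reindex[OF inj]) simp
  also have "\<dots> = (\<Sum>A\<in>?S P (x div p). w p * (\<Prod>p\<in>A. w p))"
  proof (rule sum.cong)
    fix A assume "A \<in> ?S P (x div p)"
    hence "p \<notin> A" "finite A" using assms finite_subset by auto
    thus "(\<Prod>p\<in>insert p A. w p) = w p * (\<Prod>p\<in>A. w p)" by simp
  qed simp
  finally show ?thesis by (simp add: ssum_def sum_distrib_left)
qed

text \<open>By \<open>2 / (p - 1) + 1 / (p - 1)\<^sup>2 \<le> 2 / (p - 2)\<close> this is an induction on the set of primes.\<close>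
lemma ssum_product_le:
  assumes "finite P" "\<And>p. p \<in> P \<Longrightarrow> p \<ge> 3"
  shows "ssum (\<lambda>p. 1 / (real p - 1)) P x * ssum (\<lambda>p. 1 / (real p - 1)) P y \<le> ssum (\<lambda>p. 2 / (real p - 2)) P (x * y)"
  using assms
proof (induction P arbitrary: x y)
  case empty
  show ?case by (simp add: ssum_empty)
next
  case (insert p P)
  define H where "H x = ssum (\<lambda>p. 1 / (real p - 1)) P x" for x
  define G where "G x = ssum (\<lambda>p. 2 / (real p - 2)) P x" for x
  define a where "a = 1 / (real p - 1)"
  have p: "p \<ge> 3" using insert.prems by simp
  have a: "a \<ge> 0" using p by (simp add: a_def)
  have IH: "H x * H y \<le> G (x * y)" for x y
    unfolding H_def G_def by (rule insert.IH) (use insert.prems in auto)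
  have w: "2 / (real p - 2) \<ge> 0" if "p \<in> P" for p
    using insert.prems[of p] that by auto
  have mono: "G x \<le> G y" if "x \<le> y" for x y
    unfolding G_def by (rule ssum_mono) (use insert.hyps w that in auto)
  have G0: "G x \<ge> 0" for x unfolding G_def by (rule ssum_nonneg) (use w in auto)
  have le: "(x div p) * y \<le> x * y div p" "x * (y div p) \<le> x * y div p" for x y
    using p by (simp_all add: less_eq_div_iff_mult_less_eq)
  have "(H x + a * H (x div p)) * (H y + a * H (y div p)) =
      H x * H y + a * (H (x div p) * H y) + a * (H x * H (y div p)) + a\<^sup>2 * (H (x div p) * H (y div p))"
    by (simp add: algebra_simps power2_eq_square)
  also have "\<dots> \<le> G (x * y) + a * G (x * y div p) + a * G (x * y div p) + a\<^sup>2 * G (x * y div p)"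
  proof (intro add_mono mult_left_mono)
    have "(x div p) * (y div p) \<le> x * y div p"
      using le(1)[of x y] mult_le_mono2[OF div_le_dividend[of y p], of "x div p"] by (rule le_trans[rotated])
    thus "H (x div p) * H (y div p) \<le> G (x * y div p)" by (rule order_trans[OF IH mono])
    show "H (x div p) * H y \<le> G (x * y div p)" "H x * H (y div p) \<le> G (x * y div p)"
      by (rule order_trans[OF IH mono[OF le(1)]], rule order_trans[OF IH mono[OF le(2)]])
  qed (use a IH in auto)
  also have "\<dots> = G (x * y) + (2 * a + a\<^sup>2) * G (x * y div p)" by (simp add: algebra_simps)
  also have "\<dots> \<le> G (x * y) + 2 / (real p - 2) * G (x * y div p)"
  proof (intro add_left_mono mult_right_mono G0)
    define t where "t = real p - 2"
    have t: "t \<ge> 1" "a = 1 / (t + 1)" using p by (simp_all add: t_def a_def)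
    have gen: "2 * (1 / s) + (1 / s)\<^sup>2 = (2 * s + 1) / s\<^sup>2" if "s > 0" for s :: real
      using that by (simp add: add_divide_distrib power2_eq_square)
    have t1: "t > 0" "t + 1 > 0" "(t + 1)\<^sup>2 > 0" using t(1) by simp_all
    have "2 * a + a\<^sup>2 = (2 * (t + 1) + 1) / (t + 1)\<^sup>2"
      unfolding t(2) by (rule gen[OF t1(2)])
    also have "\<dots> \<le> 2 / t"
    proof -
      have "(2 * (t + 1) + 1) * t \<le> 2 * (t + 1)\<^sup>2" using t(1) by (simp add: algebra_simps power2_eq_square)
      thus ?thesis using t1 by (simp only: pos_divide_le_eq times_divide_eq_left pos_le_divide_eq)
    qed
    finally show "2 * a + a\<^sup>2 \<le> 2 / (real p - 2)" by (simp add: t_def)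
  qed
  finally show ?case
    using insert.hyps p by (simp add: ssum_insert H_def G_def a_def)
qed

lemma smooth_sum_empty: "smooth_sum {} x = (if 1 \<le> x then 1 else 0)"
proof -
  have "{n \<in> {1..x}. prime_factors n \<subseteq> {}} = (if 1 \<le> x then {1} else {})"
    by (auto simp: prime_factorization_empty_iff)
  thus ?thesis by (simp add: smooth_sum_def)
qed

lemma smooth_sum_mono: "x \<le> y \<Longrightarrow> smooth_sum P x \<le> smooth_sum P y"
  unfolding smooth_sum_def by (intro sum_mono2) auto

lemma smooth_sum_insert:
  assumes p: "prime p" "p \<notin> P"
  shows "smooth_sum (insert p P) x = smooth_sum P x + 1 / real p * smooth_sum (insert p P) (x div p)"
proof -
  let ?S = "\<lambda>P x. {n \<in> {1..x}. prime_factors n \<subseteq> P}"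
  have p0: "p > 0" using prime_gt_0_nat[OF p(1)] .
  have le: "p * m \<le> x \<longleftrightarrow> m \<le> x div p" for m
    using p0 by (simp add: less_eq_div_iff_mult_less_eq mult.commute)
  have pf: "prime_factors (p * m) = insert p (prime_factors m)" if "m > 0" for m
    using that p p0 by (simp add: prime_factors_product prime_factorization_prime)
  have eq: "?S (insert p P) x = ?S P x \<union> (*) p ` ?S (insert p P) (x div p)"
  proof (intro equalityI subsetI)
    fix n assume n: "n \<in> ?S (insert p P) x"
    show "n \<in> ?S P x \<union> (*) p ` ?S (insert p P) (x div p)"
    proof (cases "p dvd n")
      case True
      then obtain m where m: "n = p * m" by (elim dvdE)
      have "m > 0" using n m by (auto intro!: Nat.gr0I)
      hence "m \<in> ?S (insert p P) (x div p)" using n pf[of m] le unfolding m by auto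
      thus ?thesis using m by blast
    next
      case False
      hence "p \<notin> prime_factors n" by (auto simp: in_prime_factors_iff)
      thus ?thesis using n by auto
    qed
  next
    fix n assume "n \<in> ?S P x \<union> (*) p ` ?S (insert p P) (x div p)"
    thus "n \<in> ?S (insert p P) x"
    proof
      assume "n \<in> (*) p ` ?S (insert p P) (x div p)"
      then obtain m where m: "n = p * m" "m > 0" "m \<le> x div p" "prime_factors m \<subseteq> insert p P" by auto
      thus ?thesis using pf[OF m(2)] le p0 by auto
    qed auto
  qed
  have disj: "?S P x \<inter> (*) p ` ?S (insert p P) (x div p) = {}"
  proof -
    have "p \<in> prime_factors n" if "n \<in> (*) p ` ?S (insert p P) (x div p)" for n
      using that pf by auto
    thus ?thesis using p(2) by auto
  qed
  have inj: "inj_on ((*) p) (?S (insert p P) (x div p))" using p0 by (auto simp: inj_on_def)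
  have "smooth_sum (insert p P) x = smooth_sum P x + (\<Sum>n\<in>(*) p ` ?S (insert p P) (x div p). 1 / real n)"
    unfolding smooth_sum_def eq by (rule sum.union_disjoint) (use disj in auto)
  also have "(\<Sum>n\<in>(*) p ` ?S (insert p P) (x div p). 1 / real n) = 1 / real p * smooth_sum (insert p P) (x div p)"
    by (subst sum.reindex[OF inj]) (simp add: smooth_sum_def sum_distrib_left)
  finally show ?thesis .
qed

text \<open>Splitting off p repeatedly produces 1/p + 1/p^2 + ... = 1/(p - 1); by monotonicity the
  arguments x div p^k may all be replaced by x div p.\<close>

lemma smooth_sum_insert_le:
  assumes p: "prime p" "p \<notin> P"
  shows "smooth_sum (insert p P) x \<le> smooth_sum P x + 1 / (real p - 1) * smooth_sum P (x div p)"
proof (induction x rule: less_induct)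
  case (less x)
  have p2: "real p \<ge> 2" using prime_ge_2_nat[OF p(1)] by simp
  show ?case
  proof (cases "x = 0")
    case True
    thus ?thesis by (simp add: smooth_sum_def)
  next
    case False
    hence "x div p < x" using prime_gt_1_nat[OF p(1)] by simp
    have "smooth_sum P (x div p div p) \<le> smooth_sum P (x div p)" by (rule smooth_sum_mono) simp
    hence "smooth_sum P (x div p) + 1 / (real p - 1) * smooth_sum P (x div p div p)
        \<le> smooth_sum P (x div p) + 1 / (real p - 1) * smooth_sum P (x div p)"
      using p2 by (intro add_left_mono mult_left_mono) auto
    also have "\<dots> = real p / (real p - 1) * smooth_sum P (x div p)" using p2 by (simp add: field_simps)
    finally have "smooth_sum (insert p P) (x div p) \<le> real p / (real p - 1) * smooth_sum P (x div p)"
      using less.IH[OF \<open>x div p < x\<close>] by linarith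
    hence "1 / real p * smooth_sum (insert p P) (x div p) \<le> 1 / real p * (real p / (real p - 1) * smooth_sum P (x div p))"
      by (rule mult_left_mono) simp
    also have "\<dots> = 1 / (real p - 1) * smooth_sum P (x div p)" using p2 by simp
    finally show ?thesis unfolding smooth_sum_insert[OF p, of x] by linarith
  qed
qed

text \<open>Integers are grouped by their squarefree kernel: for a kernel with prime set A, the sum
  of 1/n is the product of the 1/(p - 1), and n \<le> x implies that the kernel is at most
  x.\<close>

lemma smooth_sum_le_ssum:
  assumes "finite P" "\<And>p. p \<in> P \<Longrightarrow> prime p"
  shows "smooth_sum P x \<le> ssum (\<lambda>p. 1 / (real p - 1)) P x"
  using assms
proof (induction P arbitrary: x)
  case empty
  show ?case by (simp add: smooth_sum_empty ssum_empty)
next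
  case (insert p P)
  have p: "prime p" using insert.prems by simp
  have "smooth_sum (insert p P) x \<le> smooth_sum P x + 1 / (real p - 1) * smooth_sum P (x div p)"
    by (rule smooth_sum_insert_le[OF p insert.hyps(2)])
  also have "\<dots> \<le> ssum (\<lambda>p. 1 / (real p - 1)) P x + 1 / (real p - 1) * ssum (\<lambda>p. 1 / (real p - 1)) P (x div p)"
    using prime_gt_0_nat[OF p] insert by (intro add_mono mult_left_mono) auto
  also have "\<dots> = ssum (\<lambda>p. 1 / (real p - 1)) (insert p P) x"
    using insert.hyps prime_gt_0_nat[OF p] by (simp add: ssum_insert)
  finally show ?case .
qed

text \<open>Each prime left out of the sieve costs a factor p/(p - 1) in the lower bound for the
  weight.\<close>

lemma smooth_sum_union_le:
  assumes "finite D" "\<And>p. p \<in> D \<Longrightarrow> prime p" "D \<inter> P = {}"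
  shows "smooth_sum (D \<union> P) x \<le> (\<Prod>p\<in>D. real p / (real p - 1)) * smooth_sum P x"
  using assms
proof (induction D)
  case (insert p D)
  have p: "prime p" using insert.prems by simp
  have p2: "real p \<ge> 2" using prime_ge_2_nat[OF p] by simp
  have "smooth_sum (insert p (D \<union> P)) x \<le> smooth_sum (D \<union> P) x + 1 / (real p - 1) * smooth_sum (D \<union> P) (x div p)"
    by (rule smooth_sum_insert_le[OF p]) (use insert in auto)
  also have "\<dots> \<le> smooth_sum (D \<union> P) x + 1 / (real p - 1) * smooth_sum (D \<union> P) x"
    using p2 by (intro add_left_mono mult_left_mono smooth_sum_mono) auto
  also have "\<dots> = real p / (real p - 1) * smooth_sum (D \<union> P) x" using p2 by (simp add: field_simps)
  also have "\<dots> \<le> real p / (real p - 1) * ((\<Prod>p\<in>D. real p / (real p - 1)) * smooth_sum P x)"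
    by (rule mult_left_mono[OF insert.IH]) (use insert.prems p2 in auto)
  finally show ?case using insert.hyps by simp
qed simp

lemma smooth_sum_all_primes: "smooth_sum {p. prime p \<and> p \<le> y} y \<ge> ln (real y)"
proof -
  have "{n \<in> {1..y}. prime_factors n \<subseteq> {p. prime p \<and> p \<le> y}} = {1..y}"
    by (auto simp: in_prime_factors_iff intro: order_trans[OF dvd_imp_le])
  hence "smooth_sum {p. prime p \<and> p \<le> y} y = harm y"
    by (simp add: smooth_sum_def harm_def inverse_eq_divide)
  also have "\<dots> \<ge> ln (real y + 1)" by (rule ln_le_harm)
  finally have "ln (real y + 1) \<le> smooth_sum {p. prime p \<and> p \<le> y} y" .
  moreover have "ln (real y) \<le> ln (real y + 1)" by (cases "y = 0") simp_all
  ultimately show ?thesis by linarith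
qed

text \<open>The quotient k / \<phi>(k) for positive k, written as a product over primes.\<close>

definition totient_ratio :: "nat \<Rightarrow> real" where
  "totient_ratio k = (\<Prod>p\<in>prime_factors k. real p / (real p - 1))"

lemma prime_ratio_ge_1: "prime (p::nat) \<Longrightarrow> 1 \<le> real p / (real p - 1)"
  using prime_gt_1_nat[of p] by simp

lemma ratio_nonneg: "0 \<le> real p / (real p - 1)"
  by (cases p) simp_all

lemma totient_ratio_ge_1: "1 \<le> totient_ratio k"
  unfolding totient_ratio_def by (rule prod_ge_1) (auto intro: prime_ratio_ge_1)

text \<open>The classes are 0 and the inverse of k times -j; they differ because j is a unit modulo
  p.\<close>

lemma card_two_roots:
  fixes p k :: nat and j :: int
  assumes p: "prime p" "\<not> p dvd k" "\<bar>j\<bar> = 1"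
  shows "card {r \<in> {..<p}. p dvd r \<or> int p dvd int k * int r + j} = 2"
proof -
  have p1: "p > 1" using prime_gt_1_nat[OF p(1)] .
  have "coprime (int k) (int p)"
    using prime_imp_coprime[OF p(1,2)] by (simp add: coprime_commute)
  then obtain x where x: "[int k * x = 1] (mod int p)" using cong_solve_coprime_int by blast
  define r where "r = nat ((- j * x) mod int p)"
  have r: "int r = (- j * x) mod int p" "r < p"
    using p1 by (auto simp: r_def nat_less_iff)
  have "[int k * int r = int k * (- j * x)] (mod int p)" unfolding r(1) by (intro cong_mult) (auto simp: cong_def)
  also have "int k * (- j * x) = - j * (int k * x)" by simp
  also have "[- j * (int k * x) = - j * 1] (mod int p)" by (intro cong_mult cong_refl x)
  finally have kr: "[int k * int r = - j] (mod int p)" by simp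
  have nj: "\<not> int p dvd j"
  proof
    assume "int p dvd j"
    hence "int p dvd \<bar>j\<bar>" by simp
    thus False using p1 unfolding p(3) by simp
  qed
  have root: "int p dvd int k * int s + j \<longleftrightarrow> [int k * int s = - j] (mod int p)" for s
    by (simp add: cong_iff_dvd_diff)
  have r0: "r \<noteq> 0"
  proof
    assume "r = 0"
    hence "[0 = - j] (mod int p)" using kr by simp
    thus False using nj by (simp add: cong_iff_dvd_diff)
  qed
  have "{s \<in> {..<p}. p dvd s \<or> int p dvd int k * int s + j} = {0, r}"
  proof (intro equalityI subsetI)
    fix s assume s: "s \<in> {s \<in> {..<p}. p dvd s \<or> int p dvd int k * int s + j}"
    show "s \<in> {0, r}"
    proof (cases "p dvd s")
      case True
      thus ?thesis using s by (auto dest: dvd_imp_le)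
    next
      case False
      hence "[int k * int s = - j] (mod int p)" using s root by auto
      hence "[int k * int s = int k * int r] (mod int p)" by (rule cong_trans[OF _ cong_sym[OF kr]])
      hence "[int s = int r] (mod int p)" by (simp only: cong_mult_lcancel[OF \<open>coprime (int k) (int p)\<close>])
      hence "s = r" using s r(2) by (simp add: cong_int_iff cong_def)
      thus ?thesis by simp
    qed
  next
    fix s assume "s \<in> {0, r}"
    thus "s \<in> {s \<in> {..<p}. p dvd s \<or> int p dvd int k * int s + j}"
      using r(2) p1 kr root by auto
  qed
  thus ?thesis using r0 by simp
qed

text \<open>Left out are 2 and 3, too small for the sieve, and the primes dividing k, for which
  there is only one forbidden class. They cost at most 2 (3/2) = 3 times
  \<open>totient_ratio k\<close>, whence ln y \<le> 3 W H. Since H^2 is at most the weight at level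
  y^2, the square gives the 9, and the error (y^2)^4 is y^8.\<close>

lemma prime_pair_sieve:
  fixes j :: int and k M N y :: nat
  assumes j: "\<bar>j\<bar> = 1" and k: "k > 0" and y: "y \<ge> 2"
  shows "real (card {n \<in> {M..<M+N}. \<forall>p. prime p \<longrightarrow> 5 \<le> p \<longrightarrow> p \<le> y \<longrightarrow> \<not> p dvd n \<and> \<not> int p dvd int k * int n + j})
    \<le> 9 * real N * totient_ratio k ^ 2 / ln (real y) ^ 2 + real y ^ 8"
proof -
  define P where "P = {p. prime p \<and> 5 \<le> p \<and> p \<le> y \<and> \<not> p dvd k}"
  define D where "D = {p. prime p \<and> p \<le> y} - P"
  define bad where "bad p n \<longleftrightarrow> p dvd n \<or> int p dvd int k * int n + j" for p n
  have finP: "finite P" "finite D" unfolding P_def D_def by (auto intro: finite_subset[of _ "{..y}"])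
  interpret two_class_sieve P bad
  proof
    fix p assume p: "p \<in> P"
    show "card {r \<in> {..<p}. bad p r} = 2" unfolding bad_def
      by (rule card_two_roots) (use p j in \<open>auto simp: P_def\<close>)
    fix n
    have "[int k * int (n mod p) + j = int k * int n + j] (mod int p)"
      by (intro cong_add cong_mult cong_refl) (simp add: cong_def zmod_int)
    thus "bad p (n mod p) = bad p n"
      unfolding bad_def by (simp add: dvd_mod_iff cong_dvd_iff)
  qed (use finP in \<open>auto simp: P_def\<close>)
  let ?S = "{n \<in> {M..<M+N}. \<forall>p\<in>P. \<not> bad p n}"
  define W where "W = totient_ratio k"
  have W: "W \<ge> 1" unfolding W_def by (rule totient_ratio_ge_1)
  have prD: "prime p" if "p \<in> D" for p using that by (auto simp: D_def)
  have V: "(\<Prod>p\<in>D. real p / (real p - 1)) \<le> 3 * W"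
  proof -
    have sub: "D \<subseteq> {2, 3} \<union> (prime_factors k - {2, 3})"
    proof
      fix p assume p: "p \<in> D"
      show "p \<in> {2, 3} \<union> (prime_factors k - {2, 3})"
      proof (cases "p < 5")
        case True
        have "p \<noteq> 4"
        proof
          assume "p = 4"
          hence "2 dvd p" by simp
          hence "2 = p" using primes_dvd_imp_eq[OF two_is_prime_nat prD[OF p]] by simp
          thus False using \<open>p = 4\<close> by simp
        qed
        thus ?thesis using True prime_ge_2_nat[OF prD[OF p]] by auto
      next
        case False
        thus ?thesis using p k by (auto simp: D_def P_def in_prime_factors_iff)
      qed
    qed
    have "(\<Prod>p\<in>D. real p / (real p - 1)) \<le> (\<Prod>p\<in>{2, 3} \<union> (prime_factors k - {2, 3}). real p / (real p - 1))"
      by (rule prod_mono2[OF _ sub]) (auto intro: prime_ratio_ge_1 simp: ratio_nonneg)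
    also have "\<dots> = (\<Prod>p\<in>{2, 3::nat}. real p / (real p - 1)) * (\<Prod>p\<in>prime_factors k - {2, 3}. real p / (real p - 1))"
      by (rule prod.union_disjoint) auto
    also have "(\<Prod>p\<in>{2, 3::nat}. real p / (real p - 1)) = 3" by simp
    also have "(\<Prod>p\<in>prime_factors k - {2, 3}. real p / (real p - 1)) \<le> W"
      unfolding W_def totient_ratio_def
      by (rule prod_mono2) (auto intro: prime_ratio_ge_1 simp: ratio_nonneg)
    finally show ?thesis by simp
  qed
  define H where "H = ssum (\<lambda>p. 1 / (real p - 1)) P y"
  define G where "G = weight (y * y)"
  have "ln (real y) \<le> smooth_sum {p. prime p \<and> p \<le> y} y" by (rule smooth_sum_all_primes)
  also have "{p. prime p \<and> p \<le> y} = D \<union> P" by (auto simp: D_def P_def)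
  also have "smooth_sum (D \<union> P) y \<le> (\<Prod>p\<in>D. real p / (real p - 1)) * smooth_sum P y"
    by (rule smooth_sum_union_le[OF finP(2) prD]) (simp_all add: D_def Int_commute)
  also have "\<dots> \<le> 3 * W * H"
  proof (rule mult_mono[OF V])
    show "smooth_sum P y \<le> H" unfolding H_def by (rule smooth_sum_le_ssum[OF finP(1) prime_P])
    show "0 \<le> smooth_sum P y" unfolding smooth_sum_def by (rule sum_nonneg) simp
  qed (use W in simp)
  finally have lnH: "ln (real y) \<le> 3 * W * H" .
  have "H * H \<le> G"
    unfolding H_def G_def weight_def admissible_def wt_def[abs_def] ssum_def[symmetric]
    by (rule ssum_product_le[OF finP(1)]) (drule ge_5, simp)
  have lny: "ln (real y) > 0" using y by simp
  have "ln (real y) ^ 2 \<le> (3 * W * H) ^ 2" using lnH lny by (intro power_mono) auto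
  also have "\<dots> = 9 * W\<^sup>2 * (H * H)" by (simp add: power2_eq_square)
  also have "\<dots> \<le> 9 * W\<^sup>2 * G" using \<open>H * H \<le> G\<close> by (intro mult_left_mono) auto
  finally have lnG: "ln (real y) ^ 2 \<le> 9 * W\<^sup>2 * G" .
  have G1: "G \<ge> 1"
  proof -
    have "(\<Sum>A\<in>{{}}. \<Prod>p\<in>A. wt p) \<le> G"
      unfolding G_def weight_def
    proof (rule sum_mono2)
      show "finite (admissible (y * y))" using fin by (simp add: admissible_def)
      show "{{}} \<subseteq> admissible (y * y)" using y by (simp add: admissible_def)
      show "0 \<le> (\<Prod>p\<in>A. wt p)" if "A \<in> admissible (y * y) - {{}}" for A
        using that wt_bounds(1) by (intro prod_nonneg) (auto simp: admissible_def less_imp_le)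
    qed
    thus ?thesis by simp
  qed
  have "real (card ?S) * G ^ 2 \<le> real N * G + real (y * y) ^ 4"
    unfolding G_def by (rule sieve_inequality) (use y in simp)
  hence "real (card ?S) \<le> (real N * G + real y ^ 8) / G ^ 2"
    using G1 by (simp add: pos_le_divide_eq power_mult_distrib flip: power_add)
  also have "\<dots> = real N / G + real y ^ 8 / G ^ 2" using G1 by (simp add: add_divide_distrib power2_eq_square)
  also have "real N / G \<le> 9 * real N * W\<^sup>2 / ln (real y) ^ 2"
  proof -
    have "real N * ln (real y) ^ 2 \<le> real N * (9 * W\<^sup>2 * G)" by (rule mult_left_mono[OF lnG]) simp
    thus ?thesis using G1 lny by (simp add: pos_divide_le_eq pos_le_divide_eq mult_ac)
  qed
  also have "real y ^ 8 / G ^ 2 \<le> real y ^ 8"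
    using G1 by (simp add: pos_divide_le_eq mult_le_cancel_left1 one_le_power)
  finally have "real (card ?S) \<le> 9 * real N * W\<^sup>2 / ln (real y) ^ 2 + real y ^ 8" by simp
  moreover have "card {n \<in> {M..<M+N}. \<forall>p. prime p \<longrightarrow> 5 \<le> p \<longrightarrow> p \<le> y \<longrightarrow> \<not> p dvd n \<and> \<not> int p dvd int k * int n + j} \<le> card ?S"
    by (rule card_mono) (auto simp: P_def bad_def)
  ultimately show ?thesis unfolding W_def by linarith
qed

text \<open>Primes q and kq + j that exceed y have no prime factor up to y, so such q survive the
  sieve. The implied constant must not depend on k, because k is summed over afterwards.\<close>

lemma prime_pair_count:
  "\<exists>C>0. \<forall>\<^sub>F u::real in at_top. \<forall>k>0. \<forall>j::int. \<bar>j\<bar> = 1 \<longrightarrow>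
     real (card {q. prime q \<and> u < real q \<and> real q \<le> 2 * u \<and> prime (nat (int k * int q + j))})
       \<le> C * totient_ratio k ^ 2 * u / ln u ^ 2"
proof -
  have ev1: "\<forall>\<^sub>F u::real in at_top. u powr (1/32) \<le> u powr (1/16) - 1" by real_asymp
  have ev2: "\<forall>\<^sub>F u::real in at_top. u powr (1/2) \<le> u / ln u ^ 2" by real_asymp
  have ev3: "\<forall>\<^sub>F u::real in at_top. u powr (1/16) < u - 1" by real_asymp
  have ev4: "\<forall>\<^sub>F u::real in at_top. u powr (1/16) \<ge> 3" by real_asymp
  have "\<forall>\<^sub>F u::real in at_top. \<forall>k>0. \<forall>j::int. \<bar>j\<bar> = 1 \<longrightarrow>
     real (card {q. prime q \<and> u < real q \<and> real q \<le> 2 * u \<and> prime (nat (int k * int q + j))})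
       \<le> 18433 * totient_ratio k ^ 2 * u / ln u ^ 2"
    using ev1 ev2 ev3 ev4 eventually_gt_at_top[of 2]
  proof eventually_elim
    case (elim u)
    \<comment> \<open>The exponent 1/16 keeps the sieve error y^8 below sqrt u, which is eventually
      less than u / ln^2 u.\<close>
    define y where "y = nat \<lfloor>u powr (1/16)\<rfloor>"
    have y: "real y \<le> u powr (1/16)" "u powr (1/16) < real y + 1"
      unfolding y_def using powr_ge_zero[of u "1/16"] by linarith+
    have y2: "y \<ge> 2" using y elim(4) by linarith
    have "u powr (1/32) \<le> real y" using y elim(1) by linarith
    hence "ln (u powr (1/32)) \<le> ln (real y)" using elim(5) by (intro ln_mono) auto
    hence lny: "ln u / 32 \<le> ln (real y)" using elim(5) by (simp add: ln_powr)
    have lnu: "ln u > 0" using elim(5) by simp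
    have y8: "real y ^ 8 \<le> u powr (1/2)"
    proof -
      have "real y ^ 8 \<le> (u powr (1/16)) ^ 8" by (rule power_mono[OF y(1)]) simp
      also have "\<dots> = u powr (1/2)" using elim(5) by (simp add: powr_powr flip: powr_numeral)
      finally show ?thesis .
    qed
    show ?case
    proof (intro allI impI)
      fix k :: nat and j :: int assume k: "k > 0" and j: "\<bar>j\<bar> = 1"
      let ?Q = "{q. prime q \<and> u < real q \<and> real q \<le> 2 * u \<and> prime (nat (int k * int q + j))}"
      define W where "W = totient_ratio k"
      have W: "W \<ge> 1" unfolding W_def by (rule totient_ratio_ge_1)
      define M where "M = nat \<lfloor>u\<rfloor>"
      define N where "N = nat \<lfloor>2 * u\<rfloor> - nat \<lfloor>u\<rfloor>"
      have N: "real N \<le> u + 1" unfolding N_def using elim(5) by linarith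
      have sub: "?Q \<subseteq> {n \<in> {M+1..<M+1+N}. \<forall>p. prime p \<longrightarrow> 5 \<le> p \<longrightarrow> p \<le> y \<longrightarrow> \<not> p dvd n \<and> \<not> int p dvd int k * int n + j}"
      proof
        fix q assume q: "q \<in> ?Q"
        have qM: "q \<in> {M+1..<M+1+N}"
        proof -
          have "M < q" using q elim(5) unfolding M_def by (auto simp: nat_less_iff floor_less_iff)
          moreover have "q \<le> nat \<lfloor>2 * u\<rfloor>" using q by (simp add: le_nat_floor)
          moreover have "nat \<lfloor>u\<rfloor> \<le> nat \<lfloor>2 * u\<rfloor>" using elim(5) by (intro nat_mono floor_mono) simp
          ultimately show ?thesis unfolding N_def M_def by auto
        qed
        have "\<not> p dvd q \<and> \<not> int p dvd int k * int q + j" if p: "prime p" "p \<le> y" for p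
        proof
          have yq: "real p + 1 < real q" using p y elim(3) q by (auto intro: le_less_trans)
          show "\<not> p dvd q"
          proof
            assume "p dvd q"
            hence "p = q" using primes_dvd_imp_eq[OF p(1)] q by auto
            thus False using yq by simp
          qed
          show "\<not> int p dvd int k * int q + j"
          proof
            assume d: "int p dvd int k * int q + j"
            define r where "r = nat (int k * int q + j)"
            have "int q \<le> int k * int q" using k by (simp add: mult_le_cancel_right1)
            moreover have "int p + 1 < int q" using yq by linarith
            ultimately have big: "int p < int k * int q + j" using j by linarith
            hence r: "int r = int k * int q + j" by (simp add: r_def)
            hence "p dvd r" using d by (simp flip: int_dvd_int_iff)
            hence "p = r" using primes_dvd_imp_eq[OF p(1)] q by (auto simp: r_def)
            thus False using big r by simp
          qed
        qed
        thus "q \<in> {n \<in> {M+1..<M+1+N}. \<forall>p. prime p \<longrightarrow> 5 \<le> p \<longrightarrow> p \<le> y \<longrightarrow> \<not> p dvd n \<and> \<not> int p dvd int k * int n + j}"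
          using qM by blast
      qed
      have "real (card ?Q) \<le> real (card {n \<in> {M+1..<M+1+N}. \<forall>p. prime p \<longrightarrow> 5 \<le> p \<longrightarrow> p \<le> y \<longrightarrow> \<not> p dvd n \<and> \<not> int p dvd int k * int n + j})"
        by (rule of_nat_mono, rule card_mono[OF _ sub]) simp
      also have "\<dots> \<le> 9 * real N * W ^ 2 / ln (real y) ^ 2 + real y ^ 8"
        unfolding W_def by (rule prime_pair_sieve[OF j k y2])
      also have "9 * real N * W ^ 2 / ln (real y) ^ 2 \<le> 9 * (2 * u) * W ^ 2 / (ln u / 32) ^ 2"
        using N elim(5) lny lnu W by (intro frac_le mult_mono mult_left_mono power_mono mult_nonneg_nonneg) auto
      \<comment> \<open>18432 = 9 * 2 * 32^2, from N \<le> 2u and ln y \<ge> ln u / 32. One more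
        unit absorbs the error term.\<close>
      also have "\<dots> = 18432 * (W ^ 2 * (u / ln u ^ 2))" by (simp add: power_divide)
      finally have "real (card ?Q) \<le> 18432 * (W ^ 2 * (u / ln u ^ 2)) + real y ^ 8" by simp
      moreover have "real y ^ 8 \<le> u / ln u ^ 2" using y8 elim(2) by linarith
      moreover have "u / ln u ^ 2 \<le> W ^ 2 * (u / ln u ^ 2)"
      proof -
        have "1 * (u / ln u ^ 2) \<le> W ^ 2 * (u / ln u ^ 2)"
          by (rule mult_right_mono[OF one_le_power[OF W]]) (use elim(5) in simp)
        thus ?thesis by (simp only: mult_1)
      qed
      ultimately have "real (card ?Q) \<le> 18433 * (W ^ 2 * (u / ln u ^ 2))" by linarith
      thus "real (card ?Q) \<le> 18433 * totient_ratio k ^ 2 * u / ln u ^ 2"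
        by (simp add: W_def)
    qed
  qed
  thus ?thesis by (intro exI[of _ 18433]) simp
qed

text \<open>Primewise this is (p - 2)(4p - 3) \<ge> 0. The constant 6 is forced by p = 2, where
  equality holds.\<close>

lemma totient_ratio_square_le: "totient_ratio k ^ 2 \<le> (\<Prod>p\<in>prime_factors k. 1 + 6 / real p)"
  unfolding totient_ratio_def prod_power_distrib
proof (rule prod_mono, intro conjI)
  fix p assume "p \<in> prime_factors k"
  hence p: "p \<ge> 2" by (auto dest: in_prime_factors_imp_prime simp: prime_ge_2_nat)
  have "(real p / (real p - 1)) ^ 2 \<le> (real p + 6) / real p"
  proof -
    have "0 \<le> (real p - 2) * (4 * real p - 3)" using p by (intro mult_nonneg_nonneg) auto
    hence "real p ^ 2 * real p \<le> (real p + 6) * (real p - 1) ^ 2"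
      by (simp add: power2_eq_square algebra_simps)
    moreover have "(real p - 1) ^ 2 > 0" "real p > 0" using p by auto
    ultimately show ?thesis
      by (simp only: power_divide pos_divide_le_eq times_divide_eq_left pos_le_divide_eq)
  qed
  also have "\<dots> = 1 + 6 / real p" using p by (simp add: add_divide_distrib)
  finally show "(real p / (real p - 1)) ^ 2 \<le> 1 + 6 / real p" .
qed auto

text \<open>Primes are added one at a time. The extra summand 6/p is present only for k = pm, and
  with 1/k = 1/(pm) it contributes 6/p^2 times the previous sum.\<close>

lemma sum_multiplicative_le:
  assumes "finite P" "\<And>p. p \<in> P \<Longrightarrow> prime p"
  shows "(\<Sum>k\<in>{1..x}. (\<Prod>p\<in>prime_factors k \<inter> P. 1 + 6 / real p) / real k) \<le> (\<Prod>p\<in>P. 1 + 6 / real p ^ 2) * harm x"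
  using assms
proof (induction P arbitrary: x)
  case empty
  show ?case by (simp add: harm_def inverse_eq_divide)
next
  case (insert p P)
  have p: "prime p" using insert.prems by simp
  have p0: "p > 0" using prime_gt_0_nat[OF p] .
  define T where "T k = (\<Prod>p\<in>prime_factors k \<inter> P. 1 + 6 / real p)" for k
  have T0: "T k \<ge> 0" for k unfolding T_def by (intro prod_nonneg) auto
  have Tp: "T (p * m) = T m" if "m > 0" for m
  proof -
    have "prime_factors (p * m) = insert p (prime_factors m)"
      using that p p0 by (simp add: prime_factors_product prime_factorization_prime)
    thus ?thesis using insert.hyps by (simp add: T_def)
  qed
  have ins: "(\<Prod>r\<in>prime_factors k \<inter> insert p P. 1 + 6 / real r) = T k + (if p dvd k then 6 / real p * T k else 0)" if "k > 0" for k
  proof (cases "p dvd k")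
    case True
    hence "prime_factors k \<inter> insert p P = insert p (prime_factors k \<inter> P)" using that p by (auto simp: in_prime_factors_iff)
    thus ?thesis using insert.hyps True by (simp add: T_def algebra_simps)
  next
    case False
    hence "prime_factors k \<inter> insert p P = prime_factors k \<inter> P" by (auto simp: in_prime_factors_iff)
    thus ?thesis using False by (simp add: T_def)
  qed
  have "(\<Sum>k\<in>{1..x}. (\<Prod>r\<in>prime_factors k \<inter> insert p P. 1 + 6 / real r) / real k)
      = (\<Sum>k\<in>{1..x}. T k / real k) + (\<Sum>k\<in>{1..x}. if p dvd k then 6 / real p * T k / real k else 0)"
    unfolding sum.distrib[symmetric] by (rule sum.cong) (auto simp: ins add_divide_distrib)
  also have "(\<Sum>k\<in>{1..x}. if p dvd k then 6 / real p * T k / real k else 0) = (\<Sum>m\<in>{1..x div p}. 6 / real p ^ 2 * (T m / real m))"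
  proof -
    have inj: "inj_on ((*) p) {1..x div p}" using p0 by (auto simp: inj_on_def)
    have img: "{k \<in> {1..x}. p dvd k} = (*) p ` {1..x div p}"
    proof (intro equalityI subsetI)
      fix k assume "k \<in> {k \<in> {1..x}. p dvd k}"
      then obtain m where "k = p * m" "1 \<le> p * m" "p * m \<le> x" by (auto elim: dvdE)
      moreover from this have "m \<ge> 1" "m \<le> x div p"
        using p0 by (auto simp: less_eq_div_iff_mult_less_eq mult.commute intro!: Suc_leI Nat.gr0I)
      ultimately show "k \<in> (*) p ` {1..x div p}" by auto
    next
      fix k assume "k \<in> (*) p ` {1..x div p}"
      thus "k \<in> {k \<in> {1..x}. p dvd k}"
        using p0 by (auto simp: less_eq_div_iff_mult_less_eq mult.commute)
    qed
    have "(\<Sum>k\<in>{1..x}. if p dvd k then 6 / real p * T k / real k else 0) = (\<Sum>k\<in>{k \<in> {1..x}. p dvd k}. 6 / real p * T k / real k)"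
      by (rule sum.inter_filter[symmetric]) simp
    also have "\<dots> = (\<Sum>m\<in>{1..x div p}. 6 / real p * T (p * m) / real (p * m))"
      unfolding img by (subst sum.reindex[OF inj]) simp
    also have "\<dots> = (\<Sum>m\<in>{1..x div p}. 6 / real p ^ 2 * (T m / real m))"
      by (rule sum.cong) (auto simp: Tp power2_eq_square)
    finally show ?thesis .
  qed
  also have "\<dots> \<le> (\<Sum>m\<in>{1..x}. 6 / real p ^ 2 * (T m / real m))"
    by (rule sum_mono2) (use T0 in \<open>auto intro: order_trans[OF _ div_le_dividend]\<close>)
  also have "(\<Sum>k\<in>{1..x}. T k / real k) + \<dots> = (1 + 6 / real p ^ 2) * (\<Sum>k\<in>{1..x}. T k / real k)"
    by (simp only: sum_distrib_left[symmetric] distrib_right mult_1)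
  also have "\<dots> \<le> (1 + 6 / real p ^ 2) * ((\<Prod>p\<in>P. 1 + 6 / real p ^ 2) * harm x)"
    unfolding T_def by (rule mult_left_mono[OF insert.IH]) (use insert.prems in auto)
  finally show ?case using insert.hyps by (simp add: mult.assoc)
qed

text \<open>The sieve loses (k / \<phi>(k))^2, which is bounded on logarithmic average; this keeps
  the k-sum as small as a harmonic sum.\<close>

lemma sum_totient_ratio_square: "\<exists>C>0. \<forall>x. (\<Sum>k\<in>{1..x}. totient_ratio k ^ 2 / real k) \<le> C * harm x"
proof -
  define S where "S = (\<Sum>n. 1 / real n ^ 2)"
  have sm: "summable (\<lambda>n. 1 / real n ^ 2)"
    using inverse_power_summable[of 2, where 'a = real] by (simp add: inverse_eq_divide)
  have "(\<Sum>k\<in>{1..x}. totient_ratio k ^ 2 / real k) \<le> exp (6 * S) * harm x" for x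
  proof -
    define P where "P = {p. prime p \<and> p \<le> x}"
    have P: "finite P" "\<And>p. p \<in> P \<Longrightarrow> prime p" by (auto simp: P_def)
    have "(\<Sum>k\<in>{1..x}. totient_ratio k ^ 2 / real k) \<le> (\<Sum>k\<in>{1..x}. (\<Prod>p\<in>prime_factors k \<inter> P. 1 + 6 / real p) / real k)"
    proof (rule sum_mono)
      fix k assume k: "k \<in> {1..x}"
      have "prime_factors k \<inter> P = prime_factors k"
        using k by (auto simp: P_def in_prime_factors_iff intro: order_trans[OF dvd_imp_le])
      thus "totient_ratio k ^ 2 / real k \<le> (\<Prod>p\<in>prime_factors k \<inter> P. 1 + 6 / real p) / real k"
        using totient_ratio_square_le[of k] by (simp add: divide_right_mono)
    qed
    also have "\<dots> \<le> (\<Prod>p\<in>P. 1 + 6 / real p ^ 2) * harm x" by (rule sum_multiplicative_le[OF P])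
    also have "(\<Prod>p\<in>P. 1 + 6 / real p ^ 2) \<le> (\<Prod>p\<in>P. exp (6 / real p ^ 2))"
      by (rule prod_mono) (auto simp: exp_ge_add_one_self)
    also have "\<dots> = exp (6 * (\<Sum>p\<in>P. 1 / real p ^ 2))"
      using P(1) by (simp add: exp_sum sum_distrib_left)
    also have "\<dots> \<le> exp (6 * S)"
      unfolding S_def using sum_le_suminf[OF sm P(1)] by simp
    finally show ?thesis by (simp add: harm_nonneg mult_right_mono)
  qed
  thus ?thesis by (intro exI[of _ "exp (6 * S)"]) simp
qed

section \<open>Summation over the moduli\<close>

lemma harm_le: "n \<ge> 1 \<Longrightarrow> harm n \<le> 1 + ln (real n)"
proof (induction n rule: nat_induct_at_least)
  case base
  show ?case by (simp add: harm_def)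
next
  case (Suc n)
  have "ln (real n / real (Suc n)) \<le> real n / real (Suc n) - 1"
    using Suc.hyps by (intro ln_le_minus_one) simp
  also have "\<dots> = - (1 / real (Suc n))" by (simp add: field_simps)
  finally have "1 / real (Suc n) \<le> ln (real (Suc n)) - ln (real n)"
    using Suc.hyps by (simp add: ln_div)
  thus ?case using Suc.IH by (simp add: harm_Suc inverse_eq_divide)
qed

lemma abel_sum:
  fixes D f :: "nat \<Rightarrow> real"
  assumes "N \<le> M"
  shows "(\<Sum>n\<in>{N<..M}. (D n - D (n - 1)) * f n) = D M * f (Suc M) - D N * f (Suc N) + (\<Sum>n\<in>{N<..M}. D n * (f n - f (Suc n)))"
  using assms
proof (induction M rule: dec_induct)
  case (step M)
  have "{N<..Suc M} = insert (Suc M) {N<..M}" using step.hyps by auto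
  thus ?case using step.IH by (simp add: algebra_simps)
qed simp

lemma ln_ge_1: "n \<ge> 3 \<Longrightarrow> ln (real n) \<ge> 1"
proof -
  assume "n \<ge> 3"
  hence "ln (exp 1) \<le> ln (real n)" using exp_le by (intro ln_mono) auto
  thus ?thesis by simp
qed

text \<open>All bounds are uniform for \<sigma> between 1 and 2. The last one is what the cube of
  the logarithm buys: its left side is of order 1/(n ln^2 n), and the right side telescopes.\<close>

lemma ln_powr_diff_bounds:
  assumes n: "n \<ge> 3" and \<sigma>: "1 \<le> \<sigma>" "\<sigma> \<le> 2"
  defines "f \<equiv> \<lambda>n. ln (real n) * real n powr (-\<sigma>)"
  shows "0 \<le> f (Suc n)" "real n / ln (real n) ^ 3 * f (Suc n) \<le> 2 / ln (real n)"
    "real n / ln (real n) ^ 3 * \<bar>f n - f (Suc n)\<bar> \<le> 3 * (1 / ln (real (n - 1)) - 1 / ln (real n))"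
proof -
  define x where "x = real n"
  have x: "x \<ge> 3" "x > 0" using n by (simp_all add: x_def)
  define l where "l = ln x"
  have l: "l \<ge> 1" using ln_ge_1[OF n] by (simp add: l_def x_def)
  have Suc: "real (Suc n) = x + 1" by (simp add: x_def)
  have pw: "(x + 1) powr (-\<sigma>) \<le> 1 / (x + 1)" "x powr (-\<sigma>) \<le> 1 / x"
    using x \<sigma> powr_mono[of "-\<sigma>" "-1" "x + 1"] powr_mono[of "-\<sigma>" "-1" x] by (simp_all add: powr_minus_divide)
  have ln1: "0 \<le> ln (x + 1) - l" "ln (x + 1) - l \<le> 1 / x"
  proof -
    show "0 \<le> ln (x + 1) - l" using x by (simp add: l_def)
    have "ln ((x + 1) / x) \<le> (x + 1) / x - 1" using x by (intro ln_le_minus_one) auto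
    moreover have "ln ((x + 1) / x) = ln (x + 1) - l" unfolding l_def using x by (intro ln_divide_pos) auto
    moreover have "(x + 1) / x - 1 = 1 / x" using x by (simp add: add_divide_distrib)
    ultimately show "ln (x + 1) - l \<le> 1 / x" by simp
  qed
  show "0 \<le> f (Suc n)" unfolding f_def by simp
  have fS: "f (Suc n) = ln (x + 1) * (x + 1) powr (-\<sigma>)" by (simp only: f_def Suc)
  have fn: "f n = l * x powr (-\<sigma>)" by (simp add: f_def l_def x_def)
  have "1 / x \<le> 1" using x by simp
  hence l2: "ln (x + 1) \<le> 2 * l" using ln1(2) l by linarith
  show "real n / ln (real n) ^ 3 * f (Suc n) \<le> 2 / ln (real n)"
  proof -
    have "x * f (Suc n) \<le> x * (2 * l * (1 / (x + 1)))"
      unfolding fS using x l l2 pw by (intro mult_left_mono mult_mono) auto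
    also have "\<dots> = 2 * l * (x / (x + 1))" by simp
    also have "\<dots> \<le> 2 * l * 1" using x l by (intro mult_left_mono) auto
    finally have "x * f (Suc n) / l ^ 3 \<le> 2 * l / l ^ 3" using l by (intro divide_right_mono) auto
    also have "\<dots> = 2 / l / l" using l by (simp add: power3_eq_cube)
    also have "\<dots> \<le> 2 / l / 1" using l by (intro divide_left_mono) auto
    finally show ?thesis by (simp add: l_def x_def)
  qed
  have dp: "0 \<le> x powr (-\<sigma>) - (x + 1) powr (-\<sigma>)" "x powr (-\<sigma>) - (x + 1) powr (-\<sigma>) \<le> 2 / x\<^sup>2"
  proof -
    show "0 \<le> x powr (-\<sigma>) - (x + 1) powr (-\<sigma>)" using x \<sigma> powr_mono2'[of "-\<sigma>" x "x + 1"] by simp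
    \<comment> \<open>The ratio of consecutive integers, so that (x + 1)^(-\<sigma>) = x^(-\<sigma>)
      t^\<sigma>. As t \<le> 1 and \<sigma> \<le> 2, t^\<sigma> may be replaced by t^2, which
      removes \<sigma>.\<close>
    define t where "t = x / (x + 1)"
    have t: "0 < t" "t \<le> 1" using x by (simp_all add: t_def)
    have "(x + 1) powr (-\<sigma>) = x powr (-\<sigma>) * t powr \<sigma>"
      using x by (simp add: t_def powr_divide powr_minus field_simps)
    moreover have "t ^ 2 \<le> t powr \<sigma>"
      using powr_mono'[of \<sigma> 2 t] t \<sigma> by (simp add: powr_numeral)
    ultimately have "x powr (-\<sigma>) - (x + 1) powr (-\<sigma>) \<le> x powr (-\<sigma>) * (1 - t ^ 2)"
      by (simp add: right_diff_distrib mult_left_mono)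
    also have "\<dots> \<le> 1 / x * (1 - t ^ 2)"
      using pw t by (intro mult_right_mono) (auto simp: power_le_one)
    also have "\<dots> \<le> 1 / x * (2 / x)"
    proof (rule mult_left_mono)
      have "1 - t ^ 2 \<le> 2 * (1 - t)" using zero_le_power2[of "1 - t"] by (simp add: power2_eq_square algebra_simps)
      also have "1 - t = 1 / (x + 1)" using x by (simp add: t_def field_simps)
      also have "2 * (1 / (x + 1)) \<le> 2 / x" using x by (simp add: frac_le)
      finally show "1 - t ^ 2 \<le> 2 / x" .
    qed (use x in simp)
    finally show "x powr (-\<sigma>) - (x + 1) powr (-\<sigma>) \<le> 2 / x\<^sup>2"
      by (simp add: power2_eq_square)
  qed
  have "f n - f (Suc n) = l * (x powr (-\<sigma>) - (x + 1) powr (-\<sigma>)) - (ln (x + 1) - l) * (x + 1) powr (-\<sigma>)"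
    unfolding fn fS by (simp add: algebra_simps)
  moreover have "0 \<le> l * (x powr (-\<sigma>) - (x + 1) powr (-\<sigma>))" using l dp(1) by simp
  moreover have "l * (x powr (-\<sigma>) - (x + 1) powr (-\<sigma>)) \<le> l * (2 / x\<^sup>2)" using l dp(2) by (intro mult_left_mono) auto
  moreover have "0 \<le> (ln (x + 1) - l) * (x + 1) powr (-\<sigma>)" using ln1 by simp
  moreover have "(ln (x + 1) - l) * (x + 1) powr (-\<sigma>) \<le> l * (1 / x\<^sup>2)"
  proof -
    have "1 / (x + 1) \<le> 1 / x" using x by (intro divide_left_mono) auto
    hence "(ln (x + 1) - l) * (x + 1) powr (-\<sigma>) \<le> 1 / x * (1 / x)"
      using ln1 pw x by (intro mult_mono) auto
    also have "\<dots> = 1 * (1 / x\<^sup>2)" by (simp add: power2_eq_square)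
    also have "\<dots> \<le> l * (1 / x\<^sup>2)" using l by (intro mult_right_mono) auto
    finally show ?thesis .
  qed
  ultimately have "\<bar>f n - f (Suc n)\<bar> \<le> l * (2 / x\<^sup>2) + l * (1 / x\<^sup>2)" by linarith
  also have "\<dots> = 3 * l / x\<^sup>2" by (simp add: add_divide_distrib[symmetric])
  finally have "x / l ^ 3 * \<bar>f n - f (Suc n)\<bar> \<le> x / l ^ 3 * (3 * l / x\<^sup>2)"
    using x l by (intro mult_left_mono) auto
  also have "\<dots> = 3 * (1 / x / (l * l))" using x l by (simp add: power2_eq_square power3_eq_cube)
  also have "\<dots> \<le> 3 * (1 / ln (x - 1) - 1 / l)"
  proof -
    have p: "ln (x - 1) > 0" using x by simp
    have "ln ((x - 1) / x) \<le> (x - 1) / x - 1" using x by (intro ln_le_minus_one) auto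
    moreover have "ln ((x - 1) / x) = ln (x - 1) - l" unfolding l_def using x by (intro ln_divide_pos) auto
    moreover have "(x - 1) / x - 1 = - (1 / x)" using x by (simp add: diff_divide_distrib)
    ultimately have d: "1 / x \<le> l - ln (x - 1)" by linarith
    have m: "ln (x - 1) \<le> l" using x by (simp add: l_def)
    have "1 / x / (l * l) \<le> (l - ln (x - 1)) / (l * ln (x - 1))"
      using d p m l x by (intro frac_le mult_left_mono) auto
    also have "\<dots> = 1 / ln (x - 1) - 1 / l" using p l by (simp add: field_simps)
    finally show ?thesis by simp
  qed
  finally show "real n / ln (real n) ^ 3 * \<bar>f n - f (Suc n)\<bar> \<le> 3 * (1 / ln (real (n - 1)) - 1 / ln (real n))"
    using n by (simp add: x_def l_def of_nat_diff)
qed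

text \<open>Summing over q after partial summation, the hypothesis is used only for averages at
  integers n \<ge> N. The constant 7 is 2 + 2 for the two boundary terms and 3 for the telescoping
  sum.\<close>

lemma abel_sum_bound:
  fixes D :: "'q \<Rightarrow> nat \<Rightarrow> real"
  assumes C: "C \<ge> 0" and E: "\<And>n. n \<ge> N \<Longrightarrow> (\<Sum>q\<in>S. \<bar>D q n\<bar>) \<le> C * (real n / ln (real n) ^ 3)"
    and N: "N \<ge> 3" and M: "M \<ge> N" and \<sigma>: "1 \<le> \<sigma>" "\<sigma> \<le> 2"
  shows "(\<Sum>q\<in>S. \<bar>\<Sum>n\<in>{N<..M}. (D q n - D q (n - 1)) * (ln (real n) * real n powr (-\<sigma>))\<bar>) \<le> 7 * C / ln (real N)"
proof -
  define f where "f n = ln (real n) * real n powr (-\<sigma>)" for n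
  define e where "e n = real n / ln (real n) ^ 3" for n
  note f = ln_powr_diff_bounds[OF _ \<sigma>, folded f_def]
  have lnN: "ln (real N) \<ge> 1" using ln_ge_1[OF N] .
  have b: "(\<Sum>q\<in>S. \<bar>D q n\<bar>) * f (Suc n) \<le> 2 * C / ln (real N)" if "n \<ge> N" for n
  proof -
    have "n \<ge> 3" using N that by simp
    have "(\<Sum>q\<in>S. \<bar>D q n\<bar>) * f (Suc n) \<le> C * e n * f (Suc n)"
      unfolding e_def by (rule mult_right_mono[OF E[OF that] f(1)[OF \<open>n \<ge> 3\<close>]])
    also have "\<dots> = C * (e n * f (Suc n))" by simp
    also have "\<dots> \<le> C * (2 / ln (real n))"
      unfolding e_def by (rule mult_left_mono[OF f(2)[OF \<open>n \<ge> 3\<close>] C])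
    also have "\<dots> \<le> C * (2 / ln (real N))"
      using C lnN that N by (intro mult_left_mono divide_left_mono ln_mono mult_pos_pos) auto
    also have "\<dots> = 2 * C / ln (real N)" by simp
    finally show ?thesis .
  qed
  have "(\<Sum>q\<in>S. \<bar>\<Sum>n\<in>{N<..M}. (D q n - D q (n - 1)) * f n\<bar>)
      \<le> (\<Sum>q\<in>S. \<bar>D q M\<bar> * f (Suc M) + \<bar>D q N\<bar> * f (Suc N) + (\<Sum>n\<in>{N<..M}. \<bar>D q n\<bar> * \<bar>f n - f (Suc n)\<bar>))"
  proof (rule sum_mono)
    fix q
    have "\<bar>\<Sum>n\<in>{N<..M}. D q n * (f n - f (Suc n))\<bar> \<le> (\<Sum>n\<in>{N<..M}. \<bar>D q n\<bar> * \<bar>f n - f (Suc n)\<bar>)"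
      by (rule order_trans[OF sum_abs]) (simp add: abs_mult)
    moreover have "\<bar>D q M * f (Suc M)\<bar> = \<bar>D q M\<bar> * f (Suc M)" "\<bar>D q N * f (Suc N)\<bar> = \<bar>D q N\<bar> * f (Suc N)"
      using f(1)[of M] f(1)[of N] N M by (simp_all add: abs_mult)
    ultimately show "\<bar>\<Sum>n\<in>{N<..M}. (D q n - D q (n - 1)) * f n\<bar>
      \<le> \<bar>D q M\<bar> * f (Suc M) + \<bar>D q N\<bar> * f (Suc N) + (\<Sum>n\<in>{N<..M}. \<bar>D q n\<bar> * \<bar>f n - f (Suc n)\<bar>)"
      unfolding abel_sum[OF M] by linarith
  qed
  also have "\<dots> = (\<Sum>q\<in>S. \<bar>D q M\<bar>) * f (Suc M) + (\<Sum>q\<in>S. \<bar>D q N\<bar>) * f (Suc N) + (\<Sum>n\<in>{N<..M}. (\<Sum>q\<in>S. \<bar>D q n\<bar>) * \<bar>f n - f (Suc n)\<bar>)"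
    by (simp add: sum.distrib sum_distrib_right sum.swap[of _ S])
  also have "\<dots> \<le> 2 * C / ln (real N) + 2 * C / ln (real N) + 3 * C / ln (real N)"
  proof (intro add_mono b)
    have "(\<Sum>n\<in>{N<..M}. (\<Sum>q\<in>S. \<bar>D q n\<bar>) * \<bar>f n - f (Suc n)\<bar>)
        \<le> (\<Sum>n\<in>{N<..M}. 3 * C * (1 / ln (real (n - 1)) - 1 / ln (real n)))"
    proof (rule sum_mono)
      fix n assume "n \<in> {N<..M}"
      hence n: "n \<ge> N" "n \<ge> 3" using N by auto
      have "(\<Sum>q\<in>S. \<bar>D q n\<bar>) * \<bar>f n - f (Suc n)\<bar> \<le> C * e n * \<bar>f n - f (Suc n)\<bar>"
        unfolding e_def by (rule mult_right_mono[OF E[OF n(1)]]) simp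
      also have "\<dots> = C * (e n * \<bar>f n - f (Suc n)\<bar>)" by simp
      also have "\<dots> \<le> C * (3 * (1 / ln (real (n - 1)) - 1 / ln (real n)))"
        unfolding e_def by (rule mult_left_mono[OF f(3)[OF n(2)] C])
      also have "\<dots> = 3 * C * (1 / ln (real (n - 1)) - 1 / ln (real n))" by (simp only: mult_ac)
      finally show "(\<Sum>q\<in>S. \<bar>D q n\<bar>) * \<bar>f n - f (Suc n)\<bar> \<le> 3 * C * (1 / ln (real (n - 1)) - 1 / ln (real n))" .
    qed
    also have "\<dots> = 3 * C * (1 / ln (real N) - 1 / ln (real M))"
      unfolding sum_distrib_left[symmetric] using M
    proof (induction M rule: dec_induct)
      case (step M)
      have "{N<..Suc M} = insert (Suc M) {N<..M}" using step.hyps by auto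
      thus ?case using step.IH by (simp add: algebra_simps)
    qed simp
    also have "\<dots> \<le> 3 * C * (1 / ln (real N))"
      using C M N by (intro mult_left_mono) auto
    finally show "(\<Sum>n\<in>{N<..M}. (\<Sum>q\<in>S. \<bar>D q n\<bar>) * \<bar>f n - f (Suc n)\<bar>) \<le> 3 * C / ln (real N)" by simp
  qed (use M in auto)
  finally show ?thesis by (simp add: f_def add_divide_distrib[symmetric])
qed

section \<open>Primes below the threshold\<close>

lemma finite_odd_primes_in: "finite (odd_primes_in a b)"
  by (rule finite_subset[of _ "{..nat \<lfloor>b\<rfloor>}"]) (auto simp: odd_primes_in_def le_nat_floor)

definition prime_sign :: "nat \<Rightarrow> nat \<Rightarrow> real" where
  "prime_sign q n = (if prime n then of_bool ([n = 1] (mod q)) - of_bool ([n = q - 1] (mod q)) else 0)"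

text \<open>Its jump at n is \<open>prime_sign q n\<close>, see \<open>ap_difference_step\<close>,
  so the hypothesis bounds the partial sums of the sign sequence.\<close>

definition ap_difference :: "nat \<Rightarrow> nat \<Rightarrow> real" where
  "ap_difference q n = real (prime_count_ap (real n) q 1) - real (prime_count_ap (real n) q (-1))"

lemma cong_minus_1_iff:
  assumes "q > 0"
  shows "[int n = - 1] (mod int q) \<longleftrightarrow> [n = q - 1] (mod q)" "[n = q - 1] (mod q) \<longleftrightarrow> q dvd n + 1"
proof -
  have "[n = q - 1] (mod q) \<longleftrightarrow> int q dvd int n - int (q - 1)"
    by (simp only: cong_int_iff[symmetric] cong_iff_dvd_diff)
  also have "int n - int (q - 1) = (int n + 1) - int q" using assms by (simp add: of_nat_diff)
  also have "int q dvd (int n + 1) - int q \<longleftrightarrow> int q dvd int n + 1"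
    using dvd_diff[of "int q" "int n + 1" "int q"] dvd_add[of "int q" "int n + 1 - int q" "int q"] by auto
  finally have *: "[n = q - 1] (mod q) \<longleftrightarrow> int q dvd int n + 1" .
  show "[int n = - 1] (mod int q) \<longleftrightarrow> [n = q - 1] (mod q)"
    unfolding * by (simp add: cong_iff_dvd_diff)
  have "int n + 1 = int (n + 1)" by simp
  thus "[n = q - 1] (mod q) \<longleftrightarrow> q dvd n + 1"
    unfolding * by (simp only: int_dvd_int_iff)
qed

lemma prime_count_ap_step:
  assumes "n > 0"
  shows "real (prime_count_ap (real n) q a) - real (prime_count_ap (real (n - 1)) q a) =
    of_bool (prime n \<and> [int n = a] (mod int q))"
proof -
  let ?A = "\<lambda>n. {p::nat. prime p \<and> real p \<le> real n \<and> [int p = a] (mod int q)}"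
  have fin: "finite (?A n)" for n by (rule finite_subset[of _ "{..n}"]) auto
  have step: "p \<le> n \<longleftrightarrow> p = n \<or> p \<le> n - 1" for p using assms by auto
  show ?thesis
  proof (cases "prime n \<and> [int n = a] (mod int q)")
    case True
    have "?A n = insert n (?A (n - 1))" using True step by auto
    moreover have "n \<notin> ?A (n - 1)" using assms by auto
    ultimately have "card (?A n) = Suc (card (?A (n - 1)))" using fin by simp
    thus ?thesis using True by (simp add: prime_count_ap_def)
  next
    case False
    hence "?A n = ?A (n - 1)" using step by auto
    thus ?thesis using False by (simp add: prime_count_ap_def)
  qed
qed

lemma ap_difference_step:
  assumes "n > 0" "q > 0"
  shows "ap_difference q n - ap_difference q (n - 1) = prime_sign q n"
proof -
  have "ap_difference q n - ap_difference q (n - 1) =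
      (real (prime_count_ap (real n) q 1) - real (prime_count_ap (real (n - 1)) q 1)) -
      (real (prime_count_ap (real n) q (-1)) - real (prime_count_ap (real (n - 1)) q (-1)))"
    by (simp add: ap_difference_def)
  thus ?thesis
    unfolding prime_count_ap_step[OF assms(1)] cong_minus_1_iff(1)[OF assms(2)]
    using cong_int_iff[of n 1 q] by (simp add: prime_sign_def)
qed

lemma ln_nat_nonneg: "0 \<le> ln (real n)"
  by (cases "n = 0") simp_all

text \<open>Every prime that counts is n = kq \<plusminus> 1. Exchanging the sums, the q that make
  kq + j prime are counted by the sieve for fixed k and j; since 1/n is at most 2/(ku), what remains
  is the sum of (k / \<phi>(k))^2 / k.\<close>

lemma small_primes_bound:
  "\<exists>C>0. \<forall>\<^sub>F u::real in at_top. \<forall>N\<ge>1.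
    (\<Sum>q\<in>odd_primes_in u (2 * u). \<Sum>n\<in>{1..N}. \<bar>prime_sign q n\<bar> * (ln (real n) / real n))
      \<le> C * (ln (real N) / ln u ^ 2) * harm (nat \<lfloor>(real N + 1) / u\<rfloor>)"
proof -
  obtain C2 where C2: "C2 > 0" "\<forall>\<^sub>F u::real in at_top. \<forall>k>0. \<forall>j::int. \<bar>j\<bar> = 1 \<longrightarrow>
     real (card {q. prime q \<and> u < real q \<and> real q \<le> 2 * u \<and> prime (nat (int k * int q + j))})
       \<le> C2 * totient_ratio k ^ 2 * u / ln u ^ 2" using prime_pair_count by blast
  obtain C3 where C3: "C3 > 0" "\<And>x. (\<Sum>k\<in>{1..x}. totient_ratio k ^ 2 / real k) \<le> C3 * harm x"
    using sum_totient_ratio_square by blast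
  have "\<forall>\<^sub>F u::real in at_top. \<forall>N\<ge>1.
    (\<Sum>q\<in>odd_primes_in u (2 * u). \<Sum>n\<in>{1..N}. \<bar>prime_sign q n\<bar> * (ln (real n) / real n))
      \<le> 4 * C2 * C3 * (ln (real N) / ln u ^ 2) * harm (nat \<lfloor>(real N + 1) / u\<rfloor>)"
    using C2(2) eventually_gt_at_top[of 2]
  proof eventually_elim
    case (elim u)
    show ?case
    proof (intro allI impI)
      fix N :: nat assume N: "N \<ge> 1"
      define S where "S = odd_primes_in u (2 * u)"
      \<comment> \<open>From n = kq - 1 \<le> N one gets kq \<le> N + 1, so N + 1 rather than N
        limits k.\<close>
      define K where "K = nat \<lfloor>(real N + 1) / u\<rfloor>"
      define h where "h q k j = nat (int k * int q + j)" for q k :: nat and j :: int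
      define J where "J = {1, - 1 :: int}"
      have lnN: "ln (real N) \<ge> 0" using N by simp
      have per_q: "(\<Sum>n\<in>{1..N}. \<bar>prime_sign q n\<bar> * (ln (real n) / real n))
          \<le> (\<Sum>k\<in>{1..K}. \<Sum>j\<in>J. of_bool (prime (h q k j)) * (2 * ln (real N) / (real k * u)))" if q: "q \<in> S" for q
      proof -
        have qp: "prime q" "u < real q" using q by (auto simp: S_def odd_primes_in_def)
        have q0: "q > 2" using qp(2) elim(2) by linarith
        define I where "I = {(k, j) \<in> {1..K} \<times> J. prime (h q k j) \<and> h q k j \<le> N}"
        have finI: "finite I" unfolding I_def by (rule finite_subset[of _ "{1..K} \<times> J"]) (auto simp: J_def)
        let ?h = "\<lambda>(k, j). h q k j"
        have kK: "k \<le> K" if "k * q \<le> N + 1" for k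
        proof -
          have "real k * u \<le> real k * real q" using qp(2) by (intro mult_left_mono) auto
          also have "\<dots> = real (k * q)" by simp
          also have "\<dots> \<le> real (N + 1)" using that by (simp only: of_nat_le_iff)
          finally have "real k \<le> (real N + 1) / u" using elim(2) by (simp add: pos_le_divide_eq)
          thus ?thesis unfolding K_def by (rule le_nat_floor)
        qed
        have sub: "{n \<in> {1..N}. prime_sign q n \<noteq> 0} \<subseteq> ?h ` I"
        proof
          fix n assume n: "n \<in> {n \<in> {1..N}. prime_sign q n \<noteq> 0}"
          hence np: "prime n" "n \<le> N" and c: "[n = 1] (mod q) \<or> [n = q - 1] (mod q)"
            by (auto simp: prime_sign_def split: if_splits)
          have n1: "n > 1" using prime_gt_1_nat[OF np(1)] .
          from c show "n \<in> ?h ` I"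
          proof
            assume "[n = 1] (mod q)"
            hence "q dvd n - 1" using n1 by (simp add: cong_altdef_nat)
            then obtain k where k: "n - 1 = q * k" by (elim dvdE)
            have nk: "n = k * q + 1" using k n1 by (simp add: mult.commute)
            have "h q k 1 = n" unfolding h_def nk by (simp add: nat_add_distrib nat_mult_distrib)
            moreover have "k \<ge> 1" using nk n1 by (cases k) auto
            moreover have "k \<le> K" by (rule kK) (use nk np in linarith)
            ultimately have "(k, 1) \<in> I" "?h (k, 1) = n" using np by (auto simp: I_def J_def)
            thus ?thesis by (rule image_eqI[OF sym, rotated])
          next
            assume "[n = q - 1] (mod q)"
            hence "q dvd n + 1" using cong_minus_1_iff(2)[of q n] q0 by simp
            then obtain k where k: "n + 1 = q * k" by (elim dvdE)
            have "int n = int k * int q - 1" using arg_cong[OF k, of int] by (simp add: algebra_simps)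
            hence "h q k (-1) = n" unfolding h_def by simp
            moreover have "k \<ge> 1" using k by (cases k) auto
            moreover have "k \<le> K" by (rule kK) (use k np in \<open>simp add: mult.commute\<close>)
            ultimately have "(k, -1) \<in> I" "?h (k, -1) = n" using np by (auto simp: I_def J_def)
            thus ?thesis by (rule image_eqI[OF sym, rotated])
          qed
        qed
        have "(\<Sum>n\<in>{1..N}. \<bar>prime_sign q n\<bar> * (ln (real n) / real n)) = (\<Sum>n\<in>{n \<in> {1..N}. prime_sign q n \<noteq> 0}. \<bar>prime_sign q n\<bar> * (ln (real n) / real n))"
          by (rule sum.mono_neutral_right) auto
        also have "\<dots> \<le> (\<Sum>n\<in>{n \<in> {1..N}. prime_sign q n \<noteq> 0}. 1 * (ln (real n) / real n))"
          by (intro sum_mono mult_right_mono) (auto simp: prime_sign_def)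
        also have "\<dots> \<le> (\<Sum>n\<in>?h ` I. 1 * (ln (real n) / real n))"
          by (rule sum_mono2[OF finite_imageI[OF finI] sub]) (simp add: ln_nat_nonneg)
        also have "\<dots> = (\<Sum>n\<in>?h ` I. ln (real n) / real n)" by simp
        also have "\<dots> \<le> sum ((\<lambda>n. ln (real n) / real n) \<circ> ?h) I"
          by (rule sum_image_le[OF finI]) (simp add: ln_nat_nonneg)
        also have "\<dots> \<le> (\<Sum>(k, j)\<in>I. of_bool (prime (h q k j)) * (2 * ln (real N) / (real k * u)))"
        proof (rule sum_mono)
          fix x assume x: "x \<in> I"
          obtain k j where kj: "x = (k, j)" by (cases x)
          have p: "prime (h q k j)" "h q k j \<le> N" "k \<ge> 1" "\<bar>j\<bar> = 1"
            using x kj by (auto simp: I_def J_def)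
          have "int k * int q + j \<le> int (h q k j)" by (simp add: h_def)
          hence "int k * int q - 1 \<le> int (h q k j)" using p(4) by linarith
          hence "real_of_int (int k * int q - 1) \<le> real_of_int (int (h q k j))" by (simp only: of_int_le_iff)
          \<comment> \<open>Since kq > 2, kq - 1 is at least half of kq; this is the factor 2 in the
            bound for 1/n.\<close>
          hence "real (h q k j) \<ge> real k * real q - 1" by simp
          moreover have "real q \<le> real k * real q" using p(3) by (simp add: mult_le_cancel_right1)
          ultimately have "real (h q k j) \<ge> real k * real q / 2" using q0 by linarith
          moreover have "real k * u \<le> real k * real q" using qp(2) by (intro mult_left_mono) auto
          ultimately have big: "real (h q k j) \<ge> real k * u / 2" by linarith
          have "ln (real (h q k j)) / real (h q k j) \<le> ln (real N) / (real k * u / 2)"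
            by (rule frac_le) (use big p elim(2) lnN prime_gt_0_nat[OF p(1)] in \<open>auto intro!: ln_mono\<close>)
          thus "((\<lambda>n. ln (real n) / real n) \<circ> ?h) x \<le> (case x of (k, j) \<Rightarrow> of_bool (prime (h q k j)) * (2 * ln (real N) / (real k * u)))"
            using p(1) kj by (simp add: mult.commute)
        qed
        also have "\<dots> \<le> (\<Sum>(k, j)\<in>{1..K} \<times> J. of_bool (prime (h q k j)) * (2 * ln (real N) / (real k * u)))"
          by (rule sum_mono2) (use lnN elim(2) in \<open>auto simp: I_def J_def\<close>)
        finally show ?thesis by (simp add: sum.cartesian_product)
      qed
      have cnt: "(\<Sum>q\<in>S. of_bool (prime (h q k j))) \<le> C2 * totient_ratio k ^ 2 * u / ln u ^ 2" if "k \<in> {1..K}" "j \<in> J" for k j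
      proof -
        let ?Q = "{q. prime q \<and> u < real q \<and> real q \<le> 2 * u \<and> prime (nat (int k * int q + j))}"
        have "finite ?Q" by (rule finite_subset[of _ "{..nat \<lfloor>2 * u\<rfloor>}"]) (auto simp: le_nat_floor)
        hence "card {q \<in> S. prime (h q k j)} \<le> card ?Q"
          by (rule card_mono) (auto simp: S_def odd_primes_in_def h_def)
        moreover have "real (card ?Q) \<le> C2 * totient_ratio k ^ 2 * u / ln u ^ 2"
        proof -
          have "k > 0" "\<bar>j\<bar> = 1" using that by (auto simp: J_def)
          thus ?thesis by (rule elim(1)[rule_format])
        qed
        moreover have "(\<Sum>q\<in>S. of_bool (prime (h q k j))) = real (card {q \<in> S. prime (h q k j)})"
          using finite_odd_primes_in by (simp add: S_def Int_def)
        ultimately show ?thesis by linarith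
      qed
      have "(\<Sum>q\<in>S. \<Sum>n\<in>{1..N}. \<bar>prime_sign q n\<bar> * (ln (real n) / real n))
          \<le> (\<Sum>q\<in>S. \<Sum>k\<in>{1..K}. \<Sum>j\<in>J. of_bool (prime (h q k j)) * (2 * ln (real N) / (real k * u)))"
        by (intro sum_mono per_q)
      also have "\<dots> = (\<Sum>k\<in>{1..K}. \<Sum>j\<in>J. (\<Sum>q\<in>S. of_bool (prime (h q k j))) * (2 * ln (real N) / (real k * u)))"
        unfolding sum_distrib_right by (subst sum.swap) (intro sum.cong refl sum.swap)
      also have "\<dots> \<le> (\<Sum>k\<in>{1..K}. \<Sum>j\<in>J. (C2 * totient_ratio k ^ 2 * u / ln u ^ 2) * (2 * ln (real N) / (real k * u)))"
        by (intro sum_mono mult_right_mono cnt) (use lnN elim(2) in auto)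
      also have "\<dots> = (\<Sum>k\<in>{1..K}. (4 * C2 * (ln (real N) / ln u ^ 2)) * (totient_ratio k ^ 2 / real k))"
        by (rule sum.cong) (use elim(2) in \<open>auto simp: J_def field_simps\<close>)
      also have "\<dots> = (4 * C2 * (ln (real N) / ln u ^ 2)) * (\<Sum>k\<in>{1..K}. totient_ratio k ^ 2 / real k)"
        by (simp add: sum_distrib_left)
      also have "\<dots> \<le> (4 * C2 * (ln (real N) / ln u ^ 2)) * (C3 * harm K)"
        by (rule mult_left_mono[OF C3(2)]) (use C2(1) lnN in auto)
      finally show "(\<Sum>q\<in>odd_primes_in u (2 * u). \<Sum>n\<in>{1..N}. \<bar>prime_sign q n\<bar> * (ln (real n) / real n))
          \<le> 4 * C2 * C3 * (ln (real N) / ln u ^ 2) * harm (nat \<lfloor>(real N + 1) / u\<rfloor>)"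
        by (simp add: S_def K_def mult_ac)
    qed
  qed
  thus ?thesis using C2(1) C3(1) by (intro exI[of _ "4 * C2 * C3"]) auto
qed

text \<open>The product of the primes is at least 2 to their number and divides m^2 - 1; the
  constant 3 comes from ln 2 \<ge> 2/3.\<close>

lemma card_prime_divisors_le:
  assumes "finite S" "\<And>p. p \<in> S \<Longrightarrow> prime (p::nat) \<and> (p dvd m - 1 \<or> p dvd m + 1)" "m \<ge> 2"
  shows "real (card S) \<le> 3 * ln (real m)"
proof -
  have dvd: "\<Prod>S dvd (m - 1) * (m + 1)" using assms(1,2)
  proof (induction S)
    case (insert p S)
    have "p dvd m - 1 \<or> p dvd m + 1" using insert.prems[of p] by blast
    hence "p dvd (m - 1) * (m + 1)" using dvd_mult dvd_mult2 by blast
    moreover have "coprime p (\<Prod>S)"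
      using insert by (intro prod_coprime_right primes_coprime) auto
    ultimately show ?case using insert by (simp add: divides_mult)
  qed simp
  have "(2::nat) ^ card S = (\<Prod>p\<in>S. 2)" by simp
  also have "\<dots> \<le> \<Prod>S" using assms(2) by (intro prod_mono) (auto simp: prime_ge_2_nat)
  also have "\<dots> \<le> (m - 1) * (m + 1)" by (rule dvd_imp_le[OF dvd]) (use assms(3) in simp)
  also have "\<dots> \<le> m ^ 2" using assms(3) by (cases m) (auto simp: power2_eq_square)
  finally have "real (2 ^ card S) \<le> real (m ^ 2)" by (simp only: of_nat_le_iff)
  hence "ln (2 ^ card S) \<le> ln (real m ^ 2)" using assms(3) by (intro ln_mono) auto
  hence "real (card S) * ln 2 \<le> 2 * ln (real m)" using assms(3) by (simp add: ln_realpow)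
  moreover have "real (card S) * (2/3) \<le> real (card S) * ln 2" by (intro mult_left_mono ln2_ge_two_thirds) auto
  ultimately show ?thesis by linarith
qed

section \<open>Contribution of proper prime powers\<close>

lemma infsum_finite_sum:
  fixes f :: "'q \<Rightarrow> 'a \<Rightarrow> real"
  assumes "finite S" "\<And>q. q \<in> S \<Longrightarrow> f q summable_on A"
  shows "(\<lambda>m. \<Sum>q\<in>S. f q m) summable_on A \<and> infsum (\<lambda>m. \<Sum>q\<in>S. f q m) A = (\<Sum>q\<in>S. infsum (f q) A)"
  using assms
proof (induction S)
  case (insert q S)
  hence IH: "(\<lambda>m. \<Sum>q\<in>S. f q m) summable_on A" "infsum (\<lambda>m. \<Sum>q\<in>S. f q m) A = (\<Sum>q\<in>S. infsum (f q) A)"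
    and q: "f q summable_on A" by auto
  show ?case using summable_on_add[OF q IH(1)] infsum_add[OF q IH(1)] IH(2) insert.hyps by simp
qed simp

definition prime_power_part :: "nat \<Rightarrow> real \<Rightarrow> real" where
  "prime_power_part q \<sigma> = (\<Sum>\<^sub>\<infinity>m\<in>proper_prime_powers. of_bool (q dvd m - 1 \<or> q dvd m + 1) * (ln (real m) * real m powr (-\<sigma>)))"

lemma proper_prime_powers_ge_2: "m \<in> proper_prime_powers \<Longrightarrow> m \<ge> 2"
proof -
  assume "m \<in> proper_prime_powers"
  then obtain p k where pk: "m = p ^ k" "prime p" "k \<ge> 2" by (auto simp: proper_prime_powers_def)
  have "p ^ 1 \<le> p ^ k" using pk prime_gt_0_nat[OF pk(2)] by (intro power_increasing) auto
  thus "m \<ge> 2" using pk(1) prime_ge_2_nat[OF pk(2)] by simp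
qed

text \<open>Each logarithm is absorbed by ln x \<le> 8 x^(1/8), so even the square of a logarithm
  leaves the exponent -3/4.\<close>

lemma ln_powr_le_three_quarters:
  assumes "m \<ge> 1" "\<sigma> \<ge> 1"
  shows "ln (real m) ^ 2 * real m powr (-\<sigma>) \<le> 64 * real m powr (-3/4)" "ln (real m) * real m powr (-\<sigma>) \<le> 8 * real m powr (-3/4)"
proof -
  define x where "x = real m"
  have x: "x \<ge> 1" using assms by (simp add: x_def)
  have l: "0 \<le> ln x" "ln x \<le> 8 * x powr (1/8)" using x ln_le_powr[of x "1/8"] by simp_all
  have p: "x powr (-\<sigma>) \<le> x powr (-1)" using x assms(2) by (intro powr_mono) auto
  have "ln x ^ 2 * x powr (-\<sigma>) \<le> (8 * x powr (1/8)) ^ 2 * x powr (-1)"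
    using l p by (intro mult_mono power_mono) auto
  also have "\<dots> = 64 * x powr (-3/4)"
  proof -
    have "(8 * y) ^ 2 * w = 64 * (y * y * w)" for y w :: real by (simp add: power2_eq_square)
    hence "(8 * x powr (1/8)) ^ 2 * x powr (-1) = 64 * (x powr (1/8) * x powr (1/8) * x powr (-1))" .
    also have "\<dots> = 64 * x powr (1/8 + 1/8 + - 1)" by (simp only: powr_add)
    finally show ?thesis by simp
  qed
  finally show "ln (real m) ^ 2 * real m powr (-\<sigma>) \<le> 64 * real m powr (-3/4)" by (simp add: x_def)
  have "ln x * x powr (-\<sigma>) \<le> 8 * x powr (1/8) * x powr (-1)"
    using l p by (intro mult_mono) auto
  also have "\<dots> = 8 * x powr (1/8 + - 1)" by (simp only: mult.assoc powr_add)
  also have "\<dots> = 8 * x powr (-7/8)" by simp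
  also have "\<dots> \<le> 8 * x powr (-3/4)" using x by (intro mult_left_mono powr_mono) auto
  finally show "ln (real m) * real m powr (-\<sigma>) \<le> 8 * real m powr (-3/4)" by (simp add: x_def)
qed

lemma prime_power_part_summable:
  assumes "\<sigma> \<ge> 1"
  shows "(\<lambda>m. of_bool (q dvd m - 1 \<or> q dvd m + 1) * (ln (real m) * real m powr (-\<sigma>))) summable_on proper_prime_powers"
proof (rule summable_on_comparison_test)
  show "(\<lambda>m. 8 * real m powr (-3/4)) summable_on proper_prime_powers"
    using summable_on_cmult_right[OF proper_prime_powers_summable[of "3/4"], of 8] by simp
  fix m assume "m \<in> proper_prime_powers"
  hence m: "m \<ge> 2" by (rule proper_prime_powers_ge_2)
  show "of_bool (q dvd m - 1 \<or> q dvd m + 1) * (ln (real m) * real m powr (-\<sigma>)) \<le> 8 * real m powr (-3/4)"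
    using ln_powr_le_three_quarters(2)[of m \<sigma>] m assms by (cases "q dvd m - 1 \<or> q dvd m + 1") auto
  show "0 \<le> of_bool (q dvd m - 1 \<or> q dvd m + 1) * (ln (real m) * real m powr (-\<sigma>))"
    using m by simp
qed

text \<open>With the summations exchanged, a fixed m occurs for at most 3 ln m moduli. A modulus q >
  u dividing m - 1 or m + 1 forces m \<ge> u - 1, which is where the decay in u comes from.\<close>

lemma prime_power_part_bound:
  "\<exists>C>0. \<forall>u\<ge>3. \<forall>\<sigma>\<ge>1. (\<Sum>q\<in>odd_primes_in u (2 * u). prime_power_part q \<sigma>) \<le> C * (u - 1) powr (-1/8)"
proof -
  define C where "C = (\<Sum>\<^sub>\<infinity>m\<in>proper_prime_powers. real m powr (-(5/8)))"
  have sC: "(\<lambda>m. real m powr (-(5/8))) summable_on proper_prime_powers"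
    by (rule proper_prime_powers_summable) simp
  have C0: "C \<ge> 0" unfolding C_def by (rule infsum_nonneg) simp
  have "(\<Sum>q\<in>odd_primes_in u (2 * u). prime_power_part q \<sigma>) \<le> 192 * (C + 1) * (u - 1) powr (-1/8)"
    if u: "u \<ge> 3" and \<sigma>: "\<sigma> \<ge> 1" for u \<sigma>
  proof -
    define S where "S = odd_primes_in u (2 * u)"
    have S: "finite S" unfolding S_def by (rule finite_odd_primes_in)
    define c where "c = 192 * (u - 1) powr (-1/8)"
    let ?b = "\<lambda>q m. q dvd m - 1 \<or> q dvd m + 1"
    note fs = infsum_finite_sum[OF S prime_power_part_summable[OF \<sigma>]]
    have "(\<Sum>q\<in>S. prime_power_part q \<sigma>) = (\<Sum>\<^sub>\<infinity>m\<in>proper_prime_powers. \<Sum>q\<in>S. of_bool (?b q m) * (ln (real m) * real m powr (-\<sigma>)))"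
      unfolding prime_power_part_def using fs by simp
    also have "\<dots> \<le> (\<Sum>\<^sub>\<infinity>m\<in>proper_prime_powers. c * real m powr (-(5/8)))"
    proof (rule infsum_mono)
      show "(\<lambda>m. \<Sum>q\<in>S. of_bool (?b q m) * (ln (real m) * real m powr (-\<sigma>))) summable_on proper_prime_powers" using fs by simp
      show "(\<lambda>m. c * real m powr (-(5/8))) summable_on proper_prime_powers" by (rule summable_on_cmult_right[OF sC])
      fix m assume "m \<in> proper_prime_powers"
      hence m: "m \<ge> 2" by (rule proper_prime_powers_ge_2)
      let ?T = "{q \<in> S. ?b q m}"
      have eq: "(\<Sum>q\<in>S. of_bool (?b q m) * (ln (real m) * real m powr (-\<sigma>))) = real (card ?T) * (ln (real m) * real m powr (-\<sigma>))"
      proof -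
        have "(\<Sum>q\<in>S. of_bool (?b q m)) = (\<Sum>q\<in>S. if ?b q m then 1 else 0 :: real)" by (rule sum.cong) auto
        also have "\<dots> = (\<Sum>q\<in>?T. 1)" by (rule sum.inter_filter[OF S, symmetric])
        finally show ?thesis by (simp only: sum_distrib_right[symmetric]) simp
      qed
      show "(\<Sum>q\<in>S. of_bool (?b q m) * (ln (real m) * real m powr (-\<sigma>))) \<le> c * real m powr (-(5/8))"
      proof (cases "?T = {}")
        case True
        thus ?thesis unfolding eq True by (simp add: c_def)
      next
        case False
        then obtain q where q: "q \<in> S" "?b q m" by auto
        have "q \<le> m + 1" using q(2) m by (auto dest!: dvd_imp_le)
        moreover have "u < real q" using q(1) by (simp add: S_def odd_primes_in_def)
        ultimately have um: "u - 1 \<le> real m" by linarith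
        have "real (card ?T) \<le> 3 * ln (real m)"
          by (rule card_prime_divisors_le) (use S m in \<open>auto simp: S_def odd_primes_in_def\<close>)
        hence "real (card ?T) * (ln (real m) * real m powr (-\<sigma>)) \<le> 3 * ln (real m) * (ln (real m) * real m powr (-\<sigma>))"
          using m by (intro mult_right_mono) auto
        also have "\<dots> = 3 * (ln (real m) ^ 2 * real m powr (-\<sigma>))" by (simp add: power2_eq_square)
        also have "\<dots> \<le> 3 * (64 * real m powr (-3/4))"
          using ln_powr_le_three_quarters(1)[of m \<sigma>] m \<sigma> by (intro mult_left_mono) auto
        \<comment> \<open>The factor with exponent -1/8 is spent on m \<ge> u - 1; the rest, with
          5/8 > 1/2, still sums over proper prime powers.\<close>
        also have "real m powr (-3/4) = real m powr (-1/8) * real m powr (-(5/8))" by (simp flip: powr_add)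
        also have "3 * (64 * (real m powr (-1/8) * real m powr (-(5/8)))) \<le> 3 * (64 * ((u - 1) powr (-1/8) * real m powr (-(5/8))))"
          using um u by (intro mult_left_mono mult_right_mono powr_mono2') auto
        finally show ?thesis unfolding eq c_def by (simp only: mult.assoc)
      qed
    qed
    also have "\<dots> = c * C" unfolding C_def by (rule infsum_cmult_right')
    also have "\<dots> \<le> c * (C + 1)" by (intro mult_left_mono) (auto simp: c_def)
    finally show ?thesis unfolding S_def[symmetric] c_def by (simp only: mult_ac)
  qed
  thus ?thesis using C0 by (intro exI[of _ "192 * (C + 1)"]) auto
qed

lemma ln_powr_summable:
  assumes "\<sigma> > 1"
  shows "(\<lambda>n. ln (real n) * real n powr (-\<sigma>)) summable_on UNIV"
proof -
  have "dsummable (\<lambda>m. 1 * of_real (ln (real m))) \<sigma>"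
    by (rule dsummable_ln[OF dsummable_1[of "(1 + \<sigma>) / 2"]]) (use assms in auto)
  thus ?thesis by (simp add: dsummable_def ln_nat_nonneg)
qed

lemma prime_sign_le: "\<bar>prime_sign q n\<bar> \<le> 1"
  by (simp add: prime_sign_def)

definition prime_part :: "nat \<Rightarrow> real \<Rightarrow> real" where
  "prime_part q \<sigma> = (\<Sum>\<^sub>\<infinity>n. prime_sign q n * (ln (real n) * real n powr (-\<sigma>)))"

lemma prime_part_summable:
  assumes "\<sigma> > 1"
  shows "(\<lambda>n. prime_sign q n * (ln (real n) * real n powr (-\<sigma>))) summable_on UNIV"
proof (rule abs_summable_summable, rule summable_on_comparison_test[OF ln_powr_summable[OF assms]])
  show "norm (prime_sign q n * (ln (real n) * real n powr (-\<sigma>))) \<le> ln (real n) * real n powr (-\<sigma>)" for n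
    using prime_sign_le[of q n] by (simp add: abs_mult ln_nat_nonneg mult_left_le_one_le)
qed simp

section \<open>From the logarithmic series to kappa\<close>

context cyclotomic
begin

text \<open>Subtracting np times the sign series removes all primes exactly. The remainder lives on
  proper prime powers m with q dividing m - 1 or m + 1, where the coefficient is at most q; and np <
  q/2.\<close>

lemma log_series_bound:
  assumes \<sigma>: "\<sigma> > 1"
  shows "\<bar>\<Sum>\<^sub>\<infinity>m. log_coeff_diff m * ln (real m) * real m powr (-\<sigma>)\<bar>
    \<le> real q / 2 * \<bar>prime_part q \<sigma>\<bar> + real q * prime_power_part q \<sigma>"
proof -
  define w where "w m = ln (real m) * real m powr (-\<sigma>)" for m
  have w0: "w m \<ge> 0" for m by (simp add: w_def ln_nat_nonneg)
  define a where "a m = log_coeff_diff m * w m" for m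
  define s where "s m = prime_sign q m * w m" for m
  define b where "b m = of_bool (q dvd m - 1 \<or> q dvd m + 1) * w m" for m
  define r where "r m = a m - real np * s m" for m
  have sa: "a summable_on UNIV"
  proof (rule abs_summable_summable)
    have "norm (a m) = \<bar>log_coeff_diff m\<bar> * ln (real m) * real m powr (-\<sigma>)" for m
      using w0[of m] by (simp add: a_def w_def abs_mult ln_nat_nonneg)
    thus "(\<lambda>m. norm (a m)) summable_on UNIV" using log_coeff_diff_summable[OF \<sigma>] by simp
  qed
  have ss: "s summable_on UNIV" unfolding s_def w_def by (rule prime_part_summable[OF \<sigma>])
  have sb: "b summable_on proper_prime_powers"
    unfolding b_def w_def by (rule prime_power_part_summable) (use \<sigma> in simp)
  have r_zero: "r m = 0" if "m \<notin> proper_prime_powers" for m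
  proof (cases "prime m")
    case True
    thus ?thesis by (simp add: r_def a_def s_def log_coeff_diff_prime prime_sign_def)
  next
    case False
    hence "log_coeff_diff m = 0" using log_coeff_diff_nonzero[of m] that by blast
    thus ?thesis using False by (simp add: r_def a_def s_def prime_sign_def)
  qed
  have r_le: "norm (r m) \<le> real q * b m" for m
  proof (cases "prime m")
    case True
    hence "r m = 0" by (simp add: r_def a_def s_def log_coeff_diff_prime prime_sign_def)
    thus ?thesis using w0[of m] by (simp add: b_def)
  next
    case False
    hence r: "r m = log_coeff_diff m * w m" by (simp add: r_def a_def s_def prime_sign_def)
    show ?thesis
    proof (cases "log_coeff_diff m = 0")
      case True
      thus ?thesis using w0[of m] by (simp add: r b_def)
    next
      case nz: False
      hence "b m = w m" using log_coeff_diff_nonzero[OF nz False] by (auto simp: b_def)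
      thus ?thesis using log_coeff_diff_le[of m] w0[of m] by (simp add: r abs_mult mult_right_mono)
    qed
  qed
  have sqb: "(\<lambda>m. real q * b m) summable_on proper_prime_powers" by (rule summable_on_cmult_right[OF sb])
  have sr: "(\<lambda>m. norm (r m)) summable_on proper_prime_powers"
    by (rule summable_on_comparison_test[OF sqb]) (use r_le in auto)
  have "infsum a UNIV = infsum (\<lambda>m. real np * s m + r m) UNIV" by (simp add: r_def)
  also have "\<dots> = infsum (\<lambda>m. real np * s m) UNIV + infsum r UNIV"
  proof (rule infsum_add)
    show "(\<lambda>m. real np * s m) summable_on UNIV" by (rule summable_on_cmult_right[OF ss])
    show "r summable_on UNIV"
      using summable_on_add[OF sa summable_on_cmult_right[OF ss, of "- real np"]] by (simp add: r_def[abs_def])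
  qed
  also have "infsum (\<lambda>m. real np * s m) UNIV = real np * prime_part q \<sigma>"
    unfolding prime_part_def s_def w_def by (rule infsum_cmult_right')
  also have "infsum r UNIV = infsum r proper_prime_powers"
    by (rule infsum_cong_neutral) (use r_zero in auto)
  finally have "\<bar>infsum a UNIV\<bar> \<le> \<bar>real np * prime_part q \<sigma>\<bar> + norm (infsum r proper_prime_powers)" by simp
  also have "\<bar>real np * prime_part q \<sigma>\<bar> \<le> real q / 2 * \<bar>prime_part q \<sigma>\<bar>"
  proof -
    have "real q = 2 * real np + 1" using arg_cong[OF q_np, of real] by simp
    thus ?thesis unfolding abs_mult by (intro mult_right_mono) auto
  qed
  also have "norm (infsum r proper_prime_powers) \<le> infsum (\<lambda>m. norm (r m)) proper_prime_powers"
    by (rule norm_infsum_bound[OF sr])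
  also have "\<dots> \<le> infsum (\<lambda>m. real q * b m) proper_prime_powers"
    by (rule infsum_mono[OF sr sqb r_le])
  also have "\<dots> = real q * prime_power_part q \<sigma>"
    unfolding prime_power_part_def b_def w_def by (rule infsum_cmult_right')
  finally show ?thesis by (simp add: a_def w_def mult.assoc)
qed

lemma kappa_limit:
  "((\<lambda>\<sigma>. \<bar>\<Sum>\<^sub>\<infinity>m. log_coeff_diff m * ln (real m) * real m powr (-\<sigma>)\<bar> / ln (real q)) \<longlongrightarrow> norm (kappa q)) (at_right 1)"
proof -
  have "ln (real q) > 0" using q_gt by simp
  hence "norm (kappa q) = norm (gamma_cyc_plus q - gamma_cyc q) / ln (real q)"
    by (simp add: kappa_def norm_divide)
  moreover have "((\<lambda>\<sigma>. norm (complex_of_real (\<Sum>\<^sub>\<infinity>m. log_coeff_diff m * ln (real m) * real m powr (-\<sigma>))) / ln (real q))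
      \<longlongrightarrow> norm (gamma_cyc_plus q - gamma_cyc q) / ln (real q)) (at_right 1)"
    using \<open>ln (real q) > 0\<close>
    by (intro tendsto_divide tendsto_norm tendsto_const euler_kronecker_difference primes_inverse_sqrt_not_summable) auto
  ultimately show ?thesis by (simp only: norm_of_real)
qed

end

text \<open>The series is cut at M, so that partial summation stays finite, and M then tends to
  infinity with the finite sum over q outside. For n \<le> N the power n^(-\<sigma>) is replaced by
  1/n, which makes the bound independent of \<sigma>.\<close>

lemma prime_part_sum_bound:
  fixes S :: "nat set"
  assumes S: "finite S" "\<And>q. q \<in> S \<Longrightarrow> q > 0"
    and C: "C \<ge> 0" and E: "\<And>n. n \<ge> N \<Longrightarrow> (\<Sum>q\<in>S. \<bar>ap_difference q n\<bar>) \<le> C * (real n / ln (real n) ^ 3)"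
    and N: "N \<ge> 3" and \<sigma>: "1 < \<sigma>" "\<sigma> \<le> 2"
    and small: "(\<Sum>q\<in>S. \<Sum>n\<in>{1..N}. \<bar>prime_sign q n\<bar> * (ln (real n) / real n)) \<le> B"
  shows "(\<Sum>q\<in>S. \<bar>prime_part q \<sigma>\<bar>) \<le> B + 7 * C / ln (real N)"
proof -
  define f where "f n = ln (real n) * real n powr (-\<sigma>)" for n
  define s where "s q n = prime_sign q n * f n" for q n
  have lim: "((\<lambda>M. \<Sum>q\<in>S. \<bar>\<Sum>n<Suc M. s q n\<bar>) \<longlongrightarrow> (\<Sum>q\<in>S. \<bar>prime_part q \<sigma>\<bar>)) sequentially"
  proof (intro tendsto_sum tendsto_rabs)
    fix q
    have "(s q has_sum prime_part q \<sigma>) UNIV"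
      unfolding s_def f_def prime_part_def by (rule has_sum_infsum[OF prime_part_summable[OF \<sigma>(1)]])
    hence "s q sums prime_part q \<sigma>" by (rule has_sum_imp_sums)
    hence "(\<lambda>M. \<Sum>n<M. s q n) \<longlonglongrightarrow> prime_part q \<sigma>" by (simp only: sums_def)
    thus "(\<lambda>M. \<Sum>n<Suc M. s q n) \<longlonglongrightarrow> prime_part q \<sigma>" by (rule LIMSEQ_Suc)
  qed
  have bound: "(\<Sum>q\<in>S. \<bar>\<Sum>n<Suc M. s q n\<bar>) \<le> B + 7 * C / ln (real N)" if M: "M \<ge> N" for M
  proof -
    have "(\<Sum>q\<in>S. \<bar>\<Sum>n<Suc M. s q n\<bar>) \<le> (\<Sum>q\<in>S. (\<Sum>n\<in>{1..N}. \<bar>prime_sign q n\<bar> * (ln (real n) / real n))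
        + \<bar>\<Sum>n\<in>{N<..M}. (ap_difference q n - ap_difference q (n - 1)) * (ln (real n) * real n powr (-\<sigma>))\<bar>)"
    proof (rule sum_mono)
      fix q assume q: "q \<in> S"
      have "{..<Suc M} = {0} \<union> ({1..N} \<union> {N<..M})" using M by auto
      hence "(\<Sum>n<Suc M. s q n) = s q 0 + (\<Sum>n\<in>{1..N} \<union> {N<..M}. s q n)" by simp
      also have "s q 0 = 0" by (simp add: s_def prime_sign_def)
      also have "(\<Sum>n\<in>{1..N} \<union> {N<..M}. s q n) = (\<Sum>n\<in>{1..N}. s q n) + (\<Sum>n\<in>{N<..M}. s q n)"
        by (rule sum.union_disjoint) auto
      finally have "\<bar>\<Sum>n<Suc M. s q n\<bar> \<le> (\<Sum>n\<in>{1..N}. \<bar>s q n\<bar>) + \<bar>\<Sum>n\<in>{N<..M}. s q n\<bar>"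
        using sum_abs[of "s q" "{1..N}"] by linarith
      moreover have "(\<Sum>n\<in>{1..N}. \<bar>s q n\<bar>) \<le> (\<Sum>n\<in>{1..N}. \<bar>prime_sign q n\<bar> * (ln (real n) / real n))"
      proof (rule sum_mono)
        fix n assume "n \<in> {1..N}"
        hence n: "real n \<ge> 1" by simp
        have "real n powr (-\<sigma>) \<le> real n powr (-1)" using n \<sigma> by (intro powr_mono) auto
        hence "f n \<le> ln (real n) * (1 / real n)"
          unfolding f_def using n by (intro mult_left_mono) (auto simp: powr_minus_divide)
        moreover have "f n \<ge> 0" by (simp add: f_def ln_nat_nonneg)
        moreover from calculation(1) have "\<bar>prime_sign q n\<bar> * f n \<le> \<bar>prime_sign q n\<bar> * (ln (real n) * (1 / real n))"
          by (rule mult_left_mono) simp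
        ultimately show "\<bar>s q n\<bar> \<le> \<bar>prime_sign q n\<bar> * (ln (real n) / real n)"
          by (simp add: s_def abs_mult)
      qed
      moreover have "(\<Sum>n\<in>{N<..M}. s q n) = (\<Sum>n\<in>{N<..M}. (ap_difference q n - ap_difference q (n - 1)) * (ln (real n) * real n powr (-\<sigma>)))"
      proof (rule sum.cong)
        fix n assume "n \<in> {N<..M}"
        hence "n > 0" by simp
        show "s q n = (ap_difference q n - ap_difference q (n - 1)) * (ln (real n) * real n powr (-\<sigma>))"
          by (simp only: ap_difference_step[OF \<open>n > 0\<close> S(2)[OF q]] s_def f_def)
      qed simp
      ultimately show "\<bar>\<Sum>n<Suc M. s q n\<bar> \<le> (\<Sum>n\<in>{1..N}. \<bar>prime_sign q n\<bar> * (ln (real n) / real n))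
        + \<bar>\<Sum>n\<in>{N<..M}. (ap_difference q n - ap_difference q (n - 1)) * (ln (real n) * real n powr (-\<sigma>))\<bar>" by simp
    qed
    also have "\<dots> \<le> B + 7 * C / ln (real N)"
      unfolding sum.distrib by (intro add_mono small abel_sum_bound C E N M) (use \<sigma> in auto)
    finally show ?thesis .
  qed
  show ?thesis
    by (rule tendsto_upperbound[OF lim eventually_sequentiallyI[OF bound]]) simp_all
qed

text \<open>For \<sigma> between 1 and 2 the sum over q has a bound free of \<sigma>, and the limit
  \<sigma> to 1 preserves it. Since q \<le> 2u and ln q \<ge> ln u, the common factor is u / ln u,
  and H collects the three error sources.\<close>

lemma kappa_sum_bound:
  assumes "strong_elliott_halberstam"
  shows "\<exists>H. (H \<longlongrightarrow> 0) at_top \<and>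
    (\<forall>\<^sub>F u in at_top. (\<Sum>q\<in>odd_primes_in u (2 * u). norm (kappa q)) \<le> u / ln u * H u)"
proof -
  define T :: "real \<Rightarrow> real" where "T u = u * exp (ln u / sqrt (ln (ln u)))" for u
  obtain C' where C': "\<forall>\<^sub>F u in at_top. \<forall>t\<ge>T u. (\<Sum>q\<in>odd_primes_in u (2 * u).
       \<bar>real (prime_count_ap t q 1) - real (prime_count_ap t q (-1))\<bar>) \<le> C' * (t / ln t ^ 3)"
    using assms unfolding strong_elliott_halberstam_def T_def by blast
  \<comment> \<open>The constant in the hypothesis may be negative, while partial summation requires
    C \<ge> 0.\<close>
  define C where "C = max C' 0"
  have C: "C \<ge> 0" "C' \<le> C" by (simp_all add: C_def)
  obtain C1 where C1: "C1 > 0" "\<forall>\<^sub>F u::real in at_top. \<forall>N\<ge>1.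
    (\<Sum>q\<in>odd_primes_in u (2 * u). \<Sum>n\<in>{1..N}. \<bar>prime_sign q n\<bar> * (ln (real n) / real n))
      \<le> C1 * (ln (real N) / ln u ^ 2) * harm (nat \<lfloor>(real N + 1) / u\<rfloor>)"
    using small_primes_bound by blast
  obtain C2 where C2: "C2 > 0" "\<And>u \<sigma>. u \<ge> 3 \<Longrightarrow> \<sigma> \<ge> 1 \<Longrightarrow> (\<Sum>q\<in>odd_primes_in u (2 * u). prime_power_part q \<sigma>) \<le> C2 * (u - 1) powr (-1/8)"
    using prime_power_part_bound by blast
  \<comment> \<open>T u + 1 bounds the integer threshold N, the ceiling of T u, and T u + 2 bounds N
    + 1, which limits the k-sum. The factor 2 before C2 reflects the weight q \<le> 2u, against q/2
    \<le> u for primes.\<close>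
  define H where "H u = C1 * (ln (T u + 1) / ln u ^ 2 * (1 + ln ((T u + 2) / u))) + 7 * C * (1 / ln u) + 2 * C2 * (u - 1) powr (-1/8)" for u
  have "(H \<longlongrightarrow> C1 * 0 + 7 * C * 0 + 2 * C2 * 0) at_top"
    unfolding H_def T_def by (intro tendsto_add tendsto_mult_left; real_asymp)
  hence H: "(H \<longlongrightarrow> 0) at_top" by simp
  have "\<forall>\<^sub>F u::real in at_top. T u \<ge> u" unfolding T_def by real_asymp
  with C' C1(2) have "\<forall>\<^sub>F u in at_top. (\<Sum>q\<in>odd_primes_in u (2 * u). norm (kappa q)) \<le> u / ln u * H u"
    using eventually_ge_at_top[of 3]
  proof eventually_elim
    case (elim u)
    define S where "S = odd_primes_in u (2 * u)"
    have S: "finite S" unfolding S_def by (rule finite_odd_primes_in)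
    have Sq: "prime q" "odd q" "u < real q" "real q \<le> 2 * u" if "q \<in> S" for q
      using that by (auto simp: S_def odd_primes_in_def)
    define N where "N = nat \<lceil>T u\<rceil>"
    have N: "T u \<le> real N" "real N \<le> T u + 1" unfolding N_def using elim(3,4) by linarith+
    have N3: "N \<ge> 3" using N(1) elim(3,4) by linarith
    have lnu: "ln u \<ge> 1"
    proof -
      have "exp 1 \<le> u" using exp_le elim(4) by linarith
      hence "ln (exp 1) \<le> ln u" by (intro ln_mono) auto
      thus ?thesis by simp
    qed
    have E: "(\<Sum>q\<in>S. \<bar>ap_difference q n\<bar>) \<le> C * (real n / ln (real n) ^ 3)" if "n \<ge> N" for n
    proof -
      have "real n \<ge> T u" using N(1) that by linarith
      hence "(\<Sum>q\<in>S. \<bar>ap_difference q n\<bar>) \<le> C' * (real n / ln (real n) ^ 3)"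
        using elim(1) by (simp add: S_def ap_difference_def)
      also have "\<dots> \<le> C * (real n / ln (real n) ^ 3)"
        by (rule mult_right_mono[OF C(2)]) (simp add: ln_nat_nonneg)
      finally show ?thesis .
    qed
    define B where "B = C1 * (ln (T u + 1) / ln u ^ 2 * (1 + ln ((T u + 2) / u)))"
    have small: "(\<Sum>q\<in>S. \<Sum>n\<in>{1..N}. \<bar>prime_sign q n\<bar> * (ln (real n) / real n)) \<le> B"
    proof -
      define K where "K = nat \<lfloor>(real N + 1) / u\<rfloor>"
      have ge1: "1 \<le> (T u + 2) / u" using elim(3,4) by (simp add: pos_le_divide_eq)
      have KT: "real K \<le> (T u + 2) / u"
      proof -
        have "real K \<le> (real N + 1) / u" unfolding K_def using elim(3,4) by (intro of_nat_floor) auto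
        also have "\<dots> \<le> (T u + 2) / u" using N(2) elim(3,4) by (intro divide_right_mono) auto
        finally show ?thesis .
      qed
      have harmK: "harm K \<le> 1 + ln ((T u + 2) / u)"
      proof (cases "K = 0")
        case True
        thus ?thesis using ge1 by (simp add: harm_def)
      next
        case False
        have "harm K \<le> 1 + ln (real K)" using False by (intro harm_le) simp
        also have "ln (real K) \<le> ln ((T u + 2) / u)" using False KT by (intro ln_mono) auto
        finally show ?thesis by simp
      qed
      have "(\<Sum>q\<in>S. \<Sum>n\<in>{1..N}. \<bar>prime_sign q n\<bar> * (ln (real n) / real n)) \<le> C1 * (ln (real N) / ln u ^ 2) * harm K"
        using elim(2) N3 unfolding S_def K_def by simp
      also have "\<dots> \<le> C1 * (ln (T u + 1) / ln u ^ 2) * (1 + ln ((T u + 2) / u))"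
        using C1(1) N N3 harmK lnu elim(3,4)
        by (intro mult_mono mult_left_mono divide_right_mono ln_mono) (auto simp: harm_nonneg)
      finally show ?thesis by (simp add: B_def mult.assoc)
    qed
    have lnN: "ln u \<le> ln (real N)" using N(1) elim(3,4) by (intro ln_mono) auto
    define V where "V q \<sigma> = \<bar>\<Sum>\<^sub>\<infinity>m. cyclotomic.log_coeff_diff q m * ln (real m) * real m powr (-\<sigma>)\<bar>" for q \<sigma>
    have cyc: "cyclotomic q" if "q \<in> S" for q using Sq[OF that] by unfold_locales auto
    have "((\<lambda>\<sigma>. \<Sum>q\<in>S. V q \<sigma> / ln (real q)) \<longlongrightarrow> (\<Sum>q\<in>S. norm (kappa q))) (at_right 1)"
      unfolding V_def by (intro tendsto_sum cyclotomic.kappa_limit cyc)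
    moreover have "\<forall>\<^sub>F \<sigma> in at_right 1. (\<Sum>q\<in>S. V q \<sigma> / ln (real q)) \<le> u / ln u * H u"
    proof -
      have "\<forall>\<^sub>F \<sigma> in at_right (1::real). \<sigma> \<in> {1<..<2}" by (rule eventually_at_right_real) simp
      thus ?thesis
      proof eventually_elim
        case (elim \<sigma>)
        hence \<sigma>: "1 < \<sigma>" "\<sigma> \<le> 2" by auto
        have pp0: "prime_power_part q \<sigma> \<ge> 0" for q
          unfolding prime_power_part_def by (rule infsum_nonneg) (simp add: ln_nat_nonneg)
        have "(\<Sum>q\<in>S. V q \<sigma> / ln (real q)) \<le> (\<Sum>q\<in>S. (u * \<bar>prime_part q \<sigma>\<bar> + 2 * u * prime_power_part q \<sigma>) / ln u)"
        proof (rule sum_mono)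
          fix q assume q: "q \<in> S"
          have "V q \<sigma> \<le> real q / 2 * \<bar>prime_part q \<sigma>\<bar> + real q * prime_power_part q \<sigma>"
            unfolding V_def by (rule cyclotomic.log_series_bound[OF cyc[OF q] \<sigma>(1)])
          also have "\<dots> \<le> u * \<bar>prime_part q \<sigma>\<bar> + 2 * u * prime_power_part q \<sigma>"
            using Sq(4)[OF q] pp0 by (intro add_mono mult_right_mono) auto
          finally have "V q \<sigma> \<le> u * \<bar>prime_part q \<sigma>\<bar> + 2 * u * prime_power_part q \<sigma>" .
          moreover have "ln u \<le> ln (real q)" using Sq(3)[OF q] \<open>3 \<le> u\<close> by (intro ln_mono) auto
          moreover have "V q \<sigma> \<ge> 0" by (simp add: V_def)
          ultimately show "V q \<sigma> / ln (real q) \<le> (u * \<bar>prime_part q \<sigma>\<bar> + 2 * u * prime_power_part q \<sigma>) / ln u"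
            using lnu by (intro frac_le) auto
        qed
        also have "\<dots> = u / ln u * ((\<Sum>q\<in>S. \<bar>prime_part q \<sigma>\<bar>) + 2 * (\<Sum>q\<in>S. prime_power_part q \<sigma>))"
        proof -
          have "(u * \<bar>prime_part q \<sigma>\<bar> + 2 * u * prime_power_part q \<sigma>) / ln u
              = u / ln u * (\<bar>prime_part q \<sigma>\<bar> + 2 * prime_power_part q \<sigma>)" for q
            by (simp add: add_divide_distrib distrib_left)
          thus ?thesis by (simp only: sum_distrib_left[symmetric] sum.distrib)
        qed
        also have "\<dots> \<le> u / ln u * H u"
        proof (rule mult_left_mono)
          have "(\<Sum>q\<in>S. \<bar>prime_part q \<sigma>\<bar>) \<le> B + 7 * C / ln (real N)"
            by (rule prime_part_sum_bound[OF S _ C(1) E N3 \<sigma> small]) (use Sq(1) prime_gt_0_nat in auto)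
          also have "7 * C / ln (real N) \<le> 7 * C / ln u"
            using C(1) lnN lnu by (intro divide_left_mono) auto
          finally have "(\<Sum>q\<in>S. \<bar>prime_part q \<sigma>\<bar>) \<le> B + 7 * C * (1 / ln u)" by simp
          moreover have "(\<Sum>q\<in>S. prime_power_part q \<sigma>) \<le> C2 * (u - 1) powr (-1/8)"
            unfolding S_def by (rule C2(2)) (use \<sigma> \<open>3 \<le> u\<close> in auto)
          ultimately show "(\<Sum>q\<in>S. \<bar>prime_part q \<sigma>\<bar>) + 2 * (\<Sum>q\<in>S. prime_power_part q \<sigma>) \<le> H u"
            unfolding H_def B_def by linarith
          show "0 \<le> u / ln u" using lnu \<open>3 \<le> u\<close> by simp
        qed
        finally show ?case .
      qed
    qed
    ultimately show ?case
      unfolding S_def by (rule tendsto_upperbound) simp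
  qed
  with H show ?thesis by blast
qed

theorem theorem7p1:
  assumes "strong_elliott_halberstam"
  shows "(\<lambda>Q::real. \<Sum>q\<in>odd_primes_in (Q / 2) Q. norm (kappa q)) \<in> o[at_top](prime_count_star)"
proof (rule landau_o.smallI)
  fix \<epsilon> :: real assume \<epsilon>: "\<epsilon> > 0"
  obtain H where H: "(H \<longlongrightarrow> 0) at_top"
    "\<forall>\<^sub>F u in at_top. (\<Sum>q\<in>odd_primes_in u (2 * u). norm (kappa q)) \<le> u / ln u * H u"
    using kappa_sum_bound[OF assms] by metis
  \<comment> \<open>With this c it suffices that \<open>H u < c * \<epsilon>\<close>: for Q \<ge> 4
    one has (Q/2) / ln(Q/2) \<le> Q / ln Q, so the sum is at most \<epsilon> times c Q / ln
    Q.\<close>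
  obtain c where c: "c > 0" "\<forall>\<^sub>F Q in at_top. prime_count_star Q \<ge> c * Q / ln Q"
    using prime_count_star_lower by blast
  have "\<forall>\<^sub>F u in at_top. H u < c * \<epsilon>" using order_tendstoD(2)[OF H(1), of "c * \<epsilon>"] c(1) \<epsilon> by simp
  hence "\<forall>\<^sub>F u in at_top. (\<Sum>q\<in>odd_primes_in u (2 * u). norm (kappa q)) \<le> u / ln u * (c * \<epsilon>)"
    using H(2) eventually_gt_at_top[of 1]
  proof eventually_elim
    case (elim u)
    have "u / ln u * H u \<le> u / ln u * (c * \<epsilon>)" by (rule mult_left_mono) (use elim in auto)
    thus ?case using elim by linarith
  qed
  moreover have half: "filterlim (\<lambda>Q::real. Q / 2) at_top at_top" by real_asymp
  ultimately have "\<forall>\<^sub>F Q in at_top. (\<Sum>q\<in>odd_primes_in (Q / 2) (2 * (Q / 2)). norm (kappa q)) \<le> (Q / 2) / ln (Q / 2) * (c * \<epsilon>)"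
    by (rule eventually_compose_filterlim)
  thus "\<forall>\<^sub>F Q in at_top. norm (\<Sum>q\<in>odd_primes_in (Q / 2) Q. norm (kappa q)) \<le> \<epsilon> * norm (prime_count_star Q)"
    using c(2) eventually_ge_at_top[of 4]
  proof eventually_elim
    case (elim Q)
    have ln: "ln (Q / 2) > 0" "ln Q > 0" using elim(3) by simp_all
    have "ln Q \<le> 2 * ln (Q / 2)"
    proof -
      have "ln 2 \<le> ln (Q / 2)" using elim(3) by (intro ln_mono) auto
      moreover have "ln (Q / 2) = ln Q - ln 2" using elim(3) by (intro ln_divide_pos) auto
      ultimately show ?thesis by linarith
    qed
    hence "Q / (2 * ln (Q / 2)) \<le> Q / ln Q"
      using ln elim(3) by (intro divide_left_mono) auto
    hence "c * \<epsilon> * (Q / (2 * ln (Q / 2))) \<le> c * \<epsilon> * (Q / ln Q)"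
      using c(1) \<epsilon> by (intro mult_left_mono) auto
    hence "(Q / 2) / ln (Q / 2) * (c * \<epsilon>) \<le> \<epsilon> * (c * Q / ln Q)"
      by (simp add: mult_ac)
    also have "\<dots> \<le> \<epsilon> * prime_count_star Q"
      by (rule mult_left_mono) (use elim(2) \<epsilon> in auto)
    also have "\<dots> \<le> \<epsilon> * norm (prime_count_star Q)"
      by (rule mult_left_mono) (use \<epsilon> in auto)
    finally have "(\<Sum>q\<in>odd_primes_in (Q / 2) Q. norm (kappa q)) \<le> \<epsilon> * norm (prime_count_star Q)"
      using elim(1) by simp
    moreover have "(\<Sum>q\<in>odd_primes_in (Q / 2) Q. norm (kappa q)) \<ge> 0" by (intro sum_nonneg) simp
    ultimately show ?case by simp
  qed
qed

end
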